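(* Let $n\ge 1$ be an integer and let $\Omega$ be a domain in $\mathbb C^n$. Suppose $u: \Omega\rightarrow \mathbb C$ with $u\in W_{loc}^{1, 2n+\epsilon}(\Omega)$ for some $\epsilon>0$ satisfies $|\bar\partial u| \le V|u|$ a.e. on $\Omega$ for some nonnegative function $V \in L_{loc}^{2n}(\Omega)$. If $u$ vanishes to infinite order in the $L^1$ sense at some $z_0\in \Omega$, then $u$ vanishes identically on $\Omega$.
   Context: A domain is a nonempty connected open set. Here $|\bar\partial u| := \left(\sum_{j=1}^n |\bar\partial_j u|^2\right)^{1/2}$, where $\bar\partial_j = \partial/\partial \bar z_j$ is taken in the weak sense. For $q\ge 1$, $u\in L^q_{loc}(\Omega)$ is said to vanish to infinite order in the $L^q$ sense at $z_0\in\Omega$ if for all $m\ge 1$, $\lim_{r\to 0} r^{-m}\int_{|z-z_0|<r}|u(z)|^q\,dv_z = 0$, where $dv$ is Lebesgue measure. "Vanishes identically" means $u=0$ as an element of $L^1_{loc}(\Omega)$, i.e. a.e. on $\Omega$. *)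

theory Defs
  imports "HOL-Analysis.Analysis"
begin

text \<open>Functions on an open set \<open>\<Omega>\<close> are total functions whose values off \<open>\<Omega>\<close> are
  irrelevant. The space \<open>\<complex>\<^sup>n\<close> is \<open>complex ^ 'n\<close> with \<open>n = CARD('n)\<close>; its norm is the
  Euclidean one and its \<open>Basis\<close> consists of the \<open>2n\<close> vectors \<open>axis j 1\<close> (direction
  \<open>x\<^sub>j = Re z\<^sub>j\<close>) and \<open>axis j \<i>\<close> (direction \<open>y\<^sub>j = Im z\<^sub>j\<close>).\<close>

definition is_domain :: "'a::topological_space set \<Rightarrow> bool" where
  "is_domain \<Omega> \<longleftrightarrow> open \<Omega> \<and> connected \<Omega> \<and> \<Omega> \<noteq> {}"

definition Lp_loc ::
  "real \<Rightarrow> 'a::euclidean_space set \<Rightarrow> ('a \<Rightarrow> 'b::real_normed_vector) \<Rightarrow> bool" where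
  "Lp_loc p \<Omega> f \<longleftrightarrow>
     set_borel_measurable lebesgue \<Omega> f \<and>
     (\<forall>K. compact K \<and> K \<subseteq> \<Omega> \<longrightarrow> set_integrable lebesgue K (\<lambda>x. norm (f x) powr p))"

primrec Ck :: "nat \<Rightarrow> ('a::euclidean_space \<Rightarrow> 'b::real_normed_vector) \<Rightarrow> bool" where
  "Ck 0 f \<longleftrightarrow> continuous_on UNIV f"
| "Ck (Suc k) f \<longleftrightarrow>
     (\<forall>x. f differentiable (at x)) \<and>
     (\<forall>b\<in>Basis. Ck k (\<lambda>x. frechet_derivative f (at x) b))"

definition test_function :: "'a::euclidean_space set \<Rightarrow> ('a \<Rightarrow> complex) \<Rightarrow> bool" where
  "test_function \<Omega> \<phi> \<longleftrightarrow>
     (\<forall>k. Ck k \<phi>) \<and> compact (closure {x. \<phi> x \<noteq> 0}) \<and> closure {x. \<phi> x \<noteq> 0} \<subseteq> \<Omega>"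

definition has_weak_partial ::
  "'a::euclidean_space set \<Rightarrow> 'a \<Rightarrow> ('a \<Rightarrow> complex) \<Rightarrow> ('a \<Rightarrow> complex) \<Rightarrow> bool" where
  "has_weak_partial \<Omega> b u g \<longleftrightarrow>
     Lp_loc 1 \<Omega> u \<and> Lp_loc 1 \<Omega> g \<and>
     (\<forall>\<phi>. test_function \<Omega> \<phi> \<longrightarrow>
        (LINT x:\<Omega>|lebesgue. u x * frechet_derivative \<phi> (at x) b)
          = - (LINT x:\<Omega>|lebesgue. g x * \<phi> x))"

definition W1p_loc :: "real \<Rightarrow> 'a::euclidean_space set \<Rightarrow> ('a \<Rightarrow> complex) \<Rightarrow> bool" where
  "W1p_loc p \<Omega> u \<longleftrightarrow>
     Lp_loc p \<Omega> u \<and> (\<forall>b\<in>Basis. \<exists>g. has_weak_partial \<Omega> b u g \<and> Lp_loc p \<Omega> g)"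

text \<open>The classical operator \<open>\<partial>/\<partial>\<bar>z\<^sub>j = (\<partial>/\<partial>x\<^sub>j + \<i> \<partial>/\<partial>y\<^sub>j)/2\<close>.\<close>

definition dbar :: "'n \<Rightarrow> (complex ^ 'n \<Rightarrow> complex) \<Rightarrow> complex ^ 'n \<Rightarrow> complex" where
  "dbar j \<phi> z =
     (frechet_derivative \<phi> (at z) (axis j 1)
       + \<i> * frechet_derivative \<phi> (at z) (axis j \<i>)) / 2"

text \<open>\<open>g\<close> is a version of the weak derivative \<open>\<partial>u/\<partial>\<bar>z\<^sub>j\<close>, which is determined only up to
  null sets.\<close>

definition has_weak_dbar ::
  "(complex ^ 'n) set \<Rightarrow> 'n \<Rightarrow> (complex ^ 'n \<Rightarrow> complex) \<Rightarrow> (complex ^ 'n \<Rightarrow> complex) \<Rightarrow> bool" where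
  "has_weak_dbar \<Omega> j u g \<longleftrightarrow>
     Lp_loc 1 \<Omega> u \<and> Lp_loc 1 \<Omega> g \<and>
     (\<forall>\<phi>. test_function \<Omega> \<phi> \<longrightarrow>
        (LINT z:\<Omega>|lebesgue. u z * dbar j \<phi> z) = - (LINT z:\<Omega>|lebesgue. g z * \<phi> z))"

text \<open>The ball need not lie in \<open>\<Omega>\<close>, but it does for all small \<open>r\<close>, and only these affect the
  limit.\<close>

definition vanishes_to_infinite_order ::
  "real \<Rightarrow> 'a::euclidean_space set \<Rightarrow> ('a \<Rightarrow> complex) \<Rightarrow> 'a \<Rightarrow> bool" where
  "vanishes_to_infinite_order q \<Omega> u z0 \<longleftrightarrow>
     Lp_loc q \<Omega> u \<and> z0 \<in> \<Omega> \<and>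
     (\<forall>m::nat. m \<ge> 1 \<longrightarrow>
        ((\<lambda>r. (LINT z:ball z0 r|lebesgue. cmod (u z) powr q) / r ^ m) \<longlongrightarrow> 0) (at_right 0))"

end

theory Submission
  imports Defs
begin

text \<open>
The proof restricts \<open>u\<close> to the complex lines through the point of infinite order, which may be taken to be the origin.
On the line \<open>\<tau> \<mapsto> \<tau> z\<close> the Cauchy-Riemann operator of \<open>u\<close> is bounded by \<open>\<bar>z\<bar> V \<bar>u\<bar>\<close>, up to a factor
that depends on \<open>n\<close>. The measure \<open>\<bar>z\<bar>\<^sup>-\<^sup>2\<^sup>n dz\<close> on \<open>\<complex>\<^sup>n\<close> (\<open>hmeas\<close>) is invariant under complex dilations, so
Fubini's theorem relates it to the measure \<open>\<bar>\<tau>\<bar>\<^sup>-\<^sup>2 d\<tau>\<close> on almost every line. In particular \<open>V \<in> L\<^sup>2\<^sup>n\<close> near the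
origin means that on almost every line \<open>\<bar>\<tau> z\<bar> V(\<tau> z)\<close> has a finite \<open>2n\<close>-th moment for this invariant measure.
The critical exponent \<open>2n\<close> of the theorem is exactly the one for which the density cancels.

On one line the argument is of Carleman type. Division by \<open>\<tau> ^ m\<close> commutes with the Cauchy-Riemann operator away from
the origin, and the Cauchy-Pompeiu formula bounds \<open>\<bar>\<tau>\<bar> powr (1/2 - m) * \<bar>u\<bar>\<close>, times a cutoff, by the integral
of the corresponding derivative against the scale invariant kernel \<open>sqrt (\<bar>\<tau>\<bar> \<bar>\<zeta>\<bar>) / \<bar>\<tau> - \<zeta>\<bar>\<close>, with
constants independent of \<open>m\<close> (\<open>dilation_inequality\<close>, \<open>disc_inequality\<close>). Pairing this inequality with the derivative
and using a Hardy-Littlewood-Sobolev inequality for the kernel (\<open>HLS_cylinder\<close>) bounds the weighted integral of derivative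
times \<open>u\<close> by itself times a norm of \<open>V\<close>, plus a contribution of the cutoff. Where the norm of \<open>V\<close> is small, the first term is
absorbed (\<open>HLS_absorb\<close>); letting \<open>m\<close> tend to infinity shows that \<open>u\<close> vanishes inside the cutoff region
(\<open>line_absorption\<close>). Smallness of \<open>V\<close> matters only on the set where \<open>u\<close> does not vanish yet, so it is available
just beyond the largest radius up to which \<open>u\<close> vanishes, whatever \<open>V\<close> is, and this radius advances to the boundary of
the ball (\<open>line_continuation\<close>, \<open>ball_vanishing\<close>).

The singular weights are admissible because infinite order of vanishing in \<open>L\<^sup>1\<close>, together with \<open>u \<in> L\<^sup>q\<close> for some \<open>q > 2\<close>,
makes \<open>\<bar>u\<bar>\<^sup>2\<close> integrable against all negative powers of the distance (\<open>flat_weighted_L2\<close>). Weak derivatives are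
treated by mollification. Finally, \<open>u\<close> vanishes on every ball around the point whose closure lies in \<open>\<Omega>\<close>, and hence is
of infinite order at all points of such a ball; the set of points near which \<open>u\<close> vanishes is therefore open and closed
in \<open>\<Omega>\<close>.
\<close>

section \<open>The measure with density \<open>1 / norm x ^ d\<close>\<close>

lemma nn_integral_lborel_shift:
  fixes a :: "'a::euclidean_space"
  assumes [measurable]: "f \<in> borel_measurable borel"
  shows "(\<integral>\<^sup>+x. f (x + a) \<partial>lborel) = (\<integral>\<^sup>+x. f x \<partial>lborel)"
proof -
  have "(\<integral>\<^sup>+x. f x \<partial>lborel) = (\<integral>\<^sup>+x. f x \<partial>distr lborel borel ((+) a))"
    by (simp add: lborel_distr_plus)
  also have "\<dots> = (\<integral>\<^sup>+x. f (a + x) \<partial>lborel)"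
    by (subst nn_integral_distr) auto
  finally show ?thesis by (simp add: add.commute)
qed

lemma linear_borel_measurable:
  fixes T :: "'a::euclidean_space \<Rightarrow> 'b::euclidean_space"
  assumes "linear T" shows "T \<in> borel_measurable borel"
  using assms by (intro borel_measurable_continuous_onI linear_continuous_on)
    (simp add: linear_linear)

text \<open>The factor is found by averaging over translations by the vectors of the unit ball: after an exchange of the two
integrals there remains the volume of a preimage of a unit ball under \<open>T\<close>, which is a ball of radius \<open>1 / r\<close>.\<close>

lemma nn_integral_lborel_similarity:
  fixes T :: "'a::euclidean_space \<Rightarrow> 'a"
  assumes T: "linear T" and norm_T: "\<And>x. norm (T x) = r * norm x" and r: "r > 0"
    and f [measurable]: "f \<in> borel_measurable borel"
  shows "(\<integral>\<^sup>+x. f (T x) \<partial>lborel) = ennreal (1 / r ^ DIM('a)) * (\<integral>\<^sup>+x. f x \<partial>lborel)"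
proof -
  define c where "c = unit_ball_vol (real DIM('a))"
  have c: "c > 0" by (simp add: c_def)
  have ball: "emeasure lborel (ball a t :: 'a set) = ennreal (c * t ^ DIM('a))" if "t \<ge> 0" for a t
    using that by (simp add: emeasure_ball c_def)
  have [measurable]: "T \<in> borel \<rightarrow>\<^sub>M borel" using linear_borel_measurable[OF T] by simp
  have inj: "inj T"
    using norm_T r by (auto simp: linear_injective_0[OF T]) (metis mult_eq_0_iff norm_eq_zero order_less_irrefl)
  then have surj: "surj T" using T by (simp add: linear_injective_imp_surjective)
  define S where "S = inv T"
  have TS [simp]: "T (S y) = y" for y by (simp add: S_def surj surj_f_inv_f)
  let ?B = "ball (0::'a) 1"
  have [measurable]: "?B \<in> sets borel" by simp
  have "(\<integral>\<^sup>+x. f (T x) \<partial>lborel) * ennreal c = (\<integral>\<^sup>+y. (\<integral>\<^sup>+x. f (T x) \<partial>lborel) * indicator ?B y \<partial>lborel)"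
    by (subst nn_integral_cmult_indicator) (auto simp: ball)
  also have "\<dots> = (\<integral>\<^sup>+y. (\<integral>\<^sup>+x. f (T (x + S y)) \<partial>lborel) * indicator ?B y \<partial>lborel)"
    using nn_integral_lborel_shift[of "\<lambda>x. f (T x)"] by simp
  also have "\<dots> = (\<integral>\<^sup>+y. (\<integral>\<^sup>+x. f (T x + y) * indicator ?B y \<partial>lborel) \<partial>lborel)"
    by (subst nn_integral_multc) (auto simp: linear_add[OF T])
  also have "\<dots> = (\<integral>\<^sup>+x. (\<integral>\<^sup>+y. f (T x + y) * indicator ?B y \<partial>lborel) \<partial>lborel)"
    by (rule lborel_pair.Fubini') simp
  also have "\<dots> = (\<integral>\<^sup>+x. (\<integral>\<^sup>+y. f y * indicator ?B (y - T x) \<partial>lborel) \<partial>lborel)"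
  proof (rule nn_integral_cong)
    fix x
    show "(\<integral>\<^sup>+y. f (T x + y) * indicator ?B y \<partial>lborel) = (\<integral>\<^sup>+y. f y * indicator ?B (y - T x) \<partial>lborel)"
      using nn_integral_lborel_shift[of "\<lambda>y. f y * indicator ?B (y - T x)" "T x"]
      by (simp add: add.commute)
  qed
  also have "\<dots> = (\<integral>\<^sup>+y. (\<integral>\<^sup>+x. f y * indicator ?B (y - T x) \<partial>lborel) \<partial>lborel)"
    by (rule lborel_pair.Fubini') simp
  also have "\<dots> = (\<integral>\<^sup>+y. f y * ennreal (c * (1 / r) ^ DIM('a)) \<partial>lborel)"
  proof (intro nn_integral_cong)
    fix y
    have "indicator ?B (y - T x) = (indicator (ball (S y) (1 / r)) x :: ennreal)" for x
    proof -
      have "norm (y - T x) = r * norm (S y - x)"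
        using norm_T[of "S y - x"] by (simp add: linear_diff[OF T])
      then show ?thesis using r by (auto simp: indicator_def dist_norm norm_minus_commute field_simps)
    qed
    then have "(\<integral>\<^sup>+x. f y * indicator ?B (y - T x) \<partial>lborel)
        = (\<integral>\<^sup>+x. f y * indicator (ball (S y) (1 / r)) x \<partial>lborel)" by simp
    also have "\<dots> = f y * ennreal (c * (1 / r) ^ DIM('a))"
      using r by (subst nn_integral_cmult_indicator) (auto simp: ball)
    finally show "(\<integral>\<^sup>+x. f y * indicator ?B (y - T x) \<partial>lborel) = f y * ennreal (c * (1 / r) ^ DIM('a))" .
  qed
  also have "\<dots> = (\<integral>\<^sup>+y. f y \<partial>lborel) * ennreal (c * (1 / r) ^ DIM('a))"
    by (subst nn_integral_multc) auto
  finally have eq: "ennreal c * (\<integral>\<^sup>+x. f (T x) \<partial>lborel)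
      = ennreal c * (ennreal (1 / r ^ DIM('a)) * (\<integral>\<^sup>+y. f y \<partial>lborel))"
    using c r ennreal_mult[of c "1 / r ^ DIM('a)"] by (simp only: power_one_over mult.assoc mult.commute mult.left_commute) (simp add: mult_ac)
  show ?thesis
    using eq c by (subst (asm) ennreal_mult_cancel_left) (auto simp: ennreal_mult_eq_top_iff)
qed

text \<open>In dimension \<open>d\<close> the Lebesgue measure scales by \<open>r ^ d\<close> under a similarity of ratio \<open>r\<close>, so this density
makes the measure invariant under all linear similarities, in particular under \<open>z \<mapsto> \<tau> *s z\<close>. In the plane it is
the Haar measure of the multiplicative group of nonzero complex numbers.\<close>

definition hmeas :: "'a::euclidean_space measure" where
  "hmeas = density lborel (\<lambda>x. ennreal (1 / norm x ^ DIM('a)))"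

lemma sets_hmeas [simp, measurable_cong]: "sets hmeas = sets borel"
  and space_hmeas [simp]: "space hmeas = UNIV"
  by (simp_all add: hmeas_def)

lemma sigma_finite_hmeas: "sigma_finite_measure (hmeas :: 'a::euclidean_space measure)"
  unfolding hmeas_def
  by (subst sigma_finite_measure.sigma_finite_iff_density_finite[OF sigma_finite_lborel]) auto

interpretation hmeas: sigma_finite_measure hmeas by (rule sigma_finite_hmeas)

interpretation hmeas_pair: pair_sigma_finite hmeas hmeas ..

lemma nn_integral_hmeas:
  fixes f :: "'a::euclidean_space \<Rightarrow> ennreal"
  assumes "f \<in> borel_measurable borel"
  shows "(\<integral>\<^sup>+x. f x \<partial>hmeas) = (\<integral>\<^sup>+x. ennreal (1 / norm x ^ DIM('a)) * f x \<partial>lborel)"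
  using assms unfolding hmeas_def by (subst nn_integral_density) auto

lemma AE_hmeas_iff:
  assumes "Measurable.pred borel P"
  shows "(AE x in hmeas. P x) \<longleftrightarrow> (AE x in lborel. P (x::'a::euclidean_space))"
proof -
  have "0 < ennreal (1 / norm x ^ DIM('a)) \<longleftrightarrow> x \<noteq> 0" for x :: 'a
    by (auto simp: zero_power)
  then have "(AE x in hmeas. P x) \<longleftrightarrow> (AE x in lborel. x \<noteq> 0 \<longrightarrow> P x)"
    unfolding hmeas_def by (subst AE_density) auto
  also have "\<dots> \<longleftrightarrow> (AE x in lborel. P x)"
    using AE_lborel_singleton[of 0] by (auto elim: eventually_elim2)
  finally show ?thesis .
qed

lemma nn_integral_hmeas_similarity:
  fixes T :: "'a::euclidean_space \<Rightarrow> 'a"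
  assumes T: "linear T" and norm_T: "\<And>x. norm (T x) = r * norm x" and r: "r > 0"
    and f [measurable]: "f \<in> borel_measurable borel"
  shows "(\<integral>\<^sup>+x. f (T x) \<partial>hmeas) = (\<integral>\<^sup>+x. f x \<partial>hmeas)"
proof -
  have [measurable]: "T \<in> borel \<rightarrow>\<^sub>M borel" using linear_borel_measurable[OF T] by simp
  let ?d = "DIM('a)"
  have "(\<integral>\<^sup>+x. f (T x) \<partial>hmeas) = (\<integral>\<^sup>+x. ennreal (1 / norm x ^ ?d) * f (T x) \<partial>lborel)"
    by (rule nn_integral_hmeas) simp
  also have "\<dots> = (\<integral>\<^sup>+x. ennreal (r ^ ?d) * (ennreal (1 / norm (T x) ^ ?d) * f (T x)) \<partial>lborel)"
    using r by (intro nn_integral_cong)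
      (simp add: norm_T power_mult_distrib mult.assoc[symmetric] ennreal_mult[symmetric])
  also have "\<dots> = ennreal (r ^ ?d) * (\<integral>\<^sup>+x. ennreal (1 / norm (T x) ^ ?d) * f (T x) \<partial>lborel)"
    by (rule nn_integral_cmult) measurable
  also have "(\<integral>\<^sup>+x. ennreal (1 / norm (T x) ^ ?d) * f (T x) \<partial>lborel)
      = ennreal (1 / r ^ ?d) * (\<integral>\<^sup>+x. ennreal (1 / norm x ^ ?d) * f x \<partial>lborel)"
    using nn_integral_lborel_similarity[OF T norm_T r, of "\<lambda>x. ennreal (1 / norm x ^ ?d) * f x"]
    by simp
  also have "ennreal (r ^ ?d) * \<dots> = (\<integral>\<^sup>+x. ennreal (1 / norm x ^ ?d) * f x \<partial>lborel)"
    using r by (simp add: mult.assoc[symmetric] ennreal_mult[symmetric])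
  finally show ?thesis by (simp add: nn_integral_hmeas)
qed

lemma nn_integral_hmeas_mult:
  fixes c :: complex
  assumes "c \<noteq> 0" "f \<in> borel_measurable borel"
  shows "(\<integral>\<^sup>+x. f (x * c) \<partial>hmeas) = (\<integral>\<^sup>+x. f x \<partial>hmeas)"
  using assms by (intro nn_integral_hmeas_similarity[where r = "norm c"])
    (auto intro!: linearI simp: algebra_simps norm_mult)

section \<open>Integrals of powers over discs and their complements\<close>

lemma ennreal_le_suminf: "f k \<le> (\<Sum>k. f k :: ennreal)"
  using sum_le_suminf[of f "{k}"] by simp

text \<open>The balls of radius \<open>2 ^ (-k)\<close> cover the singularity in dyadic shells, and the resulting geometric series has the
ratio \<open>2 powr (a - 2)\<close>.\<close>

lemma nn_integral_ball_powr_finite: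
  fixes a :: real
  assumes a: "0 \<le> a" "a < 2"
  shows "(\<integral>\<^sup>+x. ennreal (norm x powr (-a)) * indicator (ball (0::complex) 1) x \<partial>lborel) < \<infinity>"
proof -
  let ?q = "2 powr (a - 2)"
  have "(\<integral>\<^sup>+x. ennreal (norm x powr (-a)) * indicator (ball (0::complex) 1) x \<partial>lborel)
     \<le> (\<integral>\<^sup>+x. (\<Sum>k. ennreal (2 powr (a * (real k + 1))) * indicator (ball (0::complex) (2 powr (- real k))) x) \<partial>lborel)"
  proof (rule nn_integral_mono)
    fix x :: complex
    show "ennreal (norm x powr (-a)) * indicator (ball (0::complex) 1) x \<le>
      (\<Sum>k. ennreal (2 powr (a * (real k + 1))) * indicator (ball (0::complex) (2 powr (- real k))) x)"
    proof (cases "x \<noteq> 0 \<and> norm x < 1")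
      case True
      define k where "k = nat (\<lceil>- log 2 (norm x)\<rceil> - 1)"
      have pos: "- log 2 (norm x) > 0" using True by simp
      then have rk: "real k = of_int (\<lceil>- log 2 (norm x)\<rceil> - 1)"
        unfolding k_def by (simp add: of_nat_nat)
      have k: "real k < - log 2 (norm x)" "- log 2 (norm x) \<le> real k + 1"
        unfolding rk by linarith+
      have nx: "norm x = 2 powr (log 2 (norm x))" using True by simp
      have "norm x < 2 powr (- real k)"
        by (subst nx) (use k in \<open>simp add: powr_less_cancel_iff\<close>)
      moreover have "norm x powr (-a) \<le> 2 powr (a * (real k + 1))"
      proof -
        have "norm x powr (-a) = 2 powr (- a * log 2 (norm x))"
          by (subst nx) (simp add: powr_powr mult.commute)
        also have "- a * log 2 (norm x) \<le> a * (real k + 1)"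
          using mult_left_mono[OF k(2) a(1)] by simp
        finally show ?thesis by simp
      qed
      ultimately have "ennreal (norm x powr (-a)) * indicator (ball (0::complex) 1) x \<le>
         ennreal (2 powr (a * (real k + 1))) * indicator (ball (0::complex) (2 powr (- real k))) x"
        using True by (simp add: indicator_def)
      also have "\<dots> \<le> (\<Sum>k. ennreal (2 powr (a * (real k + 1))) * indicator (ball (0::complex) (2 powr (- real k))) x)"
        by (rule ennreal_le_suminf)
      finally show ?thesis .
    next
      case False
      then have "ennreal (norm x powr (-a)) * indicator (ball 0 1) x = 0" by (auto simp: indicator_def)
      then show ?thesis by (simp only: zero_le)
    qed
  qed
  also have "\<dots> = (\<Sum>k. (\<integral>\<^sup>+x. ennreal (2 powr (a * (real k + 1))) * indicator (ball (0::complex) (2 powr (- real k))) x \<partial>lborel))"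
    by (subst nn_integral_suminf)
      (intro borel_measurable_times_ennreal borel_measurable_const borel_measurable_indicator, simp, rule refl)
  also have "\<dots> = (\<Sum>k. ennreal (2 powr a * pi * ?q ^ k))"
  proof (intro suminf_cong)
    fix k
    have "2 powr (a * (real k + 1)) * (pi * (2 powr (- real k))\<^sup>2) = 2 powr a * pi * ?q ^ k"
    proof -
      have "2 powr (a * (real k + 1)) * (2 powr (- real k))\<^sup>2 = 2 powr (a + (a - 2) * real k)"
        by (simp add: powr_add[symmetric] power2_eq_square algebra_simps)
      also have "\<dots> = 2 powr a * ?q ^ k" by (simp add: powr_add powr_powr[symmetric] powr_realpow)
      finally show ?thesis by (simp add: algebra_simps)
    qed
    then show "(\<integral>\<^sup>+x. ennreal (2 powr (a * (real k + 1))) * indicator (ball (0::complex) (2 powr (- real k))) x \<partial>lborel)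
       = ennreal (2 powr a * pi * ?q ^ k)"
      by (subst nn_integral_cmult_indicator) (auto simp: emeasure_ball unit_ball_vol_2 ennreal_mult[symmetric])
  qed
  also have "\<dots> = ennreal (\<Sum>k. 2 powr a * pi * ?q ^ k)"
  proof (rule suminf_ennreal2)
    have "?q < 2 powr 0" by (rule powr_less_mono) (use a in auto)
    then show "summable (\<lambda>k. 2 powr a * pi * ?q ^ k)"
      by (intro summable_mult summable_geometric) auto
  qed auto
  also have "\<dots> < \<infinity>" by simp
  finally show ?thesis .
qed

lemma nn_integral_outside_ball_powr_finite:
  fixes a :: real
  assumes a: "2 < a"
  shows "(\<integral>\<^sup>+x. ennreal (norm x powr (-a)) * indicator (- ball (0::complex) 1) x \<partial>lborel) < \<infinity>"
proof -
  let ?q = "2 powr (2 - a)"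
  have "(\<integral>\<^sup>+x. ennreal (norm x powr (-a)) * indicator (- ball (0::complex) 1) x \<partial>lborel)
     \<le> (\<integral>\<^sup>+x. (\<Sum>k. ennreal (2 powr (- a * real k)) * indicator (ball (0::complex) (2 powr (real k + 1))) x) \<partial>lborel)"
  proof (rule nn_integral_mono)
    fix x :: complex
    show "ennreal (norm x powr (-a)) * indicator (- ball (0::complex) 1) x \<le>
      (\<Sum>k. ennreal (2 powr (- a * real k)) * indicator (ball (0::complex) (2 powr (real k + 1))) x)"
    proof (cases "norm x \<ge> 1")
      case True
      define k where "k = nat \<lfloor>log 2 (norm x)\<rfloor>"
      have pos: "log 2 (norm x) \<ge> 0" using True by (subst zero_le_log_cancel_iff) auto
      then have rk: "real k = of_int \<lfloor>log 2 (norm x)\<rfloor>"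
        unfolding k_def by (simp add: of_nat_nat)
      have k: "real k \<le> log 2 (norm x)" "log 2 (norm x) < real k + 1"
        unfolding rk by linarith+
      have "norm x > 0" using True by linarith
      then have nx: "norm x = 2 powr (log 2 (norm x))" by simp
      have "norm x < 2 powr (real k + 1)"
        by (subst nx) (use k in \<open>simp add: powr_less_cancel_iff\<close>)
      moreover have "norm x powr (-a) \<le> 2 powr (- a * real k)"
      proof -
        have "norm x powr (-a) = 2 powr (- a * log 2 (norm x))"
          by (subst nx) (simp add: powr_powr mult.commute)
        also have "- a * log 2 (norm x) \<le> - a * real k"
          using mult_left_mono[OF k(1), of a] a by simp
        finally show ?thesis by simp
      qed
      ultimately have "ennreal (norm x powr (-a)) * indicator (- ball (0::complex) 1) x \<le>
         ennreal (2 powr (- a * real k)) * indicator (ball (0::complex) (2 powr (real k + 1))) x"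
        using True by (simp add: indicator_def)
      also have "\<dots> \<le> (\<Sum>k. ennreal (2 powr (- a * real k)) * indicator (ball (0::complex) (2 powr (real k + 1))) x)"
        by (rule ennreal_le_suminf)
      finally show ?thesis .
    next
      case False
      then have "ennreal (norm x powr (-a)) * indicator (- ball 0 1) x = 0" by (auto simp: indicator_def)
      then show ?thesis by (simp only: zero_le)
    qed
  qed
  also have "\<dots> = (\<Sum>k. (\<integral>\<^sup>+x. ennreal (2 powr (- a * real k)) * indicator (ball (0::complex) (2 powr (real k + 1))) x \<partial>lborel))"
    by (subst nn_integral_suminf)
      (intro borel_measurable_times_ennreal borel_measurable_const borel_measurable_indicator, simp, rule refl)
  also have "\<dots> = (\<Sum>k. ennreal (4 * pi * ?q ^ k))"
  proof (intro suminf_cong)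
    fix k
    have "2 powr (- a * real k) * (pi * (2 powr (real k + 1))\<^sup>2) = 4 * pi * ?q ^ k"
    proof -
      have "2 powr (- a * real k) * (2 powr (real k + 1))\<^sup>2 = 2 powr (2 + (2 - a) * real k)"
        by (simp add: powr_add[symmetric] power2_eq_square algebra_simps)
      also have "\<dots> = 4 * ?q ^ k" by (simp add: powr_add powr_powr[symmetric] powr_realpow)
      finally show ?thesis by (simp add: algebra_simps)
    qed
    then show "(\<integral>\<^sup>+x. ennreal (2 powr (- a * real k)) * indicator (ball (0::complex) (2 powr (real k + 1))) x \<partial>lborel)
       = ennreal (4 * pi * ?q ^ k)"
      by (subst nn_integral_cmult_indicator) (auto simp: emeasure_ball unit_ball_vol_2 ennreal_mult[symmetric])
  qed
  also have "\<dots> = ennreal (\<Sum>k. 4 * pi * ?q ^ k)"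
  proof (rule suminf_ennreal2)
    have "?q < 2 powr 0" by (rule powr_less_mono) (use a in auto)
    then show "summable (\<lambda>k. 4 * pi * ?q ^ k)"
      by (intro summable_mult summable_geometric) auto
  qed auto
  also have "\<dots> < \<infinity>" by simp
  finally show ?thesis .
qed

lemma nn_integral_complex_powr_rescale:
  fixes c :: complex and a :: real
  assumes R: "R > 0" and [measurable]: "S \<in> sets borel"
    and S: "\<And>x. c + of_real R * x \<in> S' \<longleftrightarrow> x \<in> S" and [measurable]: "S' \<in> sets borel"
  shows "(\<integral>\<^sup>+x. ennreal (norm (x - c) powr (-a)) * indicator S' x \<partial>lborel)
    = ennreal (R powr (2 - a)) * (\<integral>\<^sup>+x. ennreal (norm x powr (-a)) * indicator S x \<partial>lborel)"
proof -
  let ?I = "\<integral>\<^sup>+x. ennreal (norm (x - c) powr (-a)) * indicator S' x \<partial>lborel"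
  have "?I = (\<integral>\<^sup>+x. ennreal (norm x powr (-a)) * indicator S' (x + c) \<partial>lborel)"
    using nn_integral_lborel_shift[of "\<lambda>x. ennreal (norm (x - c) powr (-a)) * indicator S' x" c] by simp
  moreover have "(\<integral>\<^sup>+x. ennreal (norm (of_real R * x) powr (-a)) * indicator S' (of_real R * x + c) \<partial>lborel)
      = ennreal (1 / R ^ DIM(complex)) * (\<integral>\<^sup>+x. ennreal (norm x powr (-a)) * indicator S' (x + c) \<partial>lborel)"
    by (rule nn_integral_lborel_similarity[where T = "\<lambda>x. of_real R * x" and r = R])
       (use R in \<open>auto intro!: linearI simp: algebra_simps norm_mult scaleR_conv_of_real\<close>)
  moreover have "(\<integral>\<^sup>+x. ennreal (norm (of_real R * x) powr (-a)) * indicator S' (of_real R * x + c) \<partial>lborel)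
      = ennreal (R powr (-a)) * (\<integral>\<^sup>+x. ennreal (norm x powr (-a)) * indicator S x \<partial>lborel)"
  proof -
    have "ennreal (norm (of_real R * x) powr (-a)) * indicator S' (of_real R * x + c)
       = ennreal (R powr (-a)) * (ennreal (norm x powr (-a)) * indicator S x)" for x :: complex
      using R S[of x] by (simp add: indicator_def add.commute norm_mult powr_mult ennreal_mult)
    then show ?thesis by (simp add: nn_integral_cmult)
  qed
  ultimately have eq: "ennreal (R powr (-a)) * (\<integral>\<^sup>+x. ennreal (norm x powr (-a)) * indicator S x \<partial>lborel)
    = ennreal (1 / R\<^sup>2) * ?I" by simp
  have "?I = ennreal (R\<^sup>2) * (ennreal (1 / R\<^sup>2) * ?I)"
    using R by (simp add: mult.assoc[symmetric] ennreal_mult[symmetric])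
  also have "\<dots> = ennreal (R\<^sup>2 * R powr (-a)) * (\<integral>\<^sup>+x. ennreal (norm x powr (-a)) * indicator S x \<partial>lborel)"
    unfolding eq[symmetric] using R by (simp add: mult.assoc[symmetric] ennreal_mult[symmetric])
  also have "R\<^sup>2 * R powr (-a) = R powr (2 - a)"
    using R by (simp add: powr_diff powr_minus_divide)
  finally show ?thesis .
qed

lemma nn_integral_ball_powr:
  fixes a :: real
  assumes a: "0 \<le> a" "a < 2"
  obtains C where "C \<ge> 0" "\<And>(c::complex) R. R > 0 \<Longrightarrow>
    (\<integral>\<^sup>+x. ennreal (norm (x - c) powr (-a)) * indicator (ball c R) x \<partial>lborel) \<le> ennreal (C * R powr (2 - a))"
proof -
  let ?I = "\<integral>\<^sup>+x. ennreal (norm x powr (-a)) * indicator (ball (0::complex) 1) x \<partial>lborel"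
  show ?thesis
  proof (rule that[of "enn2real ?I"])
    fix c :: complex and R :: real assume R: "R > 0"
    have "(\<integral>\<^sup>+x. ennreal (norm (x - c) powr (-a)) * indicator (ball c R) x \<partial>lborel) = ennreal (R powr (2 - a)) * ?I"
      using R by (intro nn_integral_complex_powr_rescale) (auto simp: dist_norm norm_mult)
    also have "?I = ennreal (enn2real ?I)"
      using nn_integral_ball_powr_finite[OF a] by (simp add: less_top)
    finally show "(\<integral>\<^sup>+x. ennreal (norm (x - c) powr (-a)) * indicator (ball c R) x \<partial>lborel) \<le> ennreal (enn2real ?I * R powr (2 - a))"
      by (simp add: ennreal_mult mult.commute)
  qed simp
qed

lemma nn_integral_outside_ball_powr:
  fixes a :: real
  assumes a: "2 < a"
  obtains C where "C \<ge> 0" "\<And>(c::complex) R. R > 0 \<Longrightarrow>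
    (\<integral>\<^sup>+x. ennreal (norm (x - c) powr (-a)) * indicator (- ball c R) x \<partial>lborel) \<le> ennreal (C * R powr (2 - a))"
proof -
  let ?I = "\<integral>\<^sup>+x. ennreal (norm x powr (-a)) * indicator (- ball (0::complex) 1) x \<partial>lborel"
  show ?thesis
  proof (rule that[of "enn2real ?I"])
    fix c :: complex and R :: real assume R: "R > 0"
    have "(\<integral>\<^sup>+x. ennreal (norm (x - c) powr (-a)) * indicator (- ball c R) x \<partial>lborel) = ennreal (R powr (2 - a)) * ?I"
      using R by (intro nn_integral_complex_powr_rescale) (auto simp: dist_norm norm_mult)
    also have "?I = ennreal (enn2real ?I)"
      using nn_integral_outside_ball_powr_finite[OF a] by (simp add: less_top)
    finally show "(\<integral>\<^sup>+x. ennreal (norm (x - c) powr (-a)) * indicator (- ball c R) x \<partial>lborel) \<le> ennreal (enn2real ?I * R powr (2 - a))"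
      by (simp add: ennreal_mult mult.commute)
  qed simp
qed

section \<open>A Hardy-Littlewood-Sobolev inequality on the punctured plane\<close>

lemma nn_integral_Holder:
  fixes f g :: "'a \<Rightarrow> real"
  assumes pq: "p > 0" "q > 0" "1 / p + 1 / q = 1"
    and [measurable]: "f \<in> borel_measurable M" "g \<in> borel_measurable M"
    and nonneg: "\<And>x. 0 \<le> f x" "\<And>x. 0 \<le> g x"
    and A: "(\<integral>\<^sup>+x. ennreal (f x powr p) \<partial>M) \<le> ennreal A" "A \<ge> 0"
    and B: "(\<integral>\<^sup>+x. ennreal (g x powr q) \<partial>M) \<le> ennreal B" "B \<ge> 0"
  shows "(\<integral>\<^sup>+x. ennreal (f x * g x) \<partial>M) \<le> ennreal (A powr (1 / p) * B powr (1 / q))"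
proof (cases "A = 0 \<or> B = 0")
  case True
  then have "(AE x in M. f x = 0) \<or> (AE x in M. g x = 0)"
  proof
    assume "A = 0"
    then have "AE x in M. ennreal (f x powr p) = 0"
      using A by (subst nn_integral_0_iff_AE[symmetric]) auto
    then show ?thesis by auto
  next
    assume "B = 0"
    then have "AE x in M. ennreal (g x powr q) = 0"
      using B by (subst nn_integral_0_iff_AE[symmetric]) auto
    then show ?thesis by auto
  qed
  then have "AE x in M. ennreal (f x * g x) = 0" by (elim disjE) auto
  then have "(\<integral>\<^sup>+x. ennreal (f x * g x) \<partial>M) = 0"
    by (subst nn_integral_0_iff_AE) auto
  then show ?thesis by simp
next
  case False
  with A B have pos: "A > 0" "B > 0" by auto
  define a where "a = A powr (1 / p)"
  define b where "b = B powr (1 / q)"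
  have ab: "a > 0" "b > 0" "a powr p = A" "b powr q = B"
    using pos pq by (auto simp: a_def b_def powr_powr)
  have p1: "p > 1" "q > 1"
  proof -
    have "1 / p < 1" "1 / q < 1"
      using pq zero_less_divide_1_iff[of p] zero_less_divide_1_iff[of q] by linarith+
    then show "p > 1" "q > 1" using pq by (simp_all add: divide_less_eq_1_pos)
  qed
  have "f x * g x \<le> a * b / (p * A) * f x powr p + a * b / (q * B) * g x powr q" for x
  proof -
    have "(f x / a) * (g x / b) \<le> (f x / a) powr p / p + (g x / b) powr q / q"
      using pq p1 nonneg[of x] ab by (intro Youngs_inequality) auto
    also have "\<dots> = f x powr p / (p * A) + g x powr q / (q * B)"
      using nonneg[of x] ab by (simp add: powr_divide field_simps)
    finally have "(a * b) * ((f x / a) * (g x / b)) \<le> (a * b) * (f x powr p / (p * A) + g x powr q / (q * B))"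
      using ab by (intro mult_left_mono) auto
    then show ?thesis using ab by (simp add: field_simps)
  qed
  then have "(\<integral>\<^sup>+x. ennreal (f x * g x) \<partial>M)
      \<le> (\<integral>\<^sup>+x. ennreal (a * b / (p * A)) * ennreal (f x powr p) + ennreal (a * b / (q * B)) * ennreal (g x powr q) \<partial>M)"
    using ab pos pq by (intro nn_integral_mono)
      (simp add: ennreal_mult[symmetric] ennreal_plus[symmetric] del: ennreal_plus)
  also have "\<dots> = ennreal (a * b / (p * A)) * (\<integral>\<^sup>+x. ennreal (f x powr p) \<partial>M)
      + ennreal (a * b / (q * B)) * (\<integral>\<^sup>+x. ennreal (g x powr q) \<partial>M)"
    by (simp add: nn_integral_add nn_integral_cmult)
  also have "\<dots> \<le> ennreal (a * b / (p * A)) * ennreal A + ennreal (a * b / (q * B)) * ennreal B"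
    by (intro add_mono mult_left_mono A B) auto
  also have "\<dots> = ennreal (a * b / (p * A) * A + a * b / (q * B) * B)"
    using ab pos pq by (simp add: ennreal_mult[symmetric] ennreal_plus[symmetric] del: ennreal_plus)
  also have "a * b / (p * A) * A + a * b / (q * B) * B = a * b * (1 / p + 1 / q)"
    using pos by (simp add: field_simps)
  finally show ?thesis using pq by (simp add: a_def b_def)
qed

text \<open>The Cauchy kernel \<open>1 / (\<tau> - \<zeta>)\<close>, made symmetric and homogeneous of degree \<open>0\<close> by the factor \<open>sqrt (norm \<tau> * norm \<zeta>)\<close>,
becomes the convolution kernel \<open>kern (\<zeta> / \<tau>)\<close> on the multiplicative group. It decays like \<open>sqrt (norm \<sigma>)\<close> at
\<open>0\<close> and like \<open>1 / sqrt (norm \<sigma>)\<close> at infinity; its only singularity is at \<open>1\<close>.\<close>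

definition kern :: "complex \<Rightarrow> real" where
  "kern \<sigma> = sqrt (norm \<sigma>) / norm (\<sigma> - 1)"

lemma kern_measurable [measurable]: "kern \<in> borel_measurable borel"
  unfolding kern_def by measurable

lemma kern_nonneg [simp]: "kern \<sigma> \<ge> 0" by (simp add: kern_def)

lemma nn_integral_hmeas_complex:
  assumes [measurable]: "f \<in> borel_measurable borel"
  shows "(\<integral>\<^sup>+x. f x \<partial>(hmeas::complex measure)) = (\<integral>\<^sup>+x. ennreal (1 / (norm x)\<^sup>2) * f x \<partial>lborel)"
  using nn_integral_hmeas[of f] by simp

lemma kern_far_integral:
  assumes s: "0 < s" "s \<le> 2"
  shows "(\<integral>\<^sup>+\<sigma>. ennreal (kern \<sigma> powr s * indicator (- ball 1 (1/2)) \<sigma>) \<partial>hmeas) < \<infinity>"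
proof -
  obtain C1 where C1: "C1 \<ge> 0" "\<And>(c::complex) R. R > 0 \<Longrightarrow>
    (\<integral>\<^sup>+x. ennreal (norm (x - c) powr (-(2 - s/2))) * indicator (ball c R) x \<partial>lborel) \<le> ennreal (C1 * R powr (2 - (2 - s/2)))"
    using nn_integral_ball_powr[of "2 - s/2"] s by auto
  obtain C2 where C2: "C2 \<ge> 0" "\<And>(c::complex) R. R > 0 \<Longrightarrow>
    (\<integral>\<^sup>+x. ennreal (norm (x - c) powr (-(2 + s/2))) * indicator (- ball c R) x \<partial>lborel) \<le> ennreal (C2 * R powr (2 - (2 + s/2)))"
    using nn_integral_outside_ball_powr[of "2 + s/2"] s by auto
  have pt: "1 / (norm \<sigma>)\<^sup>2 * (kern \<sigma> powr s * indicator (- ball 1 (1/2)) \<sigma>)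
    \<le> 2 powr s * (norm (\<sigma> - 0) powr (-(2 - s/2)) * indicator (ball 0 2) \<sigma>
         + norm (\<sigma> - 0) powr (-(2 + s/2)) * indicator (- ball 0 2) \<sigma>)" for \<sigma> :: complex
  proof (cases "norm (\<sigma> - 1) \<ge> 1/2 \<and> \<sigma> \<noteq> 0")
    case True
    then have pos: "norm \<sigma> > 0" "norm (\<sigma> - 1) > 0" by auto
    have eq: "1 / (norm \<sigma>)\<^sup>2 * kern \<sigma> powr s = norm \<sigma> powr (s/2 - 2) * norm (\<sigma> - 1) powr (- s)"
    proof -
      have "sqrt (norm \<sigma>) powr s = norm \<sigma> powr (s/2)"
        using pos by (simp add: powr_half_sqrt[symmetric] powr_powr)
      moreover have "(norm \<sigma>)\<^sup>2 = norm \<sigma> powr 2" using pos by simp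
      ultimately show ?thesis using pos
        unfolding kern_def by (simp add: powr_divide powr_diff powr_minus divide_simps powr_add[symmetric] del: powr_numeral)
    qed
    show ?thesis
    proof (cases "norm \<sigma> < 2")
      case near: True
      have "norm (\<sigma> - 1) powr (- s) \<le> (1/2) powr (- s)"
        using True s by (intro powr_mono2') auto
      also have "\<dots> = 2 powr s" by (simp add: powr_minus powr_divide)
      finally have "norm \<sigma> powr (s/2 - 2) * norm (\<sigma> - 1) powr (- s) \<le> norm \<sigma> powr (s/2 - 2) * 2 powr s"
        by (intro mult_left_mono) auto
      moreover have "indicator (- ball 1 (1/2)) \<sigma> = (1::real)" "indicator (ball 0 2) \<sigma> = (1::real)"
        "indicator (- ball 0 2) \<sigma> = (0::real)"
        using near True by (auto simp: indicator_def dist_norm norm_minus_commute)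
      ultimately show ?thesis by (simp only: eq mult_1_right mult_zero_right add_0_right) (simp add: mult.commute)
    next
      case far: False
      have "norm \<sigma> \<le> norm (\<sigma> - 1) + 1" using norm_triangle_ineq[of "\<sigma> - 1" 1] by simp
      then have "norm (\<sigma> - 1) \<ge> norm \<sigma> / 2" using far by linarith
      then have "norm (\<sigma> - 1) powr (- s) \<le> (norm \<sigma> / 2) powr (- s)"
        using pos s by (intro powr_mono2') auto
      also have "\<dots> = 2 powr s * norm \<sigma> powr (- s)" using pos by (simp add: powr_minus powr_divide) (simp add: divide_inverse)
      finally have "norm \<sigma> powr (s/2 - 2) * norm (\<sigma> - 1) powr (- s) \<le> norm \<sigma> powr (s/2 - 2) * (2 powr s * norm \<sigma> powr (- s))"
        by (rule mult_left_mono) auto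
      also have "\<dots> = 2 powr s * (norm \<sigma> powr (s/2 - 2) * norm \<sigma> powr (- s))" by simp
      also have "\<dots> = 2 powr s * norm \<sigma> powr (-(2 + s/2))"
      proof -
        have ex: "s/2 - 2 + - s = -(2 + s/2)" by linarith
        show ?thesis unfolding powr_add[symmetric] ex ..
      qed
      finally have "norm \<sigma> powr (s/2 - 2) * norm (\<sigma> - 1) powr (- s) \<le> 2 powr s * norm \<sigma> powr (-(2 + s/2))" .
      moreover have "indicator (- ball 1 (1/2)) \<sigma> = (1::real)" "indicator (ball 0 2) \<sigma> = (0::real)"
        "indicator (- ball 0 2) \<sigma> = (1::real)"
        using far True by (auto simp: indicator_def dist_norm norm_minus_commute)
      ultimately show ?thesis by (simp only: eq mult_1_right mult_zero_right add_0_left diff_0_right)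
    qed
  next
    case False
    then have "\<sigma> = 0 \<or> indicator (- ball 1 (1/2)) \<sigma> = (0::real)"
      by (auto simp: indicator_def dist_norm norm_minus_commute)
    then show ?thesis by auto
  qed
  have "(\<integral>\<^sup>+\<sigma>. ennreal (kern \<sigma> powr s * indicator (- ball 1 (1/2)) \<sigma>) \<partial>hmeas)
     = (\<integral>\<^sup>+\<sigma>. ennreal (1 / (norm \<sigma>)\<^sup>2 * (kern \<sigma> powr s * indicator (- ball 1 (1/2)) \<sigma>)) \<partial>lborel)"
    by (subst nn_integral_hmeas_complex) (auto simp: ennreal_mult[symmetric] intro!: borel_measurable_indicator)
  also have "\<dots> \<le> (\<integral>\<^sup>+\<sigma>. ennreal (2 powr s) * (ennreal (norm (\<sigma> - 0) powr (-(2 - s/2))) * indicator (ball 0 2) \<sigma>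
         + ennreal (norm (\<sigma> - 0) powr (-(2 + s/2))) * indicator (- ball 0 2) \<sigma>) \<partial>(lborel::complex measure))"
  proof (rule nn_integral_mono)
    fix \<sigma> :: complex
    show "ennreal (1 / (norm \<sigma>)\<^sup>2 * (kern \<sigma> powr s * indicator (- ball 1 (1/2)) \<sigma>))
      \<le> ennreal (2 powr s) * (ennreal (norm (\<sigma> - 0) powr (-(2 - s/2))) * indicator (ball 0 2) \<sigma>
         + ennreal (norm (\<sigma> - 0) powr (-(2 + s/2))) * indicator (- ball 0 2) \<sigma>)"
      using ennreal_leI[OF pt[of \<sigma>]] by (auto simp: ennreal_mult indicator_def split: if_splits)
  qed
  also have "\<dots> = ennreal (2 powr s) * ((\<integral>\<^sup>+\<sigma>. ennreal (norm (\<sigma> - 0) powr (-(2 - s/2))) * indicator (ball 0 2) \<sigma> \<partial>(lborel::complex measure))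
         + (\<integral>\<^sup>+\<sigma>. ennreal (norm (\<sigma> - 0) powr (-(2 + s/2))) * indicator (- ball 0 2) \<sigma> \<partial>(lborel::complex measure)))"
  proof -
    have [measurable]: "ball (0::complex) 2 \<in> sets borel" "- ball (0::complex) 2 \<in> sets borel" by auto
    show ?thesis by (simp add: nn_integral_cmult nn_integral_add)
  qed
  also have "\<dots> \<le> ennreal (2 powr s) * (ennreal (C1 * 2 powr (2 - (2 - s/2))) + ennreal (C2 * 2 powr (2 - (2 + s/2))))"
    by (intro mult_left_mono add_mono C1 C2) auto
  also have "\<dots> < \<infinity>" by (simp add: ennreal_mult_less_top)
  finally show ?thesis .
qed

lemma kern_near_bound:
  assumes q: "q > 0" and "norm (\<sigma> - 1) < 1/2"
  shows "1 / (norm \<sigma>)\<^sup>2 * kern \<sigma> powr q \<le> 4 * 2 powr q * norm (\<sigma> - 1) powr (- q)"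
proof -
  have lo: "norm \<sigma> \<ge> 1/2" and hi: "norm \<sigma> \<le> 2"
    using norm_triangle_ineq2[of 1 "1 - \<sigma>"] norm_triangle_ineq[of "\<sigma> - 1" 1] assms
    by (auto simp: norm_minus_commute)
  have "1 / (norm \<sigma>)\<^sup>2 \<le> 1 / (1/2)\<^sup>2"
    using lo by (intro divide_left_mono power_mono mult_pos_pos zero_less_power) auto
  moreover have "kern \<sigma> powr q \<le> (2 / norm (\<sigma> - 1)) powr q"
  proof -
    have "sqrt (norm \<sigma>) \<le> sqrt (2\<^sup>2)" using hi by (intro real_sqrt_le_mono) auto
    then show ?thesis unfolding kern_def using q by (intro powr_mono2 divide_right_mono) auto
  qed
  ultimately have "1 / (norm \<sigma>)\<^sup>2 * kern \<sigma> powr q \<le> (1 / (1/2)\<^sup>2) * (2 / norm (\<sigma> - 1)) powr q"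
    by (intro mult_mono) auto
  also have "\<dots> = 4 * 2 powr q * norm (\<sigma> - 1) powr (- q)"
    by (simp add: powr_divide powr_minus field_simps power2_eq_square)
  finally show ?thesis .
qed

lemma kern_near_integral:
  assumes q: "q > 0" and S: "S \<subseteq> ball 1 (1/2)" and [measurable]: "S \<in> sets borel"
    and bd: "(\<integral>\<^sup>+x. ennreal (norm (x - 1) powr (-q)) * indicator S x \<partial>lborel) \<le> ennreal B" "B \<ge> 0"
  shows "(\<integral>\<^sup>+\<sigma>. ennreal (kern \<sigma> powr q * indicator S \<sigma>) \<partial>hmeas) \<le> ennreal (4 * 2 powr q * B)"
proof -
  have "(\<integral>\<^sup>+\<sigma>. ennreal (kern \<sigma> powr q * indicator S \<sigma>) \<partial>hmeas)
     = (\<integral>\<^sup>+\<sigma>. ennreal (1 / (norm \<sigma>)\<^sup>2 * (kern \<sigma> powr q * indicator S \<sigma>)) \<partial>lborel)"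
    by (subst nn_integral_hmeas_complex) (auto simp: ennreal_mult[symmetric])
  also have "\<dots> \<le> (\<integral>\<^sup>+\<sigma>. ennreal (4 * 2 powr q) * (ennreal (norm (\<sigma> - 1) powr (-q)) * indicator S \<sigma>) \<partial>lborel)"
  proof (rule nn_integral_mono)
    fix \<sigma> :: complex
    have "1 / (norm \<sigma>)\<^sup>2 * kern \<sigma> powr q \<le> 4 * 2 powr q * norm (\<sigma> - 1) powr (- q)" if "\<sigma> \<in> S"
      using that S by (intro kern_near_bound q) (auto simp: dist_norm norm_minus_commute)
    then show "ennreal (1 / (norm \<sigma>)\<^sup>2 * (kern \<sigma> powr q * indicator S \<sigma>))
      \<le> ennreal (4 * 2 powr q) * (ennreal (norm (\<sigma> - 1) powr (-q)) * indicator S \<sigma>)"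
      by (auto simp: indicator_def ennreal_mult[symmetric] intro!: ennreal_leI)
  qed
  also have "\<dots> = ennreal (4 * 2 powr q) * (\<integral>\<^sup>+\<sigma>. (ennreal (norm (\<sigma> - 1) powr (-q)) * indicator S \<sigma>) \<partial>lborel)"
    by (rule nn_integral_cmult) measurable
  also have "\<dots> \<le> ennreal (4 * 2 powr q) * ennreal B"
    by (intro mult_left_mono bd) auto
  also have "\<dots> = ennreal (4 * 2 powr q * B)" using bd by (simp add: ennreal_mult)
  finally show ?thesis .
qed

lemma kern_integrable:
  assumes s: "0 < s" "s < 2"
  shows "(\<integral>\<^sup>+\<sigma>. ennreal (kern \<sigma> powr s) \<partial>hmeas) < \<infinity>"
proof -
  obtain C where C: "C \<ge> 0" "\<And>(c::complex) R. R > 0 \<Longrightarrow>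
    (\<integral>\<^sup>+x. ennreal (norm (x - c) powr (-s)) * indicator (ball c R) x \<partial>lborel) \<le> ennreal (C * R powr (2 - s))"
    using nn_integral_ball_powr[of s] s by auto
  have [measurable]: "ball (1::complex) (1/2) \<in> sets borel" "- ball (1::complex) (1/2) \<in> sets borel" by auto
  have near: "(\<integral>\<^sup>+\<sigma>. ennreal (kern \<sigma> powr s * indicator (ball 1 (1/2)) \<sigma>) \<partial>hmeas) < \<infinity>"
    using s C by (intro le_less_trans[OF kern_near_integral[OF _ _ _ C(2)]]) auto
  have "(\<integral>\<^sup>+\<sigma>. ennreal (kern \<sigma> powr s) \<partial>hmeas) =
     (\<integral>\<^sup>+\<sigma>. ennreal (kern \<sigma> powr s * indicator (ball 1 (1/2)) \<sigma>) + ennreal (kern \<sigma> powr s * indicator (- ball 1 (1/2)) \<sigma>) \<partial>hmeas)"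
    by (intro nn_integral_cong) (auto simp: indicator_def)
  also have "\<dots> = (\<integral>\<^sup>+\<sigma>. ennreal (kern \<sigma> powr s * indicator (ball 1 (1/2)) \<sigma>) \<partial>hmeas)
     + (\<integral>\<^sup>+\<sigma>. ennreal (kern \<sigma> powr s * indicator (- ball 1 (1/2)) \<sigma>) \<partial>hmeas)"
    by (intro nn_integral_add) auto
  also have "\<dots> < \<infinity>"
    using near kern_far_integral[of s] s by simp
  finally show ?thesis .
qed

text \<open>The exponent \<open>p\<close> is such that \<open>(2 - p) * (2 * N) = p\<close>. So with \<open>f = f powr (p - 1) * f powr (2 - p)\<close> the first factor
can be estimated by the upper bound \<open>l\<close>, and Hoelder's inequality with the exponents \<open>s\<close> and \<open>2 * N\<close> applies to
the second.\<close>

lemma kern_inner_Holder: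
  fixes N :: real and f :: "complex \<Rightarrow> real"
  assumes N: "N \<ge> 1" and p: "p = 4 * N / (2 * N + 1)" and s: "s = 2 * N / (2 * N - 1)"
    and [measurable]: "f \<in> borel_measurable borel" "S \<in> sets borel"
    and f: "\<And>x. 0 \<le> f x" "\<And>x. f x \<le> l" and l: "l > 0"
    and A: "(\<integral>\<^sup>+x. ennreal (f x powr p) \<partial>hmeas) \<le> ennreal A" "A \<ge> 0"
    and B: "(\<integral>\<^sup>+x. ennreal (kern x powr s * indicator S x) \<partial>hmeas) \<le> ennreal B" "B \<ge> 0"
  shows "(\<integral>\<^sup>+x. ennreal (kern x * f x * indicator S x) \<partial>hmeas)
    \<le> ennreal (B powr (1 / s) * (l powr (p - 1) * A powr (1 / (2 * N))))"
proof -
  have p12: "1 < p" "p < 2" using N by (auto simp: p field_simps)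
  have s0: "s > 0" "1 / s + 1 / (2 * N) = 1" using N by (auto simp: s field_simps)
  have e: "(2 - p) * (2 * N) = p" using N by (simp add: p field_simps)
  have "(\<integral>\<^sup>+x. ennreal ((kern x * indicator S x) * (f x powr (2 - p))) \<partial>hmeas)
     \<le> ennreal (B powr (1 / s) * A powr (1 / (2 * N)))"
  proof (rule nn_integral_Holder)
    show "(\<integral>\<^sup>+x. ennreal ((f x powr (2 - p)) powr (2 * N)) \<partial>hmeas) \<le> ennreal A"
      using A f by (simp add: powr_powr e)
    have "(kern x * indicator S x) powr s = kern x powr s * indicator S x" for x
      by (simp add: indicator_def)
    then show "(\<integral>\<^sup>+x. ennreal ((kern x * indicator S x) powr s) \<partial>hmeas) \<le> ennreal B"
      using B by simp
  qed (use s0 N A B in auto)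
  then have le: "ennreal (l powr (p - 1)) * (\<integral>\<^sup>+x. ennreal ((kern x * indicator S x) * (f x powr (2 - p))) \<partial>hmeas)
     \<le> ennreal (l powr (p - 1)) * ennreal (B powr (1 / s) * A powr (1 / (2 * N)))"
    by (rule mult_left_mono) simp
  have "(\<integral>\<^sup>+x. ennreal (kern x * f x * indicator S x) \<partial>hmeas)
     \<le> (\<integral>\<^sup>+x. ennreal (l powr (p - 1)) * ennreal ((kern x * indicator S x) * (f x powr (2 - p))) \<partial>hmeas)"
  proof (rule nn_integral_mono)
    fix x
    have "f x = f x powr (p - 1) * f x powr (2 - p)"
      using f[of x] by (cases "f x = 0") (auto simp: powr_add[symmetric])
    also have "\<dots> \<le> l powr (p - 1) * f x powr (2 - p)"
      using f[of x] p12 by (intro mult_right_mono powr_mono2) auto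
    finally have "kern x * indicator S x * f x \<le> kern x * indicator S x * (l powr (p - 1) * f x powr (2 - p))"
      by (intro mult_left_mono) auto
    then show "ennreal (kern x * f x * indicator S x)
       \<le> ennreal (l powr (p - 1)) * ennreal ((kern x * indicator S x) * (f x powr (2 - p)))"
      by (simp add: ennreal_mult[symmetric] mult_ac)
  qed
  also have "\<dots> = ennreal (l powr (p - 1)) * (\<integral>\<^sup>+x. ennreal ((kern x * indicator S x) * (f x powr (2 - p))) \<partial>hmeas)"
    by (rule nn_integral_cmult) measurable
  also note le
  also have "ennreal (l powr (p - 1)) * ennreal (B powr (1 / s) * A powr (1 / (2 * N)))
     = ennreal (B powr (1 / s) * (l powr (p - 1) * A powr (1 / (2 * N))))"
    by (simp add: ennreal_mult[symmetric] mult_ac)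
  finally show ?thesis .
qed

text \<open>In the case \<open>N = 1\<close> the dual exponent is \<open>s = 2\<close>, and \<open>kern\<close> is only weakly square integrable near \<open>1\<close>. There a disc of
suitable radius is cut out: inside it \<open>f \<le> l\<close> and the integrability of \<open>kern\<close> are used, outside it Hoelder's
inequality with the exponents \<open>4\<close> and \<open>4/3\<close>.\<close>

lemma kern_inner_near:
  obtains C where "C \<ge> 0"
   "\<And>f l A. f \<in> borel_measurable borel \<Longrightarrow> (\<And>x. 0 \<le> f x) \<Longrightarrow> (\<And>x. f x \<le> l) \<Longrightarrow> l > 0 \<Longrightarrow> A > 0 \<Longrightarrow>
     (\<integral>\<^sup>+x. ennreal (f x powr (4/3)) \<partial>hmeas) \<le> ennreal A \<Longrightarrow>
     (\<integral>\<^sup>+x. ennreal (kern x * f x * indicator (ball 1 (1/2)) x) \<partial>hmeas) \<le> ennreal (C * (l powr (1/3) * A powr (1/2)))"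
proof -
  obtain C1 where C1: "C1 \<ge> 0" "\<And>(c::complex) R. R > 0 \<Longrightarrow>
    (\<integral>\<^sup>+x. ennreal (norm (x - c) powr (-1)) * indicator (ball c R) x \<partial>lborel) \<le> ennreal (C1 * R powr (2 - 1))"
    using nn_integral_ball_powr[of 1] by auto
  obtain C4 where C4: "C4 \<ge> 0" "\<And>(c::complex) R. R > 0 \<Longrightarrow>
    (\<integral>\<^sup>+x. ennreal (norm (x - c) powr (-4)) * indicator (- ball c R) x \<partial>lborel) \<le> ennreal (C4 * R powr (2 - 4))"
    using nn_integral_outside_ball_powr[of 4] by auto
  define D1 where "D1 = 4 * 2 powr 1 * C1"
  define D4 where "D4 = 4 * 2 powr 4 * C4"
  have D: "D1 \<ge> 0" "D4 \<ge> 0" using C1 C4 by (auto simp: D1_def D4_def)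
  show ?thesis
  proof (rule that[of "D1 + D4 powr (1/4)"])
    fix f :: "complex \<Rightarrow> real" and l A :: real
    assume [measurable]: "f \<in> borel_measurable borel" and f: "\<And>x. 0 \<le> f x" "\<And>x. f x \<le> l"
      and l: "l > 0" and A: "A > 0" "(\<integral>\<^sup>+x. ennreal (f x powr (4/3)) \<partial>hmeas) \<le> ennreal A"
    define a where "a = A powr (1/2)"
    define k where "k = l powr (1/3)"
    have ak: "a > 0" "k > 0" "A = a\<^sup>2" "l = k ^ 3"
      using l A by (auto simp: a_def k_def powr_realpow[symmetric] powr_powr)
    \<comment> \<open>At the radius \<open>a / k\<^sup>2\<close> the bounds for the inner disc and for the annulus balance.\<close>
    define R where "R = min (1/2) (a / k\<^sup>2)"
    have R: "0 < R" "R \<le> 1/2" "R \<le> a / k\<^sup>2" using ak unfolding R_def by (simp, linarith, simp)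
    let ?T = "ball (1::complex) (1/2) - ball 1 R"
    have [measurable]: "ball (1::complex) R \<in> sets borel" "?T \<in> sets borel" by auto
    have first: "(\<integral>\<^sup>+x. ennreal (kern x * f x * indicator (ball 1 R) x) \<partial>hmeas) \<le> ennreal (D1 * (k * a))"
    proof -
      have "(\<integral>\<^sup>+x. ennreal (kern x * f x * indicator (ball 1 R) x) \<partial>hmeas)
        \<le> (\<integral>\<^sup>+x. ennreal l * ennreal (kern x powr 1 * indicator (ball 1 R) x) \<partial>hmeas)"
      proof (rule nn_integral_mono)
        fix x
        have "(kern x * indicator (ball 1 R) x) * f x \<le> (kern x * indicator (ball 1 R) x) * l"
          by (intro mult_left_mono f) auto
        then show "ennreal (kern x * f x * indicator (ball 1 R) x) \<le> ennreal l * ennreal (kern x powr 1 * indicator (ball 1 R) x)"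
          using l by (simp add: ennreal_mult[symmetric] mult_ac)
      qed
      also have "\<dots> = ennreal l * (\<integral>\<^sup>+x. ennreal (kern x powr 1 * indicator (ball 1 R) x) \<partial>hmeas)"
        by (rule nn_integral_cmult) measurable
      also have "\<dots> \<le> ennreal l * ennreal (4 * 2 powr 1 * (C1 * R powr (2 - 1)))"
        using R C1 by (intro mult_left_mono kern_near_integral C1) auto
      also have "\<dots> = ennreal (l * (D1 * R))"
        using R C1 l by (simp add: ennreal_mult[symmetric] D1_def mult_ac)
      also have "\<dots> \<le> ennreal (D1 * (k * a))"
      proof (rule ennreal_leI)
        have "l * R \<le> l * (a / k\<^sup>2)" using R l by (intro mult_left_mono) auto
        also have "\<dots> = k * a" using ak by (simp add: power2_eq_square power3_eq_cube)
        finally show "l * (D1 * R) \<le> D1 * (k * a)" using mult_left_mono[OF _ D(1), of "l * R" "k * a"] by (simp add: mult_ac)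
      qed
      finally show ?thesis .
    qed
    have second: "(\<integral>\<^sup>+x. ennreal (kern x * f x * indicator ?T x) \<partial>hmeas) \<le> ennreal (D4 powr (1/4) * (k * a))"
    proof (cases "R = 1/2")
      case True
      then show ?thesis by simp
    next
      case False
      then have Req: "R = a / k\<^sup>2" by (auto simp: R_def min_def split: if_splits)
      have B: "(\<integral>\<^sup>+x. ennreal (kern x powr 4 * indicator ?T x) \<partial>hmeas) \<le> ennreal (4 * 2 powr 4 * (C4 * R powr (2 - 4)))"
      proof (rule kern_near_integral)
        have "(\<integral>\<^sup>+x. ennreal (norm (x - 1) powr (-4)) * indicator ?T x \<partial>lborel)
          \<le> (\<integral>\<^sup>+x. ennreal (norm (x - 1) powr (-4)) * indicator (- ball (1::complex) R) x \<partial>lborel)"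
          by (intro nn_integral_mono mult_left_mono) (auto simp: indicator_def)
        also note C4(2)[OF R(1), of 1]
        finally show "(\<integral>\<^sup>+x. ennreal (norm (x - 1) powr (-4)) * indicator ?T x \<partial>lborel) \<le> ennreal (C4 * R powr (2 - 4))" .
      qed (use C4 in auto)
      have "(\<integral>\<^sup>+x. ennreal ((kern x * indicator ?T x) * f x) \<partial>hmeas)
          \<le> ennreal ((D4 * R powr (2 - 4)) powr (1 / 4) * A powr (1 / (4/3)))"
      proof (rule nn_integral_Holder)
        have "(kern x * indicator ?T x) powr 4 = kern x powr 4 * indicator ?T x" for x
          by (simp add: indicator_def)
        then show "(\<integral>\<^sup>+x. ennreal ((kern x * indicator ?T x) powr 4) \<partial>hmeas) \<le> ennreal (D4 * R powr (2 - 4))"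
          using B by (simp add: D4_def mult_ac)
      qed (use A f D in auto)
      also have "(D4 * R powr (2 - 4)) powr (1 / 4) * A powr (1 / (4/3)) = D4 powr (1/4) * (k * a)"
      proof -
        have "(R powr (2 - 4)) powr (1/4) * A powr (3/4) = R powr (-1/2) * A powr (3/4)"
          by (simp add: powr_powr)
        also have "\<dots> = (a / k powr 2) powr (-1/2) * (a powr 2) powr (3/4)"
          using ak by (simp add: Req)
        also have "\<dots> = a powr (-1/2) * a powr (3/2) * (k powr 2) powr (1/2)"
          using ak by (simp add: powr_divide powr_powr powr_minus field_simps del: powr_numeral)
        also have "\<dots> = a powr 1 * k"
          unfolding powr_add[symmetric] powr_powr using ak by simp
        finally show ?thesis using R ak D by (simp add: powr_mult mult_ac)
      qed
      finally show ?thesis by (simp add: mult_ac)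
    qed
    have "(\<integral>\<^sup>+x. ennreal (kern x * f x * indicator (ball 1 (1/2)) x) \<partial>hmeas)
      = (\<integral>\<^sup>+x. ennreal (kern x * f x * indicator (ball 1 R) x) + ennreal (kern x * f x * indicator ?T x) \<partial>hmeas)"
      using R by (intro nn_integral_cong) (auto simp: indicator_def)
    also have "\<dots> = (\<integral>\<^sup>+x. ennreal (kern x * f x * indicator (ball 1 R) x) \<partial>hmeas)
        + (\<integral>\<^sup>+x. ennreal (kern x * f x * indicator ?T x) \<partial>hmeas)"
      by (rule nn_integral_add) measurable
    also have "\<dots> \<le> ennreal (D1 * (k * a)) + ennreal (D4 powr (1/4) * (k * a))"
      by (intro add_mono first second)
    also have "\<dots> = ennreal ((D1 + D4 powr (1/4)) * (l powr (1/3) * A powr (1/2)))"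
      unfolding a_def[symmetric] k_def[symmetric]
      using D ak(1,2) by (simp add: ennreal_plus[symmetric] algebra_simps del: ennreal_plus)
    finally show "(\<integral>\<^sup>+x. ennreal (kern x * f x * indicator (ball 1 (1/2)) x) \<partial>hmeas) \<le> ennreal ((D1 + D4 powr (1/4)) * (l powr (1/3) * A powr (1/2)))" .
  qed (use D in auto)
qed

text \<open>For \<open>N \<ge> 2\<close> the dual exponent is less than \<open>2\<close> and \<open>kern_inner_Holder\<close> applies on the whole plane. For \<open>N = 1\<close> it
is used away from the singularity only, and \<open>kern_inner_near\<close> covers the rest.\<close>

lemma kern_inner:
  fixes N :: nat
  assumes N: "N \<ge> 1" and p: "p = 4 * real N / (2 * real N + 1)"
  obtains C where "C \<ge> 0"
   "\<And>f l A. f \<in> borel_measurable borel \<Longrightarrow> (\<And>x. 0 \<le> f x) \<Longrightarrow> (\<And>x. f x \<le> l) \<Longrightarrow> l > 0 \<Longrightarrow> A > 0 \<Longrightarrow>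
     (\<integral>\<^sup>+x. ennreal (f x powr p) \<partial>hmeas) \<le> ennreal A \<Longrightarrow>
     (\<integral>\<^sup>+x. ennreal (kern x * f x) \<partial>hmeas) \<le> ennreal (C * (l powr (p - 1) * A powr (1 / (2 * real N))))"
proof (cases "N = 1")
  case False
  define s where "s = 2 * real N / (2 * real N - 1)"
  define B where "B = enn2real (\<integral>\<^sup>+\<sigma>. ennreal (kern \<sigma> powr s) \<partial>hmeas)"
  have "(\<integral>\<^sup>+\<sigma>. ennreal (kern \<sigma> powr s) \<partial>hmeas) < \<infinity>"
    using N False by (intro kern_integrable) (auto simp: s_def field_simps)
  then have B: "(\<integral>\<^sup>+\<sigma>. ennreal (kern \<sigma> powr s) \<partial>hmeas) \<le> ennreal B"
    by (simp add: B_def less_top)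
  show ?thesis
  proof (rule that[of "B powr (1 / s)"])
    fix f :: "complex \<Rightarrow> real" and l A :: real
    assume [measurable]: "f \<in> borel_measurable borel" and f: "\<And>x. 0 \<le> f x" "\<And>x. f x \<le> l"
      and l: "l > 0" and A: "A > 0" "(\<integral>\<^sup>+x. ennreal (f x powr p) \<partial>hmeas) \<le> ennreal A"
    show "(\<integral>\<^sup>+x. ennreal (kern x * f x) \<partial>hmeas) \<le> ennreal (B powr (1 / s) * (l powr (p - 1) * A powr (1 / (2 * real N))))"
      using kern_inner_Holder[of "real N" p s f UNIV l A B] N p f l A B by (simp add: s_def B_def)
  qed simp
next
  case True
  then have p: "p = 4/3" using p by simp
  obtain C where C: "C \<ge> 0"
   "\<And>f l A. f \<in> borel_measurable borel \<Longrightarrow> (\<And>x. 0 \<le> f x) \<Longrightarrow> (\<And>x. f x \<le> l) \<Longrightarrow> l > 0 \<Longrightarrow> A > 0 \<Longrightarrow>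
     (\<integral>\<^sup>+x. ennreal (f x powr (4/3)) \<partial>hmeas) \<le> ennreal A \<Longrightarrow>
     (\<integral>\<^sup>+x. ennreal (kern x * f x * indicator (ball 1 (1/2)) x) \<partial>hmeas) \<le> ennreal (C * (l powr (1/3) * A powr (1/2)))"
    using kern_inner_near by blast
  define B where "B = enn2real (\<integral>\<^sup>+\<sigma>. ennreal (kern \<sigma> powr 2 * indicator (- ball 1 (1/2)) \<sigma>) \<partial>hmeas)"
  have B: "(\<integral>\<^sup>+\<sigma>. ennreal (kern \<sigma> powr 2 * indicator (- ball 1 (1/2)) \<sigma>) \<partial>hmeas) \<le> ennreal B"
    using kern_far_integral[of 2] by (simp add: B_def less_top)
  have B0: "B \<ge> 0" by (simp add: B_def)
  have [measurable]: "ball (1::complex) (1/2) \<in> sets borel" "- ball (1::complex) (1/2) \<in> sets borel" by auto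
  show ?thesis
  proof (rule that[of "C + B powr (1 / 2)"])
    fix f :: "complex \<Rightarrow> real" and l A :: real
    assume [measurable]: "f \<in> borel_measurable borel" and f: "\<And>x. 0 \<le> f x" "\<And>x. f x \<le> l"
      and l: "l > 0" and A: "A > 0" "(\<integral>\<^sup>+x. ennreal (f x powr p) \<partial>hmeas) \<le> ennreal A"
    have "(\<integral>\<^sup>+x. ennreal (kern x * f x) \<partial>hmeas)
       = (\<integral>\<^sup>+x. ennreal (kern x * f x * indicator (ball 1 (1/2)) x) + ennreal (kern x * f x * indicator (- ball 1 (1/2)) x) \<partial>hmeas)"
      by (intro nn_integral_cong) (auto simp: indicator_def)
    also have "\<dots> = (\<integral>\<^sup>+x. ennreal (kern x * f x * indicator (ball 1 (1/2)) x) \<partial>hmeas)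
        + (\<integral>\<^sup>+x. ennreal (kern x * f x * indicator (- ball 1 (1/2)) x) \<partial>hmeas)"
      by (rule nn_integral_add) measurable
    also have "\<dots> \<le> ennreal (C * (l powr (1/3) * A powr (1/2)))
       + ennreal (B powr (1 / 2) * (l powr (4/3 - 1) * A powr (1 / (2 * 1))))"
      using f l A B B0 by (intro add_mono C kern_inner_Holder) (auto simp: p)
    also have "\<dots> = ennreal ((C + B powr (1 / 2)) * (l powr (p - 1) * A powr (1 / (2 * real N))))"
      using C(1) by (simp add: p True ennreal_plus[symmetric] algebra_simps del: ennreal_plus)
    finally show "(\<integral>\<^sup>+x. ennreal (kern x * f x) \<partial>hmeas) \<le> ennreal ((C + B powr (1 / 2)) * (l powr (p - 1) * A powr (1 / (2 * real N))))" .
  qed (use C in auto)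
qed

definition Kern :: "complex \<Rightarrow> complex \<Rightarrow> real" where
  "Kern \<tau> \<zeta> = sqrt (norm \<tau> * norm \<zeta>) / norm (\<tau> - \<zeta>)"

lemma Kern_measurable [measurable]: "(\<lambda>x. Kern (fst x) (snd x)) \<in> borel_measurable (borel \<Otimes>\<^sub>M borel)"
  unfolding Kern_def by measurable

lemma Kern_measurable2 [measurable (raw)]:
  fixes f g :: "'a \<Rightarrow> complex"
  assumes [measurable]: "f \<in> borel_measurable M" "g \<in> borel_measurable M"
  shows "(\<lambda>x. Kern (f x) (g x)) \<in> borel_measurable M"
  unfolding Kern_def by measurable

lemma Kern_nonneg [simp]: "Kern \<tau> \<zeta> \<ge> 0" by (simp add: Kern_def)

lemma Kern_sym: "Kern \<tau> \<zeta> = Kern \<zeta> \<tau>" by (simp add: Kern_def norm_minus_commute mult.commute)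

lemma Kern_mult: "\<tau> \<noteq> 0 \<Longrightarrow> Kern \<tau> (\<sigma> * \<tau>) = kern \<sigma>"
proof -
  assume "\<tau> \<noteq> 0"
  moreover have "norm (\<tau> - \<sigma> * \<tau>) = norm (\<sigma> - 1) * norm \<tau>"
    unfolding norm_mult[symmetric] by (simp add: algebra_simps norm_minus_commute)
  moreover have "sqrt (norm \<tau> * (norm \<sigma> * norm \<tau>)) = sqrt (norm \<sigma>) * norm \<tau>"
    by (simp add: real_sqrt_mult mult_ac)
  ultimately show ?thesis by (simp add: Kern_def kern_def norm_mult)
qed

lemma nn_integral_Kern:
  assumes "\<tau> \<noteq> 0" and [measurable]: "f \<in> borel_measurable borel"
  shows "(\<integral>\<^sup>+\<zeta>. ennreal (Kern \<tau> \<zeta>) * f \<zeta> \<partial>hmeas) = (\<integral>\<^sup>+\<sigma>. ennreal (kern \<sigma>) * f (\<sigma> * \<tau>) \<partial>hmeas)"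
  using nn_integral_hmeas_mult[OF assms(1), of "\<lambda>\<zeta>. ennreal (Kern \<tau> \<zeta>) * f \<zeta>"] assms(1)
  by (simp add: Kern_mult)

text \<open>This is the diagonal Hardy-Littlewood-Sobolev inequality for the kernel \<open>Kern\<close>. By symmetry it is enough to integrate
over the pairs with \<open>g \<zeta> \<le> g \<tau>\<close>. For fixed \<open>\<tau>\<close> the truncated function is bounded by \<open>g \<tau>\<close>, so \<open>kern_inner\<close> bounds
the inner integral by a multiple of \<open>g \<tau> powr (p - 1)\<close>, and the outer integral is again that of \<open>g powr p\<close>.\<close>

lemma HLS_cylinder:
  fixes N :: nat
  assumes N: "N \<ge> 1" and p: "p = 4 * real N / (2 * real N + 1)"
  obtains C where "C \<ge> 0"
   "\<And>g A. g \<in> borel_measurable borel \<Longrightarrow> (\<And>x. 0 \<le> g x) \<Longrightarrow> A > 0 \<Longrightarrow>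
     (\<integral>\<^sup>+x. ennreal (g x powr p) \<partial>hmeas) \<le> ennreal A \<Longrightarrow>
     (\<integral>\<^sup>+\<tau>. \<integral>\<^sup>+\<zeta>. ennreal (Kern \<tau> \<zeta> * g \<tau> * g \<zeta>) \<partial>hmeas \<partial>hmeas) \<le> ennreal (C * A powr (2 / p))"
proof -
  obtain C where C: "C \<ge> 0"
   "\<And>f l A. f \<in> borel_measurable borel \<Longrightarrow> (\<And>x. 0 \<le> f x) \<Longrightarrow> (\<And>x. f x \<le> l) \<Longrightarrow> l > 0 \<Longrightarrow> A > 0 \<Longrightarrow>
     (\<integral>\<^sup>+x. ennreal (f x powr p) \<partial>hmeas) \<le> ennreal A \<Longrightarrow>
     (\<integral>\<^sup>+x. ennreal (kern x * f x) \<partial>hmeas) \<le> ennreal (C * (l powr (p - 1) * A powr (1 / (2 * real N))))"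
    using kern_inner[OF N p] by blast
  have p0: "p > 0" and e: "1 + 1 / (2 * real N) = 2 / p" using N by (auto simp: p field_simps)
  show ?thesis
  proof (rule that[of "2 * C"])
    fix g :: "complex \<Rightarrow> real" and A :: real
    assume [measurable]: "g \<in> borel_measurable borel" and g: "\<And>x. 0 \<le> g x"
      and A: "A > 0" "(\<integral>\<^sup>+x. ennreal (g x powr p) \<partial>hmeas) \<le> ennreal A"
    \<comment> \<open>The part of the integrand where \<open>g \<tau>\<close> is the larger value; by symmetry it carries at least
      half of the double integral.\<close>
    define F where "F \<tau> \<zeta> = ennreal (Kern \<tau> \<zeta> * g \<tau> * (if g \<zeta> \<le> g \<tau> then g \<zeta> else 0))" for \<tau> \<zeta>
    have [measurable]: "(\<lambda>x. F (fst x) (snd x)) \<in> borel_measurable (borel \<Otimes>\<^sub>M borel)"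
      "(\<lambda>x. F (snd x) (fst x)) \<in> borel_measurable (borel \<Otimes>\<^sub>M borel)"
      unfolding F_def by measurable
    have inner: "(\<integral>\<^sup>+\<zeta>. F \<tau> \<zeta> \<partial>hmeas) \<le> ennreal (C * A powr (1 / (2 * real N))) * ennreal (g \<tau> powr p)" for \<tau>
    proof (cases "\<tau> = 0 \<or> g \<tau> = 0")
      case True
      then have "F \<tau> \<zeta> = 0" for \<zeta> by (auto simp: F_def Kern_def)
      then show ?thesis by simp
    next
      case False
      then have tau: "\<tau> \<noteq> 0" and gt: "g \<tau> > 0" using g[of \<tau>] by auto
      define f where "f \<zeta> = (if g \<zeta> \<le> g \<tau> then g \<zeta> else 0)" for \<zeta>
      have [measurable]: "f \<in> borel_measurable borel" unfolding f_def by measurable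
      have "(\<integral>\<^sup>+\<zeta>. F \<tau> \<zeta> \<partial>hmeas) = (\<integral>\<^sup>+\<zeta>. ennreal (g \<tau>) * (ennreal (Kern \<tau> \<zeta>) * ennreal (f \<zeta>)) \<partial>hmeas)"
        using g by (intro nn_integral_cong) (auto simp: F_def f_def ennreal_mult[symmetric] mult_ac)
      also have "\<dots> = ennreal (g \<tau>) * (\<integral>\<^sup>+\<zeta>. ennreal (Kern \<tau> \<zeta>) * ennreal (f \<zeta>) \<partial>hmeas)"
        by (rule nn_integral_cmult) measurable
      also have "(\<integral>\<^sup>+\<zeta>. ennreal (Kern \<tau> \<zeta>) * ennreal (f \<zeta>) \<partial>hmeas) = (\<integral>\<^sup>+\<sigma>. ennreal (kern \<sigma>) * ennreal (f (\<sigma> * \<tau>)) \<partial>hmeas)"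
        by (rule nn_integral_Kern[OF tau]) measurable
      also have "\<dots> = (\<integral>\<^sup>+\<sigma>. ennreal (kern \<sigma> * f (\<sigma> * \<tau>)) \<partial>hmeas)"
        using g by (intro nn_integral_cong) (auto simp: f_def ennreal_mult)
      also have "\<dots> \<le> ennreal (C * (g \<tau> powr (p - 1) * A powr (1 / (2 * real N))))"
      proof (rule C(2))
        have "(\<integral>\<^sup>+x. ennreal (f (x * \<tau>) powr p) \<partial>hmeas) = (\<integral>\<^sup>+x. ennreal (f x powr p) \<partial>hmeas)"
          by (rule nn_integral_hmeas_mult[OF tau]) measurable
        also have "\<dots> \<le> (\<integral>\<^sup>+x. ennreal (g x powr p) \<partial>hmeas)"
          using g by (intro nn_integral_mono) (auto simp: f_def)
        finally show "(\<integral>\<^sup>+x. ennreal (f (x * \<tau>) powr p) \<partial>hmeas) \<le> ennreal A" using A by order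
      qed (use g gt A in \<open>auto simp: f_def\<close>)
      also have "ennreal (g \<tau>) * ennreal (C * (g \<tau> powr (p - 1) * A powr (1 / (2 * real N))))
         = ennreal (C * A powr (1 / (2 * real N))) * ennreal (g \<tau> powr p)"
      proof -
        have "g \<tau> * g \<tau> powr (p - 1) = g \<tau> powr p" using gt by (simp add: powr_diff)
        then have "g \<tau> * (C * (g \<tau> powr (p - 1) * A powr (1 / (2 * real N)))) = C * A powr (1 / (2 * real N)) * g \<tau> powr p"
          by (metis (no_types, opaque_lifting) mult.assoc mult.commute)
        then show ?thesis using C(1) g[of \<tau>] by (simp add: ennreal_mult[symmetric])
      qed
      finally show ?thesis by (simp add: mult_left_mono)
    qed
    have outer: "(\<integral>\<^sup>+\<tau>. \<integral>\<^sup>+\<zeta>. F \<tau> \<zeta> \<partial>hmeas \<partial>hmeas) \<le> ennreal (C * A powr (2 / p))"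
    proof -
      have "(\<integral>\<^sup>+\<tau>. \<integral>\<^sup>+\<zeta>. F \<tau> \<zeta> \<partial>hmeas \<partial>hmeas)
         \<le> (\<integral>\<^sup>+\<tau>. ennreal (C * A powr (1 / (2 * real N))) * ennreal (g \<tau> powr p) \<partial>hmeas)"
        by (intro nn_integral_mono inner)
      also have "\<dots> = ennreal (C * A powr (1 / (2 * real N))) * (\<integral>\<^sup>+\<tau>. ennreal (g \<tau> powr p) \<partial>hmeas)"
        by (rule nn_integral_cmult) measurable
      also have "\<dots> \<le> ennreal (C * A powr (1 / (2 * real N))) * ennreal A"
        by (intro mult_left_mono A) auto
      also have "\<dots> = ennreal (C * A powr (2 / p))"
        unfolding e[symmetric] using A C by (simp add: ennreal_mult[symmetric] powr_add mult_ac)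
      finally show ?thesis .
    qed
    have "(\<integral>\<^sup>+\<tau>. \<integral>\<^sup>+\<zeta>. ennreal (Kern \<tau> \<zeta> * g \<tau> * g \<zeta>) \<partial>hmeas \<partial>hmeas)
       \<le> (\<integral>\<^sup>+\<tau>. \<integral>\<^sup>+\<zeta>. F \<tau> \<zeta> + F \<zeta> \<tau> \<partial>hmeas \<partial>hmeas)"
      using g by (intro nn_integral_mono) (auto simp: F_def Kern_sym mult_ac)
    also have "\<dots> = (\<integral>\<^sup>+\<tau>. (\<integral>\<^sup>+\<zeta>. F \<tau> \<zeta> \<partial>hmeas) + (\<integral>\<^sup>+\<zeta>. F \<zeta> \<tau> \<partial>hmeas) \<partial>hmeas)"
      by (intro nn_integral_cong nn_integral_add) (simp_all add: F_def)
    also have "\<dots> = (\<integral>\<^sup>+\<tau>. (\<integral>\<^sup>+\<zeta>. F \<tau> \<zeta> \<partial>hmeas) \<partial>hmeas) + (\<integral>\<^sup>+\<tau>. (\<integral>\<^sup>+\<zeta>. F \<zeta> \<tau> \<partial>hmeas) \<partial>hmeas)"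
      by (rule nn_integral_add) (simp_all add: F_def)
    also have "(\<integral>\<^sup>+\<tau>. (\<integral>\<^sup>+\<zeta>. F \<zeta> \<tau> \<partial>hmeas) \<partial>hmeas) = (\<integral>\<^sup>+\<tau>. \<integral>\<^sup>+\<zeta>. F \<tau> \<zeta> \<partial>hmeas \<partial>hmeas)"
      by (rule hmeas_pair.Fubini') (simp add: F_def)
    also have "(\<integral>\<^sup>+\<tau>. (\<integral>\<^sup>+\<zeta>. F \<tau> \<zeta> \<partial>hmeas) \<partial>hmeas) + \<dots> \<le> ennreal (C * A powr (2 / p)) + ennreal (C * A powr (2 / p))"
      by (intro add_mono outer)
    also have "\<dots> = ennreal (2 * C * A powr (2 / p))"
      using C by (simp add: ennreal_plus[symmetric] del: ennreal_plus)
    finally show "(\<integral>\<^sup>+\<tau>. \<integral>\<^sup>+\<zeta>. ennreal (Kern \<tau> \<zeta> * g \<tau> * g \<zeta>) \<partial>hmeas \<partial>hmeas) \<le> ennreal (2 * C * A powr (2 / p))" .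
  qed (use C in auto)
qed

section \<open>A Cauchy-Pompeiu inequality along complex lines\<close>

lemma lborel_integral_translate:
  fixes f :: "'a::euclidean_space \<Rightarrow> 'b::{banach,second_countable_topology}"
  assumes [measurable]: "f \<in> borel_measurable borel"
  shows "(LINT x|lborel. f (x + a)) = (LINT x|lborel. f x)"
proof -
  have "(LINT x|lborel. f x) = (LINT x|distr lborel borel ((+) a). f x)"
    by (simp add: lborel_distr_plus)
  also have "\<dots> = (LINT x|lborel. f (a + x))"
    by (subst integral_distr) auto
  finally show ?thesis by (simp add: add.commute)
qed

lemma integrable_continuous_bounded_support:
  fixes f :: "'a::euclidean_space \<Rightarrow> 'b::{banach,second_countable_topology}"
  assumes "continuous_on UNIV f" and "\<And>x. norm x > R \<Longrightarrow> f x = 0"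
  shows "integrable lborel f"
proof -
  have "integrable lborel (\<lambda>x. indicator (cball 0 R) x *\<^sub>R f x)"
    by (rule borel_integrable_compact) (auto intro: continuous_on_subset[OF assms(1)])
  moreover have "(\<lambda>x. indicator (cball 0 R) x *\<^sub>R f x) = f"
    using assms(2) by (auto simp: fun_eq_iff indicator_def)
  ultimately show ?thesis by simp
qed

text \<open>By the fundamental theorem of calculus, the mean of \<open>d\<close> over the segment from \<open>x\<close> to \<open>x + b\<close> is \<open>\<psi> (x + b) - \<psi> x\<close>;
integration over \<open>x\<close> gives zero by translation invariance.\<close>

lemma integral_directional_derivative_eq_0:
  fixes \<psi> d :: "'a::euclidean_space \<Rightarrow> complex"
  assumes deriv: "\<And>x. ((\<lambda>t::real. \<psi> (x + t *\<^sub>R b)) has_vector_derivative d x) (at 0)"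
    and cont: "continuous_on UNIV \<psi>" "continuous_on UNIV d"
    and supp: "\<And>x. norm x > R \<Longrightarrow> \<psi> x = 0" "\<And>x. norm x > R \<Longrightarrow> d x = 0"
  shows "(LINT x|lborel. d x) = 0"
proof -
  have [measurable]: "\<psi> \<in> borel_measurable borel" "d \<in> borel_measurable borel"
    using cont by (auto intro: borel_measurable_continuous_onI)
  define R' where "R' = \<bar>R\<bar> + norm b"
  have FTC: "(LINT t|lborel. indicator {0..1} t *\<^sub>R d (x + t *\<^sub>R b)) = \<psi> (x + b) - \<psi> x" for x
  proof -
    have "((\<lambda>t. \<psi> (x + t *\<^sub>R b)) has_vector_derivative d (x + t *\<^sub>R b)) (at t)" for t
    proof -
      have "((\<lambda>s. \<psi> ((x + t *\<^sub>R b) + s *\<^sub>R b)) \<circ> (\<lambda>s. s - t) has_vector_derivative (1 *\<^sub>R d (x + t *\<^sub>R b))) (at t)"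
        by (rule vector_diff_chain_at) (auto intro!: derivative_eq_intros deriv)
      then show ?thesis by (simp add: o_def algebra_simps)
    qed
    then have "has_bochner_integral lborel (\<lambda>t. indicator {0..1} t *\<^sub>R d (x + t *\<^sub>R b)) (\<psi> (x + 1 *\<^sub>R b) - \<psi> (x + 0 *\<^sub>R b))"
      by (intro has_bochner_integral_FTC_Icc)
        (auto intro: has_vector_derivative_at_within intro!: continuous_on_compose2[OF cont(2)] continuous_intros)
    then show ?thesis by (simp add: has_bochner_integral_iff)
  qed
  have int: "integrable (lborel \<Otimes>\<^sub>M lborel) (case_prod (\<lambda>x t. indicator {0..1::real} t *\<^sub>R d (x + t *\<^sub>R b)))"
  proof -
    have "integrable lborel (\<lambda>p. indicator (cball 0 R' \<times> {0..1::real}) p *\<^sub>R d (fst p + snd p *\<^sub>R b))"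
      by (rule borel_integrable_compact)
        (auto intro!: compact_Times continuous_on_compose2[OF cont(2)] continuous_intros)
    moreover have "indicator (cball 0 R' \<times> {0..1::real}) p *\<^sub>R d (fst p + snd p *\<^sub>R b)
      = (case_prod (\<lambda>x t. indicator {0..1::real} t *\<^sub>R d (x + t *\<^sub>R b))) p" for p
    proof (cases p)
      case (Pair x t)
      have "d (x + t *\<^sub>R b) = 0" if "norm x > R'" "0 \<le> t" "t \<le> 1"
      proof (rule supp)
        have "norm (t *\<^sub>R b) \<le> norm b" using that mult_right_mono[of t 1 "norm b"] by simp
        then show "R < norm (x + t *\<^sub>R b)"
          using that norm_triangle_ineq2[of x "- (t *\<^sub>R b)"] by (simp add: R'_def)
      qed
      then show ?thesis by (cases "norm x > R'") (auto simp: Pair indicator_def)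
    qed
    ultimately show ?thesis by (simp add: lborel_prod)
  qed
  have psi: "integrable lborel \<psi>" by (rule integrable_continuous_bounded_support[OF cont(1) supp(1)])
  have psib: "integrable lborel (\<lambda>x. \<psi> (x + b))"
  proof (rule integrable_continuous_bounded_support[of _ R'])
    show "continuous_on UNIV (\<lambda>x. \<psi> (x + b))"
      by (intro continuous_on_compose2[OF cont(1)] continuous_intros) auto
    show "\<psi> (x + b) = 0" if "norm x > R'" for x
    proof (rule supp)
      show "R < norm (x + b)"
        using that norm_triangle_ineq2[of x "- b"] by (simp add: R'_def)
    qed
  qed
  have "(LINT t|lborel. (LINT x|lborel. indicator {0..1::real} t *\<^sub>R d (x + t *\<^sub>R b)))
      = (LINT x|lborel. (LINT t|lborel. indicator {0..1::real} t *\<^sub>R d (x + t *\<^sub>R b)))"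
    by (rule lborel_pair.Fubini_integral[OF int])
  also have "\<dots> = (LINT x|lborel. \<psi> (x + b)) - (LINT x|lborel. \<psi> x)"
    using psi psib by (simp add: FTC)
  also have "\<dots> = 0" by (simp add: lborel_integral_translate)
  finally have "(LINT t|lborel. indicator {0..1::real} t *\<^sub>R (LINT x|lborel. d x)) = 0"
    by (simp add: lborel_integral_translate)
  then show ?thesis by simp
qed

text \<open>Rescalings of this function are the derivatives, in the conjugate variable, of the smooth kernels that replace the
Cauchy kernel. Its mass takes the place of the constant \<open>\<pi>\<close> in the Cauchy-Pompeiu formula.\<close>

definition bubble :: "complex \<Rightarrow> real" where "bubble s = 1 / (1 + (norm s)\<^sup>2)\<^sup>2"

definition bubble_mass :: real where "bubble_mass = (LINT s|lborel. bubble s)"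

lemma bubble_measurable [measurable]: "bubble \<in> borel_measurable borel"
  unfolding bubble_def by measurable

lemma bubble_pos: "bubble s > 0"
  unfolding bubble_def by (intro divide_pos_pos zero_less_power add_pos_nonneg) auto

lemma integrable_bubble: "integrable lborel bubble"
proof (rule integrableI_bounded)
  have [measurable]: "ball (0::complex) 1 \<in> sets borel" "- ball (0::complex) 1 \<in> sets borel" by auto
  have "(\<integral>\<^sup>+s. ennreal (norm (bubble s)) \<partial>lborel)
     \<le> (\<integral>\<^sup>+s. indicator (ball (0::complex) 1) s + ennreal (norm s powr (-4)) * indicator (- ball (0::complex) 1) s \<partial>lborel)"
  proof (rule nn_integral_mono)
    fix s :: complex
    have 1: "bubble s \<le> 1" unfolding bubble_def by (auto simp: divide_le_eq_1 one_le_power)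
    have 2: "bubble s \<le> norm s powr (-4)" if "norm s \<ge> 1"
    proof -
      have "bubble s \<le> 1 / ((norm s)\<^sup>2)\<^sup>2"
        unfolding bubble_def using that
        by (intro divide_left_mono power_mono mult_pos_pos zero_less_power add_pos_nonneg) (auto intro: order_less_le_trans[of 0 1])
      also have "\<dots> = norm s powr (-4)"
        using that by (subst powr_minus) (simp add: inverse_eq_divide)
      finally show ?thesis .
    qed
    show "ennreal (norm (bubble s)) \<le> indicator (ball 0 1) s + ennreal (norm s powr (-4)) * indicator (- ball 0 1) s"
      using 1 2 bubble_pos[of s] by (auto simp: indicator_def intro: ennreal_leI)
  qed
  also have "\<dots> = emeasure lborel (ball (0::complex) 1) + (\<integral>\<^sup>+s. ennreal (norm s powr (-4)) * indicator (- ball (0::complex) 1) s \<partial>lborel)"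
    by (simp add: nn_integral_add)
  also have "\<dots> < \<infinity>"
    using nn_integral_outside_ball_powr_finite[of 4] by (simp add: emeasure_ball)
  finally show "(\<integral>\<^sup>+s. ennreal (norm (bubble s)) \<partial>lborel) < \<infinity>" .
qed measurable

lemma bubble_mass_pos: "bubble_mass > 0"
proof -
  have "bubble_mass \<ge> 0" unfolding bubble_mass_def
    by (intro Bochner_Integration.integral_nonneg) (auto intro: less_imp_le bubble_pos)
  moreover have "bubble_mass \<noteq> 0"
  proof
    assume "bubble_mass = 0"
    then have "AE s in lborel. bubble s = 0"
      unfolding bubble_mass_def
      by (subst (asm) integral_nonneg_eq_0_iff_AE[OF integrable_bubble]) (auto intro: less_imp_le bubble_pos)
    then have "AE s::complex in lborel. False"
      by eventually_elim (use bubble_pos in \<open>metis less_irrefl\<close>)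
    then show False by (simp add: eventually_False ae_filter_eq_bot_iff)
  qed
  ultimately show ?thesis by simp
qed

lemma integral_complex_affine:
  fixes f :: "complex \<Rightarrow> complex"
  assumes r: "r > 0" and [measurable]: "f \<in> borel_measurable borel"
  shows "(LINT x|lborel. f x) = of_real (r\<^sup>2) * (LINT s|lborel. f (a + of_real r * s))"
proof -
  have "(LINT x|lborel. f x) = (LINT x|density (distr lborel borel (\<lambda>x. a + r *\<^sub>R x)) (\<lambda>_. ennreal (\<bar>r\<bar>^DIM(complex))). f x)"
    using lborel_affine[of r a] r by simp
  also have "\<dots> = (LINT x|distr lborel borel (\<lambda>x. a + r *\<^sub>R x). (r\<^sup>2) *\<^sub>R f x)"
    by (subst integral_density) auto
  also have "\<dots> = (LINT s|lborel. (r\<^sup>2) *\<^sub>R f (a + r *\<^sub>R s))"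
    by (subst integral_distr) auto
  finally show ?thesis by (simp add: scaleR_conv_of_real)
qed

text \<open>The Cauchy kernel is replaced by the smooth kernel \<open>cnj (\<tau> - a) / ((norm (\<tau> - a))\<^sup>2 + \<delta>\<^sup>2)\<close>, which is smaller in
modulus. Integration by parts against it gives the mean of \<open>\<phi>\<close> over a bubble of width \<open>\<delta>\<close>, which tends to
\<open>bubble_mass * \<phi> a\<close>.\<close>

lemma cauchy_pompeiu_inequality:
  fixes \<phi> d1 d2 :: "complex \<Rightarrow> complex"
  assumes deriv: "\<And>x. ((\<lambda>t::real. \<phi> (x + of_real t)) has_vector_derivative d1 x) (at 0)"
      "\<And>x. ((\<lambda>t::real. \<phi> (x + of_real t * \<i>)) has_vector_derivative d2 x) (at 0)"
    and cont: "continuous_on UNIV \<phi>" "continuous_on UNIV d1" "continuous_on UNIV d2"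
    and supp: "\<And>x. norm x > R \<Longrightarrow> \<phi> x = 0" "\<And>x. norm x > R \<Longrightarrow> d1 x = 0" "\<And>x. norm x > R \<Longrightarrow> d2 x = 0"
  shows "ennreal (bubble_mass * norm (\<phi> a)) \<le> (\<integral>\<^sup>+\<tau>. ennreal (norm ((d1 \<tau> + \<i> * d2 \<tau>) / 2) / norm (\<tau> - a)) \<partial>lborel)"
    (is "_ \<le> ?RHS")
proof -
  have [measurable]: "\<phi> \<in> borel_measurable borel" "d1 \<in> borel_measurable borel" "d2 \<in> borel_measurable borel"
    using cont by (auto intro: borel_measurable_continuous_onI)
  have step: "ennreal (norm (LINT s|lborel. \<phi> (a + of_real \<delta> * s) * of_real (bubble s))) \<le> ?RHS" if \<delta>: "\<delta> > 0" for \<delta>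
  proof -
    define D where "D \<tau> = complex_of_real ((norm (\<tau> - a))\<^sup>2 + \<delta>\<^sup>2)" for \<tau>
    \<comment> \<open>A smooth substitute for the Cauchy kernel \<open>1 / (\<tau> - a)\<close>; its derivative in the variable \<open>cnj \<tau>\<close> is
      \<open>\<delta>\<^sup>2 / (D \<tau>)\<^sup>2\<close>, a rescaled bubble.\<close>
    define \<kappa> where "\<kappa> \<tau> = cnj (\<tau> - a) / D \<tau>" for \<tau>
    have D0: "D \<tau> \<noteq> 0" for \<tau>
    proof -
      have "(norm (\<tau> - a))\<^sup>2 + \<delta>\<^sup>2 > 0" using \<delta> by (intro add_nonneg_pos) auto
      then show ?thesis unfolding D_def by (metis less_irrefl of_real_eq_0_iff)
    qed
    have D_eq: "D \<tau> = (\<tau> - a) * cnj (\<tau> - a) + of_real (\<delta>\<^sup>2)" for \<tau>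
      unfolding D_def by (simp only: complex_norm_square[symmetric] of_real_add)
    have contD: "continuous_on UNIV D" unfolding D_def by (intro continuous_intros)
    have cont\<kappa>: "continuous_on UNIV \<kappa>" unfolding \<kappa>_def using D0 contD by (intro continuous_intros) auto
    have deriv\<kappa>: "((\<lambda>t::real. \<kappa> (\<tau> + of_real t * b)) has_vector_derivative
        (cnj b * of_real (\<delta>\<^sup>2) - b * (cnj (\<tau> - a))\<^sup>2) / (D \<tau>)\<^sup>2) (at 0)" for \<tau> b
    proof -
      have "((\<lambda>u. (cnj (\<tau> - a) + u * cnj b) / (((\<tau> - a) + u * b) * (cnj (\<tau> - a) + u * cnj b) + of_real (\<delta>\<^sup>2)))
         has_field_derivative ((cnj b * D \<tau> - cnj (\<tau> - a) * ((\<tau> - a) * cnj b + b * cnj (\<tau> - a))) / (D \<tau>)\<^sup>2)) (at (of_real 0))"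
        using D0[of \<tau>] unfolding D_eq
        by (auto intro!: derivative_eq_intros simp: power2_eq_square algebra_simps)
      from has_vector_derivative_real_field[OF this]
      have "((\<lambda>t::real. (cnj (\<tau> - a) + of_real t * cnj b) / (((\<tau> - a) + of_real t * b) * (cnj (\<tau> - a) + of_real t * cnj b) + of_real (\<delta>\<^sup>2)))
         has_vector_derivative ((cnj b * D \<tau> - cnj (\<tau> - a) * ((\<tau> - a) * cnj b + b * cnj (\<tau> - a))) / (D \<tau>)\<^sup>2)) (at 0)" .
      moreover have "(\<lambda>t::real. (cnj (\<tau> - a) + of_real t * cnj b) / (((\<tau> - a) + of_real t * b) * (cnj (\<tau> - a) + of_real t * cnj b) + of_real (\<delta>\<^sup>2)))
         = (\<lambda>t. \<kappa> (\<tau> + of_real t * b))"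
        unfolding \<kappa>_def D_eq by (simp add: algebra_simps fun_eq_iff)
      moreover have "cnj b * D \<tau> - cnj (\<tau> - a) * ((\<tau> - a) * cnj b + b * cnj (\<tau> - a)) = cnj b * of_real (\<delta>\<^sup>2) - b * (cnj (\<tau> - a))\<^sup>2"
        unfolding D_eq by (simp add: algebra_simps power2_eq_square)
      ultimately show ?thesis by simp
    qed
    define k1 where "k1 \<tau> = (of_real (\<delta>\<^sup>2) - (cnj (\<tau> - a))\<^sup>2) / (D \<tau>)\<^sup>2" for \<tau>
    define k2 where "k2 \<tau> = (- \<i> * of_real (\<delta>\<^sup>2) - \<i> * (cnj (\<tau> - a))\<^sup>2) / (D \<tau>)\<^sup>2" for \<tau>
    have contk: "continuous_on UNIV k1" "continuous_on UNIV k2"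
      unfolding k1_def k2_def using D0 contD by (intro continuous_intros; auto)+
    have i1: "(LINT \<tau>|lborel. d1 \<tau> * \<kappa> \<tau> + \<phi> \<tau> * k1 \<tau>) = 0"
    proof (rule integral_directional_derivative_eq_0[where b=1 and \<psi> = "\<lambda>\<tau>. \<phi> \<tau> * \<kappa> \<tau>"])
      fix x
      show "((\<lambda>t. \<phi> (x + t *\<^sub>R 1) * \<kappa> (x + t *\<^sub>R 1)) has_vector_derivative d1 x * \<kappa> x + \<phi> x * k1 x) (at 0)"
        using has_vector_derivative_mult[OF deriv(1)[of x] deriv\<kappa>[of x 1]]
        by (simp add: scaleR_conv_of_real k1_def add.commute)
    qed (use supp cont contk cont\<kappa> in \<open>auto intro!: continuous_intros\<close>)
    have i2: "(LINT \<tau>|lborel. d2 \<tau> * \<kappa> \<tau> + \<phi> \<tau> * k2 \<tau>) = 0"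
    proof (rule integral_directional_derivative_eq_0[where b=\<i> and \<psi> = "\<lambda>\<tau>. \<phi> \<tau> * \<kappa> \<tau>"])
      fix x
      show "((\<lambda>t. \<phi> (x + t *\<^sub>R \<i>) * \<kappa> (x + t *\<^sub>R \<i>)) has_vector_derivative d2 x * \<kappa> x + \<phi> x * k2 x) (at 0)"
        using has_vector_derivative_mult[OF deriv(2)[of x] deriv\<kappa>[of x \<i>]]
        by (simp add: scaleR_conv_of_real k2_def add.commute)
    qed (use supp cont contk cont\<kappa> in \<open>auto intro!: continuous_intros\<close>)
    have int1: "integrable lborel (\<lambda>\<tau>. d1 \<tau> * \<kappa> \<tau> + \<phi> \<tau> * k1 \<tau>)" "integrable lborel (\<lambda>\<tau>. d2 \<tau> * \<kappa> \<tau> + \<phi> \<tau> * k2 \<tau>)"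
      by (rule integrable_continuous_bounded_support[of _ R];
          use supp cont contk cont\<kappa> in \<open>auto intro!: continuous_intros\<close>)+
    have int2: "integrable lborel (\<lambda>\<tau>. (d1 \<tau> + \<i> * d2 \<tau>) / 2 * \<kappa> \<tau>)"
      by (rule integrable_continuous_bounded_support[of _ R];
          use supp cont contk cont\<kappa> in \<open>auto intro!: continuous_intros\<close>)
    have int3: "integrable lborel (\<lambda>\<tau>. \<phi> \<tau> * (of_real (\<delta>\<^sup>2) / (D \<tau>)\<^sup>2))"
      by (rule integrable_continuous_bounded_support[of _ R];
          use supp cont contD D0 in \<open>auto intro!: continuous_intros\<close>)
    have kk: "k1 \<tau> + \<i> * k2 \<tau> = 2 * (of_real (\<delta>\<^sup>2) / (D \<tau>)\<^sup>2)" for \<tau>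
      unfolding k1_def k2_def using D0[of \<tau>] by (simp add: field_simps)
    have "0 = (LINT \<tau>|lborel. d1 \<tau> * \<kappa> \<tau> + \<phi> \<tau> * k1 \<tau>) + \<i> * (LINT \<tau>|lborel. d2 \<tau> * \<kappa> \<tau> + \<phi> \<tau> * k2 \<tau>)"
      using i1 i2 by simp
    also have "\<dots> = (LINT \<tau>|lborel. (d1 \<tau> * \<kappa> \<tau> + \<phi> \<tau> * k1 \<tau>) + \<i> * (d2 \<tau> * \<kappa> \<tau> + \<phi> \<tau> * k2 \<tau>))"
      using int1 by simp
    also have "\<dots> = (LINT \<tau>|lborel. 2 * ((d1 \<tau> + \<i> * d2 \<tau>) / 2 * \<kappa> \<tau> + \<phi> \<tau> * (of_real (\<delta>\<^sup>2) / (D \<tau>)\<^sup>2)))"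
    proof (intro Bochner_Integration.integral_cong refl)
      fix \<tau>
      have "(d1 \<tau> * \<kappa> \<tau> + \<phi> \<tau> * k1 \<tau>) + \<i> * (d2 \<tau> * \<kappa> \<tau> + \<phi> \<tau> * k2 \<tau>)
        = (d1 \<tau> + \<i> * d2 \<tau>) * \<kappa> \<tau> + \<phi> \<tau> * (k1 \<tau> + \<i> * k2 \<tau>)" by (simp add: algebra_simps)
      then show "(d1 \<tau> * \<kappa> \<tau> + \<phi> \<tau> * k1 \<tau>) + \<i> * (d2 \<tau> * \<kappa> \<tau> + \<phi> \<tau> * k2 \<tau>)
        = 2 * ((d1 \<tau> + \<i> * d2 \<tau>) / 2 * \<kappa> \<tau> + \<phi> \<tau> * (of_real (\<delta>\<^sup>2) / (D \<tau>)\<^sup>2))"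
        unfolding kk by (simp add: algebra_simps)
    qed
    also have "\<dots> = 2 * ((LINT \<tau>|lborel. (d1 \<tau> + \<i> * d2 \<tau>) / 2 * \<kappa> \<tau>) + (LINT \<tau>|lborel. \<phi> \<tau> * (of_real (\<delta>\<^sup>2) / (D \<tau>)\<^sup>2)))"
      by (subst integral_mult_right_zero, subst Bochner_Integration.integral_add[OF int2 int3]) (rule refl)
    finally have eq: "norm (LINT \<tau>|lborel. \<phi> \<tau> * (of_real (\<delta>\<^sup>2) / (D \<tau>)\<^sup>2)) = norm (LINT \<tau>|lborel. (d1 \<tau> + \<i> * d2 \<tau>) / 2 * \<kappa> \<tau>)"
      by (metis (no_types, lifting) add_eq_0_iff2 mult_eq_0_iff norm_minus_cancel zero_neq_numeral)
    have "(LINT \<tau>|lborel. \<phi> \<tau> * (of_real (\<delta>\<^sup>2) / (D \<tau>)\<^sup>2)) = of_real (\<delta>\<^sup>2) * (LINT s|lborel. \<phi> (a + of_real \<delta> * s) * (of_real (\<delta>\<^sup>2) / (D (a + of_real \<delta> * s))\<^sup>2))"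
      by (rule integral_complex_affine[OF \<delta>]) (simp add: D_def)
    also have "\<dots> = (LINT s|lborel. of_real (\<delta>\<^sup>2) * (\<phi> (a + of_real \<delta> * s) * (of_real (\<delta>\<^sup>2) / (D (a + of_real \<delta> * s))\<^sup>2)))"
      by (rule integral_mult_right_zero[symmetric])
    also have "\<dots> = (LINT s|lborel. \<phi> (a + of_real \<delta> * s) * of_real (bubble s))"
    proof (intro Bochner_Integration.integral_cong refl)
      fix s :: complex
      have "D (a + of_real \<delta> * s) = of_real (\<delta>\<^sup>2 * (1 + (norm s)\<^sup>2))"
        unfolding D_def using \<delta> by (simp add: norm_mult power_mult_distrib algebra_simps)
      then show "of_real (\<delta>\<^sup>2) * (\<phi> (a + of_real \<delta> * s) * (of_real (\<delta>\<^sup>2) / (D (a + of_real \<delta> * s))\<^sup>2)) = \<phi> (a + of_real \<delta> * s) * of_real (bubble s)"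
        using \<delta> by (simp add: bubble_def power_mult_distrib power2_eq_square)
    qed
    finally have "ennreal (norm (LINT s|lborel. \<phi> (a + of_real \<delta> * s) * of_real (bubble s))) = ennreal (norm (LINT \<tau>|lborel. (d1 \<tau> + \<i> * d2 \<tau>) / 2 * \<kappa> \<tau>))"
      using eq by simp
    also have "\<dots> \<le> (\<integral>\<^sup>+\<tau>. ennreal (norm ((d1 \<tau> + \<i> * d2 \<tau>) / 2 * \<kappa> \<tau>)) \<partial>lborel)"
      by (rule integral_norm_bound_ennreal[OF int2])
    also have "\<dots> \<le> ?RHS"
    proof (intro nn_integral_mono ennreal_leI)
      fix \<tau>
      have "norm (\<kappa> \<tau>) \<le> 1 / norm (\<tau> - a)"
      proof (cases "\<tau> = a")
        case False
        have "norm (D \<tau>) = (norm (\<tau> - a))\<^sup>2 + \<delta>\<^sup>2" unfolding D_def norm_of_real by simp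
        then have "norm (\<kappa> \<tau>) = norm (\<tau> - a) / ((norm (\<tau> - a))\<^sup>2 + \<delta>\<^sup>2)"
          unfolding \<kappa>_def norm_divide complex_mod_cnj by simp
        also have "\<dots> \<le> norm (\<tau> - a) / ((norm (\<tau> - a))\<^sup>2)"
          using False by (intro divide_left_mono) (auto intro!: mult_pos_pos add_pos_nonneg)
        also have "\<dots> = 1 / norm (\<tau> - a)" by (simp add: power2_eq_square)
        finally show ?thesis .
      qed (simp add: \<kappa>_def)
      then show "norm ((d1 \<tau> + \<i> * d2 \<tau>) / 2 * \<kappa> \<tau>) \<le> norm ((d1 \<tau> + \<i> * d2 \<tau>) / 2) / norm (\<tau> - a)"
        unfolding norm_mult using mult_left_mono[of "norm (\<kappa> \<tau>)" "1 / norm (\<tau> - a)" "norm ((d1 \<tau> + \<i> * d2 \<tau>) / 2)"] by simp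
    qed
    finally show ?thesis .
  qed
  obtain B where B: "\<And>x. norm (\<phi> x) \<le> B"
  proof -
    have "compact (\<phi> ` cball 0 R)"
      by (rule compact_continuous_image) (auto intro: continuous_on_subset[OF cont(1)])
    then obtain B where "\<forall>y\<in>\<phi> ` cball 0 R. norm y \<le> B"
      by (metis bounded_iff compact_imp_bounded)
    then have "norm (\<phi> x) \<le> max B 0" for x
      using supp(1)[of x] by (cases "norm x \<le> R") (auto simp: le_max_iff_disj)
    then show ?thesis using that by blast
  qed
  have "(\<lambda>n. (LINT s|lborel. \<phi> (a + of_real (inverse (real (Suc n))) * s) * of_real (bubble s))) \<longlonglongrightarrow> (LINT s|lborel. \<phi> a * of_real (bubble s))"
  proof (rule integral_dominated_convergence[where w = "\<lambda>s. B * bubble s"])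
    show "integrable lborel (\<lambda>s. B * bubble s)" using integrable_bubble by simp
    show "AE s in lborel. (\<lambda>n. \<phi> (a + of_real (inverse (real (Suc n))) * s) * of_real (bubble s)) \<longlonglongrightarrow> \<phi> a * of_real (bubble s)"
    proof (rule AE_I2)
      fix s
      have "(\<lambda>n. a + of_real (inverse (real (Suc n))) * s) \<longlonglongrightarrow> a + of_real 0 * s"
        by (intro tendsto_intros LIMSEQ_inverse_real_of_nat)
      then have "(\<lambda>n. \<phi> (a + of_real (inverse (real (Suc n))) * s)) \<longlonglongrightarrow> \<phi> a"
        using cont(1) by (intro continuous_on_tendsto_compose[OF cont(1)]) auto
      then show "(\<lambda>n. \<phi> (a + of_real (inverse (real (Suc n))) * s) * of_real (bubble s)) \<longlonglongrightarrow> \<phi> a * of_real (bubble s)"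
        by (intro tendsto_intros)
    qed
    show "AE s in lborel. norm (\<phi> (a + of_real (inverse (real (Suc n))) * s) * of_real (bubble s)) \<le> B * bubble s" for n
      by (rule AE_I2, unfold norm_mult norm_of_real)
        (use B bubble_pos in \<open>auto simp: abs_of_pos intro!: mult_right_mono less_imp_le\<close>)
  qed measurable
  then have "(\<lambda>n. ennreal (norm (LINT s|lborel. \<phi> (a + of_real (inverse (real (Suc n))) * s) * of_real (bubble s)))) \<longlonglongrightarrow> ennreal (norm (LINT s|lborel. \<phi> a * of_real (bubble s)))"
    by (intro tendsto_intros)
  then have "ennreal (norm (LINT s|lborel. \<phi> a * of_real (bubble s))) \<le> ?RHS"
    by (rule LIMSEQ_le_const2) (intro exI[of _ 0] allI impI step, simp)
  also have "norm (LINT s|lborel. \<phi> a * of_real (bubble s)) = bubble_mass * norm (\<phi> a)"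
    using bubble_mass_pos by (simp add: bubble_mass_def[symmetric] norm_mult)
  finally show ?thesis .
qed

lemma norm_smult: "norm (c *s x) = norm c * norm (x :: complex ^ 'n)"
  by (simp add: norm_vec_def norm_mult L2_set_right_distrib)

lemma scaleR_smult: "(r *\<^sub>R c) *s x = r *\<^sub>R (c *s x)" for x :: "complex ^ 'n"
  by (simp add: vec_eq_iff)

lemma linear_smult_right: "linear (\<lambda>x :: complex ^ 'n. c *s x)"
  by (rule linearI) (simp_all add: vector_add_ldistrib vec_eq_iff)

lemma linear_smult_left: "linear (\<lambda>c. c *s (x :: complex ^ 'n))"
  by (rule linearI) (simp_all add: vector_sadd_rdistrib scaleR_smult)

lemma bounded_linear_smult_left: "bounded_linear (\<lambda>c. c *s (x :: complex ^ 'n))"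
  using linear_smult_left linear_linear by blast

lemma continuous_on_smult [continuous_intros]:
  assumes "continuous_on S f" "continuous_on S g"
  shows "continuous_on S (\<lambda>x. f x *s (g x :: complex ^ 'n))"
  unfolding vector_scalar_mult_def
  by (intro continuous_on_vec_lambda continuous_intros assms)

text \<open>If \<open>W x\<close> is the real derivative at \<open>x\<close>, then this is the antiholomorphic derivative in the direction of \<open>x\<close> itself,
that is \<open>\<Sum>j. cnj (x $ j) * \<partial>w/\<partial>(cnj z)\<^sub>j\<close>.\<close>

definition Lbar :: "(complex ^ 'n \<Rightarrow> complex ^ 'n \<Rightarrow> complex) \<Rightarrow> complex ^ 'n \<Rightarrow> complex" where
  "Lbar W x = (W x x + \<i> * W x (\<i> *s x)) / 2"

lemma Lbar_smult:
  assumes "linear (W (\<tau> *s z))"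
  shows "Lbar W (\<tau> *s z) = cnj \<tau> * ((W (\<tau> *s z) z + \<i> * W (\<tau> *s z) (\<i> *s z)) / 2)"
proof -
  define L where "L = W (\<tau> *s z)"
  have L: "linear L" using assms by (simp add: L_def)
  have 1: "\<tau> *s z = Re \<tau> *\<^sub>R z + Im \<tau> *\<^sub>R (\<i> *s z)"
    by (simp add: vec_eq_iff complex_eq_iff algebra_simps)
  have 2: "\<i> *s (\<tau> *s z) = Re \<tau> *\<^sub>R (\<i> *s z) - Im \<tau> *\<^sub>R z"
    by (simp add: vec_eq_iff complex_eq_iff algebra_simps)
  have a: "L (\<tau> *s z) = of_real (Re \<tau>) * L z + of_real (Im \<tau>) * L (\<i> *s z)"
    unfolding 1 by (simp add: linear_add[OF L] linear_scale[OF L]) (simp add: scaleR_conv_of_real)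
  have b: "L (\<i> *s (\<tau> *s z)) = of_real (Re \<tau>) * L (\<i> *s z) - of_real (Im \<tau>) * L z"
    unfolding 2 by (simp add: linear_diff[OF L] linear_scale[OF L]) (simp add: scaleR_conv_of_real)
  have c: "cnj \<tau> = of_real (Re \<tau>) - \<i> * of_real (Im \<tau>)" by (simp add: complex_eq_iff)
  show ?thesis unfolding Lbar_def L_def[symmetric] a b c by (simp add: algebra_simps)
qed

text \<open>On the complex line through \<open>z\<close> the function \<open>\<tau> \<mapsto> w (\<tau> *s z) / \<tau> ^ m\<close> has compact support away from \<open>0\<close>, so the
Cauchy-Pompeiu inequality applies at \<open>\<tau> = 1\<close>. The exponent \<open>1/2 - m\<close> instead of \<open>- m\<close> is what makes the kernel
symmetric. The constant does not depend on \<open>m\<close>.\<close>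

lemma dilation_inequality:
  fixes w :: "complex ^ 'n \<Rightarrow> complex" and m :: nat
  assumes D: "\<And>x. (w has_derivative W x) (at x)"
    and contW: "\<And>v. continuous_on UNIV (\<lambda>x. W x v)"
    and supp: "\<And>x. w x \<noteq> 0 \<Longrightarrow> r0 \<le> norm x \<and> norm x \<le> R0" and r0: "0 < r0"
    and z: "z \<noteq> 0"
  shows "ennreal (bubble_mass * (norm (w z) * norm z powr (1/2 - real m)))
    \<le> (\<integral>\<^sup>+\<tau>. ennreal (kern \<tau> * (norm (\<tau> *s z) powr (1/2 - real m) * norm (Lbar W (\<tau> *s z)))) \<partial>hmeas)"
proof -
  have linW: "linear (W x)" for x using D[of x] has_derivative_linear by blast
  have W0: "W x v = 0" if x: "norm x < r0 \<or> norm x > R0" for x v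
  proof -
    let ?S = "{x :: complex ^ 'n. norm x < r0} \<union> {x. norm x > R0}"
    have "open ?S" by (intro open_Un open_Collect_less continuous_intros)
    moreover have "x \<in> ?S" using x by auto
    moreover have "(0 :: complex) = w y" if "y \<in> ?S" for y using supp[of y] that by force
    ultimately have "(w has_derivative (\<lambda>_. 0)) (at x)"
      by (intro has_derivative_transform_within_open[of "\<lambda>_. 0" "\<lambda>_. 0" x UNIV ?S w]) auto
    with D[of x] have "W x = (\<lambda>_. 0)" by (rule has_derivative_unique)
    then show ?thesis by simp
  qed
  have contw: "continuous_on UNIV w"
    by (meson D continuous_at_imp_continuous_on has_derivative_continuous)
  \<comment> \<open>The factor \<open>1 / \<tau> ^ m\<close> is holomorphic where \<open>w (\<tau> *s z)\<close> does not vanish, so that it passes through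
    the Cauchy-Riemann operator.\<close>
  define \<phi> where "\<phi> \<tau> = w (\<tau> *s z) / \<tau> ^ m" for \<tau>
  define d where "d b \<tau> = W (\<tau> *s z) (b *s z) / \<tau> ^ m - of_nat m * b * w (\<tau> *s z) / \<tau> ^ Suc m" for b \<tau>
  define \<rho> where "\<rho> = r0 / norm z"
  have \<rho>: "\<rho> > 0" using r0 z by (simp add: \<rho>_def)
  have zero: "w (\<tau> *s z) = 0" "W (\<tau> *s z) v = 0" if "norm \<tau> < \<rho>" for \<tau> v
  proof -
    have "norm (\<tau> *s z) < r0" using that z by (simp add: norm_smult \<rho>_def pos_less_divide_eq)
    then show "w (\<tau> *s z) = 0" "W (\<tau> *s z) v = 0" using supp[of "\<tau> *s z"] W0 by force+
  qed
  have outer: "w (\<tau> *s z) = 0 \<and> W (\<tau> *s z) v = 0" if "norm \<tau> > R0 / norm z" for \<tau> v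
  proof -
    have "norm (\<tau> *s z) > R0" using that z by (simp add: norm_smult pos_divide_less_eq)
    then show ?thesis using supp[of "\<tau> *s z"] W0 by force
  qed
  have UNIV_eq: "UNIV = {\<tau>::complex. norm \<tau> < \<rho>} \<union> - {0}" using \<rho> by auto
  have cont_glue: "continuous_on UNIV f"
    if "\<And>\<tau>. norm \<tau> < \<rho> \<Longrightarrow> f \<tau> = 0" "continuous_on (- {0}) f" for f :: "complex \<Rightarrow> complex"
    unfolding UNIV_eq
  proof (rule continuous_on_open_Un)
    show "continuous_on {\<tau>::complex. norm \<tau> < \<rho>} f"
      by (rule continuous_on_eq[of _ "\<lambda>_. 0"]) (use that in auto)
  qed (use that in \<open>auto intro!: open_Collect_less continuous_intros\<close>)
  have cont\<phi>: "continuous_on UNIV \<phi>"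
  proof (rule cont_glue)
    show "continuous_on (- {0}) \<phi>" unfolding \<phi>_def
      by (intro continuous_intros continuous_on_compose2[OF contw]) auto
  qed (simp add: \<phi>_def zero)
  have contd: "continuous_on UNIV (d b)" for b
  proof (rule cont_glue)
    show "continuous_on (- {0}) (d b)" unfolding d_def
      by (intro continuous_intros continuous_on_compose2[OF contw] continuous_on_compose2[OF contW]) auto
  qed (simp add: d_def zero)
  have deriv: "((\<lambda>t::real. \<phi> (x + of_real t * b)) has_vector_derivative d b x) (at 0)" for x b
  proof (cases "x = 0")
    case True
    have "((\<lambda>t::real. 0 :: complex) has_vector_derivative 0) (at 0)" by simp
    then have "((\<lambda>t::real. \<phi> (x + of_real t * b)) has_vector_derivative 0) (at 0)"
    proof (rule has_vector_derivative_transform_within_open[where S = "{t::real. \<bar>t\<bar> * norm b < \<rho>}"])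
      show "open {t::real. \<bar>t\<bar> * norm b < \<rho>}" by (intro open_Collect_less continuous_intros)
      show "0 = \<phi> (x + of_real t * b)" if "t \<in> {t::real. \<bar>t\<bar> * norm b < \<rho>}" for t
        using that by (simp add: \<phi>_def True zero norm_mult)
    qed (use \<rho> in auto)
    moreover have "d b x = 0" using zero[of x] \<rho> True by (simp add: d_def)
    ultimately show ?thesis by simp
  next
    case False
    have "((\<lambda>t::real. w ((x + of_real t * b) *s z)) has_derivative (\<lambda>t. W (x *s z) ((of_real t * b) *s z))) (at 0)"
    proof -
      have "((\<lambda>t::real. (x + of_real t * b) *s z) has_derivative (\<lambda>t. (of_real t * b) *s z)) (at 0)"
        by (rule bounded_linear.has_derivative[OF bounded_linear_smult_left]) (auto intro!: derivative_eq_intros)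
      moreover have "(w has_derivative W (x *s z)) (at ((x + of_real (0::real) * b) *s z))" using D by simp
      ultimately show ?thesis by (rule has_derivative_compose)
    qed
    moreover have "W (x *s z) ((of_real t * b) *s z) = t *\<^sub>R W (x *s z) (b *s z)" for t
    proof -
      have "(of_real t * b) *s z = t *\<^sub>R (b *s z)"
        by (simp add: vec_eq_iff) (simp add: scaleR_conv_of_real)
      then show ?thesis using linear_scale[OF linW, of "x *s z" t "b *s z"] by simp
    qed
    ultimately have 1: "((\<lambda>t::real. w ((x + of_real t * b) *s z)) has_vector_derivative W (x *s z) (b *s z)) (at 0)"
      by (simp add: has_vector_derivative_def)
    have "((\<lambda>u. inverse ((x + u * b) ^ m)) has_field_derivative (- (of_nat m * b) / x ^ Suc m)) (at (of_real 0))"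
    proof (cases m)
      case (Suc k)
      have "((\<lambda>u. (x + u * b) ^ Suc k) has_field_derivative (of_nat (Suc k) * b * x ^ k)) (at (of_real 0))"
      proof -
        have "((\<lambda>u. x + u * b) has_field_derivative b) (at 0)" by (auto intro!: derivative_eq_intros)
        from DERIV_power[OF this, of "Suc k"] show ?thesis by (simp add: mult_ac)
      qed
      then show ?thesis unfolding Suc
        by (rule DERIV_cong[OF DERIV_inverse_fun]) (use False in \<open>simp_all add: field_simps\<close>)
    qed simp
    from has_vector_derivative_real_field[OF this]
    have 2: "((\<lambda>t::real. inverse ((x + of_real t * b) ^ m)) has_vector_derivative (- (of_nat m * b) / x ^ Suc m)) (at 0)" .
    have "((\<lambda>t::real. w ((x + of_real t * b) *s z) * inverse ((x + of_real t * b) ^ m)) has_vector_derivative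
       (w ((x + of_real 0 * b) *s z) * (- (of_nat m * b) / x ^ Suc m) + W (x *s z) (b *s z) * inverse ((x + of_real 0 * b) ^ m))) (at 0)"
      by (rule has_vector_derivative_mult[OF 1 2])
    then show ?thesis by (simp add: \<phi>_def d_def divide_inverse algebra_simps)
  qed
  have "ennreal (bubble_mass * norm (\<phi> 1)) \<le> (\<integral>\<^sup>+\<tau>. ennreal (norm ((d 1 \<tau> + \<i> * d \<i> \<tau>) / 2) / norm (\<tau> - 1)) \<partial>lborel)"
  proof (rule cauchy_pompeiu_inequality[where R = "R0 / norm z"])
    show "((\<lambda>t::real. \<phi> (x + of_real t)) has_vector_derivative d 1 x) (at 0)" for x
      using deriv[of x 1] by simp
    show "((\<lambda>t::real. \<phi> (x + of_real t * \<i>)) has_vector_derivative d \<i> x) (at 0)" for x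
      by (rule deriv)
    show "continuous_on UNIV \<phi>" "continuous_on UNIV (d 1)" "continuous_on UNIV (d \<i>)"
      by (rule cont\<phi> contd)+
  qed (use outer in \<open>auto simp: \<phi>_def d_def\<close>)
  then have "ennreal (norm z powr (1/2 - real m)) * ennreal (bubble_mass * norm (\<phi> 1))
     \<le> ennreal (norm z powr (1/2 - real m)) * (\<integral>\<^sup>+\<tau>. ennreal (norm ((d 1 \<tau> + \<i> * d \<i> \<tau>) / 2) / norm (\<tau> - 1)) \<partial>lborel)"
    by (rule mult_left_mono) simp
  also have "\<dots> = (\<integral>\<^sup>+\<tau>. ennreal (norm z powr (1/2 - real m)) * ennreal (norm ((d 1 \<tau> + \<i> * d \<i> \<tau>) / 2) / norm (\<tau> - 1)) \<partial>lborel)"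
  proof (rule nn_integral_cmult[symmetric])
    have [measurable]: "d b \<in> borel_measurable borel" for b
      using contd by (rule borel_measurable_continuous_onI)
    show "(\<lambda>\<tau>. ennreal (norm ((d 1 \<tau> + \<i> * d \<i> \<tau>) / 2) / norm (\<tau> - 1))) \<in> borel_measurable lborel" by measurable
  qed
  also have "\<dots> = (\<integral>\<^sup>+\<tau>. ennreal (1 / (norm \<tau>)\<^sup>2) * ennreal (kern \<tau> * (norm (\<tau> *s z) powr (1/2 - real m) * norm (Lbar W (\<tau> *s z)))) \<partial>lborel)"
  proof (rule nn_integral_cong)
    fix \<tau> :: complex
    show "ennreal (norm z powr (1/2 - real m)) * ennreal (norm ((d 1 \<tau> + \<i> * d \<i> \<tau>) / 2) / norm (\<tau> - 1))
       = ennreal (1 / (norm \<tau>)\<^sup>2) * ennreal (kern \<tau> * (norm (\<tau> *s z) powr (1/2 - real m) * norm (Lbar W (\<tau> *s z))))"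
    proof (cases "\<tau> = 0")
      case True
      have "w 0 = 0" "W 0 v = 0" for v using zero[of 0] \<rho> by auto
      then show ?thesis by (simp add: True d_def)
    next
      case False
      define A where "A = (W (\<tau> *s z) z + \<i> * W (\<tau> *s z) (\<i> *s z)) / 2"
      have 1: "(d 1 \<tau> + \<i> * d \<i> \<tau>) / 2 = A / \<tau> ^ m"
        unfolding d_def A_def using False by (simp add: field_simps)
      have 2: "norm (Lbar W (\<tau> *s z)) = norm \<tau> * norm A"
        unfolding A_def Lbar_smult[OF linW] norm_mult complex_mod_cnj by simp
      have pos: "norm \<tau> > 0" "norm z > 0" using False z by auto
      have 3: "norm \<tau> powr (1/2 - real m) = sqrt (norm \<tau>) / norm \<tau> ^ m"
        using pos by (simp add: powr_diff powr_half_sqrt powr_realpow)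
      have gen: "P * (a / T / t) = 1 / (s\<^sup>2)\<^sup>2 * (s / t * (s / T * P * (s\<^sup>2 * a)))"
        if "s \<noteq> 0" "T \<noteq> 0" for P a T t s :: real
        using that by (cases "t = 0") (simp_all add: field_simps power2_eq_square)
      have "norm z powr (1/2 - real m) * (norm A / norm \<tau> ^ m / norm (\<tau> - 1))
        = 1 / (norm \<tau>)\<^sup>2 * (kern \<tau> * (norm \<tau> powr (1/2 - real m) * norm z powr (1/2 - real m) * (norm \<tau> * norm A)))"
        using gen[of "sqrt (norm \<tau>)" "norm \<tau> ^ m" "norm z powr (1/2 - real m)" "norm A" "norm (\<tau> - 1)"] pos
        unfolding kern_def 3 by simp
      then show ?thesis unfolding 1 2 norm_smult
        using pos by (simp add: ennreal_mult[symmetric] norm_divide norm_power powr_mult)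
    qed
  qed
  also have "\<dots> = (\<integral>\<^sup>+\<tau>. ennreal (kern \<tau> * (norm (\<tau> *s z) powr (1/2 - real m) * norm (Lbar W (\<tau> *s z)))) \<partial>hmeas)"
  proof (rule nn_integral_hmeas_complex[symmetric])
    have "(\<lambda>\<tau>. Lbar W (\<tau> *s z)) \<in> borel_measurable borel"
      unfolding Lbar_smult[OF linW]
      by (intro borel_measurable_continuous_onI continuous_intros continuous_on_compose2[OF contW]) auto
    moreover have "(\<lambda>\<tau>. \<tau> *s z) \<in> borel_measurable borel"
      by (intro borel_measurable_continuous_onI continuous_intros)
    ultimately show "(\<lambda>\<tau>. ennreal (kern \<tau> * (norm (\<tau> *s z) powr (1/2 - real m) * norm (Lbar W (\<tau> *s z))))) \<in> borel_measurable borel"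
      by measurable
  qed
  finally show ?thesis
    using bubble_mass_pos by (simp add: \<phi>_def ennreal_mult[symmetric] mult_ac)
qed

section \<open>Smooth bumps\<close>

text \<open>The family of all \<open>exp (- 1 / t) / t ^ j\<close>, extended by \<open>0\<close>, is closed under differentiation up to linear combinations,
which gives smoothness at \<open>t = 0\<close> without a discussion of higher derivatives.\<close>

fun flat :: "nat \<Rightarrow> real \<Rightarrow> real" where
  "flat j t = (if t \<le> 0 then 0 else exp (- (1 / t)) / t ^ j)"

declare flat.simps [simp del]

lemma flat_nonneg [simp]: "flat j t \<ge> 0" by (simp add: flat.simps)

lemma flat_pos: "t > 0 \<Longrightarrow> flat j t > 0" by (simp add: flat.simps)

lemma flat_0: "t \<le> 0 \<Longrightarrow> flat j t = 0" by (simp add: flat.simps)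

text \<open>The exponential series dominates its term of degree \<open>j + 2\<close>. The quadratic bound implies that the derivative at \<open>0\<close>
exists and vanishes.\<close>

lemma flat_le: "flat j t \<le> fact (j + 2) * t\<^sup>2"
proof (cases "t \<le> 0")
  case False
  then have t: "t > 0" by simp
  define n where "n = j + 2"
  have "(1 / t) ^ n / fact n \<le> exp (1 / t)"
  proof -
    have "(\<Sum>k\<in>{n}. inverse (fact k) * (1 / t) ^ k) \<le> (\<Sum>k. inverse (fact k) * (1 / t) ^ k)"
      using t by (intro sum_le_suminf summable_exp) auto
    then have "inverse (fact n) * (1 / t) ^ n \<le> (\<Sum>k. inverse (fact k) * (1 / t) ^ k)" by simp
    also have "\<dots> = exp (1 / t)" by (simp add: exp_def)
    finally have "inverse (fact n) * (1 / t) ^ n \<le> exp (1 / t)" .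
    then show ?thesis by (simp only: divide_inverse mult.commute)
  qed
  then have "fact n * ((1 / t) ^ n / fact n) \<le> fact n * exp (1 / t)" by (rule mult_left_mono) simp
  then have "(1 / t) ^ n \<le> fact n * exp (1 / t)" by simp
  then have "1 \<le> fact n * exp (1 / t) * t ^ n" using t by (simp add: power_divide field_simps)
  then have "exp (- (1 / t)) \<le> fact n * t ^ n"
    by (simp add: exp_minus field_simps)
  then have "exp (- (1 / t)) / t ^ j \<le> fact n * t ^ n / t ^ j"
    using t by (intro divide_right_mono) auto
  also have "\<dots> = fact n * t\<^sup>2" using t by (simp add: n_def power_add power2_eq_square)
  finally show ?thesis using t by (simp add: flat.simps n_def)
qed (simp add: flat_0)

lemma flat_deriv: "(flat j has_real_derivative (flat (j + 2) t - real j * flat (j + 1) t)) (at t)"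
proof -
  consider "t < 0" | "t = 0" | "t > 0" by linarith
  then show ?thesis
  proof cases
    case 1
    have "((\<lambda>_. 0) has_real_derivative 0) (at t)" by simp
    then have "(flat j has_real_derivative 0) (at t)"
      by (rule has_field_derivative_transform_within[where d = "-t"]) (use 1 in \<open>auto simp: dist_real_def flat_0\<close>)
    then show ?thesis using 1 by (simp add: flat_0)
  next
    case 2
    define C :: real where "C = fact (j + 2)"
    have "((\<lambda>s. flat j s / s) \<longlongrightarrow> 0) (at 0)"
    proof (rule tendsto_rabs_zero_cancel, rule real_tendsto_sandwich[of "\<lambda>_. 0" _ _ "\<lambda>s. C * \<bar>s\<bar>"])
      show "\<forall>\<^sub>F s in at 0. \<bar>flat j s / s\<bar> \<le> C * \<bar>s\<bar>"
      proof (rule eventually_at_topological[THEN iffD2, OF exI[of _ UNIV]], safe)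
        fix s :: real assume "s \<noteq> 0"
        then show "\<bar>flat j s / s\<bar> \<le> C * \<bar>s\<bar>"
          using flat_le[of j s] by (simp add: abs_divide C_def divide_le_eq power2_eq_square mult.assoc abs_mult_self_eq)
      qed auto
      show "((\<lambda>s. C * \<bar>s\<bar>) \<longlongrightarrow> 0) (at 0)" by (auto intro!: tendsto_eq_intros)
    qed auto
    then have "(flat j has_real_derivative 0) (at 0)"
      by (simp add: has_field_derivative_iff flat_0)
    then show ?thesis using 2 by (simp add: flat_0)
  next
    case 3
    have "((\<lambda>s. exp (- (1 / s)) * inverse (s ^ j)) has_real_derivative
        (exp (- (1 / t)) * (1 / t\<^sup>2)) * inverse (t ^ j) + - (inverse (t ^ j) * (real j * t ^ (j - 1)) * inverse (t ^ j)) * exp (- (1 / t))) (at t)"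
      using 3 by (intro DERIV_mult' DERIV_cong[OF DERIV_mult'] DERIV_inverse_fun)
        (auto intro!: derivative_eq_intros simp: power2_eq_square)
    also have "(exp (- (1 / t)) * (1 / t\<^sup>2)) * inverse (t ^ j) + - (inverse (t ^ j) * (real j * t ^ (j - 1)) * inverse (t ^ j)) * exp (- (1 / t))
      = flat (j + 2) t - real j * flat (j + 1) t"
      using 3 by (cases j) (simp_all add: flat.simps field_simps power2_eq_square)
    finally show ?thesis
      by (rule has_field_derivative_transform_within[where d = t]) (use 3 in \<open>auto simp: dist_real_def flat.simps divide_inverse\<close>)
  qed
qed

text \<open>A class of functions that is closed under partial derivatives, by \<open>bumps_deriv\<close>, and thus consists of smooth functions.\<close>

inductive_set bumps :: "'a::euclidean_space \<Rightarrow> real \<Rightarrow> ('a \<Rightarrow> complex) set" for a \<delta> where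
  base: "(\<lambda>y. complex_of_real (flat j (\<delta>\<^sup>2 - (y - a) \<bullet> (y - a)))) \<in> bumps a \<delta>"
| add: "f \<in> bumps a \<delta> \<Longrightarrow> g \<in> bumps a \<delta> \<Longrightarrow> (\<lambda>y. f y + g y) \<in> bumps a \<delta>"
| coord: "f \<in> bumps a \<delta> \<Longrightarrow> (\<lambda>y. complex_of_real ((y - a) \<bullet> c) * f y) \<in> bumps a \<delta>"
| cmul: "f \<in> bumps a \<delta> \<Longrightarrow> (\<lambda>y. c * f y) \<in> bumps a \<delta>"

lemma bumps_deriv:
  assumes "f \<in> bumps a \<delta>"
  shows "\<exists>f'. (\<forall>x. (f has_derivative f' x) (at x)) \<and> (\<forall>b. (\<lambda>x. f' x b) \<in> bumps a \<delta>)"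
  using assms
proof induction
  case (base j)
  let ?s = "\<lambda>x. \<delta>\<^sup>2 - (x - a) \<bullet> (x - a)"
  let ?f' = "\<lambda>x h. complex_of_real ((flat (j + 2) (?s x) - real j * flat (j + 1) (?s x)) * (- 2 * ((x - a) \<bullet> h)))"
  have "((\<lambda>y. complex_of_real (flat j (?s y))) has_derivative ?f' x) (at x)" for x
  proof -
    have "(?s has_derivative (\<lambda>h. - 2 * ((x - a) \<bullet> h))) (at x)"
      by (auto intro!: derivative_eq_intros simp: inner_commute)
    from has_derivative_compose[OF this flat_deriv[unfolded has_field_derivative_def]]
    have "((\<lambda>y. flat j (?s y)) has_derivative (\<lambda>h. (flat (j + 2) (?s x) - real j * flat (j + 1) (?s x)) * (- 2 * ((x - a) \<bullet> h)))) (at x)"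
      by simp
    from bounded_linear.has_derivative[OF bounded_linear_of_real this] show ?thesis .
  qed
  moreover have "(\<lambda>x. ?f' x b) \<in> bumps a \<delta>" for b
  proof -
    have "(\<lambda>x. (-2) * (complex_of_real ((x - a) \<bullet> b) * complex_of_real (flat (j + 2) (?s x)))
       + (2 * of_nat j) * (complex_of_real ((x - a) \<bullet> b) * complex_of_real (flat (j + 1) (?s x)))) \<in> bumps a \<delta>"
      by (intro bumps.intros)
    also have "(\<lambda>x. (-2) * (complex_of_real ((x - a) \<bullet> b) * complex_of_real (flat (j + 2) (?s x)))
       + (2 * of_nat j) * (complex_of_real ((x - a) \<bullet> b) * complex_of_real (flat (j + 1) (?s x)))) = (\<lambda>x. ?f' x b)"
      by (simp add: fun_eq_iff algebra_simps)
    finally show ?thesis .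
  qed
  ultimately show ?case by (intro exI[of _ ?f']) auto
next
  case (add f g)
  then obtain f' g' where "\<forall>x. (f has_derivative f' x) (at x)" "\<forall>b. (\<lambda>x. f' x b) \<in> bumps a \<delta>"
    "\<forall>x. (g has_derivative g' x) (at x)" "\<forall>b. (\<lambda>x. g' x b) \<in> bumps a \<delta>" by blast
  then show ?case
    by (intro exI[of _ "\<lambda>x h. f' x h + g' x h"]) (auto intro!: derivative_eq_intros bumps.intros)
next
  case (coord f c)
  then obtain f' where f': "\<forall>x. (f has_derivative f' x) (at x)" "\<forall>b. (\<lambda>x. f' x b) \<in> bumps a \<delta>" by blast
  have "((\<lambda>y. complex_of_real ((y - a) \<bullet> c) * f y) has_derivative
     (\<lambda>h. complex_of_real ((x - a) \<bullet> c) * f' x h + complex_of_real (h \<bullet> c) * f x)) (at x)" for x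
  proof (rule has_derivative_mult)
    show "((\<lambda>y. complex_of_real ((y - a) \<bullet> c)) has_derivative (\<lambda>h. complex_of_real (h \<bullet> c))) (at x)"
      by (rule bounded_linear.has_derivative[OF bounded_linear_of_real]) (auto intro!: derivative_eq_intros)
  qed (use f' in auto)
  moreover have "(\<lambda>x. complex_of_real ((x - a) \<bullet> c) * f' x h + complex_of_real (h \<bullet> c) * f x) \<in> bumps a \<delta>" for h
    using f' coord.hyps by (intro bumps.intros) auto
  ultimately show ?case by (intro exI[of _ "\<lambda>x h. complex_of_real ((x - a) \<bullet> c) * f' x h + complex_of_real (h \<bullet> c) * f x"]) auto
next
  case (cmul f c)
  then obtain f' where f': "\<forall>x. (f has_derivative f' x) (at x)" "\<forall>b. (\<lambda>x. f' x b) \<in> bumps a \<delta>" by blast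
  then show ?case
    by (intro exI[of _ "\<lambda>x h. c * f' x h"]) (auto intro!: derivative_eq_intros bumps.intros)
qed

lemma bumps_Ck: "f \<in> bumps a \<delta> \<Longrightarrow> Ck k f"
proof (induction k arbitrary: f)
  case 0
  then obtain f' where "\<forall>x. (f has_derivative f' x) (at x)" using bumps_deriv by blast
  then show ?case
    by (auto intro!: continuous_at_imp_continuous_on has_derivative_continuous)
next
  case (Suc k)
  from bumps_deriv[OF Suc.prems] obtain f' where f': "\<forall>x. (f has_derivative f' x) (at x)" "\<forall>b. (\<lambda>x. f' x b) \<in> bumps a \<delta>" by blast
  then have "frechet_derivative f (at x) = f' x" for x using frechet_derivative_at by metis
  then show ?case using f' Suc.IH by (auto simp: differentiable_def)
qed

definition eta :: "real \<Rightarrow> 'a::euclidean_space \<Rightarrow> real" where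
  "eta \<delta> v = flat 0 (\<delta>\<^sup>2 - v \<bullet> v)"

definition etad :: "real \<Rightarrow> 'a::euclidean_space \<Rightarrow> 'a" where
  "etad \<delta> v = (- 2 * flat 2 (\<delta>\<^sup>2 - v \<bullet> v)) *\<^sub>R v"

lemma eta_deriv: "(eta \<delta> has_derivative (\<lambda>h. etad \<delta> v \<bullet> h)) (at v)"
proof -
  have "((\<lambda>x. \<delta>\<^sup>2 - x \<bullet> x) has_derivative (\<lambda>h. - 2 * (v \<bullet> h))) (at v)"
    by (auto intro!: derivative_eq_intros simp: inner_commute)
  from has_derivative_compose[OF this flat_deriv[of 0, unfolded has_field_derivative_def]]
  show ?thesis unfolding eta_def[abs_def] etad_def by (simp add: mult_ac numeral_2_eq_2)
qed

lemma isCont_flat: "isCont (flat j) t"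
  using flat_deriv DERIV_isCont by blast

lemma continuous_on_flat: "continuous_on UNIV (flat j)"
  by (simp add: continuous_at_imp_continuous_on isCont_flat)

lemma continuous_on_eta: "continuous_on UNIV (eta \<delta>)"
  unfolding eta_def[abs_def]
  by (intro continuous_on_compose2[OF continuous_on_flat] continuous_intros) auto

lemma continuous_on_etad: "continuous_on UNIV (etad \<delta>)"
  unfolding etad_def[abs_def]
  by (intro continuous_intros continuous_on_compose2[OF continuous_on_flat]) auto

lemma eta_measurable [measurable]: "eta \<delta> \<in> borel_measurable borel"
  and etad_measurable [measurable]: "etad \<delta> \<in> borel_measurable borel"
  using continuous_on_eta continuous_on_etad by (auto intro: borel_measurable_continuous_onI)

lemma eta_nonneg [simp]: "eta \<delta> v \<ge> 0" by (simp add: eta_def)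

lemma inner_self_ge: "\<delta> > 0 \<Longrightarrow> norm v \<ge> \<delta> \<Longrightarrow> \<delta>\<^sup>2 - v \<bullet> v \<le> 0"
  by (simp add: dot_square_norm power_mono)

lemma eta_zero: "\<delta> > 0 \<Longrightarrow> norm v \<ge> \<delta> \<Longrightarrow> eta \<delta> v = 0"
  unfolding eta_def by (intro flat_0 inner_self_ge)

lemma etad_zero: "\<delta> > 0 \<Longrightarrow> norm v \<ge> \<delta> \<Longrightarrow> etad \<delta> v = 0"
  unfolding etad_def by (subst flat_0[OF inner_self_ge]) auto

lemma test_function_eta:
  fixes x :: "'a::euclidean_space"
  assumes \<delta>: "\<delta> > 0" and sub: "cball x \<delta> \<subseteq> \<Omega>"
  shows "test_function \<Omega> (\<lambda>y. complex_of_real (eta \<delta> (x - y)))"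
proof -
  have eq: "(\<lambda>y. complex_of_real (eta \<delta> (x - y))) = (\<lambda>y. complex_of_real (flat 0 (\<delta>\<^sup>2 - (y - x) \<bullet> (y - x))))"
    by (simp add: eta_def fun_eq_iff dot_square_norm norm_minus_commute)
  have "{y. complex_of_real (eta \<delta> (x - y)) \<noteq> 0} \<subseteq> cball x \<delta>"
    using eta_zero[OF \<delta>] by (force simp: dist_norm)
  then have cl: "closure {y. complex_of_real (eta \<delta> (x - y)) \<noteq> 0} \<subseteq> cball x \<delta>"
    by (simp add: closure_minimal)
  then have "compact (closure {y. complex_of_real (eta \<delta> (x - y)) \<noteq> 0})"
    by (meson bounded_cball bounded_subset closed_closure compact_eq_bounded_closed)
  moreover have "Ck k (\<lambda>y. complex_of_real (eta \<delta> (x - y)))" for k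
    unfolding eq by (rule bumps_Ck) (rule bumps.base)
  ultimately show ?thesis using cl sub by (auto simp: test_function_def)
qed

definition eta_mass :: "'a::euclidean_space itself \<Rightarrow> real \<Rightarrow> real" where
  "eta_mass _ \<delta> = (LINT v::'a|lborel. eta \<delta> v)"

lemma integrable_eta: "\<delta> > 0 \<Longrightarrow> integrable lborel (eta \<delta> :: 'a::euclidean_space \<Rightarrow> real)"
  by (rule integrable_continuous_bounded_support[OF continuous_on_eta, of \<delta>]) (simp add: eta_zero)

lemma eta_mass_pos:
  assumes \<delta>: "\<delta> > 0" shows "eta_mass TYPE('a::euclidean_space) \<delta> > 0"
proof -
  have "eta_mass TYPE('a) \<delta> \<ge> 0" unfolding eta_mass_def by (intro Bochner_Integration.integral_nonneg) auto
  moreover have "eta_mass TYPE('a) \<delta> \<noteq> 0"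
  proof
    assume "eta_mass TYPE('a) \<delta> = 0"
    then have "AE v::'a in lborel. eta \<delta> v = 0"
      unfolding eta_mass_def by (subst (asm) integral_nonneg_eq_0_iff_AE[OF integrable_eta[OF \<delta>]]) auto
    then have "AE v::'a in lborel. v \<notin> ball 0 \<delta>"
    proof eventually_elim
      case (elim v)
      show ?case
      proof
        assume "v \<in> ball 0 \<delta>"
        then have "v \<bullet> v < \<delta>\<^sup>2" by (simp add: dot_square_norm power_strict_mono)
        then show False using elim flat_pos[of "\<delta>\<^sup>2 - v \<bullet> v" 0] by (simp add: eta_def)
      qed
    qed
    then have "emeasure lborel (ball (0::'a) \<delta>) = 0"
      by (subst (asm) AE_iff_null_sets[symmetric]) auto
    then show False using \<delta> by (simp add: emeasure_ball unit_ball_vol_pos[THEN less_imp_neq, symmetric])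
  qed
  ultimately show ?thesis by simp
qed

section \<open>Mollification\<close>

lemma continuous_bounded_support_bounded:
  fixes f :: "'a::euclidean_space \<Rightarrow> 'b::real_normed_vector"
  assumes "continuous_on UNIV f" "\<And>v. norm v \<ge> R \<Longrightarrow> f v = 0"
  obtains B where "B \<ge> 0" "\<And>v. norm (f v) \<le> B"
proof -
  have "compact (f ` cball 0 R)"
    by (rule compact_continuous_image) (auto intro: continuous_on_subset[OF assms(1)])
  then obtain B where "\<forall>y\<in>f ` cball 0 R. norm y \<le> B"
    by (metis bounded_iff compact_imp_bounded)
  then have "norm (f x) \<le> max B 0" for x
    using assms(2)[of x] by (cases "norm x \<le> R") (auto simp: le_max_iff_disj)
  then show ?thesis using that[of "max B 0"] by auto
qed

lemma continuous_bounded_support_uniform: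
  fixes f :: "'a::euclidean_space \<Rightarrow> 'b::real_normed_vector"
  assumes f: "continuous_on UNIV f" "\<And>v. norm v \<ge> R \<Longrightarrow> f v = 0" and e: "e > 0"
  obtains \<rho> where "\<rho> > 0" "\<And>v w. norm (v - w) < \<rho> \<Longrightarrow> norm (f v - f w) \<le> e"
proof -
  have "uniformly_continuous_on (cball 0 (R + 2)) f"
    by (rule compact_uniformly_continuous) (auto intro: continuous_on_subset[OF f(1)])
  then obtain d where d: "d > 0" "\<And>v w. v \<in> cball 0 (R + 2) \<Longrightarrow> w \<in> cball 0 (R + 2) \<Longrightarrow> dist w v < d \<Longrightarrow> dist (f w) (f v) < e"
    unfolding uniformly_continuous_on_def using e by meson
  show ?thesis
  proof (rule that[of "min d 1"])
    fix v w :: 'a assume vw: "norm (v - w) < min d 1"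
    show "norm (f v - f w) \<le> e"
    proof (cases "norm v \<le> R + 1")
      case True
      then have "norm w \<le> R + 2" using vw norm_triangle_ineq2[of w v] by (simp add: norm_minus_commute)
      then have "dist (f v) (f w) < e" using d(2)[of w v] True vw by (auto simp: dist_norm)
      then show ?thesis by (simp add: dist_norm)
    next
      case False
      then have "norm w \<ge> R" using vw norm_triangle_ineq2[of v w] by simp
      then show ?thesis using f(2)[of v] f(2)[of w] False e by simp
    qed
  qed (use d in auto)
qed

lemma eta_taylor:
  assumes \<delta>: "\<delta> > 0" and e: "e > 0"
  obtains \<rho> where "\<rho> > 0" "\<And>v h::'a::euclidean_space. norm h < \<rho> \<Longrightarrow> \<bar>eta \<delta> (v + h) - eta \<delta> v - etad \<delta> v \<bullet> h\<bar> \<le> e * norm h"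
proof -
  obtain \<rho> where \<rho>: "\<rho> > 0" "\<And>v w::'a. norm (v - w) < \<rho> \<Longrightarrow> norm (etad \<delta> v - etad \<delta> w) \<le> e"
    using continuous_bounded_support_uniform[OF continuous_on_etad etad_zero[OF \<delta>] e] by metis
  show ?thesis
  proof (rule that[OF \<rho>(1)])
    fix v h :: 'a assume h: "norm h < \<rho>"
    have der: "((\<lambda>t::real. eta \<delta> (v + t *\<^sub>R h)) has_real_derivative (etad \<delta> (v + t *\<^sub>R h) \<bullet> h)) (at t)" for t
    proof -
      have "((\<lambda>t::real. v + t *\<^sub>R h) has_derivative (\<lambda>t. t *\<^sub>R h)) (at t)"
        by (auto intro!: derivative_eq_intros)
      from has_derivative_compose[OF this eta_deriv[of \<delta>]]
      have "((\<lambda>t. eta \<delta> (v + t *\<^sub>R h)) has_derivative (\<lambda>s. s * (etad \<delta> (v + t *\<^sub>R h) \<bullet> h))) (at t)" by simp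
      then show ?thesis by (simp add: has_field_derivative_def mult_commute_abs)
    qed
    obtain t where t: "0 < t" "t < 1" "eta \<delta> (v + 1 *\<^sub>R h) - eta \<delta> (v + 0 *\<^sub>R h) = (1 - 0) * (etad \<delta> (v + t *\<^sub>R h) \<bullet> h)"
      using MVT2[of 0 1 "\<lambda>t. eta \<delta> (v + t *\<^sub>R h)" "\<lambda>t. etad \<delta> (v + t *\<^sub>R h) \<bullet> h"] der by auto
    have "norm (t *\<^sub>R h) < \<rho>"
      using t h mult_right_mono[of t 1 "norm h"] by simp
    then have "norm (etad \<delta> (v + t *\<^sub>R h) - etad \<delta> v) \<le> e" using \<rho>(2)[of "v + t *\<^sub>R h" v] by simp
    moreover have "eta \<delta> (v + h) - eta \<delta> v - etad \<delta> v \<bullet> h = (etad \<delta> (v + t *\<^sub>R h) - etad \<delta> v) \<bullet> h"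
      using t by (simp add: inner_diff_left)
    ultimately show "\<bar>eta \<delta> (v + h) - eta \<delta> v - etad \<delta> v \<bullet> h\<bar> \<le> e * norm h"
      by (metis Cauchy_Schwarz_ineq2 mult_right_mono norm_ge_zero order_trans)
  qed
qed

lemma integrable_mult_kernel:
  fixes U :: "'a::euclidean_space \<Rightarrow> complex"
  assumes U: "integrable lborel U" and [measurable]: "k \<in> borel_measurable borel" and B: "\<And>v. \<bar>k v\<bar> \<le> B"
  shows "integrable lborel (\<lambda>y. U y * complex_of_real (k y))"
proof (rule Bochner_Integration.integrable_bound)
  show "integrable lborel (\<lambda>y. B * norm (U y))" using U by simp
  show "(\<lambda>y. U y * complex_of_real (k y)) \<in> borel_measurable lborel"
    using borel_measurable_integrable[OF U] by measurable
  show "AE y in lborel. norm (U y * complex_of_real (k y)) \<le> norm (B * norm (U y))"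
    by (intro AE_I2) (auto simp: norm_mult abs_mult mult.commute[of "norm (U _)"] intro!: mult_mono order_trans[OF B abs_ge_self])
qed

definition moll :: "real \<Rightarrow> ('a::euclidean_space \<Rightarrow> complex) \<Rightarrow> 'a \<Rightarrow> complex" where
  "moll \<delta> U x = (LINT y|lborel. U y * of_real (eta \<delta> (x - y))) / of_real (eta_mass TYPE('a) \<delta>)"

definition molld :: "real \<Rightarrow> ('a::euclidean_space \<Rightarrow> complex) \<Rightarrow> 'a \<Rightarrow> 'a \<Rightarrow> complex" where
  "molld \<delta> U x h = (LINT y|lborel. U y * of_real (etad \<delta> (x - y) \<bullet> h)) / of_real (eta_mass TYPE('a) \<delta>)"

lemma integrable_moll:
  fixes U :: "'a::euclidean_space \<Rightarrow> complex"
  assumes U: "integrable lborel U" and \<delta>: "\<delta> > 0"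
  shows "integrable lborel (\<lambda>y. U y * of_real (eta \<delta> (x - y)))"
    "integrable lborel (\<lambda>y. U y * of_real (etad \<delta> (x - y) \<bullet> h))"
proof -
  obtain B where B: "\<And>v::'a. norm (eta \<delta> v) \<le> B"
    using continuous_bounded_support_bounded[OF continuous_on_eta eta_zero[OF \<delta>]] by metis
  show "integrable lborel (\<lambda>y. U y * of_real (eta \<delta> (x - y)))"
    by (rule integrable_mult_kernel[OF U, where B = B]) (use B in auto)
  obtain B where B: "\<And>v::'a. norm (etad \<delta> v) \<le> B"
    using continuous_bounded_support_bounded[OF continuous_on_etad etad_zero[OF \<delta>]] by metis
  show "integrable lborel (\<lambda>y. U y * of_real (etad \<delta> (x - y) \<bullet> h))"
  proof (rule integrable_mult_kernel[OF U, where B = "B * norm h"])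
    fix y show "\<bar>etad \<delta> (x - y) \<bullet> h\<bar> \<le> B * norm h"
      using B[of "x - y"] by (meson Cauchy_Schwarz_ineq2 mult_right_mono norm_ge_zero order_trans)
  qed measurable
qed

text \<open>The first order Taylor expansion of the bump is uniform in its argument, so it can be integrated against \<open>U\<close>.\<close>

lemma moll_has_derivative:
  fixes U :: "'a::euclidean_space \<Rightarrow> complex"
  assumes U: "integrable lborel U" and \<delta>: "\<delta> > 0"
  shows "(moll \<delta> U has_derivative molld \<delta> U x) (at x)"
proof -
  note int = integrable_moll[OF U \<delta>]
  let ?Z = "eta_mass TYPE('a) \<delta>"
  have Z: "?Z > 0" by (rule eta_mass_pos[OF \<delta>])
  let ?N = "LINT y|lborel. norm (U y)"
  have N: "?N \<ge> 0" by simp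
  have lin: "linear (molld \<delta> U x)"
  proof (rule linearI)
    fix h k :: 'a and r :: real
    show "molld \<delta> U x (h + k) = molld \<delta> U x h + molld \<delta> U x k"
      unfolding molld_def add_divide_distrib[symmetric]
      by (subst Bochner_Integration.integral_add[OF int(2) int(2), symmetric]) (simp add: inner_add_right algebra_simps)
    show "molld \<delta> U x (r *\<^sub>R h) = r *\<^sub>R molld \<delta> U x h"
    proof -
      have "(LINT y|lborel. U y * of_real (etad \<delta> (x - y) \<bullet> (r *\<^sub>R h))) = (LINT y|lborel. of_real r * (U y * of_real (etad \<delta> (x - y) \<bullet> h)))"
        by (simp add: mult_ac)
      also have "\<dots> = of_real r * (LINT y|lborel. U y * of_real (etad \<delta> (x - y) \<bullet> h))"
        by (rule integral_mult_right_zero)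
      finally show ?thesis by (simp add: molld_def scaleR_conv_of_real)
    qed
  qed
  show ?thesis
    unfolding has_derivative_at_alt
  proof (intro conjI allI impI)
    show "bounded_linear (molld \<delta> U x)" using lin linear_linear by blast
    fix e :: real assume e: "e > 0"
    define e' where "e' = e * ?Z / (?N + 1)"
    have e': "e' > 0" unfolding e'_def using e Z N by (intro divide_pos_pos mult_pos_pos add_nonneg_pos) auto
    obtain \<rho> where \<rho>: "\<rho> > 0" "\<And>v h::'a. norm h < \<rho> \<Longrightarrow> \<bar>eta \<delta> (v + h) - eta \<delta> v - etad \<delta> v \<bullet> h\<bar> \<le> e' * norm h"
      using eta_taylor[OF \<delta> e'] by metis
    show "\<exists>d>0. \<forall>y. norm (y - x) < d \<longrightarrow> norm (moll \<delta> U y - moll \<delta> U x - molld \<delta> U x (y - x)) \<le> e * norm (y - x)"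
    proof (intro exI conjI allI impI, rule \<rho>(1))
      fix y assume y: "norm (y - x) < \<rho>"
      define h where "h = y - x"
      let ?k = "\<lambda>v. eta \<delta> (v + h) - eta \<delta> v - etad \<delta> v \<bullet> h"
      have "moll \<delta> U y - moll \<delta> U x - molld \<delta> U x (y - x)
        = (LINT t|lborel. U t * of_real (eta \<delta> (y - t)) - U t * of_real (eta \<delta> (x - t)) - U t * of_real (etad \<delta> (x - t) \<bullet> (y - x))) / of_real ?Z"
        unfolding moll_def molld_def diff_divide_distrib[symmetric]
        using int by simp
      also have "(LINT t|lborel. U t * of_real (eta \<delta> (y - t)) - U t * of_real (eta \<delta> (x - t)) - U t * of_real (etad \<delta> (x - t) \<bullet> (y - x)))
        = (LINT t|lborel. U t * of_real (?k (x - t)))"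
        by (intro Bochner_Integration.integral_cong) (auto simp: h_def algebra_simps)
      finally have "norm (moll \<delta> U y - moll \<delta> U x - molld \<delta> U x (y - x)) = norm (LINT t|lborel. U t * of_real (?k (x - t))) / ?Z"
        using Z by (simp add: norm_divide)
      also have "norm (LINT t|lborel. U t * of_real (?k (x - t))) \<le> (LINT t|lborel. norm (U t * of_real (?k (x - t))))"
        by (rule integral_norm_bound)
      also have "\<dots> \<le> (LINT t|lborel. norm (U t) * (e' * norm h))"
      proof (rule integral_mono')
        show "integrable lborel (\<lambda>t. norm (U t) * (e' * norm h))" using U by simp
        show "norm (U t * of_real (?k (x - t))) \<le> norm (U t) * (e' * norm h)" for t
          unfolding norm_mult norm_of_real using \<rho>(2)[of h "x - t"] y by (intro mult_left_mono) (auto simp: h_def)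
        show "norm (U t) * (e' * norm h) \<ge> 0" for t using e' by simp
      qed
      also have "\<dots> = ?N * (e' * norm h)" by simp
      also have "?N * (e' * norm h) / ?Z \<le> e * norm h"
      proof -
        have "?N * e' \<le> e * ?Z"
        proof -
          have "?N / (?N + 1) \<le> 1" using N by (subst divide_le_eq_1_pos) (auto intro: add_nonneg_pos)
          then have "e * ?Z * (?N / (?N + 1)) \<le> e * ?Z * 1" using e Z by (intro mult_left_mono) auto
          then show ?thesis unfolding e'_def by (simp add: mult_ac)
        qed
        then have "?N * e' * norm h \<le> e * ?Z * norm h" by (rule mult_right_mono) simp
        then show ?thesis using Z by (simp add: field_simps)
      qed
      finally show "norm (moll \<delta> U y - moll \<delta> U x - molld \<delta> U x (y - x)) \<le> e * norm (y - x)"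
        using Z by (simp add: h_def divide_right_mono)
    qed
  qed
qed

lemma continuous_on_molld:
  fixes U :: "'a::euclidean_space \<Rightarrow> complex"
  assumes U: "integrable lborel U" and \<delta>: "\<delta> > 0"
  shows "continuous_on UNIV (\<lambda>x. molld \<delta> U x h)"
  unfolding continuous_on_iff
proof (intro ballI allI impI)
  note int = integrable_moll[OF U \<delta>]
  let ?Z = "eta_mass TYPE('a) \<delta>"
  have Z: "?Z > 0" by (rule eta_mass_pos[OF \<delta>])
  let ?N = "LINT y|lborel. norm (U y)"
  have N: "?N \<ge> 0" by simp
  fix x :: 'a and e :: real assume e: "e > 0"
  define K where "K = (?N + 1) * (norm h + 1)"
  have K: "K > 0" using N by (auto simp: K_def intro!: mult_pos_pos add_nonneg_pos)
  define e' where "e' = e * ?Z / (2 * K)"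
  have e': "e' > 0" using e Z K by (simp add: e'_def)
  obtain \<rho> where \<rho>: "\<rho> > 0" "\<And>v w::'a. norm (v - w) < \<rho> \<Longrightarrow> norm (etad \<delta> v - etad \<delta> w) \<le> e'"
    using continuous_bounded_support_uniform[OF continuous_on_etad etad_zero[OF \<delta>] e'] by metis
  show "\<exists>d>0. \<forall>x'\<in>UNIV. dist x' x < d \<longrightarrow> dist (molld \<delta> U x' h) (molld \<delta> U x h) < e"
  proof (intro exI conjI ballI impI, rule \<rho>(1))
    fix y assume y: "dist y x < \<rho>"
    have "molld \<delta> U y h - molld \<delta> U x h = (LINT t|lborel. U t * of_real ((etad \<delta> (y - t) - etad \<delta> (x - t)) \<bullet> h)) / of_real ?Z"
      unfolding molld_def diff_divide_distrib[symmetric]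
      by (subst Bochner_Integration.integral_diff[OF int(2) int(2), symmetric]) (simp add: inner_diff_left algebra_simps)
    then have "dist (molld \<delta> U y h) (molld \<delta> U x h) = norm (LINT t|lborel. U t * of_real ((etad \<delta> (y - t) - etad \<delta> (x - t)) \<bullet> h)) / ?Z"
      using Z by (simp add: dist_norm norm_divide)
    also have "norm (LINT t|lborel. U t * of_real ((etad \<delta> (y - t) - etad \<delta> (x - t)) \<bullet> h)) \<le> (LINT t|lborel. norm (U t * of_real ((etad \<delta> (y - t) - etad \<delta> (x - t)) \<bullet> h)))"
      by (rule integral_norm_bound)
    also have "\<dots> \<le> (LINT t|lborel. norm (U t) * (e' * norm h))"
    proof (rule integral_mono')
      show "integrable lborel (\<lambda>t. norm (U t) * (e' * norm h))" using U by simp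
      show "norm (U t * of_real ((etad \<delta> (y - t) - etad \<delta> (x - t)) \<bullet> h)) \<le> norm (U t) * (e' * norm h)" for t
      proof -
        have "norm (etad \<delta> (y - t) - etad \<delta> (x - t)) \<le> e'"
          using \<rho>(2)[of "y - t" "x - t"] y by (simp add: dist_norm)
        then have "\<bar>(etad \<delta> (y - t) - etad \<delta> (x - t)) \<bullet> h\<bar> \<le> e' * norm h"
          by (meson Cauchy_Schwarz_ineq2 mult_right_mono norm_ge_zero order_trans)
        then show ?thesis unfolding norm_mult norm_of_real by (intro mult_left_mono) auto
      qed
      show "norm (U t) * (e' * norm h) \<ge> 0" for t using e' by simp
    qed
    also have "\<dots> = (?N * norm h) * e'" by simp
    also have "\<dots> / ?Z < e"
    proof -
      have "?N * norm h \<le> K" unfolding K_def using N by (intro mult_mono) auto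
      then have "(?N * norm h) * e' \<le> K * e'" using e' by (intro mult_right_mono) auto
      also have "\<dots> < e * ?Z" using K e Z by (simp add: e'_def)
      finally show ?thesis using Z by (simp add: pos_divide_less_eq)
    qed
    finally show "dist (molld \<delta> U y h) (molld \<delta> U x h) < e" using Z by (simp add: divide_right_mono)
  qed
qed

definition L1cont :: "('a::euclidean_space \<Rightarrow> complex) \<Rightarrow> bool" where
  "L1cont U \<longleftrightarrow> (\<forall>e>0. \<exists>d>0. \<forall>h. norm h < d \<longrightarrow> (\<integral>\<^sup>+x. ennreal (norm (U (x + h) - U x)) \<partial>lborel) \<le> ennreal e)"

text \<open>Let \<open>K\<close> be compact, \<open>Q\<close> open, \<open>K \<subseteq> A \<subseteq> Q\<close>, and \<open>Q - K\<close> of small measure. A shift that is smaller than the distance from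
\<open>K\<close> to the complement of \<open>Q\<close> changes the indicator function of \<open>A\<close> only on small sets.\<close>

lemma L1cont_indicator:
  assumes A: "A \<in> sets lborel" "emeasure lborel A < \<infinity>"
  shows "L1cont (\<lambda>x::'a::euclidean_space. indicator A x *\<^sub>R c)"
  unfolding L1cont_def
proof (intro allI impI)
  fix e :: real assume e: "e > 0"
  define e' where "e' = e / (6 * (norm c + 1))"
  have e': "e' > 0" using e by (auto simp: e'_def intro!: divide_pos_pos mult_pos_pos add_nonneg_pos)
  have Ab [measurable]: "A \<in> sets borel" using A by simp
  obtain Q where Q: "open Q" "A \<subseteq> Q" "emeasure lborel (Q - A) < ennreal e'"
    using outer_regular_lborel[OF Ab e'] by metis
  have "A \<in> sets lebesgue" using Ab by simp
  then obtain T where T: "closed T" "T \<subseteq> A" "emeasure lebesgue (A - T) < ennreal e'"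
    using sets_lebesgue_inner_closed[OF _ e'] by metis
  have Tb [measurable]: "T \<in> sets borel" using T by (simp add: borel_closed)
  have TA: "emeasure lborel (A - T) < ennreal e'" using T Ab Tb by simp
  have "(\<lambda>n. emeasure lborel (A - cball 0 (real n))) \<longlonglongrightarrow> emeasure lborel (\<Inter>n. A - cball 0 (real n))"
  proof (rule Lim_emeasure_decseq)
    show "range (\<lambda>n. A - cball 0 (real n)) \<subseteq> sets lborel" using A by auto
    show "decseq (\<lambda>n. A - cball 0 (real n))" by (auto simp: decseq_def)
    fix n
    have "emeasure lborel (A - cball 0 (real n)) \<le> emeasure lborel A" using A by (intro emeasure_mono) auto
    with A(2) show "emeasure lborel (A - cball 0 (real n)) \<noteq> \<infinity>" by (auto simp: top_unique)
  qed
  moreover have "(\<Inter>n. A - cball 0 (real n)) = {}"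
    using real_arch_simple by (auto simp: not_le)
  ultimately have "(\<lambda>n. emeasure lborel (A - cball 0 (real n))) \<longlonglongrightarrow> 0" by (simp only: emeasure_empty)
  then have "\<forall>\<^sub>F n in sequentially. emeasure lborel (A - cball 0 (real n)) < ennreal e'"
    using e' by (intro order_tendstoD) auto
  then obtain n where n: "emeasure lborel (A - cball 0 (real n)) < ennreal e'"
    by (auto simp: eventually_sequentially)
  define K where "K = T \<inter> cball 0 (real n)"
  have K: "compact K" "K \<subseteq> A" using T by (auto simp: K_def closed_Int_compact)
  have Kb [measurable]: "K \<in> sets borel" using K by (simp add: compact_imp_closed borel_closed)
  have Ob [measurable]: "Q \<in> sets borel" using Q by simp
  have OK: "emeasure lborel (Q - K) \<le> ennreal (3 * e')"
  proof -
    have "emeasure lborel (Q - K) \<le> emeasure lborel ((Q - A) \<union> ((A - T) \<union> (A - cball 0 (real n))))"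
      by (intro emeasure_mono) (auto simp: K_def)
    also have "\<dots> \<le> emeasure lborel (Q - A) + emeasure lborel ((A - T) \<union> (A - cball 0 (real n)))"
      by (intro emeasure_subadditive) auto
    also have "\<dots> \<le> emeasure lborel (Q - A) + (emeasure lborel (A - T) + emeasure lborel (A - cball 0 (real n)))"
      by (intro add_left_mono emeasure_subadditive) auto
    also have "\<dots> \<le> ennreal e' + (ennreal e' + ennreal e')"
      using Q TA n by (intro add_mono) (auto intro: less_imp_le)
    also have "\<dots> = ennreal (3 * e')" using e' by (simp add: ennreal_plus[symmetric] del: ennreal_plus)
    finally show ?thesis .
  qed
  obtain d where d: "d > 0" "\<And>x y. x \<in> K \<Longrightarrow> y \<in> - Q \<Longrightarrow> d \<le> dist x y"
  proof -
    have "K \<inter> - Q = {}" "closed (- Q)" using K Q by (auto simp: closed_Compl)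
    then show ?thesis using separate_compact_closed[OF K(1), of "- Q"] that by blast
  qed
  show "\<exists>d>0. \<forall>h. norm h < d \<longrightarrow> (\<integral>\<^sup>+x. ennreal (norm (indicator A (x + h) *\<^sub>R c - indicator A x *\<^sub>R c)) \<partial>lborel) \<le> ennreal e"
  proof (intro exI conjI allI impI, rule d(1))
    fix h :: 'a assume h: "norm h < d"
    have "(\<integral>\<^sup>+x. ennreal (norm (indicator A (x + h) *\<^sub>R c - indicator A x *\<^sub>R c)) \<partial>lborel)
      \<le> (\<integral>\<^sup>+x. ennreal (norm c) * (indicator (Q - K) (x + h) + indicator (Q - K) x) \<partial>lborel)"
    proof (rule nn_integral_mono)
      fix x
      have 1: "x + h \<in> Q" if "x \<in> K"
        using d(2)[OF that, of "x + h"] h by (auto simp: dist_norm)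
      have 2: "x \<in> Q" if "x + h \<in> K"
        using d(2)[OF that, of "x"] h by (auto simp: dist_norm)
      show "ennreal (norm (indicator A (x + h) *\<^sub>R c - indicator A x *\<^sub>R c)) \<le> ennreal (norm c) * (indicator (Q - K) (x + h) + indicator (Q - K) x)"
      proof -
        have "ennreal (norm c) \<le> ennreal (norm c) * 2" by (simp add: mult_2_right add_increasing2)
        then show ?thesis using 1 2 K Q by (auto simp: indicator_def)
      qed
    qed
    also have "\<dots> = ennreal (norm c) * ((\<integral>\<^sup>+x. indicator (Q - K) (x + h) \<partial>lborel) + (\<integral>\<^sup>+x. indicator (Q - K) x \<partial>lborel))"
      by (subst nn_integral_cmult, measurable, subst nn_integral_add) auto
    also have "(\<integral>\<^sup>+x. indicator (Q - K) (x + h) \<partial>lborel) = (\<integral>\<^sup>+x. indicator (Q - K) x \<partial>lborel)"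
      by (rule nn_integral_lborel_shift) measurable
    also have "(\<integral>\<^sup>+x. indicator (Q - K) x \<partial>lborel) = emeasure lborel (Q - K)" by simp
    also have "ennreal (norm c) * (emeasure lborel (Q - K) + emeasure lborel (Q - K)) \<le> ennreal (norm c) * (ennreal (3 * e') + ennreal (3 * e'))"
      using OK by (intro mult_left_mono add_mono) auto
    also have "\<dots> = ennreal (norm c * (6 * e'))"
      using e' by (simp add: ennreal_plus[symmetric] ennreal_mult[symmetric] del: ennreal_plus)
    also have "\<dots> \<le> ennreal e"
    proof (rule ennreal_leI)
      have "norm c * e \<le> (norm c + 1) * e" using e by (intro mult_right_mono) auto
      moreover have "norm c + 1 > 0" by (intro add_nonneg_pos) auto
      ultimately show "norm c * (6 * e') \<le> e" unfolding e'_def by (simp add: field_simps)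
    qed
    finally show "(\<integral>\<^sup>+x. ennreal (norm (indicator A (x + h) *\<^sub>R c - indicator A x *\<^sub>R c)) \<partial>lborel) \<le> ennreal e" .
  qed
qed

lemma L1cont_integrable:
  fixes U :: "'a::euclidean_space \<Rightarrow> complex"
  assumes "integrable lborel U"
  shows "L1cont U"
  using assms
proof (induction rule: integrable_induct)
  case (base A c)
  then show ?case by (rule L1cont_indicator)
next
  case (add f g)
  have [measurable]: "f \<in> borel_measurable borel" "g \<in> borel_measurable borel"
    using add by (auto dest: borel_measurable_integrable)
  show ?case unfolding L1cont_def
  proof (intro allI impI)
    fix e :: real assume "e > 0"
    then have e2: "e / 2 > 0" by simp
    obtain d1 where d1: "d1 > 0" "\<And>h. norm h < d1 \<Longrightarrow> (\<integral>\<^sup>+x. ennreal (norm (f (x + h) - f x)) \<partial>lborel) \<le> ennreal (e/2)"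
      using add e2 unfolding L1cont_def by metis
    obtain d2 where d2: "d2 > 0" "\<And>h. norm h < d2 \<Longrightarrow> (\<integral>\<^sup>+x. ennreal (norm (g (x + h) - g x)) \<partial>lborel) \<le> ennreal (e/2)"
      using add e2 unfolding L1cont_def by metis
    show "\<exists>d>0. \<forall>h. norm h < d \<longrightarrow> (\<integral>\<^sup>+x. ennreal (norm (f (x + h) + g (x + h) - (f x + g x))) \<partial>lborel) \<le> ennreal e"
    proof (intro exI[of _ "min d1 d2"] conjI allI impI)
      fix h :: 'a assume h: "norm h < min d1 d2"
      have "(\<integral>\<^sup>+x. ennreal (norm (f (x + h) + g (x + h) - (f x + g x))) \<partial>lborel)
         \<le> (\<integral>\<^sup>+x. ennreal (norm (f (x + h) - f x)) + ennreal (norm (g (x + h) - g x)) \<partial>lborel)"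
        by (intro nn_integral_mono) (simp add: ennreal_plus[symmetric] norm_diff_triangle_ineq del: ennreal_plus)
      also have "\<dots> = (\<integral>\<^sup>+x. ennreal (norm (f (x + h) - f x)) \<partial>lborel) + (\<integral>\<^sup>+x. ennreal (norm (g (x + h) - g x)) \<partial>lborel)"
        by (rule nn_integral_add) measurable
      also have "\<dots> \<le> ennreal (e/2) + ennreal (e/2)"
        using d1(2)[of h] d2(2)[of h] h by (intro add_mono) auto
      also have "\<dots> = ennreal e" using e2 by (simp add: ennreal_plus[symmetric] del: ennreal_plus)
      finally show "(\<integral>\<^sup>+x. ennreal (norm (f (x + h) + g (x + h) - (f x + g x))) \<partial>lborel) \<le> ennreal e" .
    qed (use d1 d2 in auto)
  qed
next
  case (lim f s)
  have [measurable]: "f \<in> borel_measurable borel" "s i \<in> borel_measurable borel" for i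
    using lim by (auto dest: borel_measurable_integrable)
  have conv: "(\<lambda>i. \<integral>\<^sup>+x. ennreal (norm (s i x - f x)) \<partial>lborel) \<longlonglongrightarrow> 0"
  proof -
    have "(\<lambda>i. \<integral>\<^sup>+x. norm (f x - s i x) \<partial>lborel) \<longlonglongrightarrow> 0"
    proof (rule nn_integral_dominated_convergence_norm[where w = "\<lambda>x. 2 * norm (f x)"])
      show "(\<integral>\<^sup>+x. ennreal (2 * norm (f x)) \<partial>lborel) < \<infinity>"
        using \<open>integrable lborel f\<close> by (simp add: integrable_iff_bounded ennreal_mult nn_integral_cmult ennreal_mult_less_top)
    qed (use lim in auto)
    then show ?thesis by (simp add: norm_minus_commute)
  qed
  show ?case unfolding L1cont_def
  proof (intro allI impI)
    fix e :: real assume "e > 0"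
    then have e3: "e / 3 > 0" by simp
    have "\<forall>\<^sub>F i in sequentially. (\<integral>\<^sup>+x. ennreal (norm (s i x - f x)) \<partial>lborel) < ennreal (e/3)"
      using e3 by (intro order_tendstoD[OF conv]) simp
    then obtain i where i: "(\<integral>\<^sup>+x. ennreal (norm (s i x - f x)) \<partial>lborel) < ennreal (e/3)"
      by (auto simp: eventually_sequentially)
    obtain d where d: "d > 0" "\<And>h. norm h < d \<Longrightarrow> (\<integral>\<^sup>+x. ennreal (norm (s i (x + h) - s i x)) \<partial>lborel) \<le> ennreal (e/3)"
    proof -
      have "L1cont (s i)" by (rule lim)
      then show ?thesis using that e3 unfolding L1cont_def by metis
    qed
    show "\<exists>d>0. \<forall>h. norm h < d \<longrightarrow> (\<integral>\<^sup>+x. ennreal (norm (f (x + h) - f x)) \<partial>lborel) \<le> ennreal e"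
    proof (intro exI[of _ d] conjI allI impI)
      fix h :: 'a assume h: "norm h < d"
      have "(\<integral>\<^sup>+x. ennreal (norm (f (x + h) - f x)) \<partial>lborel)
         \<le> (\<integral>\<^sup>+x. ennreal (norm (s i (x + h) - f (x + h))) + (ennreal (norm (s i (x + h) - s i x)) + ennreal (norm (s i x - f x))) \<partial>lborel)"
      proof (rule nn_integral_mono)
        fix x
        have "norm (f (x + h) - f x) \<le> norm (s i (x + h) - f (x + h)) + (norm (s i (x + h) - s i x) + norm (s i x - f x))"
          by norm
        then show "ennreal (norm (f (x + h) - f x)) \<le> ennreal (norm (s i (x + h) - f (x + h))) + (ennreal (norm (s i (x + h) - s i x)) + ennreal (norm (s i x - f x)))"
          by (simp add: ennreal_plus[symmetric] del: ennreal_plus)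
      qed
      also have "\<dots> = (\<integral>\<^sup>+x. ennreal (norm (s i (x + h) - f (x + h))) \<partial>lborel) + ((\<integral>\<^sup>+x. ennreal (norm (s i (x + h) - s i x)) \<partial>lborel) + (\<integral>\<^sup>+x. ennreal (norm (s i x - f x)) \<partial>lborel))"
        by (subst nn_integral_add, measurable, subst nn_integral_add) auto
      also have "(\<integral>\<^sup>+x. ennreal (norm (s i (x + h) - f (x + h))) \<partial>lborel) = (\<integral>\<^sup>+x. ennreal (norm (s i x - f x)) \<partial>lborel)"
        by (rule nn_integral_lborel_shift) measurable
      also have "(\<integral>\<^sup>+x. ennreal (norm (s i x - f x)) \<partial>lborel) + ((\<integral>\<^sup>+x. ennreal (norm (s i (x + h) - s i x)) \<partial>lborel) + (\<integral>\<^sup>+x. ennreal (norm (s i x - f x)) \<partial>lborel))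
        \<le> ennreal (e/3) + (ennreal (e/3) + ennreal (e/3))"
        using i d(2)[OF h] by (intro add_mono) auto
      also have "\<dots> = ennreal e" using e3 by (simp add: ennreal_plus[symmetric] del: ennreal_plus)
      finally show "(\<integral>\<^sup>+x. ennreal (norm (f (x + h) - f x)) \<partial>lborel) \<le> ennreal e" .
    qed (use d in auto)
  qed
qed

text \<open>The mollification is an average of translates by vectors shorter than \<open>\<delta>\<close>, so its distance from \<open>U\<close> is at most
the largest distance of such a translate.\<close>

lemma moll_L1_bound:
  fixes U :: "'a::euclidean_space \<Rightarrow> complex"
  assumes U: "integrable lborel U" and \<delta>: "\<delta> > 0" and e: "e \<ge> 0"
    and close: "\<And>h. norm h < \<delta> \<Longrightarrow> (\<integral>\<^sup>+x. ennreal (norm (U (x + h) - U x)) \<partial>lborel) \<le> ennreal e"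
  shows "(\<integral>\<^sup>+x. ennreal (norm (moll \<delta> U x - U x)) \<partial>lborel) \<le> ennreal e"
proof -
  have [measurable]: "U \<in> borel_measurable borel" using U by (auto dest: borel_measurable_integrable)
  let ?Z = "eta_mass TYPE('a) \<delta>"
  have Z: "?Z > 0" by (rule eta_mass_pos[OF \<delta>])
  have Zint: "(LINT y|lborel. eta \<delta> (x - y)) = ?Z" for x :: 'a
  proof -
    have "(LINT y|lborel. eta \<delta> (x - y)) = (LINT y|lborel. eta \<delta> (x - (y + x)))"
      by (rule lborel_integral_translate[symmetric]) measurable
    also have "\<dots> = ?Z" by (simp add: eta_mass_def eta_def)
    finally show ?thesis .
  qed
  have eta_int: "integrable lborel (\<lambda>y. eta \<delta> (x - y))" for x :: 'a
  proof (rule integrable_continuous_bounded_support)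
    show "continuous_on UNIV (\<lambda>y. eta \<delta> (x - y))"
      by (intro continuous_on_compose2[OF continuous_on_eta] continuous_intros) auto
    show "eta \<delta> (x - y) = 0" if "norm y > norm x + \<delta>" for y
      using that norm_triangle_ineq2[of y x] by (intro eta_zero[OF \<delta>]) (simp add: norm_minus_commute)
  qed
  have pt: "ennreal (norm (moll \<delta> U x - U x)) \<le> ennreal (1 / ?Z) * (\<integral>\<^sup>+v. ennreal (eta \<delta> v) * ennreal (norm (U (x + v) - U x)) \<partial>lborel)" for x
  proof -
    have int: "integrable lborel (\<lambda>y. U y * of_real (eta \<delta> (x - y)) - U x * of_real (eta \<delta> (x - y)))"
      using integrable_moll(1)[OF U \<delta>] eta_int[of x] by simp
    have "moll \<delta> U x - U x = (LINT y|lborel. U y * of_real (eta \<delta> (x - y)) - U x * of_real (eta \<delta> (x - y))) / of_real ?Z"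
      using integrable_moll(1)[OF U \<delta>] eta_int[of x] Z
      by (simp add: moll_def Zint diff_divide_distrib)
    then have "ennreal (norm (moll \<delta> U x - U x)) = ennreal (1 / ?Z) * ennreal (norm (LINT y|lborel. U y * of_real (eta \<delta> (x - y)) - U x * of_real (eta \<delta> (x - y))))"
      using Z by (simp add: norm_divide ennreal_mult[symmetric])
    also have "\<dots> \<le> ennreal (1 / ?Z) * (\<integral>\<^sup>+y. ennreal (norm (U y * of_real (eta \<delta> (x - y)) - U x * of_real (eta \<delta> (x - y)))) \<partial>lborel)"
      by (intro mult_left_mono integral_norm_bound_ennreal int) auto
    also have "(\<integral>\<^sup>+y. ennreal (norm (U y * of_real (eta \<delta> (x - y)) - U x * of_real (eta \<delta> (x - y)))) \<partial>lborel)
       = (\<integral>\<^sup>+v. ennreal (norm (U (v + x) * of_real (eta \<delta> (x - (v + x))) - U x * of_real (eta \<delta> (x - (v + x))))) \<partial>lborel)"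
      by (rule nn_integral_lborel_shift[symmetric]) measurable
    also have "\<dots> = (\<integral>\<^sup>+v. ennreal (eta \<delta> v) * ennreal (norm (U (x + v) - U x)) \<partial>lborel)"
      by (intro nn_integral_cong)
        (simp add: left_diff_distrib[symmetric] norm_mult ennreal_mult[symmetric] eta_def add.commute mult.commute)
    finally show ?thesis .
  qed
  have "(\<integral>\<^sup>+x. (\<integral>\<^sup>+v. ennreal (eta \<delta> v) * ennreal (norm (U (x + v) - U x)) \<partial>lborel) \<partial>lborel)
     = (\<integral>\<^sup>+v. (\<integral>\<^sup>+x. ennreal (eta \<delta> v) * ennreal (norm (U (x + v) - U x)) \<partial>lborel) \<partial>lborel)"
    by (rule lborel_pair.Fubini') measurable
  also have "\<dots> \<le> (\<integral>\<^sup>+v. ennreal e * ennreal (eta \<delta> (v::'a)) \<partial>lborel)"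
  proof (rule nn_integral_mono)
    fix v :: 'a
    have "(\<integral>\<^sup>+x. ennreal (eta \<delta> v) * ennreal (norm (U (x + v) - U x)) \<partial>lborel) = ennreal (eta \<delta> v) * (\<integral>\<^sup>+x. ennreal (norm (U (x + v) - U x)) \<partial>lborel)"
      by (rule nn_integral_cmult) measurable
    also have "\<dots> \<le> ennreal e * ennreal (eta \<delta> v)"
    proof (cases "norm v < \<delta>")
      case True
      then show ?thesis using close[OF True] by (subst mult.commute) (rule mult_right_mono, auto)
    next
      case False
      then show ?thesis by (simp add: eta_zero[OF \<delta>])
    qed
    finally show "(\<integral>\<^sup>+x. ennreal (eta \<delta> v) * ennreal (norm (U (x + v) - U x)) \<partial>lborel) \<le> ennreal e * ennreal (eta \<delta> v)" .
  qed
  also have "(\<integral>\<^sup>+v. ennreal e * ennreal (eta \<delta> (v::'a)) \<partial>lborel) = ennreal e * (\<integral>\<^sup>+v. ennreal (eta \<delta> (v::'a)) \<partial>lborel)"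
    by (rule nn_integral_cmult) measurable
  also have "(\<integral>\<^sup>+v. ennreal (eta \<delta> (v::'a)) \<partial>lborel) = ennreal ?Z"
    unfolding eta_mass_def by (rule nn_integral_eq_integral[OF integrable_eta[OF \<delta>]]) auto
  finally have inner: "(\<integral>\<^sup>+x. (\<integral>\<^sup>+v. ennreal (eta \<delta> v) * ennreal (norm (U (x + v) - U x)) \<partial>lborel) \<partial>lborel) \<le> ennreal e * ennreal ?Z" .
  have "(\<integral>\<^sup>+x. ennreal (norm (moll \<delta> U x - U x)) \<partial>lborel)
     \<le> (\<integral>\<^sup>+x. ennreal (1 / ?Z) * (\<integral>\<^sup>+v. ennreal (eta \<delta> v) * ennreal (norm (U (x + v) - U x)) \<partial>lborel) \<partial>lborel)"
    by (intro nn_integral_mono pt)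
  also have "\<dots> = ennreal (1 / ?Z) * (\<integral>\<^sup>+x. (\<integral>\<^sup>+v. ennreal (eta \<delta> v) * ennreal (norm (U (x + v) - U x)) \<partial>lborel) \<partial>lborel)"
    by (rule nn_integral_cmult) measurable
  also have "\<dots> \<le> ennreal (1 / ?Z) * (ennreal e * ennreal ?Z)"
    by (intro mult_left_mono inner) auto
  also have "ennreal (1 / ?Z) * (ennreal e * ennreal ?Z) = ennreal e"
    using Z e by (simp add: ennreal_mult[symmetric])
  finally show ?thesis .
qed

lemma moll_L1_tendsto:
  fixes U :: "'a::euclidean_space \<Rightarrow> complex"
  assumes U: "integrable lborel U" and d: "d \<longlonglongrightarrow> 0" "\<And>n::nat. d n > 0"
  shows "(\<lambda>n. \<integral>\<^sup>+x. ennreal (norm (moll (d n) U x - U x)) \<partial>lborel) \<longlonglongrightarrow> 0"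
proof (rule order_tendstoI)
  fix a :: ennreal assume a: "0 < a"
  obtain e where e: "e > 0" "ennreal e < a"
    using a by (cases a) (auto simp: ennreal_less_iff intro: that[of 1] that[of "x/2" for x])
  obtain \<rho> where \<rho>: "\<rho> > 0" "\<And>h. norm h < \<rho> \<Longrightarrow> (\<integral>\<^sup>+x. ennreal (norm (U (x + h) - U x)) \<partial>lborel) \<le> ennreal e"
    using L1cont_integrable[OF U] e(1) unfolding L1cont_def by metis
  have "\<forall>\<^sub>F n in sequentially. d n < \<rho>" using order_tendstoD(2)[OF d(1) \<rho>(1)] .
  then show "\<forall>\<^sub>F n in sequentially. (\<integral>\<^sup>+x. ennreal (norm (moll (d n) U x - U x)) \<partial>lborel) < a"
  proof eventually_elim
    case (elim n)
    have "(\<integral>\<^sup>+x. ennreal (norm (moll (d n) U x - U x)) \<partial>lborel) \<le> ennreal e"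
      by (rule moll_L1_bound[OF U d(2)]) (use e \<rho>(2) elim in auto)
    then show ?case using e(2) by (rule order_le_less_trans)
  qed
qed auto

section \<open>The weak Cauchy-Riemann operator tested against bumps\<close>

text \<open>Test functions enter only as translates of the bumps \<open>eta \<delta>\<close> whose support lies in the ball of radius \<open>R\<close>. This is
exactly what is needed to differentiate the mollifications of \<open>U\<close>. The sign differs from the usual one because
\<open>etad \<delta> (x - y)\<close> is minus the gradient with respect to \<open>y\<close>.\<close>

definition weakdbar :: "real \<Rightarrow> (complex ^ 'n \<Rightarrow> complex) \<Rightarrow> ('n \<Rightarrow> complex ^ 'n \<Rightarrow> complex) \<Rightarrow> bool" where
  "weakdbar R U E \<longleftrightarrow> (\<forall>j \<delta> x. 0 < \<delta> \<longrightarrow> norm x + \<delta> < R \<longrightarrow>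
     (LINT y|lborel. U y * ((of_real (etad \<delta> (x - y) \<bullet> axis j 1) + \<i> * of_real (etad \<delta> (x - y) \<bullet> axis j \<i>)) / 2))
      = (LINT y|lborel. E j y * of_real (eta \<delta> (x - y))))"

text \<open>Both sides are conjugate linear in the direction, so it suffices to compare them on the coordinate directions, where
the statement is the weak equation itself.\<close>

lemma Lbar_moll:
  fixes U :: "complex ^ 'n \<Rightarrow> complex"
  assumes w: "weakdbar R U E" and U: "integrable lborel U" and \<delta>: "0 < \<delta>" "norm x + \<delta> < R"
  shows "Lbar (molld \<delta> U) x = (\<Sum>j\<in>UNIV. cnj (x $ j) * moll \<delta> (E j) x)"
proof -
  define L where "L = molld \<delta> U x"
  have L: "linear L" unfolding L_def using moll_has_derivative[OF U \<delta>(1)] has_derivative_linear by blast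
  define A where "A v = (L v + \<i> * L (\<i> *s v)) / 2" for v
  have A_lin: "A (\<Sum>j\<in>S. f j) = (\<Sum>j\<in>S. A (f j))" if "finite S" for S and f :: "'n \<Rightarrow> complex ^ 'n"
    unfolding A_def
    by (simp add: linear_sum[OF L] linear_sum[OF linear_smult_right] sum_distrib_left sum_divide_distrib sum.distrib add_divide_distrib)
  have A_smult: "A (c *s v) = cnj c * A v" for c v
    using Lbar_smult[of "\<lambda>_. L" c v] L by (simp add: A_def Lbar_def)
  have Aj: "A (axis j 1) = moll \<delta> (E j) x" for j
  proof -
    have i: "\<i> *s axis j 1 = (axis j \<i> :: complex ^ 'n)"
      by (simp add: vec_eq_iff axis_def)
    note int = integrable_moll(2)[OF U \<delta>(1)]
    let ?Z = "complex_of_real (eta_mass TYPE(complex ^ 'n) \<delta>)"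
    have "A (axis j 1) = ((LINT y|lborel. U y * of_real (etad \<delta> (x - y) \<bullet> axis j 1)) + \<i> * (LINT y|lborel. U y * of_real (etad \<delta> (x - y) \<bullet> axis j \<i>))) / 2 / ?Z"
      unfolding A_def i L_def molld_def by (simp add: add_divide_distrib mult.commute)
    also have "((LINT y|lborel. U y * of_real (etad \<delta> (x - y) \<bullet> axis j 1)) + \<i> * (LINT y|lborel. U y * of_real (etad \<delta> (x - y) \<bullet> axis j \<i>))) / 2
       = (LINT y|lborel. (U y * of_real (etad \<delta> (x - y) \<bullet> axis j 1) + \<i> * (U y * of_real (etad \<delta> (x - y) \<bullet> axis j \<i>))) / 2)"
      using int by simp
    also have "\<dots> = (LINT y|lborel. U y * ((of_real (etad \<delta> (x - y) \<bullet> axis j 1) + \<i> * of_real (etad \<delta> (x - y) \<bullet> axis j \<i>)) / 2))"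
      by (intro Bochner_Integration.integral_cong) (auto simp: algebra_simps)
    also have "\<dots> = (LINT y|lborel. E j y * of_real (eta \<delta> (x - y)))"
      using w \<delta> unfolding weakdbar_def by blast
    finally show ?thesis by (simp add: moll_def)
  qed
  have "Lbar (molld \<delta> U) x = A x" by (simp add: Lbar_def A_def L_def)
  also have "\<dots> = A (\<Sum>j\<in>UNIV. (x $ j) *s axis j 1)" by (simp add: basis_expansion)
  also have "\<dots> = (\<Sum>j\<in>UNIV. cnj (x $ j) * moll \<delta> (E j) x)"
    by (simp add: A_lin A_smult Aj)
  finally show ?thesis .
qed

section \<open>Piecewise quadratic cutoffs\<close>

definition posq :: "real \<Rightarrow> real" where "posq t = (max 0 t)\<^sup>2"

lemma posq_deriv: "(posq has_real_derivative 2 * max 0 t) (at t)"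
proof -
  consider "t < 0" | "t = 0" | "t > 0" by linarith
  then show ?thesis
  proof cases
    case 1
    have "((\<lambda>_. 0) has_real_derivative 0) (at t)" by simp
    then have "(posq has_real_derivative 0) (at t)"
      by (rule has_field_derivative_transform_within[where d = "-t"]) (use 1 in \<open>auto simp: dist_real_def posq_def\<close>)
    then show ?thesis using 1 by simp
  next
    case 2
    have "((\<lambda>s. posq s / s) \<longlongrightarrow> 0) (at 0)"
    proof (rule tendsto_rabs_zero_cancel, rule real_tendsto_sandwich[of "\<lambda>_. 0" _ _ "\<lambda>s. \<bar>s\<bar>"])
      show "\<forall>\<^sub>F s in at 0. \<bar>posq s / s\<bar> \<le> \<bar>s::real\<bar>"
        by (intro always_eventually allI) (auto simp: posq_def power2_eq_square max_def)
      show "((\<lambda>s. \<bar>s\<bar>) \<longlongrightarrow> 0) (at (0::real))" by (auto intro!: tendsto_eq_intros)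
    qed auto
    then have "(posq has_real_derivative 0) (at 0)"
      by (simp add: has_field_derivative_iff) (simp add: posq_def)
    then show ?thesis using 2 by simp
  next
    case 3
    have "((\<lambda>s. s\<^sup>2) has_real_derivative 2 * t) (at t)" by (auto intro!: derivative_eq_intros)
    then have "(posq has_real_derivative 2 * t) (at t)"
      by (rule has_field_derivative_transform_within[where d = "t"]) (use 3 in \<open>auto simp: dist_real_def posq_def\<close>)
    then show ?thesis using 3 by simp
  qed
qed

text \<open>A continuously differentiable transition from \<open>0\<close> to \<open>1\<close> on the unit interval, with derivative at most \<open>2\<close>; it is the
second primitive of a step function.\<close>

definition step :: "real \<Rightarrow> real" where
  "step t = 2 * posq t - 4 * posq (t - 1/2) + 2 * posq (t - 1)"

definition step' :: "real \<Rightarrow> real" where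
  "step' t = 4 * max 0 t - 8 * max 0 (t - 1/2) + 4 * max 0 (t - 1)"

lemma step_deriv: "(step has_real_derivative step' t) (at t)"
proof -
  have sh: "((\<lambda>t. posq (t - a)) has_real_derivative 2 * max 0 (t - a)) (at t)" for a
  proof -
    have "((\<lambda>t. t - a) has_real_derivative 1) (at t)" by (auto intro!: derivative_eq_intros)
    from DERIV_chain2[OF posq_deriv this] show ?thesis by simp
  qed
  show ?thesis unfolding step_def[abs_def] step'_def
    by (rule derivative_eq_intros posq_deriv sh refl)+ simp
qed

lemma step_0: "t \<le> 0 \<Longrightarrow> step t = 0" by (simp add: step_def posq_def)
lemma step_1: "t \<ge> 1 \<Longrightarrow> step t = 1" by (simp add: step_def posq_def power2_eq_square algebra_simps)
lemma step'_0: "t \<le> 0 \<or> t \<ge> 1 \<Longrightarrow> step' t = 0" by (auto simp: step'_def)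
lemma step'_bounds: "0 \<le> step' t" "step' t \<le> 2" by (auto simp: step'_def max_def)

lemma step_nonneg: "0 \<le> step t" and step_le_1: "step t \<le> 1"
proof -
  have mono: "step a \<le> step b" if "a \<le> b" for a b
    using that by (rule DERIV_nonneg_imp_nondecreasing) (use step_deriv step'_bounds in blast)
  show "0 \<le> step t" using mono[of 0 t] step_0 by (cases "t \<ge> 0") auto
  show "step t \<le> 1" using mono[of t 1] step_1 by (cases "t \<le> 1") auto
qed

lemma continuous_on_step': "continuous_on UNIV step'"
  unfolding step'_def[abs_def] by (intro continuous_intros)

lemma continuous_on_step: "continuous_on UNIV step"
  using step_deriv DERIV_isCont by (auto intro!: continuous_at_imp_continuous_on)

section \<open>The dilation potential\<close>

definition kern_mass :: ennreal where "kern_mass = (\<integral>\<^sup>+\<sigma>. ennreal (kern \<sigma>) \<partial>hmeas)"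

lemma kern_mass_finite: "kern_mass < \<infinity>"
  using kern_integrable[of 1] by (simp add: kern_mass_def)

lemma smult_measurable [measurable (raw)]:
  fixes f :: "'b \<Rightarrow> complex" and g :: "'b \<Rightarrow> complex ^ 'n"
  assumes "f \<in> borel_measurable M" "g \<in> borel_measurable M"
  shows "(\<lambda>x. f x *s g x) \<in> borel_measurable M"
proof -
  have "(\<lambda>p. fst p *s (snd p :: complex ^ 'n)) \<in> borel_measurable borel"
    by (intro borel_measurable_continuous_onI continuous_intros)
  moreover have "(\<lambda>x. (f x, g x)) \<in> borel_measurable M" using assms by (rule borel_measurable_Pair)
  ultimately have "(\<lambda>p. fst p *s snd p) \<circ> (\<lambda>x. (f x, g x)) \<in> borel_measurable M" by (rule measurable_comp[rotated])
  then show ?thesis by (simp add: o_def)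
qed

text \<open>The right-hand side of the dilation inequality as an operator in \<open>n\<close> complex variables: it averages over the complex
line through \<open>z\<close>.\<close>

definition lineT :: "(complex ^ 'n \<Rightarrow> ennreal) \<Rightarrow> complex ^ 'n \<Rightarrow> ennreal" where
  "lineT G z = (\<integral>\<^sup>+\<tau>. ennreal (kern \<tau>) * G (\<tau> *s z) \<partial>hmeas)"

lemma lineT_measurable [measurable]:
  assumes [measurable]: "G \<in> borel_measurable borel"
  shows "lineT G \<in> borel_measurable borel"
  unfolding lineT_def[abs_def] by measurable

lemma nn_integral_hmeas_smult:
  fixes f :: "complex ^ 'n \<Rightarrow> ennreal"
  assumes "\<tau> \<noteq> 0" "f \<in> borel_measurable borel"
  shows "(\<integral>\<^sup>+z. f (\<tau> *s z) \<partial>hmeas) = (\<integral>\<^sup>+z. f z \<partial>hmeas)"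
  using assms by (intro nn_integral_hmeas_similarity[where r = "norm \<tau>"]) (auto simp: norm_smult linear_smult_right)

text \<open>The measure is invariant under \<open>z \<mapsto> \<tau> *s z\<close>, so after an exchange of integrals the operator only multiplies the total
integral by the mass of the kernel.\<close>

lemma lineT_L1:
  assumes [measurable]: "G \<in> borel_measurable borel"
  shows "(\<integral>\<^sup>+z. lineT G z \<partial>hmeas) = kern_mass * (\<integral>\<^sup>+z. G z \<partial>(hmeas :: (complex ^ 'n) measure))"
proof -
  have "(\<integral>\<^sup>+z. lineT G z \<partial>hmeas) = (\<integral>\<^sup>+\<tau>. (\<integral>\<^sup>+z. ennreal (kern \<tau>) * G (\<tau> *s z) \<partial>hmeas) \<partial>hmeas)"
    unfolding lineT_def by (rule hmeas_pair.Fubini') measurable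
  also have "\<dots> = (\<integral>\<^sup>+\<tau>. ennreal (kern \<tau>) * (\<integral>\<^sup>+z. G z \<partial>(hmeas :: (complex ^ 'n) measure)) \<partial>hmeas)"
  proof (rule nn_integral_cong)
    fix \<tau> :: complex
    have "(\<integral>\<^sup>+z. ennreal (kern \<tau>) * G (\<tau> *s z) \<partial>hmeas) = ennreal (kern \<tau>) * (\<integral>\<^sup>+z. G (\<tau> *s z) \<partial>hmeas)"
      by (rule nn_integral_cmult) measurable
    then show "(\<integral>\<^sup>+z. ennreal (kern \<tau>) * G (\<tau> *s z) \<partial>hmeas) = ennreal (kern \<tau>) * (\<integral>\<^sup>+z. G z \<partial>hmeas)"
      by (cases "\<tau> = 0") (auto simp: kern_def nn_integral_hmeas_smult)
  qed
  also have "\<dots> = kern_mass * (\<integral>\<^sup>+z. G z \<partial>(hmeas :: (complex ^ 'n) measure))"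
    unfolding kern_mass_def by (rule nn_integral_multc) measurable
  finally show ?thesis .
qed

lemma lineT_mono: "(\<And>z. G z \<le> G' z) \<Longrightarrow> lineT G z \<le> lineT G' z"
  unfolding lineT_def by (intro nn_integral_mono mult_left_mono) auto

lemma lineT_add:
  assumes [measurable]: "G \<in> borel_measurable borel" "G' \<in> borel_measurable borel"
  shows "lineT (\<lambda>z. G z + G' z) z = lineT G z + lineT G' z"
  unfolding lineT_def distrib_left by (rule nn_integral_add) measurable

text \<open>As \<open>lineT\<close> is bounded in \<open>L\<^sup>1\<close>, the integral of the excess \<open>c * H - lineT G\<close>, truncated at \<open>0\<close>, is at most the
\<open>L\<^sup>1\<close> distance to the approximating inequalities.\<close>

lemma lineT_closure:
  fixes H :: "complex ^ 'n \<Rightarrow> real"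
  assumes [measurable]: "H \<in> borel_measurable borel" "G \<in> borel_measurable borel"
      "\<And>n::nat. Hn n \<in> borel_measurable borel" "\<And>n. Gn n \<in> borel_measurable borel"
    and c: "c \<ge> 0"
    and le: "\<And>n. AE z in hmeas. ennreal (c * Hn n z) \<le> lineT (\<lambda>z. ennreal (Gn n z)) z"
    and H: "(\<lambda>n. \<integral>\<^sup>+z. ennreal \<bar>Hn n z - H z\<bar> \<partial>hmeas) \<longlonglongrightarrow> 0"
    and G: "(\<lambda>n. \<integral>\<^sup>+z. ennreal \<bar>Gn n z - G z\<bar> \<partial>hmeas) \<longlonglongrightarrow> 0"
  shows "AE z in hmeas. ennreal (c * H z) \<le> lineT (\<lambda>z. ennreal (G z)) z"
proof -
  define d where "d z = ennreal (c * H z) - lineT (\<lambda>z. ennreal (G z)) z" for z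
  have [measurable]: "d \<in> borel_measurable borel" unfolding d_def by measurable
  have bound: "(\<integral>\<^sup>+z. d z \<partial>hmeas) \<le> ennreal c * (\<integral>\<^sup>+z. ennreal \<bar>Hn n z - H z\<bar> \<partial>hmeas) + kern_mass * (\<integral>\<^sup>+z. ennreal \<bar>Gn n z - G z\<bar> \<partial>hmeas)" for n
  proof -
    have "AE z in hmeas. d z \<le> ennreal c * ennreal \<bar>Hn n z - H z\<bar> + lineT (\<lambda>z. ennreal \<bar>Gn n z - G z\<bar>) z"
      using le[of n]
    proof eventually_elim
      case (elim z)
      have "ennreal (c * H z) \<le> ennreal (c * Hn n z) + ennreal c * ennreal \<bar>Hn n z - H z\<bar>"
      proof -
        have "c * H z \<le> c * Hn n z + c * \<bar>Hn n z - H z\<bar>"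
          using mult_left_mono[OF _ c, of "H z" "Hn n z + \<bar>Hn n z - H z\<bar>"] by (simp add: algebra_simps abs_if)
        then have "ennreal (c * H z) \<le> ennreal (max 0 (c * Hn n z) + c * \<bar>Hn n z - H z\<bar>)"
          by (intro ennreal_leI) auto
        also have "\<dots> = ennreal (c * Hn n z) + ennreal c * ennreal \<bar>Hn n z - H z\<bar>"
          using c by (simp add: ennreal_plus ennreal_mult)
            (simp add: max_def ennreal_neg)
        finally show ?thesis .
      qed
      also have "\<dots> \<le> lineT (\<lambda>z. ennreal (Gn n z)) z + ennreal c * ennreal \<bar>Hn n z - H z\<bar>"
        using elim by (rule add_right_mono)
      also have "lineT (\<lambda>z. ennreal (Gn n z)) z \<le> lineT (\<lambda>z. ennreal (G z) + ennreal \<bar>Gn n z - G z\<bar>) z"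
      proof (rule lineT_mono)
        fix z
        have "ennreal (Gn n z) \<le> ennreal (max 0 (G z) + \<bar>Gn n z - G z\<bar>)" by (intro ennreal_leI) auto
        also have "\<dots> = ennreal (G z) + ennreal \<bar>Gn n z - G z\<bar>"
          by (simp add: ennreal_plus) (simp add: max_def ennreal_neg)
        finally show "ennreal (Gn n z) \<le> ennreal (G z) + ennreal \<bar>Gn n z - G z\<bar>" .
      qed
      also have "\<dots> = lineT (\<lambda>z. ennreal (G z)) z + lineT (\<lambda>z. ennreal \<bar>Gn n z - G z\<bar>) z"
        by (rule lineT_add) measurable
      finally have "ennreal (c * H z) \<le> lineT (\<lambda>z. ennreal (G z)) z + (ennreal c * ennreal \<bar>Hn n z - H z\<bar> + lineT (\<lambda>z. ennreal \<bar>Gn n z - G z\<bar>) z)"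
        by (simp add: add_ac)
      then show ?case unfolding d_def by (simp add: ennreal_minus_le_iff)
    qed
    then have "(\<integral>\<^sup>+z. d z \<partial>hmeas) \<le> (\<integral>\<^sup>+z. ennreal c * ennreal \<bar>Hn n z - H z\<bar> + lineT (\<lambda>z. ennreal \<bar>Gn n z - G z\<bar>) z \<partial>hmeas)"
      by (rule nn_integral_mono_AE)
    also have "\<dots> = (\<integral>\<^sup>+z. ennreal c * ennreal \<bar>Hn n z - H z\<bar> \<partial>hmeas) + (\<integral>\<^sup>+z. lineT (\<lambda>z. ennreal \<bar>Gn n z - G z\<bar>) z \<partial>hmeas)"
      by (rule nn_integral_add) measurable
    also have "\<dots> = ennreal c * (\<integral>\<^sup>+z. ennreal \<bar>Hn n z - H z\<bar> \<partial>hmeas) + kern_mass * (\<integral>\<^sup>+z. ennreal \<bar>Gn n z - G z\<bar> \<partial>hmeas)"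
      by (subst lineT_L1, measurable, subst nn_integral_cmult) auto
    finally show ?thesis .
  qed
  have "(\<lambda>n. ennreal c * (\<integral>\<^sup>+z. ennreal \<bar>Hn n z - H z\<bar> \<partial>hmeas) + kern_mass * (\<integral>\<^sup>+z. ennreal \<bar>Gn n z - G z\<bar> \<partial>hmeas))
     \<longlonglongrightarrow> ennreal c * 0 + kern_mass * 0"
    using kern_mass_finite by (intro tendsto_add ennreal_tendsto_cmult H G) auto
  then have "(\<integral>\<^sup>+z. d z \<partial>hmeas) \<le> ennreal c * 0 + kern_mass * 0"
    by (rule LIMSEQ_le_const) (use bound in auto)
  then have "AE z in hmeas. d z = 0"
    by (subst nn_integral_0_iff_AE[symmetric]) auto
  then show ?thesis by eventually_elim (simp add: d_def ennreal_minus_eq_0)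
qed

section \<open>Weighted inequalities for weak derivatives\<close>

lemma powr_between:
  fixes t e :: real
  assumes "0 < r0" "r0 \<le> t" "t \<le> R0"
  shows "t powr e \<le> r0 powr e + R0 powr e"
proof (cases "e \<ge> 0")
  case True
  then have "t powr e \<le> R0 powr e" using assms by (intro powr_mono2) auto
  then show ?thesis by (simp add: add_increasing)
next
  case False
  then have "t powr e \<le> r0 powr e" using assms by (intro powr_mono2') auto
  then show ?thesis by (simp add: add_increasing2)
qed

lemma nn_integral_hmeas_annulus:
  fixes f g :: "'a::euclidean_space \<Rightarrow> real"
  assumes r0: "r0 > 0" and [measurable]: "f \<in> borel_measurable borel" "g \<in> borel_measurable borel"
    and f: "\<And>z. norm z < r0 \<Longrightarrow> f z = 0" "\<And>z. r0 \<le> norm z \<Longrightarrow> \<bar>f z\<bar> \<le> g z"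
  shows "(\<integral>\<^sup>+z. ennreal \<bar>f z\<bar> \<partial>hmeas) \<le> ennreal (1 / r0 ^ DIM('a)) * (\<integral>\<^sup>+z. ennreal (g z) \<partial>lborel)"
proof -
  have "(\<integral>\<^sup>+z. ennreal \<bar>f z\<bar> \<partial>hmeas) = (\<integral>\<^sup>+z. ennreal (1 / norm z ^ DIM('a)) * ennreal \<bar>f z\<bar> \<partial>lborel)"
    by (rule nn_integral_hmeas) measurable
  also have "\<dots> \<le> (\<integral>\<^sup>+z. ennreal (1 / r0 ^ DIM('a)) * ennreal (g z) \<partial>lborel)"
  proof (rule nn_integral_mono)
    fix z :: 'a
    show "ennreal (1 / norm z ^ DIM('a)) * ennreal \<bar>f z\<bar> \<le> ennreal (1 / r0 ^ DIM('a)) * ennreal (g z)"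
    proof (cases "norm z < r0")
      case False
      then have "1 / norm z ^ DIM('a) \<le> 1 / r0 ^ DIM('a)"
        using r0 by (intro divide_left_mono power_mono mult_pos_pos zero_less_power) auto
      then show ?thesis using f(2)[of z] False by (intro mult_mono ennreal_leI) auto
    qed (simp add: f)
  qed
  also have "\<dots> = ennreal (1 / r0 ^ DIM('a)) * (\<integral>\<^sup>+z. ennreal (g z) \<partial>lborel)"
    by (rule nn_integral_cmult) measurable
  finally show ?thesis .
qed

lemma inner_ii: "x \<bullet> (\<i> *s x) = (0::real)" for x :: "complex ^ 'n"
  by (simp add: inner_vec_def inner_complex_def sum.neutral)

lemma moll_measurable: "integrable lborel U \<Longrightarrow> \<delta> > 0 \<Longrightarrow> moll \<delta> U \<in> borel_measurable borel"
  by (meson borel_measurable_continuous_onI continuous_at_imp_continuous_on has_derivative_continuous moll_has_derivative)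

text \<open>The cutoff \<open>a (z \<bullet> z)\<close> times a mollification of \<open>U\<close> satisfies the dilation inequality. On the annulus the weights
are bounded, so both sides converge in \<open>L\<^sup>1\<close> as the mollification parameter tends to \<open>0\<close>.\<close>

lemma annular_inequality:
  fixes U :: "complex ^ 'n \<Rightarrow> complex" and m :: nat
  assumes w: "weakdbar R U E" and U: "integrable lborel U" and E: "\<And>j. integrable lborel (E j)"
    and a: "\<And>t. (a has_real_derivative a' t) (at t)" and ca': "continuous_on UNIV a'"
    and supp: "\<And>t. a t \<noteq> 0 \<Longrightarrow> r0\<^sup>2 \<le> t \<and> t \<le> R0\<^sup>2" and r: "0 < r0" "r0 \<le> R0" "R0 < R"
  shows "AE z in hmeas. ennreal (bubble_mass * (norm z powr (1/2 - real m) * (\<bar>a (z \<bullet> z)\<bar> * norm (U z))))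
    \<le> lineT (\<lambda>z. ennreal (norm z powr (1/2 - real m) * (\<bar>a (z \<bullet> z)\<bar> * (norm z * (\<Sum>j\<in>UNIV. norm (E j z))) + \<bar>a' (z \<bullet> z)\<bar> * (z \<bullet> z) * norm (U z)))) z"
proof -
  have ca: "continuous_on UNIV a" using a DERIV_isCont by (auto intro!: continuous_at_imp_continuous_on)
  have supp': "r0\<^sup>2 \<le> t \<and> t \<le> R0\<^sup>2" if "a' t \<noteq> 0" for t
  proof (rule ccontr)
    assume n: "\<not> (r0\<^sup>2 \<le> t \<and> t \<le> R0\<^sup>2)"
    have "((\<lambda>_. 0) has_real_derivative 0) (at t)" by simp
    then have "(a has_real_derivative 0) (at t)"
      by (rule has_field_derivative_transform_within_open[where S = "{t. t < r0\<^sup>2} \<union> {t. t > R0\<^sup>2}"])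
        (use n supp in \<open>auto intro!: open_Un open_Collect_less continuous_intros simp: not_le, force+\<close>)
    with a[of t] have "a' t = 0" by (rule DERIV_unique)
    then show False using that by simp
  qed
  have [measurable]: "a \<in> borel_measurable borel" "a' \<in> borel_measurable borel"
    using ca ca' by (auto intro: borel_measurable_continuous_onI)
  have [measurable]: "U \<in> borel_measurable borel" "E j \<in> borel_measurable borel" for j
    using U E by (auto dest: borel_measurable_integrable)
  have out: "a v = 0" "a' v = 0" if "R0\<^sup>2 + 1 \<le> norm v" for v
  proof -
    have "\<not> (r0\<^sup>2 \<le> v \<and> v \<le> R0\<^sup>2)"
    proof
      assume "r0\<^sup>2 \<le> v \<and> v \<le> R0\<^sup>2"
      moreover have "0 \<le> r0\<^sup>2" by simp
      ultimately show False using that unfolding real_norm_def by linarith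
    qed
    then show "a v = 0" "a' v = 0" using supp supp' by blast+
  qed
  obtain B where B: "B \<ge> 0" "\<And>t. norm (a t) \<le> B"
    using continuous_bounded_support_bounded[OF ca out(1)] by metis
  obtain B' where B': "B' \<ge> 0" "\<And>t. norm (a' t) \<le> B'"
    using continuous_bounded_support_bounded[OF ca' out(2)] by metis
  note B = B[unfolded real_norm_def] and B' = B'[unfolded real_norm_def]
  define d where "d n = (R - R0) / 2 * inverse (real (Suc n))" for n
  have d: "d n > 0" "d n < R - R0" for n
  proof -
    show "d n > 0" using r by (simp add: d_def)
    have "inverse (real (Suc n)) \<le> 1" by (simp add: field_simps)
    then have "d n \<le> (R - R0) / 2 * 1" unfolding d_def using r by (intro mult_left_mono) auto
    then show "d n < R - R0" using r by simp
  qed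
  have dlim: "d \<longlonglongrightarrow> 0" unfolding d_def[abs_def]
    by (rule tendsto_eq_intros LIMSEQ_inverse_real_of_nat refl)+ simp
  note [measurable] = moll_measurable[OF U d(1)] moll_measurable[OF E d(1)]
  let ?p = "1/2 - real m"
  define H where "H z = norm z powr ?p * (\<bar>a (z \<bullet> z)\<bar> * norm (U z))" for z
  define G where "G z = norm z powr ?p * (\<bar>a (z \<bullet> z)\<bar> * (norm z * (\<Sum>j\<in>UNIV. norm (E j z))) + \<bar>a' (z \<bullet> z)\<bar> * (z \<bullet> z) * norm (U z))" for z
  define Hn where "Hn n z = norm z powr ?p * (\<bar>a (z \<bullet> z)\<bar> * norm (moll (d n) U z))" for n z
  define Gn where "Gn n z = norm z powr ?p * (\<bar>a (z \<bullet> z)\<bar> * (norm z * (\<Sum>j\<in>UNIV. norm (moll (d n) (E j) z))) + \<bar>a' (z \<bullet> z)\<bar> * (z \<bullet> z) * norm (moll (d n) U z))" for n z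
  have [measurable]: "H \<in> borel_measurable borel" "G \<in> borel_measurable borel"
    "Hn n \<in> borel_measurable borel" "Gn n \<in> borel_measurable borel" for n
    unfolding H_def[abs_def] G_def[abs_def] Hn_def[abs_def] Gn_def[abs_def] by measurable
  have in_ann: "r0 \<le> norm z \<and> norm z \<le> R0" if "r0\<^sup>2 \<le> z \<bullet> z \<and> z \<bullet> z \<le> R0\<^sup>2" for z :: "complex ^ 'n"
    using that r by (auto simp: dot_square_norm intro: power2_le_imp_le)
  have smooth: "ennreal (bubble_mass * Hn n z) \<le> lineT (\<lambda>z. ennreal (Gn n z)) z" if z: "z \<noteq> 0" for n z
  proof -
    let ?\<delta> = "d n"
    define u where "u x = complex_of_real (a (x \<bullet> x)) * moll ?\<delta> U x" for x
    define W where "W x h = complex_of_real (a (x \<bullet> x)) * molld ?\<delta> U x h + complex_of_real (a' (x \<bullet> x) * (2 * (x \<bullet> h))) * moll ?\<delta> U x" for x h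
    have der: "(u has_derivative W x) (at x)" for x
    proof -
      have "((\<lambda>x. x \<bullet> x) has_derivative (\<lambda>h. 2 * (x \<bullet> h))) (at x)"
        by (auto intro!: derivative_eq_intros simp: inner_commute)
      from has_derivative_compose[OF this a[unfolded has_field_derivative_def]]
      have "((\<lambda>x. a (x \<bullet> x)) has_derivative (\<lambda>h. a' (x \<bullet> x) * (2 * (x \<bullet> h)))) (at x)" .
      from has_derivative_mult[OF bounded_linear.has_derivative[OF bounded_linear_of_real this] moll_has_derivative[OF U d(1), of n x]]
      show ?thesis unfolding u_def[abs_def] W_def[abs_def] .
    qed
    have contm: "continuous_on UNIV (moll ?\<delta> U)"
      using moll_has_derivative[OF U d(1)] by (meson continuous_at_imp_continuous_on has_derivative_continuous)
    have contW: "continuous_on UNIV (\<lambda>x. W x v)" for v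
      unfolding W_def
      by (intro continuous_intros continuous_on_compose2[OF ca] continuous_on_compose2[OF ca'] continuous_on_molld[OF U d(1)] contm) auto
    have "ennreal (bubble_mass * (norm (u z) * norm z powr ?p))
      \<le> (\<integral>\<^sup>+\<tau>. ennreal (kern \<tau> * (norm (\<tau> *s z) powr ?p * norm (Lbar W (\<tau> *s z)))) \<partial>hmeas)"
    proof (rule dilation_inequality[OF der contW _ r(1) z])
      fix x assume "u x \<noteq> 0"
      then have "a (x \<bullet> x) \<noteq> 0" by (auto simp: u_def)
      then show "r0 \<le> norm x \<and> norm x \<le> R0" using supp in_ann by blast
    qed
    also have "\<dots> \<le> lineT (\<lambda>z. ennreal (Gn n z)) z"
      unfolding lineT_def
    proof (rule nn_integral_mono)
      fix \<tau>
      define x where "x = \<tau> *s z"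
      have "norm (Lbar W x) \<le> \<bar>a (x \<bullet> x)\<bar> * (norm x * (\<Sum>j\<in>UNIV. norm (moll ?\<delta> (E j) x))) + \<bar>a' (x \<bullet> x)\<bar> * (x \<bullet> x) * norm (moll ?\<delta> U x)"
      proof (cases "a (x \<bullet> x) = 0 \<and> a' (x \<bullet> x) = 0")
        case True
        then show ?thesis by (simp add: Lbar_def W_def)
      next
        case False
        then have "norm x \<le> R0" using supp supp' in_ann by blast
        then have nx: "norm x + ?\<delta> < R" using d(2)[of n] by linarith
        have "Lbar W x = complex_of_real (a (x \<bullet> x)) * Lbar (molld ?\<delta> U) x + complex_of_real (a' (x \<bullet> x) * (x \<bullet> x)) * moll ?\<delta> U x"
          unfolding Lbar_def W_def inner_ii by (simp add: field_simps)
        also have "Lbar (molld ?\<delta> U) x = (\<Sum>j\<in>UNIV. cnj (x $ j) * moll ?\<delta> (E j) x)"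
          by (rule Lbar_moll[OF w U d(1) nx])
        finally have eq: "Lbar W x = complex_of_real (a (x \<bullet> x)) * (\<Sum>j\<in>UNIV. cnj (x $ j) * moll ?\<delta> (E j) x) + complex_of_real (a' (x \<bullet> x) * (x \<bullet> x)) * moll ?\<delta> U x" .
        have "norm (Lbar W x) \<le> norm (complex_of_real (a (x \<bullet> x)) * (\<Sum>j\<in>UNIV. cnj (x $ j) * moll ?\<delta> (E j) x)) + norm (complex_of_real (a' (x \<bullet> x) * (x \<bullet> x)) * moll ?\<delta> U x)"
          unfolding eq by (rule norm_triangle_ineq)
        also have "\<dots> = \<bar>a (x \<bullet> x)\<bar> * norm (\<Sum>j\<in>UNIV. cnj (x $ j) * moll ?\<delta> (E j) x) + \<bar>a' (x \<bullet> x)\<bar> * (x \<bullet> x) * norm (moll ?\<delta> U x)"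
          by (simp only: norm_mult norm_of_real abs_mult) simp
        also have "norm (\<Sum>j\<in>UNIV. cnj (x $ j) * moll ?\<delta> (E j) x) \<le> norm x * (\<Sum>j\<in>UNIV. norm (moll ?\<delta> (E j) x))"
        proof -
          have "norm (\<Sum>j\<in>UNIV. cnj (x $ j) * moll ?\<delta> (E j) x) \<le> (\<Sum>j\<in>UNIV. norm x * norm (moll ?\<delta> (E j) x))"
            by (rule sum_norm_le) (simp add: norm_mult mult_right_mono Finite_Cartesian_Product.norm_nth_le)
          then show ?thesis by (simp add: sum_distrib_left)
        qed
        finally show ?thesis by (simp add: mult_left_mono)
      qed
      then have "norm x powr ?p * norm (Lbar W x) \<le> Gn n x" unfolding Gn_def by (intro mult_left_mono) auto
      then show "ennreal (kern \<tau> * (norm (\<tau> *s z) powr ?p * norm (Lbar W (\<tau> *s z)))) \<le> ennreal (kern \<tau>) * ennreal (Gn n (\<tau> *s z))"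
        unfolding x_def[symmetric] by (subst ennreal_mult') (auto intro!: mult_left_mono ennreal_leI)
    qed
    finally show ?thesis unfolding Hn_def u_def by (simp add: norm_mult mult_ac)
  qed
  define P where "P = r0 powr ?p + R0 powr ?p"
  have P: "P \<ge> 0" by (simp add: P_def)
  define c where "c = 1 / r0 ^ DIM(complex ^ 'n)"
  have c0: "c \<ge> 0" using r by (simp add: c_def)
  note annulus = nn_integral_hmeas_annulus[OF r(1), where 'a = "complex ^ 'n", folded c_def]
  have Hbound: "(\<integral>\<^sup>+z. ennreal \<bar>Hn n z - H z\<bar> \<partial>hmeas) \<le> ennreal (c * (P * B)) * (\<integral>\<^sup>+z. ennreal (norm (moll (d n) U z - U z)) \<partial>lborel)" for n
  proof -
    have "(\<integral>\<^sup>+z. ennreal \<bar>Hn n z - H z\<bar> \<partial>hmeas) \<le> ennreal c * (\<integral>\<^sup>+z. ennreal (P * (B * norm (moll (d n) U z - U z))) \<partial>lborel)"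
    proof (rule annulus)
      have eq: "Hn n z - H z = norm z powr ?p * (\<bar>a (z \<bullet> z)\<bar> * (norm (moll (d n) U z) - norm (U z)))" for z
        by (simp add: Hn_def H_def algebra_simps)
      have az: "a (z \<bullet> z) = 0" if "\<not> (r0 \<le> norm z \<and> norm z \<le> R0)" for z :: "complex ^ 'n"
        using that supp in_ann by blast
      show "Hn n z - H z = 0" if "norm z < r0" for z using az[of z] that by (simp add: eq)
      show "\<bar>Hn n z - H z\<bar> \<le> P * (B * norm (moll (d n) U z - U z))" for z
      proof (cases "r0 \<le> norm z \<and> norm z \<le> R0")
        case True
        then have "norm z powr ?p \<le> P" unfolding P_def using r by (intro powr_between) auto
        then show ?thesis unfolding eq abs_mult
          using B P by (intro mult_mono) (auto simp: norm_triangle_ineq3)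
      next
        case False
        then show ?thesis using az[OF False] B P by (simp add: eq)
      qed
    qed (simp_all add: Hn_def H_def)
    also have "(\<integral>\<^sup>+z. ennreal (P * (B * norm (moll (d n) U z - U z))) \<partial>lborel) = ennreal (P * B) * (\<integral>\<^sup>+z. ennreal (norm (moll (d n) U z - U z)) \<partial>lborel)"
      using P B by (subst nn_integral_cmult[symmetric]) (auto simp: ennreal_mult mult.assoc)
    also have "ennreal c * \<dots> = ennreal (c * (P * B)) * (\<integral>\<^sup>+z. ennreal (norm (moll (d n) U z - U z)) \<partial>lborel)"
      by (simp only: ennreal_mult'[OF c0] mult.assoc)
    finally show ?thesis .
  qed
  have Gbound: "(\<integral>\<^sup>+z. ennreal \<bar>Gn n z - G z\<bar> \<partial>hmeas) \<le> ennreal (c * (P * B * R0)) * (\<Sum>j\<in>UNIV. \<integral>\<^sup>+z. ennreal (norm (moll (d n) (E j) z - E j z)) \<partial>lborel)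
       + ennreal (c * (P * B' * R0\<^sup>2)) * (\<integral>\<^sup>+z. ennreal (norm (moll (d n) U z - U z)) \<partial>lborel)" for n
  proof -
    let ?e = "\<lambda>z. (\<Sum>j\<in>UNIV. norm (moll (d n) (E j) z - E j z))"
    have R0: "R0 \<ge> 0" using r by simp
    have "(\<integral>\<^sup>+z. ennreal \<bar>Gn n z - G z\<bar> \<partial>hmeas) \<le> ennreal c * (\<integral>\<^sup>+z. ennreal (P * B * R0 * ?e z + P * B' * R0\<^sup>2 * norm (moll (d n) U z - U z)) \<partial>lborel)"
    proof (rule annulus)
      have eq: "Gn n z - G z = norm z powr ?p * (\<bar>a (z \<bullet> z)\<bar> * (norm z * (\<Sum>j\<in>UNIV. norm (moll (d n) (E j) z) - norm (E j z))) + \<bar>a' (z \<bullet> z)\<bar> * (z \<bullet> z) * (norm (moll (d n) U z) - norm (U z)))" for z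
        by (simp add: Gn_def G_def algebra_simps sum_subtractf)
      have az: "a (z \<bullet> z) = 0" "a' (z \<bullet> z) = 0" if "\<not> (r0 \<le> norm z \<and> norm z \<le> R0)" for z :: "complex ^ 'n"
        using that supp supp' in_ann by blast+
      show "Gn n z - G z = 0" if "norm z < r0" for z using az[of z] that by (simp add: eq)
      show "\<bar>Gn n z - G z\<bar> \<le> P * B * R0 * ?e z + P * B' * R0\<^sup>2 * norm (moll (d n) U z - U z)" for z
      proof (cases "r0 \<le> norm z \<and> norm z \<le> R0")
        case True
        have 1: "norm z powr ?p \<le> P" unfolding P_def using True r by (intro powr_between) auto
        have 2: "\<bar>\<Sum>j\<in>UNIV. norm (moll (d n) (E j) z) - norm (E j z)\<bar> \<le> ?e z"
          by (rule order_trans[OF sum_abs]) (intro sum_mono norm_triangle_ineq3)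
        have 3: "z \<bullet> z \<le> R0\<^sup>2" using True by (simp add: dot_square_norm power_mono)
        have "\<bar>Gn n z - G z\<bar> \<le> P * (B * (R0 * ?e z) + B' * R0\<^sup>2 * norm (moll (d n) U z - U z))"
          unfolding eq abs_mult
        proof (intro mult_mono order_trans[OF abs_triangle_ineq] add_mono)
          show "\<bar>norm z powr ?p\<bar> \<le> P" using 1 by simp
          show "\<bar>\<bar>a (z \<bullet> z)\<bar> * (norm z * (\<Sum>j\<in>UNIV. norm (moll (d n) (E j) z) - norm (E j z)))\<bar> \<le> B * (R0 * ?e z)"
            unfolding abs_mult using B True R0 2 by (intro mult_mono) auto
          show "\<bar>\<bar>a' (z \<bullet> z)\<bar> * (z \<bullet> z) * (norm (moll (d n) U z) - norm (U z))\<bar> \<le> B' * R0\<^sup>2 * norm (moll (d n) U z - U z)"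
            unfolding abs_mult using B' 3 by (intro mult_mono norm_triangle_ineq3) auto
        qed (use P in auto)
        then show ?thesis by (simp add: algebra_simps)
      next
        case False
        then show ?thesis using az[OF False] B B' P R0 by (simp add: eq sum_nonneg)
      qed
    qed (simp_all add: Gn_def G_def)
    also have "(\<integral>\<^sup>+z. ennreal (P * B * R0 * ?e z + P * B' * R0\<^sup>2 * norm (moll (d n) U z - U z)) \<partial>lborel)
      = (\<integral>\<^sup>+z. ennreal (P * B * R0) * (\<Sum>j\<in>UNIV. ennreal (norm (moll (d n) (E j) z - E j z))) + ennreal (P * B' * R0\<^sup>2) * ennreal (norm (moll (d n) U z - U z)) \<partial>lborel)"
      using P B B' R0 by (intro nn_integral_cong) (simp add: ennreal_plus ennreal_mult sum_nonneg sum_ennreal)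
    also have "\<dots> = ennreal (P * B * R0) * (\<Sum>j\<in>UNIV. \<integral>\<^sup>+z. ennreal (norm (moll (d n) (E j) z - E j z)) \<partial>lborel) + ennreal (P * B' * R0\<^sup>2) * (\<integral>\<^sup>+z. ennreal (norm (moll (d n) U z - U z)) \<partial>lborel)"
      by (simp add: nn_integral_add nn_integral_cmult nn_integral_sum del: sum_ennreal)
    also have "ennreal c * \<dots> = ennreal (c * (P * B * R0)) * (\<Sum>j\<in>UNIV. \<integral>\<^sup>+z. ennreal (norm (moll (d n) (E j) z - E j z)) \<partial>lborel)
       + ennreal (c * (P * B' * R0\<^sup>2)) * (\<integral>\<^sup>+z. ennreal (norm (moll (d n) U z - U z)) \<partial>lborel)"
      by (simp only: ennreal_mult'[OF c0] distrib_left mult.assoc)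
    finally show ?thesis .
  qed
  have limU: "(\<lambda>n. \<integral>\<^sup>+z. ennreal (norm (moll (d n) U z - U z)) \<partial>lborel) \<longlonglongrightarrow> 0"
    by (rule moll_L1_tendsto[OF U dlim d(1)])
  have limE: "(\<lambda>n. \<integral>\<^sup>+z. ennreal (norm (moll (d n) (E j) z - E j z)) \<partial>lborel) \<longlonglongrightarrow> 0" for j
    by (rule moll_L1_tendsto[OF E dlim d(1)])
  have "AE z in hmeas. ennreal (bubble_mass * H z) \<le> lineT (\<lambda>z. ennreal (G z)) z"
  proof (rule lineT_closure[where Hn = Hn and Gn = Gn])
    show "AE z in hmeas. ennreal (bubble_mass * Hn n z) \<le> lineT (\<lambda>z. ennreal (Gn n z)) z" for n
    proof -
      have "AE z in (hmeas :: (complex ^ 'n) measure). z \<noteq> 0"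
        by (subst AE_hmeas_iff) (auto simp: AE_lborel_singleton)
      then show ?thesis by eventually_elim (rule smooth)
    qed
    show "(\<lambda>n. \<integral>\<^sup>+z. ennreal \<bar>Hn n z - H z\<bar> \<partial>hmeas) \<longlonglongrightarrow> 0"
    proof (rule tendsto_sandwich[OF _ _ tendsto_const])
      have "(\<lambda>n. ennreal (c * (P * B)) * (\<integral>\<^sup>+z. ennreal (norm (moll (d n) U z - U z)) \<partial>lborel)) \<longlonglongrightarrow> ennreal (c * (P * B)) * 0"
        by (intro ennreal_tendsto_cmult limU) simp
      then show "(\<lambda>n. ennreal (c * (P * B)) * (\<integral>\<^sup>+z. ennreal (norm (moll (d n) U z - U z)) \<partial>lborel)) \<longlonglongrightarrow> 0" by simp
    qed (use Hbound in \<open>auto intro!: always_eventually\<close>)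
    show "(\<lambda>n. \<integral>\<^sup>+z. ennreal \<bar>Gn n z - G z\<bar> \<partial>hmeas) \<longlonglongrightarrow> 0"
    proof (rule tendsto_sandwich[OF _ _ tendsto_const])
      let ?b = "\<lambda>n. ennreal (c * (P * B * R0)) * (\<Sum>j\<in>UNIV. \<integral>\<^sup>+z. ennreal (norm (moll (d n) (E j) z - E j z)) \<partial>lborel)
       + ennreal (c * (P * B' * R0\<^sup>2)) * (\<integral>\<^sup>+z. ennreal (norm (moll (d n) U z - U z)) \<partial>lborel)"
      have "?b \<longlonglongrightarrow> ennreal (c * (P * B * R0)) * (\<Sum>j\<in>(UNIV::'n set). 0) + ennreal (c * (P * B' * R0\<^sup>2)) * 0"
        by (intro tendsto_add ennreal_tendsto_cmult tendsto_sum limE limU) auto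
      then show "?b \<longlonglongrightarrow> 0" by simp
    qed (use Gbound in \<open>auto intro!: always_eventually\<close>)
  qed (use bubble_mass_pos in simp_all)
  then show ?thesis unfolding H_def G_def .
qed

text \<open>This removes the requirement that the cutoff vanish near the origin: the inner cutoff shrinks to the origin, and the
integrability assumptions allow a passage to the limit by dominated convergence. For a function that
vanishes to infinite order they hold for every \<open>m\<close>.\<close>

lemma disc_inequality:
  fixes U :: "complex ^ 'n \<Rightarrow> complex" and m :: nat
  assumes w: "weakdbar R U E" and U: "integrable lborel U" and E: "\<And>j. integrable lborel (E j)"
    and b: "\<And>t. (b has_real_derivative b' t) (at t)" and cb': "continuous_on UNIV b'"
    and bB: "\<And>t. \<bar>b t\<bar> \<le> B" "\<And>t. \<bar>b' t\<bar> \<le> B'"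
    and supp: "\<And>t. t > R0\<^sup>2 \<Longrightarrow> b t = 0" "\<And>t. t > R0\<^sup>2 \<Longrightarrow> b' t = 0" and r: "0 < R0" "R0 < R"
    and fin: "(\<integral>\<^sup>+z. ennreal (norm z powr (1/2 - real m) * norm (U z)) \<partial>hmeas) < \<infinity>"
      "(\<integral>\<^sup>+z. ennreal (norm z powr (1/2 - real m) * (norm z * (\<Sum>j\<in>UNIV. norm (E j z)))) \<partial>hmeas) < \<infinity>"
  shows "AE z in hmeas. ennreal (bubble_mass * (norm z powr (1/2 - real m) * (\<bar>b (z \<bullet> z)\<bar> * norm (U z))))
    \<le> lineT (\<lambda>z. ennreal (norm z powr (1/2 - real m) * (\<bar>b (z \<bullet> z)\<bar> * (norm z * (\<Sum>j\<in>UNIV. norm (E j z))) + \<bar>b' (z \<bullet> z)\<bar> * (z \<bullet> z) * norm (U z)))) z"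
proof -
  have [measurable]: "U \<in> borel_measurable borel" "E j \<in> borel_measurable borel" for j
    using U E by (auto dest: borel_measurable_integrable)
  have "continuous_on UNIV b" using b DERIV_isCont by (auto intro!: continuous_at_imp_continuous_on)
  then have [measurable]: "b \<in> borel_measurable borel" "b' \<in> borel_measurable borel"
     "step \<in> borel_measurable borel" "step' \<in> borel_measurable borel"
    using cb' continuous_on_step continuous_on_step' by (auto intro: borel_measurable_continuous_onI)
  have B0: "B \<ge> 0" "B' \<ge> 0" using bB(1)[of 0] bB(2)[of 0] by linarith+
  obtain K :: nat where K: "1 / real (Suc K) \<le> R0"
    using reals_Archimedean[OF r(1)] by (auto simp: inverse_eq_divide intro: less_imp_le)
  define k where "k n = real (Suc (K + n))" for n
  have k: "k n > 0" "1 / k n \<le> R0" for n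
  proof -
    show "k n > 0" by (simp add: k_def)
    have "1 / k n \<le> 1 / real (Suc K)" by (simp add: k_def frac_le)
    then show "1 / k n \<le> R0" using K by simp
  qed
  \<comment> \<open>\<open>s n (z \<bullet> z)\<close> vanishes for \<open>norm z \<le> 1 / k n\<close> and is \<open>1\<close> for \<open>norm z \<ge> sqrt 2 / k n\<close>; since
    \<open>s' n t * t\<close> is bounded independently of \<open>n\<close>, the derivative of this inner cutoff is dominated.\<close>
  define s where "s n t = step ((k n)\<^sup>2 * t - 1)" for n t
  define s' where "s' n t = (k n)\<^sup>2 * step' ((k n)\<^sup>2 * t - 1)" for n t
  have sd: "(s n has_real_derivative s' n t) (at t)" for n t
  proof -
    have "((\<lambda>t. (k n)\<^sup>2 * t - 1) has_real_derivative (k n)\<^sup>2) (at t)" by (auto intro!: derivative_eq_intros)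
    from DERIV_chain2[OF step_deriv this] show ?thesis by (simp add: s_def[abs_def] s'_def mult.commute)
  qed
  have s01: "0 \<le> s n t" "s n t \<le> 1" for n t by (auto simp: s_def step_nonneg step_le_1)
  have s'0: "0 \<le> s' n t" for n t using step'_bounds by (simp add: s'_def)
  have s'_bd: "s' n t * t \<le> 4" if "t \<ge> 0" for n t
  proof (cases "(k n)\<^sup>2 * t \<le> 2")
    case True
    have "s' n t * t = step' ((k n)\<^sup>2 * t - 1) * ((k n)\<^sup>2 * t)" by (simp add: s'_def)
    also have "\<dots> \<le> 2 * 2" using True that step'_bounds by (intro mult_mono) auto
    finally show ?thesis by simp
  next
    case False
    then have "s' n t = 0" by (simp add: s'_def step'_0)
    then show ?thesis by simp
  qed
  have s_far: "s n t = 1 \<and> s' n t = 0" if "(k n)\<^sup>2 * t \<ge> 2" for n t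
    using that by (simp add: s_def s'_def step_1 step'_0)
  define a where "a n t = b t * s n t" for n t
  define a' where "a' n t = b' t * s n t + b t * s' n t" for n t
  have [measurable]: "a n \<in> borel_measurable borel" "a' n \<in> borel_measurable borel" for n
    unfolding a_def a'_def s_def s'_def by measurable
  let ?p = "1/2 - real m"
  define H where "H z = norm z powr ?p * (\<bar>b (z \<bullet> z)\<bar> * norm (U z))" for z
  define G where "G z = norm z powr ?p * (\<bar>b (z \<bullet> z)\<bar> * (norm z * (\<Sum>j\<in>UNIV. norm (E j z))) + \<bar>b' (z \<bullet> z)\<bar> * (z \<bullet> z) * norm (U z))" for z
  define Hn where "Hn n z = norm z powr ?p * (\<bar>a n (z \<bullet> z)\<bar> * norm (U z))" for n z
  define Gn where "Gn n z = norm z powr ?p * (\<bar>a n (z \<bullet> z)\<bar> * (norm z * (\<Sum>j\<in>UNIV. norm (E j z))) + \<bar>a' n (z \<bullet> z)\<bar> * (z \<bullet> z) * norm (U z))" for n z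
  have [measurable]: "H \<in> borel_measurable borel" "G \<in> borel_measurable borel"
    "Hn n \<in> borel_measurable borel" "Gn n \<in> borel_measurable borel" for n
    unfolding H_def[abs_def] G_def[abs_def] Hn_def[abs_def] Gn_def[abs_def] by measurable
  have near0: "\<forall>\<^sub>F n in sequentially. 2 \<le> (k n)\<^sup>2 * (z \<bullet> z)" if "z \<noteq> 0" for z :: "complex ^ 'n"
  proof -
    have pos: "z \<bullet> z > 0" using that by simp
    have "filterlim (\<lambda>n. real (Suc (K + n))) at_top sequentially"
      by (rule filterlim_compose[OF filterlim_real_sequentially])
        (intro filterlim_subseq strict_monoI, simp)
    then have "\<forall>\<^sub>F n in sequentially. max 1 (2 / (z \<bullet> z)) \<le> real (Suc (K + n))"
      by (simp add: filterlim_at_top)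
    then show ?thesis
    proof eventually_elim
      case (elim n)
      then have kk: "k n \<ge> 1" "k n \<ge> 2 / (z \<bullet> z)" by (auto simp: k_def)
      then have "k n * (z \<bullet> z) \<ge> 2" using pos by (simp add: pos_divide_le_eq)
      moreover have "1 * (k n * (z \<bullet> z)) \<le> k n * (k n * (z \<bullet> z))"
        using kk pos by (intro mult_right_mono) auto
      ultimately show ?case by (simp add: power2_eq_square mult.assoc)
    qed
  qed
  have AE0: "AE z in (hmeas :: (complex ^ 'n) measure). z \<noteq> 0"
    by (subst AE_hmeas_iff) (auto simp: AE_lborel_singleton)
  have "AE z in hmeas. ennreal (bubble_mass * H z) \<le> lineT (\<lambda>z. ennreal (G z)) z"
  proof (rule lineT_closure[where Hn = Hn and Gn = Gn])
    show "AE z in hmeas. ennreal (bubble_mass * Hn n z) \<le> lineT (\<lambda>z. ennreal (Gn n z)) z" for n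
      unfolding Hn_def Gn_def
    proof (rule annular_inequality[OF w U E, of _ _ "1 / k n" R0])
      fix t
      show "(a n has_real_derivative a' n t) (at t)"
        using DERIV_mult[OF b[of t] sd[of n t]] by (simp add: a_def[abs_def] a'_def mult.commute add.commute)
      assume "a n t \<noteq> 0"
      then have 1: "b t \<noteq> 0" "s n t \<noteq> 0" by (auto simp: a_def)
      have "\<not> (k n)\<^sup>2 * t - 1 \<le> 0" using 1(2) step_0 by (auto simp: s_def)
      then have "(1 / k n)\<^sup>2 \<le> t" using k(1)[of n] by (simp add: power_divide field_simps)
      moreover have "t \<le> R0\<^sup>2" using supp(1)[of t] 1(1) by force
      ultimately show "(1 / k n)\<^sup>2 \<le> t \<and> t \<le> R0\<^sup>2" by simp
    next
      show "continuous_on UNIV (a' n)" unfolding a'_def s_def s'_def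
        by (intro continuous_intros cb' \<open>continuous_on UNIV b\<close> continuous_on_compose2[OF continuous_on_step] continuous_on_compose2[OF continuous_on_step']) auto
    qed (use k r in auto)
    have ad: "\<bar>\<bar>a n t\<bar> - \<bar>b t\<bar>\<bar> \<le> B" for n t
    proof -
      have "\<bar>a n t\<bar> \<le> \<bar>b t\<bar> * 1" unfolding a_def abs_mult using s01 by (intro mult_left_mono) auto
      then show ?thesis using bB(1)[of t] by linarith
    qed
    show "(\<lambda>n. \<integral>\<^sup>+z. ennreal \<bar>Hn n z - H z\<bar> \<partial>hmeas) \<longlonglongrightarrow> 0"
    proof -
      have "(\<lambda>n. \<integral>\<^sup>+z. ennreal \<bar>Hn n z - H z\<bar> \<partial>hmeas) \<longlonglongrightarrow> (\<integral>\<^sup>+z. 0 \<partial>(hmeas :: (complex ^ 'n) measure))"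
      proof (rule nn_integral_dominated_convergence[where w = "\<lambda>z. ennreal B * ennreal (norm z powr ?p * norm (U z))"])
        show "(\<integral>\<^sup>+z. ennreal B * ennreal (norm z powr ?p * norm (U z)) \<partial>hmeas) < \<infinity>"
          using fin(1) by (subst nn_integral_cmult) (auto simp: ennreal_mult_less_top)
        show "AE z in hmeas. ennreal \<bar>Hn n z - H z\<bar> \<le> ennreal B * ennreal (norm z powr ?p * norm (U z))" for n
        proof (rule AE_I2)
          fix z :: "complex ^ 'n"
          have "\<bar>Hn n z - H z\<bar> = \<bar>\<bar>a n (z \<bullet> z)\<bar> - \<bar>b (z \<bullet> z)\<bar>\<bar> * (norm z powr ?p * norm (U z))"
          proof -
            have "Hn n z - H z = (\<bar>a n (z \<bullet> z)\<bar> - \<bar>b (z \<bullet> z)\<bar>) * (norm z powr ?p * norm (U z))"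
              by (simp add: Hn_def H_def algebra_simps)
            then show ?thesis by (simp only: abs_mult) simp
          qed
          also have "\<dots> \<le> B * (norm z powr ?p * norm (U z))" by (intro mult_right_mono ad) auto
          finally show "ennreal \<bar>Hn n z - H z\<bar> \<le> ennreal B * ennreal (norm z powr ?p * norm (U z))"
            using B0 by (simp add: ennreal_mult[symmetric] ennreal_leI)
        qed
        show "AE z in hmeas. (\<lambda>n. ennreal \<bar>Hn n z - H z\<bar>) \<longlonglongrightarrow> 0"
          using AE0
        proof eventually_elim
          case (elim z)
          show ?case
            by (rule tendsto_eventually, rule eventually_mono[OF near0[OF elim]])
              (simp add: Hn_def H_def a_def s_far)
        qed
      qed (simp_all add: Hn_def H_def)
      then show ?thesis by simp
    qed
    have a'd: "\<bar>\<bar>a' n t\<bar> - \<bar>b' t\<bar>\<bar> * t \<le> B' * R0\<^sup>2 + 4 * B" if t: "t \<ge> 0" for n t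
    proof (cases "t > R0\<^sup>2")
      case True
      then show ?thesis using B0 supp by (simp add: a'_def)
    next
      case False
      have "\<bar>a' n t - b' t\<bar> \<le> \<bar>b' t * (s n t - 1)\<bar> + \<bar>b t * s' n t\<bar>"
        unfolding a'_def using abs_triangle_ineq[of "b' t * (s n t - 1)" "b t * s' n t"] by (simp add: algebra_simps)
      also have "\<dots> \<le> B' * 1 + B * s' n t"
        unfolding abs_mult using s01[of n t] s'0[of n t] bB B0 by (intro add_mono mult_mono) auto
      finally have "\<bar>\<bar>a' n t\<bar> - \<bar>b' t\<bar>\<bar> \<le> B' + B * s' n t" using abs_triangle_ineq3[of "a' n t" "b' t"] by linarith
      then have "\<bar>\<bar>a' n t\<bar> - \<bar>b' t\<bar>\<bar> * t \<le> (B' + B * s' n t) * t" using t by (rule mult_right_mono)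
      also have "\<dots> = B' * t + B * (s' n t * t)" by (simp add: algebra_simps)
      also have "\<dots> \<le> B' * R0\<^sup>2 + B * 4"
        using False t B0 s'_bd[OF t] by (intro add_mono mult_left_mono) auto
      finally show ?thesis by simp
    qed
    show "(\<lambda>n. \<integral>\<^sup>+z. ennreal \<bar>Gn n z - G z\<bar> \<partial>hmeas) \<longlonglongrightarrow> 0"
    proof -
      let ?Q = "B' * R0\<^sup>2 + 4 * B"
      let ?e = "\<lambda>z. norm z powr ?p * (norm z * (\<Sum>j\<in>UNIV. norm (E j z)))"
      have "(\<lambda>n. \<integral>\<^sup>+z. ennreal \<bar>Gn n z - G z\<bar> \<partial>hmeas) \<longlonglongrightarrow> (\<integral>\<^sup>+z. 0 \<partial>(hmeas :: (complex ^ 'n) measure))"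
      proof (rule nn_integral_dominated_convergence[where w = "\<lambda>z. ennreal B * ennreal (?e z) + ennreal ?Q * ennreal (norm z powr ?p * norm (U z))"])
        show "(\<integral>\<^sup>+z. ennreal B * ennreal (?e z) + ennreal ?Q * ennreal (norm z powr ?p * norm (U z)) \<partial>hmeas) < \<infinity>"
        proof -
          have "(\<integral>\<^sup>+z. ennreal B * ennreal (?e z) + ennreal ?Q * ennreal (norm z powr ?p * norm (U z)) \<partial>hmeas)
             = ennreal B * (\<integral>\<^sup>+z. ennreal (?e z) \<partial>hmeas) + ennreal ?Q * (\<integral>\<^sup>+z. ennreal (norm z powr ?p * norm (U z)) \<partial>hmeas)"
            by (subst nn_integral_add, measurable, subst nn_integral_cmult, measurable, subst nn_integral_cmult) auto
          then show ?thesis using fin by (simp add: ennreal_mult_less_top)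
        qed
        show "AE z in hmeas. ennreal \<bar>Gn n z - G z\<bar> \<le> ennreal B * ennreal (?e z) + ennreal ?Q * ennreal (norm z powr ?p * norm (U z))" for n
        proof (rule AE_I2)
          fix z :: "complex ^ 'n"
          have eq: "Gn n z - G z = (\<bar>a n (z \<bullet> z)\<bar> - \<bar>b (z \<bullet> z)\<bar>) * ?e z + ((\<bar>a' n (z \<bullet> z)\<bar> - \<bar>b' (z \<bullet> z)\<bar>) * (z \<bullet> z)) * (norm z powr ?p * norm (U z))"
            by (simp add: Gn_def G_def algebra_simps)
          have e0: "?e z \<ge> 0" by (intro mult_nonneg_nonneg sum_nonneg) auto
          have "\<bar>Gn n z - G z\<bar> \<le> \<bar>\<bar>a n (z \<bullet> z)\<bar> - \<bar>b (z \<bullet> z)\<bar>\<bar> * ?e z + (\<bar>\<bar>a' n (z \<bullet> z)\<bar> - \<bar>b' (z \<bullet> z)\<bar>\<bar> * (z \<bullet> z)) * (norm z powr ?p * norm (U z))"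
            unfolding eq by (rule order_trans[OF abs_triangle_ineq]) (simp add: abs_mult sum_nonneg)
          also have "\<dots> \<le> B * ?e z + ?Q * (norm z powr ?p * norm (U z))"
            using e0 by (intro add_mono mult_right_mono ad a'd) auto
          finally show "ennreal \<bar>Gn n z - G z\<bar> \<le> ennreal B * ennreal (?e z) + ennreal ?Q * ennreal (norm z powr ?p * norm (U z))"
            using B0 e0 by (simp only: ennreal_mult[symmetric] ennreal_plus[symmetric] ennreal_leI mult_nonneg_nonneg add_nonneg_nonneg zero_le_power2 powr_ge_zero norm_ge_zero zero_le_numeral)
        qed
        show "AE z in hmeas. (\<lambda>n. ennreal \<bar>Gn n z - G z\<bar>) \<longlonglongrightarrow> 0"
          using AE0
        proof eventually_elim
          case (elim z)
          show ?case
            by (rule tendsto_eventually, rule eventually_mono[OF near0[OF elim]])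
              (simp add: Gn_def G_def a_def a'_def s_far)
        qed
      qed (simp_all add: Gn_def G_def)
      then show ?thesis by simp
    qed
  qed (use bubble_mass_pos in simp_all)
  then show ?thesis unfolding H_def G_def .
qed

section \<open>Absorption on one complex line\<close>

lemma powr_add_le:
  fixes x y p :: real
  assumes "x \<ge> 0" "y \<ge> 0" "p \<ge> 0"
  shows "(x + y) powr p \<le> 2 powr p * (x powr p + y powr p)"
proof -
  have "(x + y) powr p \<le> (2 * max x y) powr p" using assms by (intro powr_mono2) auto
  also have "\<dots> = 2 powr p * (max x y) powr p" using assms by (simp add: powr_mult)
  also have "(max x y) powr p \<le> x powr p + y powr p" by (simp add: max_def)
  finally show ?thesis by (simp add: mult_left_mono)
qed

text \<open>Testing the pointwise inequality for \<open>h\<close> against \<open>g1\<close> and applying the Hardy-Littlewood-Sobolev inequality to \<open>g1 + g2\<close>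
bounds \<open>X = \<integral> g1 h\<close> by \<open>\<eta> powr (1 / (2 N)) * X\<close> plus a term in \<open>g2\<close>, up to constants. For small \<open>\<eta>\<close> the first term
is absorbed, since \<open>X\<close> is finite. The threshold \<open>\<eta>\<close> does not depend on \<open>Q\<close>, and the bound has the homogeneity \<open>P\<^sup>2\<close> with
a factor \<open>B\<close> that is independent of \<open>P\<close>; both are needed when the weight exponent \<open>m\<close> varies.\<close>

lemma HLS_absorb:
  fixes N :: nat
  assumes N: "N \<ge> 1" and c: "c > 0"
  obtains \<eta> where "\<eta> > 0"
    "\<And>Q. Q > 0 \<Longrightarrow> \<exists>B. \<forall>g1 g2 h W P.
       g1 \<in> borel_measurable borel \<longrightarrow> g2 \<in> borel_measurable borel \<longrightarrow> h \<in> borel_measurable borel \<longrightarrow> W \<in> borel_measurable borel \<longrightarrow>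
       (\<forall>x. 0 \<le> g1 x) \<longrightarrow> (\<forall>x. 0 \<le> g2 x) \<longrightarrow> (\<forall>x. 0 \<le> h x) \<longrightarrow> (\<forall>x. 0 \<le> W x) \<longrightarrow>
       (AE x in hmeas. g1 x \<le> W x * h x) \<longrightarrow>
       (AE \<tau> in hmeas. ennreal (c * h \<tau>) \<le> (\<integral>\<^sup>+\<zeta>. ennreal (Kern \<tau> \<zeta>) * ennreal (g1 \<zeta> + g2 \<zeta>) \<partial>hmeas)) \<longrightarrow>
       (\<integral>\<^sup>+x. ennreal (W x powr (2 * real N)) \<partial>hmeas) \<le> ennreal \<eta> \<longrightarrow>
       P > 0 \<longrightarrow> (\<integral>\<^sup>+x. ennreal (g2 x powr (4 * real N / (2 * real N + 1))) \<partial>hmeas) \<le> ennreal (P powr (4 * real N / (2 * real N + 1)) * Q) \<longrightarrow>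
       (\<integral>\<^sup>+x. ennreal (g1 x * h x) \<partial>hmeas) < \<infinity> \<longrightarrow>
       (\<integral>\<^sup>+x. ennreal (g1 x * h x) \<partial>hmeas) \<le> ennreal (B * P\<^sup>2)"
proof -
  define p where "p = 4 * real N / (2 * real N + 1)"
  have p: "p \<ge> 1" "p < 2" "p > 0" using N by (auto simp: p_def field_simps)
  obtain C where C: "C \<ge> 0"
   "\<And>g A. g \<in> borel_measurable borel \<Longrightarrow> (\<And>x. 0 \<le> g x) \<Longrightarrow> A > 0 \<Longrightarrow>
     (\<integral>\<^sup>+x. ennreal (g x powr p) \<partial>hmeas) \<le> ennreal A \<Longrightarrow>
     (\<integral>\<^sup>+\<tau>. \<integral>\<^sup>+\<zeta>. ennreal (Kern \<tau> \<zeta> * g \<tau> * g \<zeta>) \<partial>hmeas \<partial>hmeas) \<le> ennreal (C * A powr (2 / p))"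
    using HLS_cylinder[OF N p_def] by blast
  define q where "q = 2 / p"
  have q: "q > 0" "q \<le> 2" using p by (auto simp: q_def field_simps)
  define C' where "C' = C * (2 powr p) powr q * 2 powr q"
  have C': "C' \<ge> 0" using C by (simp add: C'_def)
  define \<eta> where "\<eta> = (c / (2 * (C' + 1))) powr (2 * real N)"
  have \<eta>: "\<eta> > 0" using c C' by (simp add: \<eta>_def)
  have \<eta>_small: "C' * \<eta> powr (1 / (2 * real N)) \<le> c / 2"
  proof -
    have a: "\<eta> powr (1 / (2 * real N)) = c / (2 * (C' + 1))"
      unfolding \<eta>_def using N c C' by (simp add: powr_powr)
    have "C' * \<eta> powr (1 / (2 * real N)) = C' * (c / (2 * (C' + 1)))" by (simp only: a)
    also have "\<dots> \<le> (C' + 1) * (c / (2 * (C' + 1)))"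
      using c C' by (intro mult_right_mono) auto
    also have "\<dots> = c / 2" using C' by (simp add: field_simps)
    finally show ?thesis .
  qed
  show ?thesis
  proof (rule that[OF \<eta>], intro exI allI impI)
    fix Q :: real and g1 g2 h W :: "complex \<Rightarrow> real" and P :: real
    assume Q: "Q > 0" and [measurable]: "g1 \<in> borel_measurable borel" "g2 \<in> borel_measurable borel" "h \<in> borel_measurable borel" "W \<in> borel_measurable borel"
      and nonneg: "\<forall>x. 0 \<le> g1 x" "\<forall>x. 0 \<le> g2 x" "\<forall>x. 0 \<le> h x" "\<forall>x. 0 \<le> W x"
      and g1W: "AE x in hmeas. g1 x \<le> W x * h x"
      and ineq: "AE \<tau> in hmeas. ennreal (c * h \<tau>) \<le> (\<integral>\<^sup>+\<zeta>. ennreal (Kern \<tau> \<zeta>) * ennreal (g1 \<zeta> + g2 \<zeta>) \<partial>hmeas)"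
      and Wsmall: "(\<integral>\<^sup>+x. ennreal (W x powr (2 * real N)) \<partial>hmeas) \<le> ennreal \<eta>"
      and P: "P > 0" and g2int: "(\<integral>\<^sup>+x. ennreal (g2 x powr (4 * real N / (2 * real N + 1))) \<partial>hmeas) \<le> ennreal (P powr (4 * real N / (2 * real N + 1)) * Q)"
      and Xfin: "(\<integral>\<^sup>+x. ennreal (g1 x * h x) \<partial>hmeas) < \<infinity>"
    define X where "X = enn2real (\<integral>\<^sup>+x. ennreal (g1 x * h x) \<partial>hmeas)"
    have X: "(\<integral>\<^sup>+x. ennreal (g1 x * h x) \<partial>hmeas) = ennreal X" "X \<ge> 0"
      using Xfin by (simp_all add: X_def less_top)
    define g where "g x = g1 x + g2 x" for x
    have [measurable]: "g \<in> borel_measurable borel" unfolding g_def by measurable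
    have g0: "g x \<ge> 0" for x using nonneg by (simp add: g_def)
    \<comment> \<open>Since \<open>g1 \<le> W h\<close>, one has \<open>g1 powr p \<le> (g1 h) powr (p/2) * W powr (p/2)\<close>; Hoelder's inequality
      with the exponents \<open>2/p\<close> and \<open>2 N + 1\<close> turns this into \<open>X\<close> times a power of the small norm of \<open>W\<close>.\<close>
    have g1int: "(\<integral>\<^sup>+x. ennreal (g1 x powr p) \<partial>hmeas) \<le> ennreal (X powr (p / 2) * \<eta> powr (1 / (2 * real N + 1)))"
    proof -
      have "AE x in hmeas. ennreal (g1 x powr p) \<le> ennreal ((g1 x * h x) powr (p / 2) * W x powr (p / 2))"
        using g1W
      proof eventually_elim
        case (elim x)
        have "g1 x powr p = (g1 x * g1 x) powr (p / 2)"
          using nonneg by (simp add: powr_mult powr_add[symmetric])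
        also have "\<dots> \<le> (g1 x * (W x * h x)) powr (p / 2)"
          using nonneg p elim by (intro powr_mono2 mult_left_mono mult_nonneg_nonneg) auto
        also have "\<dots> = (g1 x * h x) powr (p / 2) * W x powr (p / 2)"
          using nonneg by (simp add: powr_mult mult_ac)
        finally show ?case by (rule ennreal_leI)
      qed
      then have "(\<integral>\<^sup>+x. ennreal (g1 x powr p) \<partial>hmeas) \<le> (\<integral>\<^sup>+x. ennreal ((g1 x * h x) powr (p / 2) * W x powr (p / 2)) \<partial>hmeas)"
        by (rule nn_integral_mono_AE)
      also have "\<dots> \<le> ennreal (X powr (1 / (2 / p)) * \<eta> powr (1 / (2 * real N + 1)))"
      proof (rule nn_integral_Holder)
        have pp: "1 / (2 / p) = 2 * real N / (2 * real N + 1)"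
          using mult_divide_mult_cancel_left[of 2 "2 * real N" "2 * real N + 1"] by (simp add: p_def)
        show "1 / (2 / p) + 1 / (2 * real N + 1) = 1" unfolding pp by (simp add: add_divide_distrib[symmetric])
        have "((g1 x * h x) powr (p / 2)) powr (2 / p) = g1 x * h x" for x
          using p nonneg by (simp add: powr_powr)
        then show "(\<integral>\<^sup>+x. ennreal (((g1 x * h x) powr (p / 2)) powr (2 / p)) \<partial>hmeas) \<le> ennreal X" using X by simp
        have "(W x powr (p / 2)) powr (2 * real N + 1) = W x powr (2 * real N)" for x
        proof -
          have ph: "p / 2 = 2 * real N / (2 * real N + 1)" unfolding pp[symmetric] by simp
          have nz: "2 * real N + 1 \<noteq> 0" using of_nat_0_le_iff[of N, where 'a = real] by linarith
          have "p / 2 * (2 * real N + 1) = 2 * real N"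
            unfolding ph by (rule nonzero_eq_divide_eq[OF nz, THEN iffD1, OF refl])
          then show ?thesis by (simp only: powr_powr)
        qed
        then show "(\<integral>\<^sup>+x. ennreal ((W x powr (p / 2)) powr (2 * real N + 1)) \<partial>hmeas) \<le> ennreal \<eta>" using Wsmall by simp
      qed (use p X \<eta> in auto)
      finally show ?thesis by simp
    qed
    define A1 where "A1 = X powr (p / 2) * \<eta> powr (1 / (2 * real N + 1))"
    define A2 where "A2 = P powr p * Q"
    define A where "A = 2 powr p * (A1 + A2)"
    have A1: "A1 \<ge> 0" by (simp add: A1_def)
    have A2: "A2 > 0" using P Q by (simp add: A2_def)
    have A: "A > 0" using A1 A2 by (simp add: A_def add_nonneg_pos)
    have gint: "(\<integral>\<^sup>+x. ennreal (g x powr p) \<partial>hmeas) \<le> ennreal A"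
    proof -
      have "(\<integral>\<^sup>+x. ennreal (g x powr p) \<partial>hmeas) \<le> (\<integral>\<^sup>+x. ennreal (2 powr p) * (ennreal (g1 x powr p) + ennreal (g2 x powr p)) \<partial>hmeas)"
        using nonneg p unfolding g_def
        by (intro nn_integral_mono) (simp add: ennreal_plus[symmetric] ennreal_mult[symmetric] powr_add_le ennreal_leI del: ennreal_plus)
      also have "\<dots> = ennreal (2 powr p) * ((\<integral>\<^sup>+x. ennreal (g1 x powr p) \<partial>hmeas) + (\<integral>\<^sup>+x. ennreal (g2 x powr p) \<partial>hmeas))"
        by (subst nn_integral_cmult, measurable, subst nn_integral_add) auto
      also have "\<dots> \<le> ennreal (2 powr p) * (ennreal A1 + ennreal A2)"
        using g1int g2int unfolding A1_def A2_def p_def[symmetric] by (intro mult_left_mono add_mono) auto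
      also have "\<dots> = ennreal A"
        using A1 A2 by (simp add: A_def ennreal_plus[symmetric] ennreal_mult[symmetric] del: ennreal_plus)
      finally show ?thesis .
    qed
    have "ennreal (c * X) = ennreal c * (\<integral>\<^sup>+x. ennreal (g1 x * h x) \<partial>hmeas)"
      using X c by (simp add: ennreal_mult)
    also have "\<dots> = (\<integral>\<^sup>+\<tau>. ennreal (g1 \<tau>) * ennreal (c * h \<tau>) \<partial>hmeas)"
      using nonneg c by (subst nn_integral_cmult[symmetric]) (auto simp: ennreal_mult[symmetric] mult_ac)
    also have "\<dots> \<le> (\<integral>\<^sup>+\<tau>. ennreal (g \<tau>) * (\<integral>\<^sup>+\<zeta>. ennreal (Kern \<tau> \<zeta>) * ennreal (g \<zeta>) \<partial>hmeas) \<partial>hmeas)"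
    proof (rule nn_integral_mono_AE, use ineq in eventually_elim)
      case (elim \<tau>)
      show ?case using elim nonneg by (intro mult_mono ennreal_leI) (auto simp: g_def)
    qed
    also have "\<dots> = (\<integral>\<^sup>+\<tau>. \<integral>\<^sup>+\<zeta>. ennreal (Kern \<tau> \<zeta> * g \<tau> * g \<zeta>) \<partial>hmeas \<partial>hmeas)"
      using g0 by (intro nn_integral_cong, subst nn_integral_cmult[symmetric])
        (auto simp: ennreal_mult[symmetric] mult_ac)
    also have "\<dots> \<le> ennreal (C * A powr q)"
      unfolding q_def by (rule C(2)) (use g0 A gint in auto)
    finally have "c * X \<le> C * A powr q"
      using C(1) ennreal_le_iff[of "C * A powr q" "c * X"] by simp
    also have "A powr q = (2 powr p) powr q * (A1 + A2) powr q"
      unfolding A_def by (rule powr_mult)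
    also have "C * ((2 powr p) powr q * (A1 + A2) powr q) \<le> C * ((2 powr p) powr q * (2 powr q * (A1 powr q + A2 powr q)))"
      using A1 A2 q C by (intro mult_left_mono powr_add_le) auto
    also have "\<dots> = C' * A1 powr q + C' * A2 powr q" by (simp add: C'_def algebra_simps)
    also have "A1 powr q = X * \<eta> powr (1 / (2 * real N))"
    proof -
      have gen: "1 / d * (2 / (4 * e / d)) = 1 / (2 * e)" if "d > 0" "e > 0" for d e :: real
        using that by (simp add: field_simps)
      have "1 / (2 * real N + 1) * q = 1 / (2 * real N)"
        unfolding q_def p_def using N by (intro gen) auto
      moreover have "p / 2 * q = 1" using p by (simp add: q_def)
      ultimately show ?thesis unfolding A1_def using X(2) by (simp add: powr_mult powr_powr)
    qed
    also have "C' * (X * \<eta> powr (1 / (2 * real N))) = X * (C' * \<eta> powr (1 / (2 * real N)))" by simp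
    also have "\<dots> \<le> X * (c / 2)" by (intro mult_left_mono \<eta>_small X)
    also have "A2 powr q = P\<^sup>2 * Q powr q"
    proof -
      have "p * q = 2" using p by (simp add: q_def)
      then have "(P powr p) powr q = P powr 2" by (simp only: powr_powr)
      then show ?thesis unfolding A2_def using P Q by (simp add: powr_mult)
    qed
    finally have "c * X \<le> X * (c / 2) + C' * (P\<^sup>2 * Q powr q)" by simp
    then have "X \<le> (2 / c * C' * Q powr q) * P\<^sup>2" using c by (simp add: field_simps)
    then show "(\<integral>\<^sup>+x. ennreal (g1 x * h x) \<partial>hmeas) \<le> ennreal ((2 / c * C' * Q powr q) * P\<^sup>2)"
      unfolding X by (rule ennreal_leI)
  qed
qed

text \<open>Here \<open>t = b * norm \<tau>\<close> is the distance from the origin along the line. After absorption the error term lives in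
\<open>\<rho>1 \<le> t \<le> \<rho>2\<close>, where the weight \<open>t powr (1/2 - m)\<close> is at most \<open>\<rho>1 powr (1/2 - m)\<close>. On a disc of radius
\<open>\<rho>0 < \<rho>1\<close> the square of the weight is at least \<open>\<rho>0 powr (1 - 2 * m)\<close>, so the integral of \<open>t * D * u\<close> over that disc is
at most a constant times \<open>(\<rho>0 / \<rho>1) ^ (2 * m)\<close>, which tends to \<open>0\<close> as \<open>m\<close> grows. Smallness of \<open>V\<close> is required only where \<open>u\<close> does not
vanish.\<close>

lemma line_absorption:
  fixes N :: nat
  assumes N: "N \<ge> 1" and c: "c > 0"
  obtains \<eta> where "\<eta> > 0"
    "\<And>u D V \<kappa> b \<rho>1 \<rho>2 C1.
       u \<in> borel_measurable borel \<Longrightarrow> D \<in> borel_measurable borel \<Longrightarrow> V \<in> borel_measurable borel \<Longrightarrow> \<kappa> \<in> borel_measurable borel \<Longrightarrow>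
       (\<And>\<tau>. 0 \<le> u \<tau>) \<Longrightarrow> (\<And>\<tau>. 0 \<le> V \<tau>) \<Longrightarrow> (\<And>\<tau>. u \<tau> \<le> D \<tau>) \<Longrightarrow>
       b > 0 \<Longrightarrow> 0 < \<rho>1 \<Longrightarrow> \<rho>1 < \<rho>2 \<Longrightarrow> C1 \<ge> 0 \<Longrightarrow>
       (AE \<tau> in hmeas. D \<tau> \<le> V \<tau> * u \<tau>) \<Longrightarrow>
       (\<And>\<tau>. 0 \<le> \<kappa> \<tau> \<and> \<kappa> \<tau> \<le> 1) \<Longrightarrow> (\<And>\<tau>. b * norm \<tau> \<le> \<rho>1 \<Longrightarrow> \<kappa> \<tau> = 1) \<Longrightarrow> (\<And>\<tau>. b * norm \<tau> \<ge> \<rho>2 \<Longrightarrow> \<kappa> \<tau> = 0) \<Longrightarrow>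
       (\<And>m::nat. AE \<tau> in hmeas. ennreal (c * ((b * norm \<tau>) powr (1/2 - real m) * (\<kappa> \<tau> * u \<tau>)))
          \<le> (\<integral>\<^sup>+\<zeta>. ennreal (Kern \<tau> \<zeta>) * ennreal ((b * norm \<zeta>) powr (1/2 - real m) * (\<kappa> \<zeta> * ((b * norm \<zeta>) * D \<zeta>)
                + C1 * indicator {\<zeta>. \<rho>1 \<le> b * norm \<zeta> \<and> b * norm \<zeta> \<le> \<rho>2} \<zeta> * u \<zeta>)) \<partial>hmeas)) \<Longrightarrow>
       (\<And>m::nat. (\<integral>\<^sup>+\<tau>. ennreal ((b * norm \<tau>) powr (1 - 2 * real m) * ((b * norm \<tau>) * D \<tau>) * u \<tau> * indicator {\<tau>. b * norm \<tau> < \<rho>2} \<tau>) \<partial>hmeas) < \<infinity>) \<Longrightarrow>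
       (\<integral>\<^sup>+\<tau>. ennreal (u \<tau> powr (4 * real N / (2 * real N + 1)) * indicator {\<tau>. \<rho>1 \<le> b * norm \<tau> \<and> b * norm \<tau> \<le> \<rho>2} \<tau>) \<partial>hmeas) < \<infinity> \<Longrightarrow>
       (\<integral>\<^sup>+\<tau>. ennreal (((b * norm \<tau>) * V \<tau>) powr (2 * real N) * indicator {\<tau>. b * norm \<tau> < \<rho>2 \<and> u \<tau> \<noteq> 0} \<tau>) \<partial>hmeas) \<le> ennreal \<eta> \<Longrightarrow>
       AE \<tau> in hmeas. b * norm \<tau> < \<rho>1 \<longrightarrow> u \<tau> = 0"
proof -
  let ?p = "4 * real N / (2 * real N + 1)"
  have p: "?p > 0" using N by simp
  obtain \<eta> where \<eta>: "\<eta> > 0" and absorb: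
    "\<And>Q. Q > 0 \<Longrightarrow> \<exists>B. \<forall>g1 g2 h W P.
       g1 \<in> borel_measurable borel \<longrightarrow> g2 \<in> borel_measurable borel \<longrightarrow> h \<in> borel_measurable borel \<longrightarrow> W \<in> borel_measurable borel \<longrightarrow>
       (\<forall>x. 0 \<le> g1 x) \<longrightarrow> (\<forall>x. 0 \<le> g2 x) \<longrightarrow> (\<forall>x. 0 \<le> h x) \<longrightarrow> (\<forall>x. 0 \<le> W x) \<longrightarrow>
       (AE x in hmeas. g1 x \<le> W x * h x) \<longrightarrow>
       (AE \<tau> in hmeas. ennreal (c * h \<tau>) \<le> (\<integral>\<^sup>+\<zeta>. ennreal (Kern \<tau> \<zeta>) * ennreal (g1 \<zeta> + g2 \<zeta>) \<partial>hmeas)) \<longrightarrow>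
       (\<integral>\<^sup>+x. ennreal (W x powr (2 * real N)) \<partial>hmeas) \<le> ennreal \<eta> \<longrightarrow>
       P > 0 \<longrightarrow> (\<integral>\<^sup>+x. ennreal (g2 x powr ?p) \<partial>hmeas) \<le> ennreal (P powr ?p * Q) \<longrightarrow>
       (\<integral>\<^sup>+x. ennreal (g1 x * h x) \<partial>hmeas) < \<infinity> \<longrightarrow>
       (\<integral>\<^sup>+x. ennreal (g1 x * h x) \<partial>hmeas) \<le> ennreal (B * P\<^sup>2)"
    by (rule HLS_absorb[OF N c]) (rule that)
  show ?thesis
  proof (rule that[OF \<eta>])
    fix u D V \<kappa> :: "complex \<Rightarrow> real" and b \<rho>1 \<rho>2 C1 :: real
    assume [measurable]: "u \<in> borel_measurable borel" "D \<in> borel_measurable borel" "V \<in> borel_measurable borel" "\<kappa> \<in> borel_measurable borel"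
      and u0: "\<And>\<tau>. 0 \<le> u \<tau>" and V0: "\<And>\<tau>. 0 \<le> V \<tau>" and uD: "\<And>\<tau>. u \<tau> \<le> D \<tau>"
      and b: "b > 0" and \<rho>: "0 < \<rho>1" "\<rho>1 < \<rho>2" and C1: "C1 \<ge> 0"
      and DV: "AE \<tau> in hmeas. D \<tau> \<le> V \<tau> * u \<tau>"
      and \<kappa>01: "\<And>\<tau>. 0 \<le> \<kappa> \<tau> \<and> \<kappa> \<tau> \<le> 1" and \<kappa>1: "\<And>\<tau>. b * norm \<tau> \<le> \<rho>1 \<Longrightarrow> \<kappa> \<tau> = 1" and \<kappa>0: "\<And>\<tau>. b * norm \<tau> \<ge> \<rho>2 \<Longrightarrow> \<kappa> \<tau> = 0"
      and ineq: "\<And>m::nat. AE \<tau> in hmeas. ennreal (c * ((b * norm \<tau>) powr (1/2 - real m) * (\<kappa> \<tau> * u \<tau>)))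
          \<le> (\<integral>\<^sup>+\<zeta>. ennreal (Kern \<tau> \<zeta>) * ennreal ((b * norm \<zeta>) powr (1/2 - real m) * (\<kappa> \<zeta> * ((b * norm \<zeta>) * D \<zeta>)
                + C1 * indicator {\<zeta>. \<rho>1 \<le> b * norm \<zeta> \<and> b * norm \<zeta> \<le> \<rho>2} \<zeta> * u \<zeta>)) \<partial>hmeas)"
      and Xfin: "\<And>m::nat. (\<integral>\<^sup>+\<tau>. ennreal ((b * norm \<tau>) powr (1 - 2 * real m) * ((b * norm \<tau>) * D \<tau>) * u \<tau> * indicator {\<tau>. b * norm \<tau> < \<rho>2} \<tau>) \<partial>hmeas) < \<infinity>"
      and ufin: "(\<integral>\<^sup>+\<tau>. ennreal (u \<tau> powr ?p * indicator {\<tau>. \<rho>1 \<le> b * norm \<tau> \<and> b * norm \<tau> \<le> \<rho>2} \<tau>) \<partial>hmeas) < \<infinity>"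
      and Vsmall: "(\<integral>\<^sup>+\<tau>. ennreal (((b * norm \<tau>) * V \<tau>) powr (2 * real N) * indicator {\<tau>. b * norm \<tau> < \<rho>2 \<and> u \<tau> \<noteq> 0} \<tau>) \<partial>hmeas) \<le> ennreal \<eta>"
    define t where "t \<tau> = b * norm \<tau>" for \<tau> :: complex
    have t0: "t \<tau> \<ge> 0" for \<tau> using b by (simp add: t_def)
    have D0: "D \<tau> \<ge> 0" for \<tau> using order_trans[OF u0 uD] .
    have [measurable]: "t \<in> borel_measurable borel" unfolding t_def by measurable
    let ?I = "indicator {\<zeta>. \<rho>1 \<le> t \<zeta> \<and> t \<zeta> \<le> \<rho>2} :: complex \<Rightarrow> real"
    have [measurable]: "{\<zeta>. \<rho>1 \<le> t \<zeta> \<and> t \<zeta> \<le> \<rho>2} \<in> sets borel" "{\<tau>. t \<tau> < \<rho>2 \<and> u \<tau> \<noteq> 0} \<in> sets borel"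
      by measurable
    define Q0 where "Q0 = enn2real (\<integral>\<^sup>+\<tau>. ennreal (u \<tau> powr ?p * ?I \<tau>) \<partial>hmeas)"
    have Q0: "(\<integral>\<^sup>+\<tau>. ennreal (u \<tau> powr ?p * ?I \<tau>) \<partial>hmeas) = ennreal Q0" "Q0 \<ge> 0"
      using ufin by (simp_all add: Q0_def t_def less_top)
    define Q where "Q = C1 powr ?p * Q0 + 1"
    have Q: "Q > 0" using Q0 by (simp add: Q_def add_nonneg_pos)
    define W where "W \<tau> = t \<tau> * V \<tau> * indicator {\<tau>. t \<tau> < \<rho>2 \<and> u \<tau> \<noteq> 0} \<tau>" for \<tau>
    define h where "h m \<tau> = t \<tau> powr (1/2 - real m) * (\<kappa> \<tau> * u \<tau>)" for m :: nat and \<tau>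
    define g1 where "g1 m \<tau> = t \<tau> powr (1/2 - real m) * (\<kappa> \<tau> * (t \<tau> * D \<tau>))" for m :: nat and \<tau>
    define g2 where "g2 m \<tau> = t \<tau> powr (1/2 - real m) * (C1 * ?I \<tau> * u \<tau>)" for m :: nat and \<tau>
    obtain B where B: "\<forall>g1 g2 h W P.
       g1 \<in> borel_measurable borel \<longrightarrow> g2 \<in> borel_measurable borel \<longrightarrow> h \<in> borel_measurable borel \<longrightarrow> W \<in> borel_measurable borel \<longrightarrow>
       (\<forall>x. 0 \<le> g1 x) \<longrightarrow> (\<forall>x. 0 \<le> g2 x) \<longrightarrow> (\<forall>x. 0 \<le> h x) \<longrightarrow> (\<forall>x. 0 \<le> W x) \<longrightarrow>
       (AE x in hmeas. g1 x \<le> W x * h x) \<longrightarrow>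
       (AE \<tau> in hmeas. ennreal (c * h \<tau>) \<le> (\<integral>\<^sup>+\<zeta>. ennreal (Kern \<tau> \<zeta>) * ennreal (g1 \<zeta> + g2 \<zeta>) \<partial>hmeas)) \<longrightarrow>
       (\<integral>\<^sup>+x. ennreal (W x powr (2 * real N)) \<partial>hmeas) \<le> ennreal \<eta> \<longrightarrow>
       P > 0 \<longrightarrow> (\<integral>\<^sup>+x. ennreal (g2 x powr ?p) \<partial>hmeas) \<le> ennreal (P powr ?p * Q) \<longrightarrow>
       (\<integral>\<^sup>+x. ennreal (g1 x * h x) \<partial>hmeas) < \<infinity> \<longrightarrow>
       (\<integral>\<^sup>+x. ennreal (g1 x * h x) \<partial>hmeas) \<le> ennreal (B * P\<^sup>2)"
      using absorb[OF Q] by blast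
    have [measurable]: "W \<in> borel_measurable borel" "h m \<in> borel_measurable borel" "g1 m \<in> borel_measurable borel" "g2 m \<in> borel_measurable borel" for m
      unfolding W_def[abs_def] h_def[abs_def] g1_def[abs_def] g2_def[abs_def] by measurable
    have g1h_le: "g1 m \<tau> * h m \<tau> \<le> t \<tau> powr (1 - 2 * real m) * (t \<tau> * D \<tau>) * u \<tau> * indicator {\<tau>. t \<tau> < \<rho>2} \<tau>" for m \<tau>
    proof (cases "t \<tau> < \<rho>2")
      case True
      have "g1 m \<tau> * h m \<tau> = (\<kappa> \<tau> * \<kappa> \<tau>) * (t \<tau> powr (1 - 2 * real m) * (t \<tau> * D \<tau>) * u \<tau>)"
      proof -
        have P: "t \<tau> powr (1 - 2 * real m) = t \<tau> powr (1/2 - real m) * t \<tau> powr (1/2 - real m)"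
          by (simp add: powr_add[symmetric])
        show ?thesis unfolding g1_def h_def P by (simp only: mult_ac)
      qed
      also have "\<dots> \<le> 1 * (t \<tau> powr (1 - 2 * real m) * (t \<tau> * D \<tau>) * u \<tau>)"
        using \<kappa>01[of \<tau>] t0 D0 u0 by (intro mult_right_mono mult_le_one) auto
      finally show ?thesis using True by simp
    next
      case False
      then show ?thesis using \<kappa>0[of \<tau>] by (simp add: g1_def t_def)
    qed
    have Xbound: "(\<integral>\<^sup>+x. ennreal (g1 m x * h m x) \<partial>hmeas) \<le> ennreal (B * (\<rho>1 powr (1/2 - real m))\<^sup>2)" if m: "m \<ge> 1" for m :: nat
    proof (rule B[rule_format])
      show "AE x in hmeas. g1 m x \<le> W x * h m x"
        using DV
      proof eventually_elim
        case (elim x)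
        show ?case
        proof (cases "t x < \<rho>2 \<and> u x \<noteq> 0")
          case True
          have "t x powr (1/2 - real m) * (\<kappa> x * (t x * D x)) \<le> t x powr (1/2 - real m) * (\<kappa> x * (t x * (V x * u x)))"
            using \<kappa>01[of x] t0[of x] elim by (intro mult_left_mono) auto
          then show ?thesis using True by (simp add: g1_def W_def h_def mult_ac)
        next
          case False
          then have "\<kappa> x = 0 \<or> D x = 0"
            using \<kappa>0[of x] elim D0[of x] by (auto simp: t_def)
          then show ?thesis using False by (auto simp: g1_def W_def)
        qed
      qed
      have "ennreal (g1 m \<zeta> + g2 m \<zeta>) = ennreal ((b * norm \<zeta>) powr (1/2 - real m) * (\<kappa> \<zeta> * ((b * norm \<zeta>) * D \<zeta>)
                + C1 * indicator {\<zeta>. \<rho>1 \<le> b * norm \<zeta> \<and> b * norm \<zeta> \<le> \<rho>2} \<zeta> * u \<zeta>))" for \<zeta>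
        by (simp add: g1_def g2_def t_def distrib_left)
      then show "AE \<tau> in hmeas. ennreal (c * h m \<tau>) \<le> (\<integral>\<^sup>+\<zeta>. ennreal (Kern \<tau> \<zeta>) * ennreal (g1 m \<zeta> + g2 m \<zeta>) \<partial>hmeas)"
        using ineq[of m] by (simp add: h_def t_def)
      have "W x powr (2 * real N) = ((b * norm x) * V x) powr (2 * real N) * indicator {\<tau>. b * norm \<tau> < \<rho>2 \<and> u \<tau> \<noteq> 0} x" for x
        by (simp add: W_def t_def indicator_def)
      then show "(\<integral>\<^sup>+x. ennreal (W x powr (2 * real N)) \<partial>hmeas) \<le> ennreal \<eta>"
        using Vsmall by simp
      show "(\<integral>\<^sup>+x. ennreal (g2 m x powr ?p) \<partial>hmeas) \<le> ennreal ((\<rho>1 powr (1/2 - real m)) powr ?p * Q)"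
      proof -
        have "(\<integral>\<^sup>+x. ennreal (g2 m x powr ?p) \<partial>hmeas) \<le> (\<integral>\<^sup>+x. ennreal ((\<rho>1 powr (1/2 - real m)) powr ?p * C1 powr ?p) * ennreal (u x powr ?p * ?I x) \<partial>hmeas)"
        proof (rule nn_integral_mono)
          fix x
          show "ennreal (g2 m x powr ?p) \<le> ennreal ((\<rho>1 powr (1/2 - real m)) powr ?p * C1 powr ?p) * ennreal (u x powr ?p * ?I x)"
          proof (cases "\<rho>1 \<le> t x \<and> t x \<le> \<rho>2")
            case True
            have "t x powr (1/2 - real m) \<le> \<rho>1 powr (1/2 - real m)"
              using True \<rho> m by (intro powr_mono2') auto
            then have "g2 m x \<le> \<rho>1 powr (1/2 - real m) * (C1 * u x)"
              unfolding g2_def using True C1 u0[of x] by (simp add: mult_right_mono)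
            moreover have "0 \<le> g2 m x" using C1 u0[of x] by (simp add: g2_def)
            ultimately have "g2 m x powr ?p \<le> (\<rho>1 powr (1/2 - real m) * (C1 * u x)) powr ?p"
              using p by (intro powr_mono2) auto
            also have "\<dots> = (\<rho>1 powr (1/2 - real m)) powr ?p * C1 powr ?p * (u x powr ?p)"
              using C1 u0[of x] by (simp only: powr_mult powr_ge_zero mult_nonneg_nonneg mult.assoc)
            finally show ?thesis using True by (simp add: ennreal_mult[symmetric] ennreal_leI)
          next
            case False
            then show ?thesis using p by (simp add: g2_def)
          qed
        qed
        also have "\<dots> = ennreal ((\<rho>1 powr (1/2 - real m)) powr ?p * C1 powr ?p) * (\<integral>\<^sup>+x. ennreal (u x powr ?p * ?I x) \<partial>hmeas)"
          by (rule nn_integral_cmult) measurable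
        also have "\<dots> = ennreal ((\<rho>1 powr (1/2 - real m)) powr ?p * (C1 powr ?p * Q0))"
          unfolding Q0 using Q0(2) by (simp add: ennreal_mult[symmetric] mult.assoc)
        also have "\<dots> \<le> ennreal ((\<rho>1 powr (1/2 - real m)) powr ?p * Q)"
          by (intro ennreal_leI mult_left_mono) (auto simp: Q_def)
        finally show ?thesis .
      qed
      have "(\<integral>\<^sup>+x. ennreal (g1 m x * h m x) \<partial>hmeas) \<le> (\<integral>\<^sup>+\<tau>. ennreal ((b * norm \<tau>) powr (1 - 2 * real m) * ((b * norm \<tau>) * D \<tau>) * u \<tau> * indicator {\<tau>. b * norm \<tau> < \<rho>2} \<tau>) \<partial>hmeas)"
        using g1h_le[of m] by (intro nn_integral_mono ennreal_leI) (simp add: t_def)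
      then show "(\<integral>\<^sup>+x. ennreal (g1 m x * h m x) \<partial>hmeas) < \<infinity>"
        using Xfin[of m] by (rule order_le_less_trans)
    qed (use \<rho> t0 u0 V0 D0 \<kappa>01 C1 in \<open>auto simp: g1_def g2_def h_def W_def\<close>)
    have inner: "AE \<tau> in hmeas. t \<tau> < \<rho>0 \<longrightarrow> u \<tau> = 0" if \<rho>0: "0 < \<rho>0" "\<rho>0 < \<rho>1" for \<rho>0
    proof -
      let ?Y = "\<integral>\<^sup>+\<tau>. ennreal (t \<tau> * D \<tau> * u \<tau> * indicator {\<tau>. t \<tau> < \<rho>0} \<tau>) \<partial>hmeas"
      have le: "?Y \<le> ennreal ((\<bar>B\<bar> * (\<rho>1 / \<rho>0)) * ((\<rho>0 / \<rho>1)\<^sup>2) ^ m)" if m: "m \<ge> 1" for m :: nat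
      proof -
        have "ennreal (\<rho>0 powr (1 - 2 * real m)) * ?Y = (\<integral>\<^sup>+\<tau>. ennreal (\<rho>0 powr (1 - 2 * real m)) * ennreal (t \<tau> * D \<tau> * u \<tau> * indicator {\<tau>. t \<tau> < \<rho>0} \<tau>) \<partial>hmeas)"
          by (rule nn_integral_cmult[symmetric]) measurable
        also have "\<dots> \<le> (\<integral>\<^sup>+x. ennreal (g1 m x * h m x) \<partial>hmeas)"
        proof (rule nn_integral_mono)
          fix x
          show "ennreal (\<rho>0 powr (1 - 2 * real m)) * ennreal (t x * D x * u x * indicator {\<tau>. t \<tau> < \<rho>0} x) \<le> ennreal (g1 m x * h m x)"
          proof (cases "t x < \<rho>0 \<and> t x \<noteq> 0")
            case True
            then have tx: "0 < t x" "t x < \<rho>0" using t0[of x] by auto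
            have k1: "\<kappa> x = 1" using \<kappa>1[of x] tx \<rho>0 by (simp add: t_def)
            have "\<rho>0 powr (1 - 2 * real m) \<le> t x powr (1 - 2 * real m)" using tx m by (intro powr_mono2') auto
            then have "\<rho>0 powr (1 - 2 * real m) * (t x * D x * u x) \<le> t x powr (1 - 2 * real m) * (t x * D x * u x)"
              using t0[of x] D0[of x] u0[of x] by (intro mult_right_mono) auto
            also have "\<dots> = g1 m x * h m x"
            proof -
              have e: "1 - 2 * real m = (1/2 - real m) + (1/2 - real m)" by simp
              show ?thesis unfolding g1_def h_def k1 e powr_add by (simp add: mult_ac)
            qed
            finally show ?thesis using True t0[of x] D0[of x] u0[of x] by (simp add: ennreal_mult[symmetric] ennreal_leI)
          next
            case False
            then show ?thesis by auto
          qed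
        qed
        also have "\<dots> \<le> ennreal (B * (\<rho>1 powr (1/2 - real m))\<^sup>2)" by (rule Xbound[OF m])
        also have "\<dots> \<le> ennreal (\<bar>B\<bar> * \<rho>1 powr (1 - 2 * real m))"
        proof (rule ennreal_leI)
          have "(\<rho>1 powr (1/2 - real m))\<^sup>2 = \<rho>1 powr (1 - 2 * real m)"
            unfolding power2_eq_square powr_add[symmetric] by simp
          then show "B * (\<rho>1 powr (1/2 - real m))\<^sup>2 \<le> \<bar>B\<bar> * \<rho>1 powr (1 - 2 * real m)"
            by (simp add: mult_right_mono)
        qed
        finally have *: "ennreal (\<rho>0 powr (1 - 2 * real m)) * ?Y \<le> ennreal (\<bar>B\<bar> * \<rho>1 powr (1 - 2 * real m))" .
        have "?Y = ennreal (\<rho>0 powr (2 * real m - 1)) * (ennreal (\<rho>0 powr (1 - 2 * real m)) * ?Y)"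
          using \<rho>0 by (simp add: mult.assoc[symmetric] ennreal_mult[symmetric] powr_add[symmetric])
        also have "\<dots> \<le> ennreal (\<rho>0 powr (2 * real m - 1)) * ennreal (\<bar>B\<bar> * \<rho>1 powr (1 - 2 * real m))"
          by (intro mult_left_mono *) auto
        also have "\<dots> = ennreal ((\<bar>B\<bar> * (\<rho>1 / \<rho>0)) * ((\<rho>0 / \<rho>1)\<^sup>2) ^ m)"
        proof -
          have a: "\<rho>0 powr (2 * real m - 1) = \<rho>0 ^ (2 * m) / \<rho>0"
            using \<rho>0 powr_realpow[of \<rho>0 "2 * m"] by (simp add: powr_diff)
          have b: "\<rho>1 powr (1 - 2 * real m) = \<rho>1 / \<rho>1 ^ (2 * m)"
            using \<rho> powr_realpow[of \<rho>1 "2 * m"] by (simp add: powr_diff)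
          have e: "((\<rho>0 / \<rho>1)\<^sup>2) ^ m = \<rho>0 ^ (2 * m) / \<rho>1 ^ (2 * m)"
            by (simp add: power_mult power_divide)
          have "\<rho>0 ^ (2 * m) / \<rho>0 * (\<bar>B\<bar> * (\<rho>1 / \<rho>1 ^ (2 * m))) = \<bar>B\<bar> * (\<rho>1 / \<rho>0) * (\<rho>0 ^ (2 * m) / \<rho>1 ^ (2 * m))"
            by simp
          then show ?thesis unfolding a b e using \<rho>0 \<rho> by (subst ennreal_mult[symmetric]) auto
        qed
        finally show ?thesis .
      qed
      have "(\<lambda>m. ((\<rho>0 / \<rho>1)\<^sup>2) ^ m) \<longlonglongrightarrow> 0"
      proof (rule LIMSEQ_realpow_zero)
        have "\<bar>\<rho>0 / \<rho>1\<bar> < 1" using \<rho>0 \<rho> by simp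
        then show "(\<rho>0 / \<rho>1)\<^sup>2 < 1" by (simp only: abs_square_less_1)
      qed simp
      from tendsto_ennrealI[OF tendsto_mult_left[OF this, of "\<bar>B\<bar> * (\<rho>1 / \<rho>0)"]]
      have "(\<lambda>m. ennreal ((\<bar>B\<bar> * (\<rho>1 / \<rho>0)) * ((\<rho>0 / \<rho>1)\<^sup>2) ^ m)) \<longlonglongrightarrow> ennreal ((\<bar>B\<bar> * (\<rho>1 / \<rho>0)) * 0)" .
      then have "?Y \<le> ennreal ((\<bar>B\<bar> * (\<rho>1 / \<rho>0)) * 0)"
        by (rule LIMSEQ_le_const) (use le in blast)
      then have "AE \<tau> in hmeas. ennreal (t \<tau> * D \<tau> * u \<tau> * indicator {\<tau>. t \<tau> < \<rho>0} \<tau>) = 0"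
        by (subst nn_integral_0_iff_AE[symmetric]) auto
      moreover have "AE \<tau> in (hmeas :: complex measure). \<tau> \<noteq> 0"
        by (subst AE_hmeas_iff) (auto simp: AE_lborel_singleton)
      ultimately show ?thesis
      proof eventually_elim
        case (elim \<tau>)
        show ?case
        proof
          assume lt: "t \<tau> < \<rho>0"
          have "t \<tau> > 0" using elim b by (simp add: t_def)
          moreover have "t \<tau> * D \<tau> * u \<tau> = 0"
          proof (rule antisym)
            show "t \<tau> * D \<tau> * u \<tau> \<le> 0" using elim(1) lt by (simp add: ennreal_eq_0_iff)
          qed (intro mult_nonneg_nonneg t0 D0 u0)
          ultimately have "D \<tau> = 0 \<or> u \<tau> = 0" by simp
          then show "u \<tau> = 0" using uD[of \<tau>] u0[of \<tau>] by auto
        qed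
      qed
    qed
    have "AE \<tau> in hmeas. \<forall>k::nat. t \<tau> < \<rho>1 * (1 - 1 / (real k + 2)) \<longrightarrow> u \<tau> = 0"
      unfolding AE_all_countable
    proof
      fix k :: nat
      have "0 < \<rho>1 * (1 - 1 / (real k + 2))" "\<rho>1 * (1 - 1 / (real k + 2)) < \<rho>1 * 1"
        using \<rho> by (intro mult_pos_pos mult_strict_left_mono; simp add: field_simps)+
      then show "AE \<tau> in hmeas. t \<tau> < \<rho>1 * (1 - 1 / (real k + 2)) \<longrightarrow> u \<tau> = 0" by (intro inner) auto
    qed
    then show "AE \<tau> in hmeas. b * norm \<tau> < \<rho>1 \<longrightarrow> u \<tau> = 0"
    proof eventually_elim
      case (elim \<tau>)
      show ?case
      proof
        assume lt: "b * norm \<tau> < \<rho>1"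
        then have "0 < 1 - t \<tau> / \<rho>1" using \<rho> by (simp add: t_def)
        then obtain k :: nat where k: "1 / real (Suc k) < 1 - t \<tau> / \<rho>1"
          using reals_Archimedean[of "1 - t \<tau> / \<rho>1"] by (auto simp: inverse_eq_divide)
        have "1 / (real k + 2) \<le> 1 / real (Suc k)" by (intro divide_left_mono) auto
        then have "t \<tau> / \<rho>1 < 1 - 1 / (real k + 2)" using k by linarith
        then have "t \<tau> < \<rho>1 * (1 - 1 / (real k + 2))" using \<rho> by (simp add: pos_divide_less_eq mult.commute)
        then show "u \<tau> = 0" using elim by blast
      qed
    qed
  qed
qed

section \<open>Radial cutoffs\<close>

definition cutf :: "real \<Rightarrow> real \<Rightarrow> real \<Rightarrow> real" where
  "cutf \<rho>1 \<rho>2 t = 1 - step ((t - \<rho>1\<^sup>2) / (\<rho>2\<^sup>2 - \<rho>1\<^sup>2))"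

definition cutf' :: "real \<Rightarrow> real \<Rightarrow> real \<Rightarrow> real" where
  "cutf' \<rho>1 \<rho>2 t = - step' ((t - \<rho>1\<^sup>2) / (\<rho>2\<^sup>2 - \<rho>1\<^sup>2)) / (\<rho>2\<^sup>2 - \<rho>1\<^sup>2)"

lemma cutf_deriv: "(cutf \<rho>1 \<rho>2 has_real_derivative cutf' \<rho>1 \<rho>2 t) (at t)"
proof -
  have "((\<lambda>t. (t - \<rho>1\<^sup>2) / (\<rho>2\<^sup>2 - \<rho>1\<^sup>2)) has_real_derivative 1 / (\<rho>2\<^sup>2 - \<rho>1\<^sup>2)) (at t)"
    by (intro DERIV_cdivide) (auto intro!: derivative_eq_intros)
  from DERIV_diff[OF DERIV_const DERIV_chain2[OF step_deriv this], of 1]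
  show ?thesis by (simp add: cutf_def[abs_def] cutf'_def)
qed

lemma cutf_bounds: "0 \<le> cutf \<rho>1 \<rho>2 t" "cutf \<rho>1 \<rho>2 t \<le> 1"
  by (auto simp: cutf_def step_nonneg step_le_1)

lemma square_gap: "0 < \<rho>1 \<Longrightarrow> \<rho>1 < \<rho>2 \<Longrightarrow> \<rho>2\<^sup>2 - \<rho>1\<^sup>2 > (0::real)"
  by (simp add: power_strict_mono)

lemma cutf_1: "0 < \<rho>1 \<Longrightarrow> \<rho>1 < \<rho>2 \<Longrightarrow> t \<le> \<rho>1\<^sup>2 \<Longrightarrow> cutf \<rho>1 \<rho>2 t = 1"
  using square_gap[of \<rho>1 \<rho>2] by (simp add: cutf_def step_0 divide_le_0_iff)

lemma cutf_0: "0 < \<rho>1 \<Longrightarrow> \<rho>1 < \<rho>2 \<Longrightarrow> t \<ge> \<rho>2\<^sup>2 \<Longrightarrow> cutf \<rho>1 \<rho>2 t = 0"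
  using square_gap[of \<rho>1 \<rho>2] by (simp add: cutf_def step_1)

lemma cutf'_0: "0 < \<rho>1 \<Longrightarrow> \<rho>1 < \<rho>2 \<Longrightarrow> t \<le> \<rho>1\<^sup>2 \<or> t \<ge> \<rho>2\<^sup>2 \<Longrightarrow> cutf' \<rho>1 \<rho>2 t = 0"
  using square_gap[of \<rho>1 \<rho>2] step'_0[of "(t - \<rho>1\<^sup>2) / (\<rho>2\<^sup>2 - \<rho>1\<^sup>2)"]
  by (auto simp: cutf'_def divide_le_0_iff)

lemma cutf'_bound: "0 < \<rho>1 \<Longrightarrow> \<rho>1 < \<rho>2 \<Longrightarrow> \<bar>cutf' \<rho>1 \<rho>2 t\<bar> \<le> 2 / (\<rho>2\<^sup>2 - \<rho>1\<^sup>2)"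
  using square_gap[of \<rho>1 \<rho>2] step'_bounds[of "(t - \<rho>1\<^sup>2) / (\<rho>2\<^sup>2 - \<rho>1\<^sup>2)"]
  by (simp add: cutf'_def divide_right_mono)

lemma cutf_measurable [measurable]: "cutf \<rho>1 \<rho>2 \<in> borel_measurable borel"
  and continuous_on_cutf': "continuous_on UNIV (cutf' \<rho>1 \<rho>2)"
proof -
  show "cutf \<rho>1 \<rho>2 \<in> borel_measurable borel"
    using cutf_deriv DERIV_isCont by (blast intro: borel_measurable_continuous_onI continuous_at_imp_continuous_on)
  show "continuous_on UNIV (cutf' \<rho>1 \<rho>2)"
  proof (cases "\<rho>2\<^sup>2 - \<rho>1\<^sup>2 = 0")
    case True
    then have "cutf' \<rho>1 \<rho>2 = (\<lambda>_. 0)" by (simp add: cutf'_def fun_eq_iff)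
    then show ?thesis by simp
  next
    case False
    then show ?thesis unfolding cutf'_def[abs_def]
      by (intro continuous_intros continuous_on_compose2[OF continuous_on_step']) auto
  qed
qed

section \<open>Almost every complex line\<close>

lemma AE_hmeas_nonzero: "AE z in (hmeas :: 'a::euclidean_space measure). z \<noteq> 0"
  by (subst AE_hmeas_iff) (auto simp: AE_lborel_singleton)

text \<open>A null set is still null after the dilation by any \<open>\<tau> \<noteq> 0\<close>; Fubini's theorem for the pairs \<open>(\<tau>, z)\<close> does the rest. The next
results use the same exchange of integrals.\<close>

lemma AE_hmeas_lines:
  fixes P :: "complex ^ 'n \<Rightarrow> bool"
  assumes P: "AE z in hmeas. P z" and [measurable]: "Measurable.pred borel P"
  shows "AE z in hmeas. AE \<tau> in hmeas. P (\<tau> *s z)"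
proof -
  define f :: "complex ^ 'n \<Rightarrow> ennreal" where "f z = (if P z then 0 else 1)" for z
  have [measurable]: "f \<in> borel_measurable borel" unfolding f_def by measurable
  have f0: "(\<integral>\<^sup>+z. f z \<partial>hmeas) = 0"
    using P by (subst nn_integral_0_iff_AE) (auto simp: f_def elim: eventually_mono)
  have "(\<integral>\<^sup>+z. (\<integral>\<^sup>+\<tau>. f (\<tau> *s z) \<partial>hmeas) \<partial>hmeas) = (\<integral>\<^sup>+\<tau>. (\<integral>\<^sup>+z. f (\<tau> *s z) \<partial>hmeas) \<partial>hmeas)"
    by (rule hmeas_pair.Fubini') measurable
  also have "\<dots> = (\<integral>\<^sup>+\<tau>. 0 \<partial>(hmeas :: complex measure))"
    by (rule nn_integral_cong_AE, use AE_hmeas_nonzero in eventually_elim)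
      (simp add: nn_integral_hmeas_smult f0)
  finally have "(\<integral>\<^sup>+z. (\<integral>\<^sup>+\<tau>. f (\<tau> *s z) \<partial>hmeas) \<partial>hmeas) = 0" by simp
  then have "AE z in hmeas. (\<integral>\<^sup>+\<tau>. f (\<tau> *s z) \<partial>hmeas) = 0"
    by (subst (asm) nn_integral_0_iff_AE) auto
  then show ?thesis
  proof eventually_elim
    case (elim z)
    then have "AE \<tau> in hmeas. f (\<tau> *s z) = 0"
      by (subst (asm) nn_integral_0_iff_AE) auto
    then show ?case by eventually_elim (auto simp: f_def split: if_splits)
  qed
qed

lemma emeasure_hmeas_UNIV: "emeasure (hmeas :: complex measure) UNIV \<noteq> 0"
proof
  assume "emeasure (hmeas :: complex measure) UNIV = 0"
  then have "AE z in (hmeas :: complex measure). False"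
    by (simp add: AE_iff_null null_sets_def)
  then have "AE z in (lborel :: complex measure). False" by (subst (asm) AE_hmeas_iff) auto
  then show False by (simp add: eventually_False ae_filter_eq_bot_iff)
qed

lemma AE_lines_imp_AE:
  fixes P :: "complex ^ 'n \<Rightarrow> bool"
  assumes P: "AE z in hmeas. AE \<tau> in hmeas. P (\<tau> *s z)" and [measurable]: "Measurable.pred borel P"
  shows "AE z in hmeas. P z"
proof -
  define f :: "complex ^ 'n \<Rightarrow> ennreal" where "f z = (if P z then 0 else 1)" for z
  have [measurable]: "f \<in> borel_measurable borel" unfolding f_def by measurable
  have "AE z in hmeas. (\<integral>\<^sup>+\<tau>. f (\<tau> *s z) \<partial>hmeas) = 0"
    using P
  proof eventually_elim
    case (elim z)
    then show ?case
      by (subst nn_integral_0_iff_AE) (auto simp: f_def elim: eventually_mono)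
  qed
  then have "(\<integral>\<^sup>+z. (\<integral>\<^sup>+\<tau>. f (\<tau> *s z) \<partial>hmeas) \<partial>hmeas) = 0"
    by (subst nn_integral_0_iff_AE) auto
  moreover have "(\<integral>\<^sup>+z. (\<integral>\<^sup>+\<tau>. f (\<tau> *s z) \<partial>hmeas) \<partial>hmeas) = (\<integral>\<^sup>+\<tau>. (\<integral>\<^sup>+z. f (\<tau> *s z) \<partial>hmeas) \<partial>hmeas)"
    by (rule hmeas_pair.Fubini') measurable
  moreover have "\<dots> = (\<integral>\<^sup>+\<tau>. (\<integral>\<^sup>+z. f z \<partial>hmeas) \<partial>(hmeas :: complex measure))"
    by (rule nn_integral_cong_AE, use AE_hmeas_nonzero in eventually_elim)
      (simp add: nn_integral_hmeas_smult)
  ultimately have "(\<integral>\<^sup>+z. f z \<partial>hmeas) * emeasure (hmeas :: complex measure) UNIV = 0" by simp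
  then have "(\<integral>\<^sup>+z. f z \<partial>hmeas) = 0" using emeasure_hmeas_UNIV by simp
  then have "AE z in hmeas. f z = 0" by (subst (asm) nn_integral_0_iff_AE) auto
  then show ?thesis by eventually_elim (auto simp: f_def split: if_splits)
qed

text \<open>A positive weight that is integrable with respect to \<open>dt / t\<close>; it compensates for the infinite measure of the dilation
group in \<open>line_finite\<close>.\<close>

definition tent :: "real \<Rightarrow> real" where "tent t = min t (1 / t)"

lemma tent_measurable [measurable]: "tent \<in> borel_measurable borel"
  unfolding tent_def[abs_def] by measurable

lemma tent_integral: "(\<integral>\<^sup>+\<tau>. ennreal (tent (1 / norm \<tau>)) \<partial>(hmeas :: complex measure)) < \<infinity>"
proof -
  have [measurable]: "ball (0::complex) 1 \<in> sets borel" "- ball (0::complex) 1 \<in> sets borel" by auto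
  have "(\<integral>\<^sup>+\<tau>. ennreal (tent (1 / norm \<tau>)) \<partial>(hmeas :: complex measure))
    = (\<integral>\<^sup>+\<tau>. ennreal (1 / (norm \<tau>)\<^sup>2) * ennreal (tent (1 / norm \<tau>)) \<partial>(lborel :: complex measure))"
    by (rule nn_integral_hmeas_complex) measurable
  also have "\<dots> \<le> (\<integral>\<^sup>+\<tau>. ennreal (norm \<tau> powr (-1)) * indicator (ball 0 1) \<tau> + ennreal (norm \<tau> powr (-3)) * indicator (- ball 0 1) \<tau> \<partial>(lborel :: complex measure))"
  proof (rule nn_integral_mono)
    fix \<tau> :: complex
    show "ennreal (1 / (norm \<tau>)\<^sup>2) * ennreal (tent (1 / norm \<tau>)) \<le> ennreal (norm \<tau> powr (-1)) * indicator (ball 0 1) \<tau> + ennreal (norm \<tau> powr (-3)) * indicator (- ball 0 1) \<tau>"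
    proof (cases "\<tau> = 0")
      case False
      then have pos: "norm \<tau> > 0" by simp
      have 1: "tent (1 / norm \<tau>) \<le> norm \<tau>" "tent (1 / norm \<tau>) \<le> 1 / norm \<tau>" "0 \<le> tent (1 / norm \<tau>)" by (auto simp: tent_def)
      have "1 / (norm \<tau>)\<^sup>2 * tent (1 / norm \<tau>) \<le> 1 / (norm \<tau>)\<^sup>2 * norm \<tau>" "1 / (norm \<tau>)\<^sup>2 * tent (1 / norm \<tau>) \<le> 1 / (norm \<tau>)\<^sup>2 * (1 / norm \<tau>)"
        using 1 by (intro mult_left_mono; simp)+
      moreover have "1 / (norm \<tau>)\<^sup>2 * norm \<tau> = norm \<tau> powr (-1)" "1 / (norm \<tau>)\<^sup>2 * (1 / norm \<tau>) = norm \<tau> powr (-3)"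
        using pos by (simp_all add: powr_minus powr_numeral power2_eq_square power3_eq_cube field_simps)
      ultimately show ?thesis using 1(3) by (auto simp: indicator_def ennreal_mult[symmetric] intro: ennreal_leI)
    qed (simp add: tent_def)
  qed
  also have "\<dots> = (\<integral>\<^sup>+\<tau>. ennreal (norm \<tau> powr (-1)) * indicator (ball 0 1) \<tau> \<partial>(lborel :: complex measure)) + (\<integral>\<^sup>+\<tau>. ennreal (norm \<tau> powr (-3)) * indicator (- ball 0 1) \<tau> \<partial>(lborel :: complex measure))"
    by (rule nn_integral_add) measurable
  also have "\<dots> < \<infinity>"
    using nn_integral_ball_powr_finite[of 1] nn_integral_outside_ball_powr_finite[of 3] by simp
  finally show ?thesis .
qed

lemma line_finite:
  fixes F :: "complex ^ 'n \<Rightarrow> ennreal"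
  assumes [measurable]: "F \<in> borel_measurable borel" and fin: "(\<integral>\<^sup>+z. F z \<partial>hmeas) < \<infinity>"
  shows "AE z in hmeas. (\<integral>\<^sup>+\<tau>. F (\<tau> *s z) \<partial>hmeas) < \<infinity>"
proof -
  define C where "C = (\<integral>\<^sup>+\<tau>. ennreal (tent (1 / norm \<tau>)) \<partial>(hmeas :: complex measure))"
  have "(\<integral>\<^sup>+z. (\<integral>\<^sup>+\<tau>. ennreal (tent (norm z)) * F (\<tau> *s z) \<partial>hmeas) \<partial>hmeas)
     = (\<integral>\<^sup>+\<tau>. (\<integral>\<^sup>+z. ennreal (tent (norm z)) * F (\<tau> *s z) \<partial>hmeas) \<partial>hmeas)"
    by (rule hmeas_pair.Fubini') measurable
  also have "\<dots> = (\<integral>\<^sup>+\<tau>. (\<integral>\<^sup>+z. ennreal (tent (norm z / norm \<tau>)) * F z \<partial>hmeas) \<partial>(hmeas :: complex measure))"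
  proof (rule nn_integral_cong_AE, use AE_hmeas_nonzero in eventually_elim)
    fix \<tau> :: complex assume "\<tau> \<noteq> 0"
    then show "(\<integral>\<^sup>+z. ennreal (tent (norm z)) * F (\<tau> *s z) \<partial>hmeas) = (\<integral>\<^sup>+z. ennreal (tent (norm z / norm \<tau>)) * F z \<partial>hmeas)"
      using nn_integral_hmeas_smult[of \<tau> "\<lambda>z. ennreal (tent (norm z / norm \<tau>)) * F z"]
      by (simp add: norm_smult)
  qed
  also have "\<dots> = (\<integral>\<^sup>+z. (\<integral>\<^sup>+\<tau>. ennreal (tent (norm z / norm \<tau>)) * F z \<partial>(hmeas :: complex measure)) \<partial>hmeas)"
    by (rule hmeas_pair.Fubini') measurable
  also have "\<dots> = (\<integral>\<^sup>+z. C * F z \<partial>hmeas)"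
  proof (rule nn_integral_cong_AE, use AE_hmeas_nonzero in eventually_elim)
    fix z :: "complex ^ 'n" assume z: "z \<noteq> 0"
    have "(\<integral>\<^sup>+\<tau>. ennreal (tent (norm z / norm \<tau>)) * F z \<partial>(hmeas :: complex measure)) = (\<integral>\<^sup>+\<tau>. ennreal (tent (norm z / norm \<tau>)) \<partial>(hmeas :: complex measure)) * F z"
      by (rule nn_integral_multc) measurable
    also have "(\<integral>\<^sup>+\<tau>. ennreal (tent (norm z / norm \<tau>)) \<partial>(hmeas :: complex measure)) = C"
    proof -
      have "(\<integral>\<^sup>+\<tau>. ennreal (tent (norm z / norm (\<tau> * complex_of_real (norm z)))) \<partial>(hmeas :: complex measure)) = (\<integral>\<^sup>+\<tau>. ennreal (tent (norm z / norm \<tau>)) \<partial>(hmeas :: complex measure))"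
        by (rule nn_integral_hmeas_mult) (use z in \<open>auto\<close>)
      moreover have "norm z / norm (\<tau> * complex_of_real (norm z)) = 1 / norm \<tau>" for \<tau>
        using z by (simp add: norm_mult)
      ultimately show ?thesis by (simp add: C_def)
    qed
    finally show "(\<integral>\<^sup>+\<tau>. ennreal (tent (norm z / norm \<tau>)) * F z \<partial>(hmeas :: complex measure)) = C * F z" .
  qed
  also have "\<dots> = C * (\<integral>\<^sup>+z. F z \<partial>hmeas)" by (rule nn_integral_cmult) measurable
  also have "\<dots> < \<infinity>" using fin tent_integral by (simp add: C_def ennreal_mult_less_top)
  finally have "AE z in hmeas. (\<integral>\<^sup>+\<tau>. ennreal (tent (norm z)) * F (\<tau> *s z) \<partial>hmeas) \<noteq> \<infinity>"
    by (intro nn_integral_PInf_AE) auto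
  then show ?thesis
    using AE_hmeas_nonzero
  proof eventually_elim
    case (elim z)
    have "(\<integral>\<^sup>+\<tau>. ennreal (tent (norm z)) * F (\<tau> *s z) \<partial>hmeas) = ennreal (tent (norm z)) * (\<integral>\<^sup>+\<tau>. F (\<tau> *s z) \<partial>hmeas)"
      by (rule nn_integral_cmult) measurable
    moreover have "tent (norm z) > 0" using elim by (simp add: tent_def)
    ultimately show ?case using elim by (auto simp: ennreal_mult_eq_top_iff less_top[symmetric])
  qed
qed

lemma null_circle: "AE \<tau> in (hmeas :: complex measure). b * norm \<tau> \<noteq> s" if "b > 0"
proof -
  have "AE \<tau> in (lborel :: complex measure). \<tau> \<notin> sphere 0 (s / b)"
  proof -
    have "sphere (0::complex) (s / b) \<in> null_sets lborel"
      using negligible_sphere[of 0 "s/b"] by (simp add: negligible_iff_null_sets null_sets_completion_iff)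
    then show ?thesis by (rule AE_not_in)
  qed
  then have "AE \<tau> in (lborel :: complex measure). b * norm \<tau> \<noteq> s"
    by eventually_elim (use that in \<open>auto simp: field_simps\<close>)
  then show ?thesis by (subst AE_hmeas_iff) auto
qed

text \<open>Let \<open>s\<close> be the largest radius up to which \<open>u\<close> vanishes. If \<open>s < R\<close>, then the set where \<open>u\<close> does not vanish and
\<open>b * norm \<tau> < \<rho>\<close> shrinks to a null set as \<open>\<rho>\<close> decreases to \<open>s\<close>. So the smallness condition holds for some
\<open>\<rho> > s\<close>, and \<open>u\<close> vanishes beyond \<open>s\<close>. Thus the finiteness of the integral of \<open>F\<close> is enough to keep going. Rational radii suffice and
are what is available after the choice of a line.\<close>

lemma line_continuation:
  fixes u F :: "complex \<Rightarrow> real"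
  assumes [measurable]: "u \<in> borel_measurable borel" "F \<in> borel_measurable borel"
    and F: "\<And>\<tau>. 0 \<le> F \<tau>" "(\<integral>\<^sup>+\<tau>. ennreal (F \<tau> * indicator {\<tau>. b * norm \<tau> < R} \<tau>) \<partial>hmeas) < \<infinity>"
    and b: "b > 0" and R: "R > 0" and \<eta>: "\<eta> > 0"
    and out: "\<And>\<tau>. b * norm \<tau> \<ge> R \<Longrightarrow> u \<tau> = 0"
    and adv: "\<And>q1 q2 :: rat. 0 < q1 \<Longrightarrow> q1 < q2 \<Longrightarrow> of_rat q2 < R \<Longrightarrow>
      (\<integral>\<^sup>+\<tau>. ennreal (F \<tau> * indicator {\<tau>. b * norm \<tau> < of_rat q2 \<and> u \<tau> \<noteq> 0} \<tau>) \<partial>hmeas) \<le> ennreal \<eta> \<Longrightarrow>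
      AE \<tau> in hmeas. b * norm \<tau> < of_rat q1 \<longrightarrow> u \<tau> = 0"
  shows "AE \<tau> in hmeas. u \<tau> = 0"
proof -
  define S where "S = {\<rho>. 0 \<le> \<rho> \<and> \<rho> \<le> R \<and> (AE \<tau> in hmeas. b * norm \<tau> < \<rho> \<longrightarrow> u \<tau> = 0)}"
  have "(0::real) \<in> S" using b R by (auto simp: S_def mult_less_0_iff)
  then have ne: "S \<noteq> {}" by auto
  have bdd: "bdd_above S" by (auto simp: S_def bdd_above_def)
  define s where "s = Sup S"
  have s0: "0 \<le> s" unfolding s_def using \<open>0 \<in> S\<close> bdd by (rule cSup_upper)
  have sR: "s \<le> R" unfolding s_def using ne by (rule cSup_least) (auto simp: S_def)
  have sS: "AE \<tau> in hmeas. b * norm \<tau> < s \<longrightarrow> u \<tau> = 0"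
  proof -
    have "AE \<tau> in hmeas. \<forall>k::nat. b * norm \<tau> < s - 1 / real (Suc k) \<longrightarrow> u \<tau> = 0"
      unfolding AE_all_countable
    proof
      fix k :: nat
      have "s - 1 / real (Suc k) < Sup S" by (simp add: s_def)
      then obtain \<rho> where \<rho>: "\<rho> \<in> S" "s - 1 / real (Suc k) < \<rho>" using less_cSup_iff[OF ne bdd] by blast
      then have "AE \<tau> in hmeas. b * norm \<tau> < \<rho> \<longrightarrow> u \<tau> = 0" by (simp add: S_def)
      then show "AE \<tau> in hmeas. b * norm \<tau> < s - 1 / real (Suc k) \<longrightarrow> u \<tau> = 0"
        by eventually_elim (use \<rho> in auto)
    qed
    then show ?thesis
    proof eventually_elim
      case (elim \<tau>)
      show ?case
      proof
        assume "b * norm \<tau> < s"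
        then have "0 < s - b * norm \<tau>" by simp
        from reals_Archimedean[OF this] obtain k :: nat where "1 / real (Suc k) < s - b * norm \<tau>"
          by (auto simp: inverse_eq_divide)
        then have "b * norm \<tau> < s - 1 / real (Suc k)" by linarith
        then show "u \<tau> = 0" using elim by blast
      qed
    qed
  qed
  have "s = R"
  proof (rule ccontr)
    assume "s \<noteq> R"
    then have sR': "s < R" using sR by simp
    define \<rho> where "\<rho> n = s + (R - s) * inverse (real (Suc n))" for n
    have \<rho>: "s < \<rho> n" "\<rho> n \<le> R" for n
    proof -
      show "s < \<rho> n" using sR' by (simp add: \<rho>_def)
      have "(R - s) * inverse (real (Suc n)) \<le> (R - s) * 1" using sR' by (intro mult_left_mono) (auto simp: field_simps)
      then show "\<rho> n \<le> R" by (simp add: \<rho>_def)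
    qed
    have \<rho>lim: "\<rho> \<longlonglongrightarrow> s" unfolding \<rho>_def[abs_def]
      by (rule tendsto_eq_intros LIMSEQ_inverse_real_of_nat refl)+ simp
    have "(\<lambda>n. \<integral>\<^sup>+\<tau>. ennreal (F \<tau> * indicator {\<tau>. b * norm \<tau> < \<rho> n \<and> u \<tau> \<noteq> 0} \<tau>) \<partial>hmeas) \<longlonglongrightarrow> (\<integral>\<^sup>+\<tau>. 0 \<partial>(hmeas :: complex measure))"
    proof (rule nn_integral_dominated_convergence[where w = "\<lambda>\<tau>. ennreal (F \<tau> * indicator {\<tau>. b * norm \<tau> < R} \<tau>)"])
      show "AE \<tau> in hmeas. ennreal (F \<tau> * indicator {\<tau>. b * norm \<tau> < \<rho> n \<and> u \<tau> \<noteq> 0} \<tau>) \<le> ennreal (F \<tau> * indicator {\<tau>. b * norm \<tau> < R} \<tau>)" for n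
        using \<rho>(2)[of n] F(1) by (intro AE_I2 ennreal_leI mult_left_mono) (auto simp: indicator_def)
      show "AE \<tau> in hmeas. (\<lambda>n. ennreal (F \<tau> * indicator {\<tau>. b * norm \<tau> < \<rho> n \<and> u \<tau> \<noteq> 0} \<tau>)) \<longlonglongrightarrow> 0"
        using sS null_circle[OF b, of s]
      proof eventually_elim
        case (elim \<tau>)
        show ?case
        proof (cases "b * norm \<tau> < s")
          case True
          then show ?thesis using elim by simp
        next
          case False
          then have "s < b * norm \<tau>" using elim by simp
          then have "\<forall>\<^sub>F n in sequentially. \<rho> n < b * norm \<tau>" using order_tendstoD(2)[OF \<rho>lim] by blast
          then show ?thesis
            by (intro tendsto_eventually) (auto elim!: eventually_mono)
        qed
      qed
    qed (use F in simp_all)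
    then have "(\<lambda>n. \<integral>\<^sup>+\<tau>. ennreal (F \<tau> * indicator {\<tau>. b * norm \<tau> < \<rho> n \<and> u \<tau> \<noteq> 0} \<tau>) \<partial>hmeas) \<longlonglongrightarrow> 0" by simp
    then have "\<forall>\<^sub>F n in sequentially. (\<integral>\<^sup>+\<tau>. ennreal (F \<tau> * indicator {\<tau>. b * norm \<tau> < \<rho> n \<and> u \<tau> \<noteq> 0} \<tau>) \<partial>hmeas) < ennreal \<eta>"
      using \<eta> by (intro order_tendstoD) auto
    then obtain n where n: "(\<integral>\<^sup>+\<tau>. ennreal (F \<tau> * indicator {\<tau>. b * norm \<tau> < \<rho> n \<and> u \<tau> \<noteq> 0} \<tau>) \<partial>hmeas) < ennreal \<eta>"
      by (auto simp: eventually_sequentially)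
    obtain q2 :: rat where q2: "s < of_rat q2" "of_rat q2 < \<rho> n" using of_rat_dense[OF \<rho>(1)[of n]] by blast
    obtain q1 :: rat where q1: "s < of_rat q1" "of_rat q1 < (of_rat q2 :: real)" using of_rat_dense[OF q2(1)] by blast
    have "AE \<tau> in hmeas. b * norm \<tau> < of_rat q1 \<longrightarrow> u \<tau> = 0"
    proof (rule adv[of q1 q2])
      have "(0::real) < of_rat q1" using s0 q1 by linarith
      then show "0 < q1" by simp
      show "q1 < q2" using q1(2) by (simp add: of_rat_less)
      show "of_rat q2 < R" using q2 \<rho>(2)[of n] by linarith
      have "(\<integral>\<^sup>+\<tau>. ennreal (F \<tau> * indicator {\<tau>. b * norm \<tau> < of_rat q2 \<and> u \<tau> \<noteq> 0} \<tau>) \<partial>hmeas)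
        \<le> (\<integral>\<^sup>+\<tau>. ennreal (F \<tau> * indicator {\<tau>. b * norm \<tau> < \<rho> n \<and> u \<tau> \<noteq> 0} \<tau>) \<partial>hmeas)"
        using q2 F(1) by (intro nn_integral_mono ennreal_leI mult_left_mono) (auto simp: indicator_def)
      then show "(\<integral>\<^sup>+\<tau>. ennreal (F \<tau> * indicator {\<tau>. b * norm \<tau> < of_rat q2 \<and> u \<tau> \<noteq> 0} \<tau>) \<partial>hmeas) \<le> ennreal \<eta>"
        using n by order
    qed
    moreover have "0 \<le> real_of_rat q1" "real_of_rat q1 \<le> R" using q1 q2 \<rho>(2)[of n] s0 by linarith+
    ultimately have "of_rat q1 \<in> S" unfolding S_def by blast
    then have "of_rat q1 \<le> s" unfolding s_def using bdd by (rule cSup_upper)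
    then show False using q1 by simp
  qed
  show ?thesis using sS unfolding \<open>s = R\<close>
  proof eventually_elim
    case (elim \<tau>)
    then show ?case using out[of \<tau>] by (cases "b * norm \<tau> < R") auto
  qed
qed

section \<open>Vanishing on a ball\<close>

text \<open>The inequality of \<open>disc_inequality\<close> restricts to almost every complex line through the origin. On such a line
\<open>norm z * V\<close> lies in \<open>L\<^sup>2\<^sup>N\<close> for the invariant measure, since \<open>(norm z) ^ (2 * N)\<close> cancels the density of \<open>hmeas\<close>
in \<open>N\<close> complex dimensions. Therefore \<open>line_absorption\<close> and \<open>line_continuation\<close> apply on each of these lines.\<close>

lemma ball_vanishing:
  fixes U :: "complex ^ 'n \<Rightarrow> complex" and E :: "'n \<Rightarrow> complex ^ 'n \<Rightarrow> complex" and V :: "complex ^ 'n \<Rightarrow> real"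
  assumes w: "weakdbar R U E" and R: "R > 0"
    and intU: "integrable lborel U" and intE: "\<And>j. integrable lborel (E j)"
    and Vm [measurable]: "V \<in> borel_measurable borel" and V0: "\<And>z. 0 \<le> V z"
    and supp: "\<And>z. norm z \<ge> R \<Longrightarrow> U z = 0" "\<And>z j. norm z \<ge> R \<Longrightarrow> E j z = 0"
    and EV: "AE z in lborel. (\<Sum>j\<in>UNIV. norm (E j z)) \<le> V z * norm (U z)"
    and E2: "(\<integral>\<^sup>+z. ennreal ((\<Sum>j\<in>UNIV. norm (E j z))\<^sup>2) \<partial>lborel) < \<infinity>"
    and U2: "\<And>M::nat. (\<integral>\<^sup>+z. ennreal ((norm (U z))\<^sup>2 * norm z powr (- real M)) \<partial>lborel) < \<infinity>"
    and VN: "(\<integral>\<^sup>+z. ennreal (V z powr (2 * real CARD('n)) * indicator (ball 0 R) z) \<partial>lborel) < \<infinity>"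
  shows "AE z in lborel. U z = 0"
proof -
  define N where "N = CARD('n)"
  have N: "N \<ge> 1" by (simp add: N_def Suc_le_eq)
  have dim: "DIM(complex ^ 'n) = 2 * N" by (simp add: N_def)
  have Um [measurable]: "U \<in> borel_measurable borel" "E j \<in> borel_measurable borel" for j
    using intU intE by (auto dest: borel_measurable_integrable)
  define S where "S z = (\<Sum>j\<in>UNIV. norm (E j z))" for z
  have [measurable]: "S \<in> borel_measurable borel" unfolding S_def[abs_def] by measurable
  have S0: "S z \<ge> 0" for z by (simp add: S_def sum_nonneg)
  define D where "D z = S z + norm (U z)" for z
  have [measurable]: "D \<in> borel_measurable borel" unfolding D_def[abs_def] by measurable
  have D0: "D z \<ge> 0" for z using S0 by (simp add: D_def)
  \<comment> \<open>The summand \<open>1\<close> corresponds to the summand \<open>norm (U z)\<close> in \<open>D\<close>, which is there to have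
    \<open>norm (U z) \<le> D z\<close>: the absorption argument shows that \<open>D\<close> times \<open>U\<close> vanishes.\<close>
  define Vh where "Vh z = V z + 1" for z
  have [measurable]: "Vh \<in> borel_measurable borel" unfolding Vh_def[abs_def] by measurable
  have [measurable]: "ball (0 :: complex ^ 'n) R \<in> sets borel" by simp
  have DV: "AE z in hmeas. D z \<le> Vh z * norm (U z)"
  proof -
    have "AE z in lborel. D z \<le> Vh z * norm (U z)"
      using EV by eventually_elim (simp add: D_def S_def Vh_def distrib_right)
    then show ?thesis by (subst AE_hmeas_iff) auto
  qed
  \<comment> \<open>The weighted integrals that enter the inequalities are finite: a factor \<open>U\<close> can carry any
    negative power of \<open>norm z\<close>, and the other factor is square integrable.\<close>
  have ball_fin: "(\<integral>\<^sup>+z. indicator (ball 0 R) z \<partial>(lborel :: (complex ^ 'n) measure)) < \<infinity>"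
    using R by (simp add: emeasure_ball)
  have U2': "(\<integral>\<^sup>+z. ennreal ((norm (U z))\<^sup>2) \<partial>lborel) < \<infinity>"
  proof -
    have "(\<integral>\<^sup>+z. ennreal ((norm (U z))\<^sup>2) \<partial>lborel) = (\<integral>\<^sup>+z. ennreal ((norm (U z))\<^sup>2 * norm z powr (- real 0)) \<partial>lborel)"
    proof (rule nn_integral_cong_AE)
      have "AE z in (lborel :: (complex ^ 'n) measure). z \<noteq> 0" by (rule AE_lborel_singleton)
      then show "AE z in lborel. ennreal ((norm (U z))\<^sup>2) = ennreal ((norm (U z))\<^sup>2 * norm z powr (- real 0))"
        by eventually_elim simp
    qed
    then show ?thesis using U2[of 0] by simp
  qed
  have weighted: "(\<integral>\<^sup>+z. ennreal (f z) \<partial>hmeas) < \<infinity>"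
    if [measurable]: "f \<in> borel_measurable borel"
      and le: "\<And>z. z \<noteq> 0 \<Longrightarrow> f z * norm z powr (- (2 * real N)) \<le> g z + (norm (U z))\<^sup>2 * norm z powr (- real M)"
      and [measurable]: "g \<in> borel_measurable borel" and g0: "\<And>z. g z \<ge> 0" and g: "(\<integral>\<^sup>+z. ennreal (g z) \<partial>lborel) < \<infinity>"
    for f g :: "complex ^ 'n \<Rightarrow> real" and M :: nat
  proof -
    have "(\<integral>\<^sup>+z. ennreal (f z) \<partial>hmeas) = (\<integral>\<^sup>+z. ennreal (1 / norm z ^ DIM(complex ^ 'n)) * ennreal (f z) \<partial>lborel)"
      by (rule nn_integral_hmeas) measurable
    also have "\<dots> \<le> (\<integral>\<^sup>+z. ennreal (g z) + ennreal ((norm (U z))\<^sup>2 * norm z powr (- real M)) \<partial>lborel)"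
    proof (rule nn_integral_mono_AE)
      have "AE z in (lborel :: (complex ^ 'n) measure). z \<noteq> 0" by (rule AE_lborel_singleton)
      then show "AE z in lborel. ennreal (1 / norm z ^ DIM(complex ^ 'n)) * ennreal (f z) \<le> ennreal (g z) + ennreal ((norm (U z))\<^sup>2 * norm z powr (- real M))"
      proof eventually_elim
        case (elim z)
        have "1 / norm z ^ DIM(complex ^ 'n) = norm z powr (- (2 * real N))"
          using elim powr_realpow[of "norm z" "2 * N"] unfolding dim by (simp add: powr_minus inverse_eq_divide)
        then have "ennreal (1 / norm z ^ DIM(complex ^ 'n)) * ennreal (f z) = ennreal (f z * norm z powr (- (2 * real N)))"
          by (subst ennreal_mult'[symmetric]) (auto simp: mult.commute)
        also have "\<dots> \<le> ennreal (g z + (norm (U z))\<^sup>2 * norm z powr (- real M))" by (intro ennreal_leI le elim)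
        finally show ?case using g0 by (simp add: ennreal_plus)
      qed
    qed
    also have "\<dots> = (\<integral>\<^sup>+z. ennreal (g z) \<partial>lborel) + (\<integral>\<^sup>+z. ennreal ((norm (U z))\<^sup>2 * norm z powr (- real M)) \<partial>lborel)"
      by (rule nn_integral_add) measurable
    also have "\<dots> < \<infinity>" using g U2 by simp
    finally show ?thesis .
  qed
  have amgm: "x * y \<le> x\<^sup>2 + y\<^sup>2" if "x \<ge> 0" "y \<ge> 0" for x y :: real
  proof -
    have "0 \<le> (x - y)\<^sup>2" by simp
    then have "2 * (x * y) \<le> x\<^sup>2 + y\<^sup>2" by (simp add: power2_diff)
    moreover have "0 \<le> x * y" using that by simp
    ultimately show ?thesis by linarith
  qed
  have w_sq: "(norm z powr a)\<^sup>2 = norm z powr (2 * a)" for z :: "complex ^ 'n" and a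
    by (simp add: power2_eq_square powr_add[symmetric])
  have w_mul: "norm z powr a * norm z * norm z powr b = norm z powr (a + 1 + b)" if "z \<noteq> 0" for z :: "complex ^ 'n" and a b
  proof -
    have "norm z powr a * norm z * norm z powr b = norm z powr a * norm z powr 1 * norm z powr b"
      using that by simp
    then show ?thesis by (simp only: powr_add)
  qed
  have fin1: "(\<integral>\<^sup>+z. ennreal (norm z powr (1/2 - real m) * norm (U z)) \<partial>hmeas) < \<infinity>" for m :: nat
  proof (rule weighted[where g = "indicator (ball 0 R)" and M = "2 * m + 4 * N - 1"])
    fix z :: "complex ^ 'n" assume z: "z \<noteq> 0"
    show "norm z powr (1/2 - real m) * norm (U z) * norm z powr (- (2 * real N)) \<le> indicator (ball 0 R) z + (norm (U z))\<^sup>2 * norm z powr (- real (2 * m + 4 * N - 1))"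
    proof (cases "norm z < R")
      case True
      have "norm z powr (1/2 - real m) * norm (U z) * norm z powr (- (2 * real N)) = 1 * (norm (U z) * norm z powr (1/2 - real m - 2 * real N))"
        by (simp add: powr_add[symmetric] mult.assoc mult.left_commute)
      also have "\<dots> \<le> 1\<^sup>2 + (norm (U z) * norm z powr (1/2 - real m - 2 * real N))\<^sup>2" by (rule amgm) auto
      also have "(norm (U z) * norm z powr (1/2 - real m - 2 * real N))\<^sup>2 = (norm (U z))\<^sup>2 * norm z powr (- real (2 * m + 4 * N - 1))"
        unfolding power_mult_distrib w_sq using N by (simp add: of_nat_diff algebra_simps)
      finally show ?thesis using True by simp
    qed (simp add: supp)
  qed (use ball_fin in \<open>simp_all add: ennreal_indicator\<close>)
  have E2': "(\<integral>\<^sup>+z. ennreal ((S z)\<^sup>2) \<partial>lborel) < \<infinity>" using E2 by (simp add: S_def)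
  have D2: "(\<integral>\<^sup>+z. ennreal (2 * (S z)\<^sup>2 + 2 * (norm (U z))\<^sup>2) \<partial>lborel) < \<infinity>"
  proof -
    have "(\<integral>\<^sup>+z. ennreal (2 * (S z)\<^sup>2 + 2 * (norm (U z))\<^sup>2) \<partial>lborel) = (\<integral>\<^sup>+z. 2 * ennreal ((S z)\<^sup>2) + 2 * ennreal ((norm (U z))\<^sup>2) \<partial>lborel)"
      by (intro nn_integral_cong) (simp add: ennreal_plus ennreal_mult)
    also have "\<dots> = 2 * (\<integral>\<^sup>+z. ennreal ((S z)\<^sup>2) \<partial>lborel) + 2 * (\<integral>\<^sup>+z. ennreal ((norm (U z))\<^sup>2) \<partial>lborel)"
      by (simp add: nn_integral_add nn_integral_cmult)
    finally show ?thesis using E2' U2' by (simp add: ennreal_mult_less_top)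
  qed
  have fin3: "(\<integral>\<^sup>+z. ennreal (norm z powr (1 - 2 * real m) * (norm z * D z) * norm (U z)) \<partial>hmeas) < \<infinity>" for m :: nat
  proof (rule weighted[where g = "\<lambda>z. 2 * (S z)\<^sup>2 + 2 * (norm (U z))\<^sup>2" and M = "4 * m + 4 * N - 4"])
    fix z :: "complex ^ 'n" assume z: "z \<noteq> 0"
    have "norm z powr (1 - 2 * real m) * (norm z * D z) * norm (U z) * norm z powr (- (2 * real N))
       = D z * (norm (U z) * norm z powr (2 - 2 * real m - 2 * real N))"
    proof -
      have "norm z powr (2 - 2 * real m - 2 * real N) = norm z powr (1 - 2 * real m) * norm z * norm z powr (- (2 * real N))"
        using z by (simp add: w_mul)
      then show ?thesis by simp
    qed
    also have "\<dots> \<le> (D z)\<^sup>2 + (norm (U z) * norm z powr (2 - 2 * real m - 2 * real N))\<^sup>2" by (rule amgm) (auto simp: D0)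
    also have "(norm (U z) * norm z powr (2 - 2 * real m - 2 * real N))\<^sup>2 = (norm (U z))\<^sup>2 * norm z powr (- real (4 * m + 4 * N - 4))"
      unfolding power_mult_distrib w_sq using N by (simp add: of_nat_diff algebra_simps)
    also have "(D z)\<^sup>2 \<le> 2 * (S z)\<^sup>2 + 2 * (norm (U z))\<^sup>2"
    proof -
      have "0 \<le> (S z - norm (U z))\<^sup>2" by simp
      then show ?thesis unfolding D_def by (simp add: power2_diff power2_sum)
    qed
    finally show "norm z powr (1 - 2 * real m) * (norm z * D z) * norm (U z) * norm z powr (- (2 * real N))
      \<le> 2 * (S z)\<^sup>2 + 2 * (norm (U z))\<^sup>2 + (norm (U z))\<^sup>2 * norm z powr (- real (4 * m + 4 * N - 4))" by simp
  qed (use D2 in simp_all)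
  have fin2: "(\<integral>\<^sup>+z. ennreal (norm z powr (1/2 - real m) * (norm z * S z)) \<partial>hmeas) < \<infinity>" for m :: nat
  proof -
    have "(\<integral>\<^sup>+z. ennreal (norm z powr (1/2 - real m) * (norm z * S z)) \<partial>hmeas)
      \<le> (\<integral>\<^sup>+z. ennreal (norm z powr (1/2 - real m) * (norm z * (V z * norm (U z)))) \<partial>hmeas)"
    proof (rule nn_integral_mono_AE)
      have "AE z in hmeas. S z \<le> V z * norm (U z)" using EV by (subst AE_hmeas_iff) (auto simp: S_def)
      then show "AE z in hmeas. ennreal (norm z powr (1/2 - real m) * (norm z * S z)) \<le> ennreal (norm z powr (1/2 - real m) * (norm z * (V z * norm (U z))))"
        by eventually_elim (intro ennreal_leI mult_left_mono, auto)
    qed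
    also have "\<dots> < \<infinity>"
    proof (rule weighted[where g = "\<lambda>z. (V z powr (2 * real N) + 1) * indicator (ball 0 R) z" and M = "2 * m + 4 * N - 3"])
      fix z :: "complex ^ 'n" assume z: "z \<noteq> 0"
      show "norm z powr (1/2 - real m) * (norm z * (V z * norm (U z))) * norm z powr (- (2 * real N))
        \<le> (V z powr (2 * real N) + 1) * indicator (ball 0 R) z + (norm (U z))\<^sup>2 * norm z powr (- real (2 * m + 4 * N - 3))"
      proof (cases "norm z < R")
        case True
        have "norm z powr (1/2 - real m) * (norm z * (V z * norm (U z))) * norm z powr (- (2 * real N))
          = V z * (norm (U z) * norm z powr (3/2 - real m - 2 * real N))"
        proof -
          have "norm z powr (3/2 - real m - 2 * real N) = norm z powr (1/2 - real m) * norm z * norm z powr (- (2 * real N))"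
            using z by (simp add: w_mul)
          then show ?thesis by simp
        qed
        also have "\<dots> \<le> (V z)\<^sup>2 + (norm (U z) * norm z powr (3/2 - real m - 2 * real N))\<^sup>2" by (rule amgm) (auto simp: V0)
        also have "(norm (U z) * norm z powr (3/2 - real m - 2 * real N))\<^sup>2 = (norm (U z))\<^sup>2 * norm z powr (- real (2 * m + 4 * N - 3))"
          unfolding power_mult_distrib w_sq using N by (simp add: of_nat_diff algebra_simps)
        also have "(V z)\<^sup>2 \<le> V z powr (2 * real N) + 1"
        proof (cases "V z \<le> 1")
          case True
          then have "(V z)\<^sup>2 \<le> 1" using V0 by (simp add: power_le_one)
          then show ?thesis by (simp add: add_increasing)
        next
          case False
          then have "V z powr 2 \<le> V z powr (2 * real N)" using N by (intro powr_mono) auto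
          then show ?thesis using False by simp
        qed
        finally show ?thesis using True by simp
      qed (simp add: supp)
    next
      have "(\<integral>\<^sup>+z. ennreal ((V z powr (2 * real N) + 1) * indicator (ball 0 R) z) \<partial>lborel)
         = (\<integral>\<^sup>+z. ennreal (V z powr (2 * real N) * indicator (ball 0 R) z) + indicator (ball 0 R) z \<partial>lborel)"
        by (intro nn_integral_cong) (auto simp: indicator_def)
      also have "\<dots> = (\<integral>\<^sup>+z. ennreal (V z powr (2 * real N) * indicator (ball 0 R) z) \<partial>lborel) + (\<integral>\<^sup>+z. indicator (ball 0 R) z \<partial>(lborel :: (complex ^ 'n) measure))"
        by (rule nn_integral_add) measurable
      also have "\<dots> < \<infinity>" using VN ball_fin by (simp add: N_def)
      finally show "(\<integral>\<^sup>+z. ennreal ((V z powr (2 * real N) + 1) * indicator (ball 0 R) z) \<partial>lborel) < \<infinity>" .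
    qed simp_all
    finally show ?thesis .
  qed
  have finU: "(\<integral>\<^sup>+z. ennreal (norm (U z) powr (4 * real N / (2 * real N + 1)) * indicator {z. r \<le> norm z} z) \<partial>hmeas) < \<infinity>" if r: "r > 0" for r
  proof -
    let ?p = "4 * real N / (2 * real N + 1)"
    have p: "0 < ?p" "?p \<le> 2" using N by (auto simp: field_simps)
    have "(\<integral>\<^sup>+z. ennreal \<bar>norm (U z) powr ?p * indicator {z. r \<le> norm z} z\<bar> \<partial>hmeas)
      \<le> ennreal (1 / r ^ DIM(complex ^ 'n)) * (\<integral>\<^sup>+z. ennreal ((norm (U z))\<^sup>2 + indicator (ball 0 R) z) \<partial>lborel)"
    proof (rule nn_integral_hmeas_annulus[OF r])
      have "{z :: complex ^ 'n. r \<le> norm z} \<in> sets borel" by measurable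
      then show "(\<lambda>z. norm (U z) powr ?p * indicator {z. r \<le> norm z} z) \<in> borel_measurable borel" by measurable
      show "\<bar>norm (U z) powr ?p * indicator {z. r \<le> norm z} z\<bar> \<le> (norm (U z))\<^sup>2 + indicator (ball 0 R) z" if "r \<le> norm z" for z
      proof (cases "norm z < R")
        case True
        have "norm (U z) powr ?p \<le> (norm (U z))\<^sup>2 + 1"
        proof (cases "norm (U z) \<le> 1")
          case True
          then have "norm (U z) powr ?p \<le> 1" using p powr_mono2[of ?p "norm (U z)" 1] by simp
          then show ?thesis by (simp add: add_increasing)
        next
          case False
          then have "norm (U z) powr ?p \<le> norm (U z) powr 2" using p by (intro powr_mono) auto
          then show ?thesis using False by simp
        qed
        then show ?thesis using True that by simp
      next
        case False
        then show ?thesis using p by (simp add: supp)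
      qed
    qed simp_all
    also have "(\<integral>\<^sup>+z. ennreal ((norm (U z))\<^sup>2 + indicator (ball 0 R) z) \<partial>lborel) = (\<integral>\<^sup>+z. ennreal ((norm (U z))\<^sup>2) + indicator (ball 0 R) z \<partial>lborel)"
      by (intro nn_integral_cong) (auto simp: indicator_def)
    also have "\<dots> = (\<integral>\<^sup>+z. ennreal ((norm (U z))\<^sup>2) \<partial>lborel) + (\<integral>\<^sup>+z. indicator (ball 0 R) z \<partial>(lborel :: (complex ^ 'n) measure))"
      by (rule nn_integral_add) measurable
    also have "ennreal (1 / r ^ DIM(complex ^ 'n)) * \<dots> < \<infinity>"
      using U2' ball_fin by (simp add: ennreal_mult_less_top)
    finally show ?thesis by simp
  qed
  have finV: "(\<integral>\<^sup>+z. ennreal ((norm z * Vh z) powr (2 * real N) * indicator {z. norm z < R} z) \<partial>hmeas) < \<infinity>"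
  proof -
    have [measurable]: "{z :: complex ^ 'n. norm z < R} \<in> sets borel" by measurable
    have "(\<integral>\<^sup>+z. ennreal ((norm z * Vh z) powr (2 * real N) * indicator {z. norm z < R} z) \<partial>hmeas)
       = (\<integral>\<^sup>+z. ennreal (1 / norm z ^ DIM(complex ^ 'n)) * ennreal ((norm z * Vh z) powr (2 * real N) * indicator {z. norm z < R} z) \<partial>lborel)"
      by (rule nn_integral_hmeas) measurable
    also have "\<dots> \<le> (\<integral>\<^sup>+z. ennreal (2 powr (2 * real N)) * (ennreal (V z powr (2 * real N) * indicator (ball 0 R) z) + indicator (ball 0 R) z) \<partial>lborel)"
    proof (rule nn_integral_mono_AE)
      have "AE z in (lborel :: (complex ^ 'n) measure). z \<noteq> 0" by (rule AE_lborel_singleton)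
      then show "AE z in lborel. ennreal (1 / norm z ^ DIM(complex ^ 'n)) * ennreal ((norm z * Vh z) powr (2 * real N) * indicator {z. norm z < R} z)
         \<le> ennreal (2 powr (2 * real N)) * (ennreal (V z powr (2 * real N) * indicator (ball 0 R) z) + indicator (ball 0 R) z)"
      proof eventually_elim
        case (elim z)
        show ?case
        proof (cases "norm z < R")
          case True
          have "norm z powr (2 * real N) = norm z ^ (2 * N)" using elim powr_realpow[of "norm z" "2 * N"] by simp
          then have "1 / norm z ^ DIM(complex ^ 'n) * (norm z * Vh z) powr (2 * real N) = Vh z powr (2 * real N)"
            using elim unfolding dim powr_mult by simp
          also have "\<dots> \<le> 2 powr (2 * real N) * (V z powr (2 * real N) + 1 powr (2 * real N))"
            unfolding Vh_def using V0 by (intro powr_add_le) auto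
          finally show ?thesis using True
            by (simp add: ennreal_mult[symmetric] ennreal_plus[symmetric] ennreal_leI del: ennreal_plus ennreal_1 flip: ennreal_1)
        qed simp
      qed
    qed
    also have "\<dots> = ennreal (2 powr (2 * real N)) * ((\<integral>\<^sup>+z. ennreal (V z powr (2 * real N) * indicator (ball 0 R) z) \<partial>lborel) + (\<integral>\<^sup>+z. indicator (ball 0 R) z \<partial>(lborel :: (complex ^ 'n) measure)))"
      by (subst nn_integral_cmult, measurable, subst nn_integral_add) auto
    also have "\<dots> < \<infinity>" using VN ball_fin by (simp add: N_def ennreal_mult_less_top)
    finally show ?thesis .
  qed
  \<comment> \<open>The exceptional null set depends on the cutoff and on \<open>m\<close>. Rational radii make the family of
    inequalities countable, so that one null set serves all of them.\<close>
  define C1 where "C1 \<rho>1 \<rho>2 = 2 / (\<rho>2\<^sup>2 - \<rho>1\<^sup>2) * \<rho>2\<^sup>2" for \<rho>1 \<rho>2 :: real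
  define Hf where "Hf m \<rho>1 \<rho>2 z = norm z powr (1/2 - real m) * (cutf \<rho>1 \<rho>2 ((norm z)\<^sup>2) * norm (U z))" for m :: nat and \<rho>1 \<rho>2 and z :: "complex ^ 'n"
  define Gf where "Gf m \<rho>1 \<rho>2 z = norm z powr (1/2 - real m) * (cutf \<rho>1 \<rho>2 ((norm z)\<^sup>2) * (norm z * D z) + C1 \<rho>1 \<rho>2 * indicator {z. \<rho>1 \<le> norm z \<and> norm z \<le> \<rho>2} z * norm (U z))" for m :: nat and \<rho>1 \<rho>2 and z :: "complex ^ 'n"
  have annm [measurable]: "{z :: complex ^ 'n. \<rho>1 \<le> norm z \<and> norm z \<le> \<rho>2} \<in> sets borel" for \<rho>1 \<rho>2 by measurable
  have [measurable]: "Hf m \<rho>1 \<rho>2 \<in> borel_measurable borel" "Gf m \<rho>1 \<rho>2 \<in> borel_measurable borel" for m \<rho>1 \<rho>2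
    unfolding Hf_def[abs_def] Gf_def[abs_def] by measurable
  have key: "AE z in hmeas. ennreal (bubble_mass * Hf m \<rho>1 \<rho>2 z) \<le> lineT (\<lambda>z. ennreal (Gf m \<rho>1 \<rho>2 z)) z"
    if \<rho>: "0 < \<rho>1" "\<rho>1 < \<rho>2" "\<rho>2 < R" for m \<rho>1 \<rho>2
  proof -
    have B: "\<bar>cutf \<rho>1 \<rho>2 t\<bar> \<le> 1" for t using cutf_bounds[of \<rho>1 \<rho>2 t] by simp
    have "AE z in hmeas. ennreal (bubble_mass * (norm z powr (1/2 - real m) * (\<bar>cutf \<rho>1 \<rho>2 (z \<bullet> z)\<bar> * norm (U z))))
      \<le> lineT (\<lambda>z. ennreal (norm z powr (1/2 - real m) * (\<bar>cutf \<rho>1 \<rho>2 (z \<bullet> z)\<bar> * (norm z * (\<Sum>j\<in>UNIV. norm (E j z))) + \<bar>cutf' \<rho>1 \<rho>2 (z \<bullet> z)\<bar> * (z \<bullet> z) * norm (U z)))) z"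
    proof (rule disc_inequality[OF w intU intE cutf_deriv continuous_on_cutf' B cutf'_bound[OF \<rho>(1,2)]])
      show "cutf \<rho>1 \<rho>2 t = 0" "cutf' \<rho>1 \<rho>2 t = 0" if "\<rho>2\<^sup>2 < t" for t
        using that \<rho> by (auto intro: cutf_0 cutf'_0)
    qed (use \<rho> fin1 fin2[unfolded S_def] in auto)
    then show ?thesis
    proof eventually_elim
      case (elim z)
      have c0: "\<bar>cutf \<rho>1 \<rho>2 t\<bar> = cutf \<rho>1 \<rho>2 t" for t using cutf_bounds[of \<rho>1 \<rho>2 t] by simp
      have "ennreal (bubble_mass * Hf m \<rho>1 \<rho>2 z) = ennreal (bubble_mass * (norm z powr (1/2 - real m) * (\<bar>cutf \<rho>1 \<rho>2 (z \<bullet> z)\<bar> * norm (U z))))"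
        by (simp add: Hf_def c0 dot_square_norm)
      also note elim
      also have "lineT (\<lambda>z. ennreal (norm z powr (1/2 - real m) * (\<bar>cutf \<rho>1 \<rho>2 (z \<bullet> z)\<bar> * (norm z * (\<Sum>j\<in>UNIV. norm (E j z))) + \<bar>cutf' \<rho>1 \<rho>2 (z \<bullet> z)\<bar> * (z \<bullet> z) * norm (U z)))) z
        \<le> lineT (\<lambda>z. ennreal (Gf m \<rho>1 \<rho>2 z)) z"
      proof (intro lineT_mono ennreal_leI)
        fix z :: "complex ^ 'n"
        have 1: "\<bar>cutf' \<rho>1 \<rho>2 (z \<bullet> z)\<bar> * (z \<bullet> z) \<le> C1 \<rho>1 \<rho>2 * indicator {z. \<rho>1 \<le> norm z \<and> norm z \<le> \<rho>2} z"
        proof (cases "\<rho>1 \<le> norm z \<and> norm z \<le> \<rho>2")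
          case True
          then have "z \<bullet> z \<le> \<rho>2\<^sup>2" by (simp add: dot_square_norm power_mono)
          then have "\<bar>cutf' \<rho>1 \<rho>2 (z \<bullet> z)\<bar> * (z \<bullet> z) \<le> C1 \<rho>1 \<rho>2"
            unfolding C1_def using cutf'_bound[OF \<rho>(1,2), of "z \<bullet> z"] square_gap[OF \<rho>(1,2)]
            by (intro mult_mono) auto
          then show ?thesis using True by simp
        next
          case False
          then have "norm z < \<rho>1 \<or> norm z > \<rho>2" by auto
          then have "z \<bullet> z \<le> \<rho>1\<^sup>2 \<or> z \<bullet> z \<ge> \<rho>2\<^sup>2"
            using \<rho> by (auto simp: dot_square_norm intro: power_mono less_imp_le)
          then show ?thesis using False cutf'_0[OF \<rho>(1,2)] by simp
        qed
        have 2: "(\<Sum>j\<in>UNIV. norm (E j z)) \<le> D z" by (simp add: D_def S_def)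
        show "norm z powr (1/2 - real m) * (\<bar>cutf \<rho>1 \<rho>2 (z \<bullet> z)\<bar> * (norm z * (\<Sum>j\<in>UNIV. norm (E j z))) + \<bar>cutf' \<rho>1 \<rho>2 (z \<bullet> z)\<bar> * (z \<bullet> z) * norm (U z)) \<le> Gf m \<rho>1 \<rho>2 z"
          unfolding Gf_def c0 dot_square_norm[of z, symmetric]
          using cutf_bounds[of \<rho>1 \<rho>2] 1 2
          by (intro mult_left_mono add_mono mult_right_mono) (auto simp: dot_square_norm)
      qed
      finally show ?case .
    qed
  qed
  have key_all: "AE z in hmeas. \<forall>m::nat. \<forall>q1 q2::rat. 0 < q1 \<longrightarrow> q1 < q2 \<longrightarrow> of_rat q2 < R \<longrightarrow>
      ennreal (bubble_mass * Hf m (of_rat q1) (of_rat q2) z) \<le> lineT (\<lambda>z. ennreal (Gf m (of_rat q1) (of_rat q2) z)) z"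
    unfolding AE_all_countable
  proof (intro allI)
    fix m :: nat and q1 q2 :: rat
    show "AE z in hmeas. 0 < q1 \<longrightarrow> q1 < q2 \<longrightarrow> of_rat q2 < R \<longrightarrow>
      ennreal (bubble_mass * Hf m (of_rat q1) (of_rat q2) z) \<le> lineT (\<lambda>z. ennreal (Gf m (of_rat q1) (of_rat q2) z)) z"
      using key[of "of_rat q1" "of_rat q2" m] by (cases "0 < q1 \<and> q1 < q2 \<and> of_rat q2 < R") (auto simp: of_rat_less)
  qed
  have key_lines: "AE z in hmeas. AE \<tau> in hmeas. \<forall>m::nat. \<forall>q1 q2::rat. 0 < q1 \<longrightarrow> q1 < q2 \<longrightarrow> of_rat q2 < R \<longrightarrow>
      ennreal (bubble_mass * Hf m (of_rat q1) (of_rat q2) (\<tau> *s z)) \<le> lineT (\<lambda>z. ennreal (Gf m (of_rat q1) (of_rat q2) z)) (\<tau> *s z)"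
    by (rule AE_hmeas_lines[OF key_all]) measurable
  have DV_lines: "AE z in hmeas. AE \<tau> in hmeas. D (\<tau> *s z) \<le> Vh (\<tau> *s z) * norm (U (\<tau> *s z))"
    by (rule AE_hmeas_lines[OF DV]) measurable
  have [measurable]: "{z :: complex ^ 'n. norm z < R} \<in> sets borel" by measurable
  have V_lines: "AE z in hmeas. (\<integral>\<^sup>+\<tau>. ennreal ((norm (\<tau> *s z) * Vh (\<tau> *s z)) powr (2 * real N) * indicator {z. norm z < R} (\<tau> *s z)) \<partial>hmeas) < \<infinity>"
    by (rule line_finite[OF _ finV]) measurable
  have X_lines: "AE z in hmeas. \<forall>m::nat. (\<integral>\<^sup>+\<tau>. ennreal (norm (\<tau> *s z) powr (1 - 2 * real m) * (norm (\<tau> *s z) * D (\<tau> *s z)) * norm (U (\<tau> *s z))) \<partial>hmeas) < \<infinity>"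
    unfolding AE_all_countable
  proof
    fix m :: nat
    show "AE z in hmeas. (\<integral>\<^sup>+\<tau>. ennreal (norm (\<tau> *s z) powr (1 - 2 * real m) * (norm (\<tau> *s z) * D (\<tau> *s z)) * norm (U (\<tau> *s z))) \<partial>hmeas) < \<infinity>"
      by (rule line_finite[OF _ fin3[of m]]) measurable
  qed
  have [measurable]: "{z :: complex ^ 'n. r \<le> norm z} \<in> sets borel" for r by measurable
  have U_lines: "AE z in hmeas. \<forall>q::rat. 0 < q \<longrightarrow> (\<integral>\<^sup>+\<tau>. ennreal (norm (U (\<tau> *s z)) powr (4 * real N / (2 * real N + 1)) * indicator {z. of_rat q \<le> norm z} (\<tau> *s z)) \<partial>hmeas) < \<infinity>"
    unfolding AE_all_countable
  proof
    fix q :: rat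
    show "AE z in hmeas. 0 < q \<longrightarrow> (\<integral>\<^sup>+\<tau>. ennreal (norm (U (\<tau> *s z)) powr (4 * real N / (2 * real N + 1)) * indicator {z. of_rat q \<le> norm z} (\<tau> *s z)) \<partial>hmeas) < \<infinity>"
    proof (cases "0 < q")
      case True
      then have q: "(0::real) < of_rat q" by simp
      have "AE z in hmeas. (\<integral>\<^sup>+\<tau>. ennreal (norm (U (\<tau> *s z)) powr (4 * real N / (2 * real N + 1)) * indicator {z. of_rat q \<le> norm z} (\<tau> *s z)) \<partial>hmeas) < \<infinity>"
        by (rule line_finite[OF _ finU[OF q]]) measurable
      then show ?thesis by eventually_elim simp
    qed simp
  qed
  show ?thesis
  proof (rule line_absorption[OF N bubble_mass_pos], goal_cases)
    case (1 \<eta>)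
    note \<eta> = 1(1) and absorb = 1(2)
    have "AE z in hmeas. AE \<tau> in hmeas. U (\<tau> *s z) = 0"
      using key_lines DV_lines V_lines X_lines U_lines AE_hmeas_nonzero
    proof eventually_elim
      case (elim z)
      define b where "b = norm z"
      have b: "b > 0" using elim by (simp add: b_def)
      have nb: "norm (\<tau> *s z) = b * norm \<tau>" for \<tau> by (simp add: norm_smult b_def)
      define u where "u \<tau> = norm (U (\<tau> *s z))" for \<tau>
      define F where "F \<tau> = (b * norm \<tau> * Vh (\<tau> *s z)) powr (2 * real N)" for \<tau>
      have [measurable]: "u \<in> borel_measurable borel" "F \<in> borel_measurable borel"
        unfolding u_def[abs_def] F_def[abs_def] by measurable
      have "AE \<tau> in hmeas. u \<tau> = 0"
      proof (rule line_continuation[where F = F and b = b and R = R and \<eta> = \<eta>])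
        show "(\<integral>\<^sup>+\<tau>. ennreal (F \<tau> * indicator {\<tau>. b * norm \<tau> < R} \<tau>) \<partial>hmeas) < \<infinity>"
          using elim(3) by (simp add: F_def nb indicator_def cong: if_cong)
        show "u \<tau> = 0" if "R \<le> b * norm \<tau>" for \<tau> using that supp(1)[of "\<tau> *s z"] by (simp add: u_def nb)
        fix q1 q2 :: rat
        assume q: "0 < q1" "q1 < q2" "of_rat q2 < R"
          and small: "(\<integral>\<^sup>+\<tau>. ennreal (F \<tau> * indicator {\<tau>. b * norm \<tau> < of_rat q2 \<and> u \<tau> \<noteq> 0} \<tau>) \<partial>hmeas) \<le> ennreal \<eta>"
        let ?q1 = "of_rat q1 :: real" and ?q2 = "of_rat q2 :: real"
        have q': "0 < ?q1" "?q1 < ?q2" using q by (auto simp: of_rat_less)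
        have q2: "0 \<le> ?q2" using q' by linarith
        show "AE \<tau> in hmeas. b * norm \<tau> < ?q1 \<longrightarrow> u \<tau> = 0"
        proof (rule absorb[where D = "\<lambda>\<tau>. D (\<tau> *s z)" and V = "\<lambda>\<tau>. Vh (\<tau> *s z)" and \<kappa> = "\<lambda>\<tau>. cutf ?q1 ?q2 ((b * norm \<tau>)\<^sup>2)" and ?C1.0 = "C1 ?q1 ?q2" and ?\<rho>2.0 = ?q2])
          show "AE \<tau> in hmeas. D (\<tau> *s z) \<le> Vh (\<tau> *s z) * u \<tau>" using elim(2) by (simp add: u_def)
          show "C1 ?q1 ?q2 \<ge> 0" using square_gap[OF q'] by (simp add: C1_def)
          show "cutf ?q1 ?q2 ((b * norm \<tau>)\<^sup>2) = 1" if "b * norm \<tau> \<le> ?q1" for \<tau>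
            using that b by (intro cutf_1[OF q'] power_mono) auto
          show "cutf ?q1 ?q2 ((b * norm \<tau>)\<^sup>2) = 0" if "?q2 \<le> b * norm \<tau>" for \<tau>
            using that q2 by (intro cutf_0[OF q'] power_mono)
          show "AE \<tau> in hmeas. ennreal (bubble_mass * ((b * norm \<tau>) powr (1/2 - real m) * (cutf ?q1 ?q2 ((b * norm \<tau>)\<^sup>2) * u \<tau>)))
            \<le> (\<integral>\<^sup>+\<zeta>. ennreal (Kern \<tau> \<zeta>) * ennreal ((b * norm \<zeta>) powr (1/2 - real m) * (cutf ?q1 ?q2 ((b * norm \<zeta>)\<^sup>2) * ((b * norm \<zeta>) * D (\<zeta> *s z))
                  + C1 ?q1 ?q2 * indicator {\<zeta>. ?q1 \<le> b * norm \<zeta> \<and> b * norm \<zeta> \<le> ?q2} \<zeta> * u \<zeta>)) \<partial>hmeas)" for m :: nat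
            using elim(1) AE_hmeas_nonzero
          proof eventually_elim
            case (elim \<tau>)
            have "ennreal (bubble_mass * Hf m ?q1 ?q2 (\<tau> *s z)) \<le> lineT (\<lambda>z. ennreal (Gf m ?q1 ?q2 z)) (\<tau> *s z)"
              using elim(1) q by blast
            also have "\<dots> = (\<integral>\<^sup>+\<sigma>. ennreal (kern \<sigma>) * ennreal (Gf m ?q1 ?q2 ((\<sigma> * \<tau>) *s z)) \<partial>hmeas)"
              unfolding lineT_def by (simp add: vector_smult_assoc)
            also have "\<dots> = (\<integral>\<^sup>+\<zeta>. ennreal (Kern \<tau> \<zeta>) * ennreal (Gf m ?q1 ?q2 (\<zeta> *s z)) \<partial>hmeas)"
              by (rule nn_integral_Kern[OF elim(2), symmetric]) measurable
            finally show ?case by (simp add: Hf_def Gf_def nb u_def indicator_def cong: if_cong)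
          qed
          show "(\<integral>\<^sup>+\<tau>. ennreal ((b * norm \<tau>) powr (1 - 2 * real m) * ((b * norm \<tau>) * D (\<tau> *s z)) * u \<tau> * indicator {\<tau>. b * norm \<tau> < ?q2} \<tau>) \<partial>hmeas) < \<infinity>" for m :: nat
          proof -
            have "(\<integral>\<^sup>+\<tau>. ennreal ((b * norm \<tau>) powr (1 - 2 * real m) * ((b * norm \<tau>) * D (\<tau> *s z)) * u \<tau> * indicator {\<tau>. b * norm \<tau> < ?q2} \<tau>) \<partial>hmeas)
              \<le> (\<integral>\<^sup>+\<tau>. ennreal (norm (\<tau> *s z) powr (1 - 2 * real m) * (norm (\<tau> *s z) * D (\<tau> *s z)) * norm (U (\<tau> *s z))) \<partial>hmeas)"
              using b D0 by (intro nn_integral_mono ennreal_leI) (auto simp: nb u_def indicator_def intro!: mult_nonneg_nonneg)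
            then show ?thesis using elim(4) by (rule_tac order_le_less_trans) auto
          qed
          show "(\<integral>\<^sup>+\<tau>. ennreal (u \<tau> powr (4 * real N / (2 * real N + 1)) * indicator {\<tau>. ?q1 \<le> b * norm \<tau> \<and> b * norm \<tau> \<le> ?q2} \<tau>) \<partial>hmeas) < \<infinity>"
          proof -
            have "(\<integral>\<^sup>+\<tau>. ennreal (u \<tau> powr (4 * real N / (2 * real N + 1)) * indicator {\<tau>. ?q1 \<le> b * norm \<tau> \<and> b * norm \<tau> \<le> ?q2} \<tau>) \<partial>hmeas)
              \<le> (\<integral>\<^sup>+\<tau>. ennreal (norm (U (\<tau> *s z)) powr (4 * real N / (2 * real N + 1)) * indicator {z. of_rat q1 \<le> norm z} (\<tau> *s z)) \<partial>hmeas)"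
              by (intro nn_integral_mono ennreal_leI) (auto simp: nb u_def indicator_def)
            then show ?thesis using elim(5) q(1) by (rule_tac order_le_less_trans) auto
          qed
          show "(\<integral>\<^sup>+\<tau>. ennreal (((b * norm \<tau>) * Vh (\<tau> *s z)) powr (2 * real N) * indicator {\<tau>. b * norm \<tau> < ?q2 \<and> u \<tau> \<noteq> 0} \<tau>) \<partial>hmeas) \<le> ennreal \<eta>"
            using small by (simp add: F_def)
        qed (use b q' V0 S0 cutf_bounds in \<open>auto simp: u_def D_def Vh_def intro: add_nonneg_nonneg\<close>)
      qed (use b R \<eta> in \<open>auto simp: F_def\<close>)
      then show ?case by (auto simp: u_def)
    qed
    then have "AE z in hmeas. U z = 0" by (rule AE_lines_imp_AE) measurable
    then show ?case by (subst (asm) AE_hmeas_iff) auto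
  qed
qed

section \<open>Borel representatives on a ball\<close>

lemma AE_lborel_shift:
  fixes a :: "'a::euclidean_space"
  assumes "AE x in lborel. P x" shows "AE x in lborel. P (x + a)"
proof -
  have "AE x in distr lborel borel ((+) a). P x" using assms by (subst lborel_distr_plus)
  from AE_distrD[OF _ this] have "AE x in lborel. P (a + x)" by simp
  then show ?thesis by (simp only: add.commute)
qed

text \<open>A Borel version of \<open>f\<close> on \<open>ball a R\<close>, translated to the origin and extended by \<open>0\<close>.\<close>

definition local_rep :: "'a::euclidean_space \<Rightarrow> real \<Rightarrow> ('a \<Rightarrow> 'b::euclidean_space) \<Rightarrow> ('a \<Rightarrow> 'b) \<Rightarrow> bool" where
  "local_rep a R f F \<longleftrightarrow> F \<in> borel_measurable borel \<and> (\<forall>y. R \<le> norm y \<longrightarrow> F y = 0) \<and>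
     (AE x in lborel. norm (x - a) < R \<longrightarrow> F (x - a) = f x)"

lemma lebesgue_AE_eq_borel:
  fixes f :: "'a::euclidean_space \<Rightarrow> 'b::euclidean_space"
  assumes f: "f \<in> borel_measurable lebesgue"
  obtains g where "g \<in> borel_measurable borel" "AE x in lborel. f x = g x"
proof -
  have "\<exists>g. g \<in> borel_measurable lborel \<and> (AE x in lborel. f x \<bullet> b = g x)" for b
    using completion_ex_borel_measurable_real[of "\<lambda>x. f x \<bullet> b" lborel] f by auto
  then obtain g where g: "\<And>b. g b \<in> borel_measurable lborel" "\<And>b. AE x in lborel. f x \<bullet> b = g b x"
    by metis
  show thesis
  proof (rule that)
    show "(\<lambda>x. \<Sum>b\<in>Basis. g b x *\<^sub>R b) \<in> borel_measurable borel" using g(1) by measurable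
    have "AE x in lborel. \<forall>b\<in>Basis. f x \<bullet> b = g b x" by (rule AE_finite_allI) (auto simp: g(2))
    then show "AE x in lborel. f x = (\<Sum>b\<in>Basis. g b x *\<^sub>R b)"
    proof eventually_elim
      case (elim x)
      have "f x = (\<Sum>b\<in>Basis. (f x \<bullet> b) *\<^sub>R b)" by (simp add: euclidean_representation)
      also have "\<dots> = (\<Sum>b\<in>Basis. g b x *\<^sub>R b)" using elim by (intro sum.cong) auto
      finally show ?case .
    qed
  qed
qed

lemma local_rep_exists:
  fixes f :: "'a::euclidean_space \<Rightarrow> 'b::euclidean_space"
  assumes f: "set_borel_measurable lebesgue \<Omega> f" and sub: "ball a R \<subseteq> \<Omega>"
  obtains F where "local_rep a R f F"
proof -
  obtain g where [measurable]: "g \<in> borel_measurable borel" and g: "AE x in lborel. indicator \<Omega> x *\<^sub>R f x = g x"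
    using lebesgue_AE_eq_borel f unfolding set_borel_measurable_def by blast
  have [measurable]: "ball (0 :: 'a) R \<in> sets borel" by simp
  have "local_rep a R f (\<lambda>y. indicator (ball 0 R) y *\<^sub>R g (y + a))"
    unfolding local_rep_def
  proof (intro conjI allI impI)
    show "(\<lambda>y. indicator (ball 0 R) y *\<^sub>R g (y + a)) \<in> borel_measurable borel" by measurable
    show "AE x in lborel. norm (x - a) < R \<longrightarrow> indicator (ball 0 R) (x - a) *\<^sub>R g (x - a + a) = f x"
      using g
    proof (eventually_elim, intro impI)
      fix x assume g: "indicator \<Omega> x *\<^sub>R f x = g x" and x: "norm (x - a) < R"
      then have "x \<in> \<Omega>" using sub by (auto simp: dist_norm norm_minus_commute)
      then show "indicator (ball 0 R) (x - a) *\<^sub>R g (x - a + a) = f x" using g x by simp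
    qed
  qed simp
  then show thesis by (rule that)
qed

lemma local_rep_powr:
  fixes f :: "'a::euclidean_space \<Rightarrow> 'b::euclidean_space"
  assumes f: "Lp_loc p \<Omega> f" and sub: "cball a R \<subseteq> \<Omega>" and F: "local_rep a R f F"
  shows "(\<integral>\<^sup>+y. ennreal (norm (F y) powr p) \<partial>lborel) < \<infinity>"
proof -
  have [measurable]: "F \<in> borel_measurable borel" and F0: "\<And>y. R \<le> norm y \<Longrightarrow> F y = 0"
    and Fe: "AE x in lborel. norm (x - a) < R \<longrightarrow> F (x - a) = f x"
    using F by (auto simp: local_rep_def)
  have "(\<integral>\<^sup>+y. ennreal (norm (F y) powr p) \<partial>lborel) = (\<integral>\<^sup>+x. ennreal (norm (F (x + - a)) powr p) \<partial>lborel)"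
    by (rule nn_integral_lborel_shift[symmetric]) measurable
  also have "\<dots> \<le> (\<integral>\<^sup>+x. ennreal (norm (indicator (cball a R) x *\<^sub>R norm (f x) powr p)) \<partial>lborel)"
    using Fe by (intro nn_integral_mono_AE, eventually_elim)
      (auto simp: indicator_def dist_norm norm_minus_commute not_less F0 less_imp_le)
  also have "\<dots> = (\<integral>\<^sup>+x. ennreal (norm (indicator (cball a R) x *\<^sub>R norm (f x) powr p)) \<partial>lebesgue)"
    by (rule nn_integral_completion[symmetric])
  also have "\<dots> < \<infinity>"
  proof -
    have "set_integrable lebesgue (cball a R) (\<lambda>x. norm (f x) powr p)"
      using f sub compact_cball unfolding Lp_loc_def by blast
    then show ?thesis unfolding set_integrable_def integrable_iff_bounded by (rule conjunct2)
  qed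
  finally show ?thesis .
qed

lemma bounded_support_powr_less:
  fixes F :: "'a::euclidean_space \<Rightarrow> 'b::euclidean_space"
  assumes F [measurable]: "F \<in> borel_measurable borel" and F0: "\<And>y. R \<le> norm y \<Longrightarrow> F y = 0"
    and fin: "(\<integral>\<^sup>+y. ennreal (norm (F y) powr p) \<partial>lborel) < \<infinity>" and s: "0 < s" "s \<le> p"
  shows "(\<integral>\<^sup>+y. ennreal (norm (F y) powr s) \<partial>lborel) < \<infinity>"
proof -
  have [measurable]: "ball (0 :: 'a) R \<in> sets borel" by simp
  have "(\<integral>\<^sup>+y. ennreal (norm (F y) powr s) \<partial>lborel) \<le> (\<integral>\<^sup>+y. ennreal (norm (F y) powr p) + indicator (ball 0 R) y \<partial>lborel)"
  proof (rule nn_integral_mono)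
    fix y
    show "ennreal (norm (F y) powr s) \<le> ennreal (norm (F y) powr p) + indicator (ball 0 R) y"
    proof (cases "norm y < R")
      case True
      have "norm (F y) powr s \<le> norm (F y) powr p + 1"
      proof (cases "norm (F y) \<le> 1")
        case True
        then have "norm (F y) powr s \<le> 1" using s powr_mono2[of s "norm (F y)" 1] by simp
        then show ?thesis by (simp add: add_increasing)
      next
        case False
        then have "norm (F y) powr s \<le> norm (F y) powr p" using s by (intro powr_mono) auto
        then show ?thesis by simp
      qed
      then have "ennreal (norm (F y) powr s) \<le> ennreal (norm (F y) powr p + 1)" by (rule ennreal_leI)
      then show ?thesis using True by simp
    next
      case False
      then show ?thesis using s by (simp add: F0)
    qed
  qed
  also have "\<dots> = (\<integral>\<^sup>+y. ennreal (norm (F y) powr p) \<partial>lborel) + (\<integral>\<^sup>+y. indicator (ball (0 :: 'a) R) y \<partial>lborel)"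
    by (rule nn_integral_add) measurable
  also have "\<dots> < \<infinity>"
    using fin emeasure_bounded_finite[of "ball (0 :: 'a) R"] by simp
  finally show ?thesis .
qed

lemma local_rep_integrable:
  fixes f :: "'a::euclidean_space \<Rightarrow> 'b::euclidean_space"
  assumes f: "Lp_loc 1 \<Omega> f" and sub: "cball a R \<subseteq> \<Omega>" and F: "local_rep a R f F"
  shows "integrable lborel F"
  using local_rep_powr[OF f sub F] F unfolding integrable_iff_bounded local_rep_def by simp

lemma local_rep_pairing:
  fixes f \<phi> :: "'a::euclidean_space \<Rightarrow> complex"
  assumes f: "set_borel_measurable lebesgue \<Omega> f" and sub: "ball a R \<subseteq> \<Omega>" and F: "local_rep a R f F"
    and [measurable]: "\<phi> \<in> borel_measurable borel" and \<phi>: "\<And>x. R \<le> norm (x - a) \<Longrightarrow> \<phi> x = 0"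
  shows "(LINT x:\<Omega>|lebesgue. f x * \<phi> x) = (LINT y|lborel. F y * \<phi> (y + a))"
proof -
  have [measurable]: "F \<in> borel_measurable borel" and Fe: "AE x in lborel. norm (x - a) < R \<longrightarrow> F (x - a) = f x"
    using F by (auto simp: local_rep_def)
  have \<phi>L: "\<phi> \<in> borel_measurable lebesgue" by (rule measurable_completion) simp
  have "(LINT x:\<Omega>|lebesgue. f x * \<phi> x) = (LINT x|lebesgue. F (x - a) * \<phi> x)"
    unfolding set_lebesgue_integral_def
  proof (rule integral_cong_AE)
    have "(\<lambda>x. (indicator \<Omega> x *\<^sub>R f x) * \<phi> x) \<in> borel_measurable lebesgue"
      using f \<phi>L unfolding set_borel_measurable_def by (rule borel_measurable_times)
    then show "(\<lambda>x. indicator \<Omega> x *\<^sub>R (f x * \<phi> x)) \<in> borel_measurable lebesgue" by simp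
    have "(\<lambda>x. F (x - a) * \<phi> x) \<in> borel_measurable lborel" by measurable
    then show "(\<lambda>x. F (x - a) * \<phi> x) \<in> borel_measurable lebesgue" by (rule measurable_completion)
    show "AE x in lebesgue. indicator \<Omega> x *\<^sub>R (f x * \<phi> x) = F (x - a) * \<phi> x"
      unfolding AE_completion_iff using Fe
    proof eventually_elim
      case (elim x)
      show ?case
      proof (cases "norm (x - a) < R")
        case True
        then have "x \<in> \<Omega>" using sub by (auto simp: dist_norm norm_minus_commute)
        then show ?thesis using elim True by simp
      qed (simp add: \<phi>)
    qed
  qed
  also have "\<dots> = (LINT x|lborel. F (x - a) * \<phi> x)" by (rule integral_completion) measurable
  also have "\<dots> = (LINT y|lborel. F (y + a - a) * \<phi> (y + a))"
    by (rule lborel_integral_translate[symmetric]) measurable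
  finally show ?thesis by simp
qed

lemma frechet_derivative_eta:
  "frechet_derivative (\<lambda>y. complex_of_real (eta \<delta> (x - y))) (at y) = (\<lambda>h. - of_real (etad \<delta> (x - y) \<bullet> h))"
proof -
  have "((\<lambda>y. x - y) has_derivative (\<lambda>h. - h)) (at y)" by (auto intro!: derivative_eq_intros)
  from has_derivative_of_real[OF has_derivative_compose[OF this eta_deriv]]
  have "((\<lambda>y. complex_of_real (eta \<delta> (x - y))) has_derivative (\<lambda>h. of_real (etad \<delta> (x - y) \<bullet> (- h)))) (at y)" .
  from frechet_derivative_at[OF this] show ?thesis by simp
qed

lemma pairing_eta:
  fixes f :: "'a::euclidean_space \<Rightarrow> complex"
  assumes f: "set_borel_measurable lebesgue \<Omega> f" and sub: "ball a R \<subseteq> \<Omega>" and F: "local_rep a R f F"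
    and \<delta>: "0 < \<delta>" "norm x + \<delta> < R"
  shows "(LINT y:\<Omega>|lebesgue. f y * of_real (eta \<delta> (x + a - y))) = (LINT y|lborel. F y * of_real (eta \<delta> (x - y)))"
    and "(LINT y:\<Omega>|lebesgue. f y * - of_real (etad \<delta> (x + a - y) \<bullet> b)) = - (LINT y|lborel. F y * of_real (etad \<delta> (x - y) \<bullet> b))"
    and "(LINT y:\<Omega>|lebesgue. f y * ((- of_real (etad \<delta> (x + a - y) \<bullet> b) + \<i> * - of_real (etad \<delta> (x + a - y) \<bullet> b')) / 2))
       = (LINT y|lborel. F y * ((- of_real (etad \<delta> (x - y) \<bullet> b) + \<i> * - of_real (etad \<delta> (x - y) \<bullet> b')) / 2))"
proof -
  have far: "\<delta> \<le> norm (x + a - y)" if "R \<le> norm (y - a)" for y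
  proof -
    have "norm (x + a - y) = norm (y - a - x)" using norm_minus_commute[of "x + a" y] by (simp add: diff_diff_eq add.commute)
    then show ?thesis using that \<delta> norm_triangle_ineq2[of "y - a" x] by linarith
  qed
  have far': "x + a - (y + a) = x - y" for y by simp
  note z = eta_zero[OF \<delta>(1) far] etad_zero[OF \<delta>(1) far]
  show "(LINT y:\<Omega>|lebesgue. f y * of_real (eta \<delta> (x + a - y))) = (LINT y|lborel. F y * of_real (eta \<delta> (x - y)))"
    by (subst local_rep_pairing[OF f sub F]) (simp_all add: z far')
  show "(LINT y:\<Omega>|lebesgue. f y * - of_real (etad \<delta> (x + a - y) \<bullet> b)) = - (LINT y|lborel. F y * of_real (etad \<delta> (x - y) \<bullet> b))"
    by (subst local_rep_pairing[OF f sub F]) (simp_all add: z far')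
  show "(LINT y:\<Omega>|lebesgue. f y * ((- of_real (etad \<delta> (x + a - y) \<bullet> b) + \<i> * - of_real (etad \<delta> (x + a - y) \<bullet> b')) / 2))
       = (LINT y|lborel. F y * ((- of_real (etad \<delta> (x - y) \<bullet> b) + \<i> * - of_real (etad \<delta> (x - y) \<bullet> b')) / 2))"
    by (subst local_rep_pairing[OF f sub F]) (simp_all add: z far')
qed

lemma test_function_shifted_eta:
  fixes a :: "'a::euclidean_space"
  assumes sub: "cball a R \<subseteq> \<Omega>" and \<delta>: "0 < \<delta>" "norm x + \<delta> < R"
  shows "test_function \<Omega> (\<lambda>y. complex_of_real (eta \<delta> (x + a - y)))"
proof (rule test_function_eta[OF \<delta>(1)])
  have "cball (x + a) \<delta> \<subseteq> cball a R"
    using \<delta> by (simp add: cball_subset_cball_iff dist_norm)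
  then show "cball (x + a) \<delta> \<subseteq> \<Omega>" using sub by blast
qed

lemma weakdbar_local_rep:
  fixes u :: "complex ^ 'n \<Rightarrow> complex"
  assumes w: "\<And>j. has_weak_dbar \<Omega> j u (D j)" and sub: "cball a R \<subseteq> \<Omega>"
    and U: "local_rep a R u U" and E: "\<And>j. local_rep a R (D j) (E j)"
  shows "weakdbar R U E"
  unfolding weakdbar_def
proof (intro allI impI)
  fix j :: 'n and \<delta> :: real and x :: "complex ^ 'n"
  assume \<delta>: "0 < \<delta>" "norm x + \<delta> < R"
  have sub': "ball a R \<subseteq> \<Omega>" using sub ball_subset_cball by blast
  have m: "set_borel_measurable lebesgue \<Omega> u" "set_borel_measurable lebesgue \<Omega> (D j)"
    using w[of j] unfolding has_weak_dbar_def Lp_loc_def by auto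
  let ?\<phi> = "\<lambda>y. complex_of_real (eta \<delta> (x + a - y))"
  have "(LINT y:\<Omega>|lebesgue. u y * dbar j ?\<phi> y) = - (LINT y:\<Omega>|lebesgue. D j y * ?\<phi> y)"
    using w[of j] test_function_shifted_eta[OF sub \<delta>] unfolding has_weak_dbar_def by blast
  then have "(LINT y|lborel. U y * ((- of_real (etad \<delta> (x - y) \<bullet> axis j 1) + \<i> * - of_real (etad \<delta> (x - y) \<bullet> axis j \<i>)) / 2))
    = - (LINT y|lborel. E j y * of_real (eta \<delta> (x - y)))"
    unfolding dbar_def frechet_derivative_eta pairing_eta(3)[OF m(1) sub' U \<delta>] pairing_eta(1)[OF m(2) sub' E \<delta>] .
  moreover have "(LINT y|lborel. U y * ((- of_real (etad \<delta> (x - y) \<bullet> axis j 1) + \<i> * - of_real (etad \<delta> (x - y) \<bullet> axis j \<i>)) / 2))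
    = - (LINT y|lborel. U y * ((of_real (etad \<delta> (x - y) \<bullet> axis j 1) + \<i> * of_real (etad \<delta> (x - y) \<bullet> axis j \<i>)) / 2))"
    unfolding Bochner_Integration.integral_minus[symmetric]
    by (rule Bochner_Integration.integral_cong) (simp_all add: algebra_simps add_divide_distrib diff_divide_distrib)
  ultimately show "(LINT y|lborel. U y * ((of_real (etad \<delta> (x - y) \<bullet> axis j 1) + \<i> * of_real (etad \<delta> (x - y) \<bullet> axis j \<i>)) / 2))
      = (LINT y|lborel. E j y * of_real (eta \<delta> (x - y)))" by simp
qed

lemma weak_partial_local_rep:
  fixes u :: "'a::euclidean_space \<Rightarrow> complex"
  assumes w: "has_weak_partial \<Omega> b u g" and sub: "cball a R \<subseteq> \<Omega>"
    and U: "local_rep a R u U" and G: "local_rep a R g G"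
    and \<delta>: "0 < \<delta>" "norm x + \<delta> < R"
  shows "(LINT y|lborel. U y * of_real (etad \<delta> (x - y) \<bullet> b)) = (LINT y|lborel. G y * of_real (eta \<delta> (x - y)))"
proof -
  have sub': "ball a R \<subseteq> \<Omega>" using sub ball_subset_cball by blast
  have m: "set_borel_measurable lebesgue \<Omega> u" "set_borel_measurable lebesgue \<Omega> g"
    using w unfolding has_weak_partial_def Lp_loc_def by auto
  let ?\<phi> = "\<lambda>y. complex_of_real (eta \<delta> (x + a - y))"
  have "(LINT y:\<Omega>|lebesgue. u y * frechet_derivative ?\<phi> (at y) b) = - (LINT y:\<Omega>|lebesgue. g y * ?\<phi> y)"
    using w test_function_shifted_eta[OF sub \<delta>] unfolding has_weak_partial_def by blast
  then show ?thesis
    unfolding frechet_derivative_eta pairing_eta(2)[OF m(1) sub' U \<delta>] pairing_eta(1)[OF m(2) sub' G \<delta>] by simp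
qed

text \<open>The mollifications converge in \<open>L\<^sup>1\<close>, so functions with the same mollifications coincide almost everywhere.\<close>

lemma moll_determines:
  fixes F G :: "'a::euclidean_space \<Rightarrow> complex"
  assumes F: "integrable lborel F" and G: "integrable lborel G"
    and eq: "\<And>\<delta> x. 0 < \<delta> \<Longrightarrow> norm x + \<delta> < R \<Longrightarrow> moll \<delta> F x = moll \<delta> G x"
  shows "AE x in lborel. norm x < R \<longrightarrow> F x = G x"
proof -
  have [measurable]: "F \<in> borel_measurable borel" "G \<in> borel_measurable borel"
    using F G by (auto dest: borel_measurable_integrable)
  define d where "d n = inverse (real (Suc n))" for n
  have d: "d \<longlonglongrightarrow> 0" "\<And>n. d n > 0" unfolding d_def by (rule LIMSEQ_inverse_real_of_nat) simp
  note mF = moll_L1_tendsto[OF F d] and mG = moll_L1_tendsto[OF G d]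
  have [measurable]: "moll (d n) F \<in> borel_measurable borel" "moll (d n) G \<in> borel_measurable borel" for n
    using moll_measurable[OF F d(2)] moll_measurable[OF G d(2)] by auto
  have "AE x in lborel. norm x + d m < R \<longrightarrow> F x = G x" for m
  proof -
    have [measurable]: "{x :: 'a. norm x + d m < R} \<in> sets borel" by measurable
    define J where "J = (\<integral>\<^sup>+x. ennreal (norm (F x - G x)) * indicator {x. norm x + d m < R} x \<partial>lborel)"
    have "J \<le> (\<integral>\<^sup>+x. ennreal (norm (moll (d n) F x - F x)) \<partial>lborel) + (\<integral>\<^sup>+x. ennreal (norm (moll (d n) G x - G x)) \<partial>lborel)" if "n \<ge> m" for n
    proof -
      have "J \<le> (\<integral>\<^sup>+x. ennreal (norm (moll (d n) F x - F x)) + ennreal (norm (moll (d n) G x - G x)) \<partial>lborel)"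
        unfolding J_def
      proof (rule nn_integral_mono)
        fix x
        show "ennreal (norm (F x - G x)) * indicator {x. norm x + d m < R} x \<le> ennreal (norm (moll (d n) F x - F x)) + ennreal (norm (moll (d n) G x - G x))"
        proof (cases "norm x + d m < R")
          case True
          have "d n \<le> d m" using that by (simp add: d_def)
          then have "moll (d n) F x = moll (d n) G x" using True d(2) by (intro eq) auto
          then have "norm (F x - G x) \<le> norm (moll (d n) F x - F x) + norm (moll (d n) G x - G x)"
            using norm_triangle_ineq4[of "moll (d n) G x - G x" "moll (d n) F x - F x"] by simp
          then have "ennreal (norm (F x - G x)) \<le> ennreal (norm (moll (d n) F x - F x) + norm (moll (d n) G x - G x))" by (rule ennreal_leI)
          then show ?thesis using True by simp
        qed simp
      qed
      also have "\<dots> = (\<integral>\<^sup>+x. ennreal (norm (moll (d n) F x - F x)) \<partial>lborel) + (\<integral>\<^sup>+x. ennreal (norm (moll (d n) G x - G x)) \<partial>lborel)"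
        by (rule nn_integral_add) measurable
      finally show ?thesis .
    qed
    then have "J \<le> 0 + 0"
      by (intro tendsto_lowerbound[OF tendsto_add[OF mF mG]]) (auto simp: eventually_sequentially)
    then have "J = 0" by simp
    then have "AE x in lborel. ennreal (norm (F x - G x)) * indicator {x. norm x + d m < R} x = 0"
      unfolding J_def by (subst (asm) nn_integral_0_iff_AE) auto
    then show ?thesis by eventually_elim (auto simp: indicator_def split: if_splits)
  qed
  then have "AE x in lborel. \<forall>m. norm x + d m < R \<longrightarrow> F x = G x" unfolding AE_all_countable by blast
  then show ?thesis
  proof (eventually_elim, intro impI)
    fix x assume x: "\<forall>m. norm x + d m < R \<longrightarrow> F x = G x" "norm x < R"
    then obtain m where "d m < R - norm x"
      using reals_Archimedean[of "R - norm x"] by (auto simp: d_def)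
    then have "norm x + d m < R" by linarith
    then show "F x = G x" using x(1) by blast
  qed
qed

section \<open>Powers of the distance against infinite order vanishing\<close>

lemma dyadic_shell:
  fixes x r :: real
  assumes "0 < x" "x < r"
  obtains k :: nat where "r * (1/2) ^ Suc k \<le> x" "x < r * (1/2) ^ k"
proof -
  have r: "r > 0" using assms by simp
  obtain n where "(1/2) ^ n < x / r" using real_arch_pow_inv[of "x / r" "1/2"] assms r by auto
  then have ex: "\<exists>n::nat. r * (1/2) ^ n \<le> x" using r by (auto simp: field_simps intro!: exI[of _ n])
  define n0 where "n0 = (LEAST n::nat. r * (1/2) ^ n \<le> x)"
  have n0: "r * (1/2) ^ n0 \<le> x" unfolding n0_def using ex by (rule LeastI_ex)
  then have "n0 \<noteq> 0" using assms by (cases n0) auto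
  then obtain k where k: "n0 = Suc k" by (cases n0) auto
  have "\<not> r * (1/2) ^ k \<le> x" using not_less_Least[of k "\<lambda>n. r * (1/2) ^ n \<le> x"] k unfolding n0_def by simp
  then show thesis using n0 unfolding k by (intro that[of k]) auto
qed

text \<open>The weight is comparable to a constant on each dyadic shell, and the integral of \<open>f\<close> over the ball that contains the
shell decays faster than the weight grows.\<close>

lemma flat_weighted_L1:
  fixes f :: "'a::euclidean_space \<Rightarrow> real"
  assumes [measurable]: "f \<in> borel_measurable borel" and f0: "\<And>z. f z \<ge> 0"
    and fin: "(\<integral>\<^sup>+z. ennreal (f z) \<partial>lborel) < \<infinity>"
    and flat: "\<And>m::nat. \<exists>r0>0. \<forall>r. 0 < r \<and> r < r0 \<longrightarrow> (\<integral>\<^sup>+z. ennreal (f z) * indicator (ball 0 r) z \<partial>lborel) \<le> ennreal (r ^ m)"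
  shows "(\<integral>\<^sup>+z. ennreal (f z * norm z powr (- real M)) \<partial>lborel) < \<infinity>"
proof -
  obtain r0 where r0: "r0 > 0" and fl: "\<And>r. 0 < r \<Longrightarrow> r < r0 \<Longrightarrow> (\<integral>\<^sup>+z. ennreal (f z) * indicator (ball 0 r) z \<partial>lborel) \<le> ennreal (r ^ Suc M)"
    using flat[of "Suc M"] by blast
  define r where "r = r0 / 2"
  have r: "0 < r" "r < r0" using r0 by (auto simp: r_def)
  define s where "s k = r * (1/2) ^ k" for k :: nat
  have s: "0 < s k" "s k < r0" "s (Suc k) = s k / 2" for k
  proof -
    show "0 < s k" "s (Suc k) = s k / 2" using r by (auto simp: s_def)
    have "s k \<le> r * 1" unfolding s_def using r by (intro mult_left_mono power_le_one) auto
    then show "s k < r0" using r by simp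
  qed
  have [measurable]: "ball (0 :: 'a) t \<in> sets borel" for t by simp
  define c where "c k = ennreal (s (Suc k) powr (- real M))" for k
  have pw: "ennreal (f z * norm z powr (- real M)) \<le> (\<Sum>k. c k * (ennreal (f z) * indicator (ball 0 (s k)) z)) + ennreal (r powr (- real M)) * ennreal (f z)"
    if z: "z \<noteq> 0" for z
  proof (cases "norm z < r")
    case True
    obtain k where k: "s (Suc k) \<le> norm z" "norm z < s k"
      using dyadic_shell[of "norm z" r] True z unfolding s_def by auto
    have "norm z powr (- real M) \<le> s (Suc k) powr (- real M)"
      using k s(1)[of "Suc k"] by (intro powr_mono2') auto
    then have "f z * norm z powr (- real M) \<le> s (Suc k) powr (- real M) * f z" using f0[of z] by (subst mult.commute) (rule mult_right_mono)
    then have "ennreal (f z * norm z powr (- real M)) \<le> c k * (ennreal (f z) * indicator (ball 0 (s k)) z)"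
      using k f0[of z] by (simp add: c_def ennreal_mult''[symmetric] ennreal_leI)
    also have "\<dots> \<le> (\<Sum>k. c k * (ennreal (f z) * indicator (ball 0 (s k)) z))"
      using sum_le_suminf[of "\<lambda>k. c k * (ennreal (f z) * indicator (ball 0 (s k)) z)" "{k}"] by simp
    finally show ?thesis by (rule add_increasing2[rotated]) simp
  next
    case False
    have "norm z powr (- real M) \<le> r powr (- real M)"
      using False r by (intro powr_mono2') auto
    then have "f z * norm z powr (- real M) \<le> r powr (- real M) * f z" using f0[of z] by (subst mult.commute) (rule mult_right_mono)
    then have "ennreal (f z * norm z powr (- real M)) \<le> ennreal (r powr (- real M)) * ennreal (f z)"
      using f0[of z] by (simp add: ennreal_mult''[symmetric] ennreal_leI)
    then show ?thesis by (rule add_increasing[rotated]) simp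
  qed
  have "(\<integral>\<^sup>+z. ennreal (f z * norm z powr (- real M)) \<partial>lborel)
     \<le> (\<integral>\<^sup>+z. (\<Sum>k. c k * (ennreal (f z) * indicator (ball 0 (s k)) z)) + ennreal (r powr (- real M)) * ennreal (f z) \<partial>lborel)"
  proof (rule nn_integral_mono_AE)
    have "AE z in (lborel :: 'a measure). z \<noteq> 0" by (rule AE_lborel_singleton)
    then show "AE z in lborel. ennreal (f z * norm z powr (- real M)) \<le> (\<Sum>k. c k * (ennreal (f z) * indicator (ball 0 (s k)) z)) + ennreal (r powr (- real M)) * ennreal (f z)"
      by eventually_elim (rule pw)
  qed
  also have "\<dots> = (\<integral>\<^sup>+z. (\<Sum>k. c k * (ennreal (f z) * indicator (ball 0 (s k)) z)) \<partial>lborel) + (\<integral>\<^sup>+z. ennreal (r powr (- real M)) * ennreal (f z) \<partial>lborel)"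
    by (rule nn_integral_add) measurable
  also have "(\<integral>\<^sup>+z. ennreal (r powr (- real M)) * ennreal (f z) \<partial>lborel) = ennreal (r powr (- real M)) * (\<integral>\<^sup>+z. ennreal (f z) \<partial>lborel)"
    by (rule nn_integral_cmult) measurable
  also have "(\<integral>\<^sup>+z. (\<Sum>k. c k * (ennreal (f z) * indicator (ball 0 (s k)) z)) \<partial>lborel)
     = (\<Sum>k. \<integral>\<^sup>+z. c k * (ennreal (f z) * indicator (ball 0 (s k)) z) \<partial>lborel)"
    by (rule nn_integral_suminf) measurable
  also have "\<dots> \<le> (\<Sum>k. ennreal (2 ^ M * r * (1/2) ^ k))"
  proof (rule suminf_le)
    fix k
    have "(\<integral>\<^sup>+z. c k * (ennreal (f z) * indicator (ball 0 (s k)) z) \<partial>lborel) = c k * (\<integral>\<^sup>+z. ennreal (f z) * indicator (ball 0 (s k)) z \<partial>lborel)"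
      by (rule nn_integral_cmult) measurable
    also have "\<dots> \<le> c k * ennreal (s k ^ Suc M)" by (intro mult_left_mono fl s) simp
    also have "\<dots> = ennreal (s (Suc k) powr (- real M) * s k ^ Suc M)"
      using s(1)[of k] by (simp add: c_def ennreal_mult)
    also have "s (Suc k) powr (- real M) = inverse ((s k / 2) ^ M)"
      using s(1)[of k] by (simp add: s(3) powr_minus powr_realpow)
    also have "inverse ((s k / 2) ^ M) * s k ^ Suc M = 2 ^ M * s k"
      using s(1)[of k] by (simp add: power_divide)
    finally show "(\<integral>\<^sup>+z. c k * (ennreal (f z) * indicator (ball 0 (s k)) z) \<partial>lborel) \<le> ennreal (2 ^ M * r * (1/2) ^ k)"
      by (simp add: s_def mult_ac)
  qed auto
  also have "\<dots> = ennreal (\<Sum>k. 2 ^ M * r * (1/2) ^ k)"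
    using r by (intro suminf_ennreal2) (auto intro!: summable_mult summable_geometric)
  finally have "(\<integral>\<^sup>+z. ennreal (f z * norm z powr (- real M)) \<partial>lborel)
     \<le> ennreal (\<Sum>k. 2 ^ M * r * (1/2) ^ k) + ennreal (r powr (- real M)) * (\<integral>\<^sup>+z. ennreal (f z) \<partial>lborel)" by (simp add: add_right_mono)
  also have "\<dots> < \<infinity>" using fin by (simp add: ennreal_mult_less_top)
  finally show ?thesis .
qed

text \<open>Infinite order in the sense of \<open>L\<^sup>1\<close> is turned into infinite order in the sense of \<open>L\<^sup>2\<close> by interpolation with the
integrability exponent \<open>q > 2\<close>.\<close>

lemma flat_weighted_L2:
  fixes f :: "'a::euclidean_space \<Rightarrow> real"
  assumes [measurable]: "f \<in> borel_measurable borel" and f0: "\<And>z. f z \<ge> 0"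
    and L1: "(\<integral>\<^sup>+z. ennreal (f z) \<partial>lborel) < \<infinity>"
    and flat: "\<And>m::nat. \<exists>r0>0. \<forall>r. 0 < r \<and> r < r0 \<longrightarrow> (\<integral>\<^sup>+z. ennreal (f z) * indicator (ball 0 r) z \<partial>lborel) \<le> ennreal (r ^ m)"
    and q: "q > 2" and Lq: "(\<integral>\<^sup>+z. ennreal (f z powr q) \<partial>lborel) < \<infinity>"
  shows "(\<integral>\<^sup>+z. ennreal ((f z)\<^sup>2 * norm z powr (- real M)) \<partial>lborel) < \<infinity>"
proof -
  \<comment> \<open>If \<open>f powr (q - 2)\<close> exceeds the weight, then \<open>f\<^sup>2\<close> times the weight is at most \<open>f powr q\<close>. Otherwise one
    of the two factors \<open>f\<close> is at most \<open>norm z powr (- M / (q - 2))\<close>, which leads to the exponent \<open>b\<close>.\<close>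
  define b where "b = real M * (1 + 1 / (q - 2))"
  obtain M' :: nat where M': "b \<le> real M'" using real_arch_simple by blast
  have pw: "(f z)\<^sup>2 * norm z powr (- real M) \<le> f z powr q + f z + f z * norm z powr (- real M')" if z: "z \<noteq> 0" for z
  proof -
    define x where "x = f z"
    define A where "A = norm z powr (- real M)"
    have x: "x \<ge> 0" and A: "A > 0" using f0 z by (auto simp: x_def A_def)
    have main: "x\<^sup>2 * A \<le> x powr q + x * norm z powr (- b)"
    proof (cases "x = 0")
      case False
      then have x: "x > 0" using x by simp
      show ?thesis
      proof (cases "A \<le> x powr (q - 2)")
        case True
        have "x\<^sup>2 * A \<le> x\<^sup>2 * x powr (q - 2)" using True by (intro mult_left_mono) auto
        also have "x\<^sup>2 = x powr 2" using x by simp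
        also have "x powr 2 * x powr (q - 2) = x powr q" by (simp add: powr_add[symmetric])
        finally show ?thesis using x by (simp add: add_increasing2)
      next
        case False
        have "x = (x powr (q - 2)) powr (1 / (q - 2))" using x q by (simp add: powr_powr)
        also have "\<dots> \<le> A powr (1 / (q - 2))" using False q by (intro powr_mono2) auto
        finally have xA: "x \<le> A powr (1 / (q - 2))" .
        have "x\<^sup>2 * A = x * (x * A)" by (simp add: power2_eq_square)
        also have "\<dots> \<le> x * (A powr (1 / (q - 2)) * A)" using xA x A by (intro mult_left_mono mult_right_mono) auto
        also have "A powr (1 / (q - 2)) * A = A powr (1 / (q - 2)) * A powr 1" using A by simp
        also have "\<dots> = A powr (1 + 1 / (q - 2))" by (simp only: powr_add[symmetric] add.commute)
        also have "\<dots> = norm z powr (- b)" by (simp add: A_def b_def powr_powr)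
        finally show ?thesis by (simp add: add_increasing)
      qed
    qed simp
    have "norm z powr (- b) \<le> 1 + norm z powr (- real M')"
    proof (cases "norm z \<le> 1")
      case True
      have "norm z powr (- b) \<le> norm z powr (- real M')" using True M' z by (intro powr_mono') auto
      then show ?thesis by simp
    next
      case False
      have "0 \<le> b" using q by (simp add: b_def)
      then have "norm z powr (- b) \<le> norm z powr 0" using False by (intro powr_mono) auto
      also have "\<dots> = 1" using z by simp
      finally show ?thesis by (simp add: add_increasing2)
    qed
    then have "x * norm z powr (- b) \<le> x * (1 + norm z powr (- real M'))" using x by (rule mult_left_mono)
    then show ?thesis using main by (simp add: x_def A_def distrib_left)
  qed
  have "(\<integral>\<^sup>+z. ennreal ((f z)\<^sup>2 * norm z powr (- real M)) \<partial>lborel)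
     \<le> (\<integral>\<^sup>+z. ennreal (f z powr q) + (ennreal (f z) + ennreal (f z * norm z powr (- real M'))) \<partial>lborel)"
  proof (rule nn_integral_mono_AE)
    have "AE z in (lborel :: 'a measure). z \<noteq> 0" by (rule AE_lborel_singleton)
    then show "AE z in lborel. ennreal ((f z)\<^sup>2 * norm z powr (- real M)) \<le> ennreal (f z powr q) + (ennreal (f z) + ennreal (f z * norm z powr (- real M')))"
    proof eventually_elim
      case (elim z)
      have "ennreal ((f z)\<^sup>2 * norm z powr (- real M)) \<le> ennreal (f z powr q + f z + f z * norm z powr (- real M'))"
        by (intro ennreal_leI pw elim)
      then show ?case using f0[of z] by (simp add: ennreal_plus add.assoc)
    qed
  qed
  also have "\<dots> = (\<integral>\<^sup>+z. ennreal (f z powr q) \<partial>lborel) + (\<integral>\<^sup>+z. ennreal (f z) + ennreal (f z * norm z powr (- real M')) \<partial>lborel)"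
    by (rule nn_integral_add) measurable
  also have "(\<integral>\<^sup>+z. ennreal (f z) + ennreal (f z * norm z powr (- real M')) \<partial>lborel) = (\<integral>\<^sup>+z. ennreal (f z) \<partial>lborel) + (\<integral>\<^sup>+z. ennreal (f z * norm z powr (- real M')) \<partial>lborel)"
    by (rule nn_integral_add) measurable
  also have "(\<integral>\<^sup>+z. ennreal (f z powr q) \<partial>lborel) + \<dots> < \<infinity>"
    using Lq L1 flat_weighted_L1[OF _ f0 L1 flat, of M'] by simp
  finally show ?thesis .
qed

section \<open>Unique continuation\<close>

text \<open>The hypothesis on \<open>D\<close> only provides local integrability. The Sobolev hypothesis provides all real partial derivatives with
exponent \<open>p\<close>, and the combination of these has the same mollifications as the weak derivative \<open>D j\<close>.\<close>

lemma dbar_square_integrable: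
  fixes u :: "complex ^ 'n \<Rightarrow> complex"
  assumes W: "W1p_loc p \<Omega> u" and p: "p \<ge> 2"
    and w: "\<And>j. has_weak_dbar \<Omega> j u (D j)" and sub: "cball a R \<subseteq> \<Omega>"
    and U: "local_rep a R u U" and E: "\<And>j. local_rep a R (D j) (E j)"
  shows "(\<integral>\<^sup>+y. ennreal ((norm (E j y))\<^sup>2) \<partial>lborel) < \<infinity>"
proof -
  have sub': "ball a R \<subseteq> \<Omega>" using sub ball_subset_cball by blast
  have B: "axis j 1 \<in> (Basis :: (complex ^ 'n) set)" "axis j \<i> \<in> (Basis :: (complex ^ 'n) set)"
    by (auto simp: axis_in_Basis_iff Basis_complex_def)
  obtain g1 g2 where g: "has_weak_partial \<Omega> (axis j 1) u g1" "Lp_loc p \<Omega> g1"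
    "has_weak_partial \<Omega> (axis j \<i>) u g2" "Lp_loc p \<Omega> g2"
    using W B unfolding W1p_loc_def by blast
  have L1: "Lp_loc 1 \<Omega> u" "Lp_loc 1 \<Omega> g1" "Lp_loc 1 \<Omega> g2" "Lp_loc 1 \<Omega> (D j)"
    using g w[of j] unfolding has_weak_partial_def has_weak_dbar_def by auto
  obtain G1 where G1: "local_rep a R g1 G1"
    using local_rep_exists[OF _ sub'] g(2) unfolding Lp_loc_def by blast
  obtain G2 where G2: "local_rep a R g2 G2"
    using local_rep_exists[OF _ sub'] g(4) unfolding Lp_loc_def by blast
  have int: "integrable lborel U" "integrable lborel G1" "integrable lborel G2" "integrable lborel (E j)"
    using local_rep_integrable[OF L1(1) sub U] local_rep_integrable[OF L1(2) sub G1]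
      local_rep_integrable[OF L1(3) sub G2] local_rep_integrable[OF L1(4) sub E] by auto
  have [measurable]: "G1 \<in> borel_measurable borel" "G2 \<in> borel_measurable borel"
    using G1 G2 by (auto simp: local_rep_def)
  have sq: "(\<integral>\<^sup>+y. ennreal ((norm (G y))\<^sup>2) \<partial>lborel) < \<infinity>" if "Lp_loc p \<Omega> g" "local_rep a R g G" for g G :: "complex ^ 'n \<Rightarrow> complex"
    using bounded_support_powr_less[of G R p 2] local_rep_powr[OF that(1) sub that(2)] that(2) p
    by (simp add: local_rep_def)
  have dist: "z * ((v + \<i> * w) / 2) = (z * v + \<i> * (z * w)) / 2" "(v * z + \<i> * (w * z)) / 2 = (v + \<i> * w) / 2 * z" for z v w :: complex
    by (simp_all add: field_simps)
  define G where "G y = (G1 y + \<i> * G2 y) / 2" for y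
  have intG: "integrable lborel G" unfolding G_def using int by simp
  have "AE y in lborel. norm y < R \<longrightarrow> E j y = G y"
  proof (rule moll_determines[OF int(4) intG])
    fix \<delta> and x :: "complex ^ 'n" assume \<delta>: "0 < \<delta>" "norm x + \<delta> < R"
    note i = integrable_moll[OF int(1) \<delta>(1)] integrable_moll[OF int(2) \<delta>(1)] integrable_moll[OF int(3) \<delta>(1)]
    have "(LINT y|lborel. E j y * of_real (eta \<delta> (x - y)))
      = (LINT y|lborel. U y * ((of_real (etad \<delta> (x - y) \<bullet> axis j 1) + \<i> * of_real (etad \<delta> (x - y) \<bullet> axis j \<i>)) / 2))"
      by (rule weakdbar_local_rep[OF w sub U E, unfolded weakdbar_def, rule_format, OF \<delta>, symmetric])
    also have "\<dots> = (LINT y|lborel. (U y * of_real (etad \<delta> (x - y) \<bullet> axis j 1) + \<i> * (U y * of_real (etad \<delta> (x - y) \<bullet> axis j \<i>))) / 2)"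
      by (simp only: dist(1))
    also have "\<dots> = ((LINT y|lborel. U y * of_real (etad \<delta> (x - y) \<bullet> axis j 1)) + \<i> * (LINT y|lborel. U y * of_real (etad \<delta> (x - y) \<bullet> axis j \<i>))) / 2"
      using i by simp
    also have "\<dots> = ((LINT y|lborel. G1 y * of_real (eta \<delta> (x - y))) + \<i> * (LINT y|lborel. G2 y * of_real (eta \<delta> (x - y)))) / 2"
      by (simp only: weak_partial_local_rep[OF g(1) sub U G1 \<delta>] weak_partial_local_rep[OF g(3) sub U G2 \<delta>])
    also have "\<dots> = (LINT y|lborel. (G1 y * of_real (eta \<delta> (x - y)) + \<i> * (G2 y * of_real (eta \<delta> (x - y)))) / 2)"
      using i by simp
    also have "\<dots> = (LINT y|lborel. G y * of_real (eta \<delta> (x - y)))"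
      by (simp only: dist(2) G_def)
    finally show "moll \<delta> (E j) x = moll \<delta> G x" by (simp add: moll_def)
  qed
  then have "(\<integral>\<^sup>+y. ennreal ((norm (E j y))\<^sup>2) \<partial>lborel) \<le> (\<integral>\<^sup>+y. ennreal ((norm (G1 y))\<^sup>2) + ennreal ((norm (G2 y))\<^sup>2) \<partial>lborel)"
  proof (intro nn_integral_mono_AE, eventually_elim)
    case (elim y)
    show ?case
    proof (cases "norm y < R")
      case True
      have Gy: "E j y = G y" using elim True by blast
      have "norm (E j y) = norm (G1 y + \<i> * G2 y) / 2" unfolding Gy G_def by (simp add: norm_divide)
      also have "\<dots> \<le> (norm (G1 y) + norm (G2 y)) / 2"
        using norm_triangle_ineq[of "G1 y" "\<i> * G2 y"] by (simp add: norm_mult)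
      finally have "norm (E j y) \<le> (norm (G1 y) + norm (G2 y)) / 2" .
      then have "(norm (E j y))\<^sup>2 \<le> ((norm (G1 y) + norm (G2 y)) / 2)\<^sup>2" by (intro power_mono) auto
      also have "\<dots> \<le> (norm (G1 y))\<^sup>2 + (norm (G2 y))\<^sup>2"
      proof -
        have "(p / 2 + q / 2)\<^sup>2 \<le> p\<^sup>2 + q\<^sup>2" for p q :: real
        proof -
          have "p\<^sup>2 + q\<^sup>2 - (p / 2 + q / 2)\<^sup>2 = (p\<^sup>2 + q\<^sup>2) / 2 + ((p - q) / 2)\<^sup>2"
            by (simp add: power2_eq_square field_simps)
          also have "\<dots> \<ge> 0" by simp
          finally show ?thesis by simp
        qed
        from this[of "norm (G1 y)" "norm (G2 y)"] show ?thesis by (simp add: add_divide_distrib)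
      qed
      finally show ?thesis by (simp add: ennreal_plus[symmetric] ennreal_leI del: ennreal_plus)
    next
      case False
      then have "E j y = 0" using E[of j] by (auto simp: local_rep_def)
      then show ?thesis by simp
    qed
  qed
  also have "\<dots> = (\<integral>\<^sup>+y. ennreal ((norm (G1 y))\<^sup>2) \<partial>lborel) + (\<integral>\<^sup>+y. ennreal ((norm (G2 y))\<^sup>2) \<partial>lborel)"
    by (rule nn_integral_add) measurable
  also have "\<dots> < \<infinity>" using sq[OF g(2) G1] sq[OF g(4) G2] by simp
  finally show ?thesis .
qed

text \<open>The exponent \<open>Suc m\<close> in the definition of infinite order is used; then \<open>r ^ Suc m \<le> r ^ m\<close> for \<open>r < 1\<close>, and the case
\<open>m = 0\<close> is included.\<close>

lemma flat_local_rep: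
  fixes u :: "'a::euclidean_space \<Rightarrow> complex"
  assumes v: "vanishes_to_infinite_order 1 \<Omega> u a" and R: "R > 0" and sub: "cball a R \<subseteq> \<Omega>"
    and U: "local_rep a R u U"
  shows "\<exists>r0>0. \<forall>r. 0 < r \<and> r < r0 \<longrightarrow> (\<integral>\<^sup>+y. ennreal (norm (U y)) * indicator (ball 0 r) y \<partial>lborel) \<le> ennreal (r ^ m)"
proof -
  have [measurable]: "U \<in> borel_measurable borel" and Ue: "AE x in lborel. norm (x - a) < R \<longrightarrow> U (x - a) = u x"
    using U by (auto simp: local_rep_def)
  have "((\<lambda>r. (LINT z:ball a r|lebesgue. cmod (u z) powr 1) / r ^ Suc m) \<longlongrightarrow> 0) (at_right 0)"
    by (rule v[unfolded vanishes_to_infinite_order_def, THEN conjunct2, THEN conjunct2, rule_format]) simp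
  then have "\<forall>\<^sub>F r in at_right 0. (LINT z:ball a r|lebesgue. cmod (u z) powr 1) / r ^ Suc m < 1"
    by (rule order_tendstoD) simp
  then obtain r1 where r1: "r1 > 0" "\<And>r. 0 < r \<Longrightarrow> r < r1 \<Longrightarrow> (LINT z:ball a r|lebesgue. cmod (u z) powr 1) / r ^ Suc m < 1"
    unfolding eventually_at_right_field by auto
  show ?thesis
  proof (intro exI[of _ "min r1 (min R 1)"] conjI allI impI)
    show "0 < min r1 (min R 1)" using r1 R by simp
    fix r assume r: "0 < r \<and> r < min r1 (min R 1)"
    have [measurable]: "ball (0 :: 'a) r \<in> sets borel" by simp
    have si: "set_integrable lebesgue (ball a r) (\<lambda>x. cmod (u x) powr 1)"
    proof (rule set_integrable_subset)
      show "set_integrable lebesgue (cball a R) (\<lambda>x. cmod (u x) powr 1)"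
        using v sub compact_cball unfolding vanishes_to_infinite_order_def Lp_loc_def by blast
      show "ball a r \<subseteq> cball a R" using r by auto
    qed simp
    have "(\<integral>\<^sup>+y. ennreal (norm (U y)) * indicator (ball 0 r) y \<partial>lborel)
      = (\<integral>\<^sup>+x. ennreal (norm (U (x + - a))) * indicator (ball 0 r) (x + - a) \<partial>lborel)"
      by (rule nn_integral_lborel_shift[symmetric]) measurable
    also have "\<dots> = (\<integral>\<^sup>+x. ennreal (indicator (ball a r) x *\<^sub>R (cmod (u x) powr 1)) \<partial>lborel)"
    proof (rule nn_integral_cong_AE)
      show "AE x in lborel. ennreal (norm (U (x + - a))) * indicator (ball 0 r) (x + - a) = ennreal (indicator (ball a r) x *\<^sub>R (cmod (u x) powr 1))"
        using Ue by eventually_elim (use r in \<open>auto simp: indicator_def dist_norm norm_minus_commute\<close>)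
    qed
    also have "\<dots> = (\<integral>\<^sup>+x. ennreal (indicator (ball a r) x *\<^sub>R (cmod (u x) powr 1)) \<partial>lebesgue)"
      by (rule nn_integral_completion[symmetric])
    also have "\<dots> = ennreal (LINT z:ball a r|lebesgue. cmod (u z) powr 1)"
      using si unfolding set_integrable_def set_lebesgue_integral_def
      by (intro nn_integral_eq_integral) auto
    also have "\<dots> \<le> ennreal (r ^ m)"
    proof (rule ennreal_leI)
      have "(LINT z:ball a r|lebesgue. cmod (u z) powr 1) / r ^ Suc m < 1" using r1 r by auto
      then have "(LINT z:ball a r|lebesgue. cmod (u z) powr 1) \<le> r ^ Suc m"
        using r by (simp add: field_simps)
      also have "\<dots> \<le> r ^ m" using r by (intro power_decreasing) auto
      finally show "(LINT z:ball a r|lebesgue. cmod (u z) powr 1) \<le> r ^ m" .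
    qed
    finally show "(\<integral>\<^sup>+y. ennreal (norm (U y)) * indicator (ball 0 r) y \<partial>lborel) \<le> ennreal (r ^ m)" .
  qed
qed

text \<open>The radius of the ball is limited only by \<open>\<Omega>\<close>, not by the size of \<open>u\<close> or \<open>V\<close>. This uniformity is what makes the
connectedness argument close.\<close>

lemma local_vanishing:
  fixes u :: "complex ^ 'n \<Rightarrow> complex" and V :: "complex ^ 'n \<Rightarrow> real"
  assumes \<epsilon>: "\<epsilon> > 0" and W: "W1p_loc (2 * real CARD('n) + \<epsilon>) \<Omega> u"
    and w: "\<And>j. has_weak_dbar \<Omega> j u (D j)"
    and V0: "\<And>z. z \<in> \<Omega> \<Longrightarrow> 0 \<le> V z" and VL: "Lp_loc (2 * real CARD('n)) \<Omega> V"
    and ineq: "AE z in lebesgue. z \<in> \<Omega> \<longrightarrow> sqrt (\<Sum>j\<in>UNIV. (cmod (D j z))\<^sup>2) \<le> V z * cmod (u z)"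
    and v: "vanishes_to_infinite_order 1 \<Omega> u a" and R: "R > 0" and sub: "cball a R \<subseteq> \<Omega>"
  shows "AE z in lebesgue. z \<in> ball a R \<longrightarrow> u z = 0"
proof -
  define N where "N = CARD('n)"
  have N: "real N \<ge> 1" by (simp add: N_def Suc_le_eq)
  have sub': "ball a R \<subseteq> \<Omega>" using sub ball_subset_cball by blast
  have L1: "Lp_loc 1 \<Omega> u" "Lp_loc 1 \<Omega> (D j)" for j
    using w[of j] unfolding has_weak_dbar_def by auto
  obtain U where U: "local_rep a R u U"
    using local_rep_exists[OF _ sub'] L1(1) unfolding Lp_loc_def by blast
  have "\<exists>Ej. local_rep a R (D j) Ej" for j
    using local_rep_exists[OF _ sub', of "D j"] L1(2)[of j] unfolding Lp_loc_def by blast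
  then obtain E where E: "\<And>j. local_rep a R (D j) (E j)" by metis
  obtain Vr where Vr: "local_rep a R V Vr"
    using local_rep_exists[OF _ sub'] VL unfolding Lp_loc_def by blast
  have [measurable]: "U \<in> borel_measurable borel" "Vr \<in> borel_measurable borel" "E j \<in> borel_measurable borel" for j
    using U Vr E by (auto simp: local_rep_def)
  have zero: "U y = 0" "E j y = 0" if "R \<le> norm y" for y j
    using that U E[of j] by (auto simp: local_rep_def)
  define Vh where "Vh y = real N * max 0 (Vr y)" for y
  have [measurable]: "Vh \<in> borel_measurable borel" unfolding Vh_def[abs_def] by measurable
  have Ue: "AE x in lborel. norm (x - a) < R \<longrightarrow> U (x - a) = u x"
    and Ve: "AE x in lborel. norm (x - a) < R \<longrightarrow> Vr (x - a) = V x"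
    using U Vr by (auto simp: local_rep_def)
  have Ee: "AE x in lborel. \<forall>j\<in>UNIV. norm (x - a) < R \<longrightarrow> E j (x - a) = D j x"
    using E by (intro AE_finite_allI) (auto simp: local_rep_def)
  have EV: "AE y in lborel. (\<Sum>j\<in>UNIV. norm (E j y)) \<le> Vh y * norm (U y)"
  proof -
    have "AE x in lborel. (\<Sum>j\<in>UNIV. norm (E j (x - a))) \<le> Vh (x - a) * norm (U (x - a))"
      using ineq[unfolded AE_completion_iff] Ue Ve Ee
    proof eventually_elim
      case (elim x)
      show ?case
      proof (cases "norm (x - a) < R")
        case True
        then have x: "x \<in> \<Omega>" using sub' by (auto simp: dist_norm norm_minus_commute)
        have "(\<Sum>j\<in>UNIV. norm (E j (x - a))) = (\<Sum>j\<in>UNIV. norm (D j x))" using elim True by simp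
        also have "\<dots> \<le> of_nat (card (UNIV :: 'n set)) * sqrt (\<Sum>j\<in>UNIV. (cmod (D j x))\<^sup>2)"
        proof (rule sum_bounded_above)
          fix j :: 'n
          show "norm (D j x) \<le> sqrt (\<Sum>j\<in>UNIV. (cmod (D j x))\<^sup>2)"
            by (rule real_le_rsqrt, rule member_le_sum) auto
        qed
        also have "\<dots> \<le> real N * (V x * cmod (u x))" using elim(1) x N by (simp add: N_def)
        also have "\<dots> = Vh (x - a) * norm (U (x - a))" using elim True V0[OF x] by (simp add: Vh_def)
        finally show ?thesis .
      next
        case False
        then show ?thesis using N by (simp add: zero Vh_def)
      qed
    qed
    from AE_lborel_shift[OF this, of a] show ?thesis by simp
  qed
  have "AE y in lborel. U y = 0"
  proof (rule ball_vanishing[OF weakdbar_local_rep[OF w sub U E] R, where V = Vh])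
    show "integrable lborel U" by (rule local_rep_integrable[OF L1(1) sub U])
    show "integrable lborel (E j)" for j by (rule local_rep_integrable[OF L1(2) sub E])
    show "(\<integral>\<^sup>+y. ennreal ((\<Sum>j\<in>UNIV. norm (E j y))\<^sup>2) \<partial>lborel) < \<infinity>"
    proof -
      have "(\<integral>\<^sup>+y. ennreal ((\<Sum>j\<in>UNIV. norm (E j y))\<^sup>2) \<partial>lborel) \<le> (\<integral>\<^sup>+y. (\<Sum>j\<in>UNIV. ennreal (real N) * ennreal ((norm (E j y))\<^sup>2)) \<partial>lborel)"
      proof (rule nn_integral_mono)
        fix y
        have "(\<Sum>j\<in>UNIV. norm (E j y))\<^sup>2 \<le> (\<Sum>j\<in>UNIV. real N * (norm (E j y))\<^sup>2)"
          using sum_squared_le_sum_of_squares[of "\<lambda>j. norm (E j y)" UNIV] by (simp add: N_def sum_distrib_left[symmetric] mult.commute)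
        then show "ennreal ((\<Sum>j\<in>UNIV. norm (E j y))\<^sup>2) \<le> (\<Sum>j\<in>UNIV. ennreal (real N) * ennreal ((norm (E j y))\<^sup>2))"
          by (simp add: ennreal_mult[symmetric] ennreal_leI sum_ennreal)
      qed
      also have "\<dots> = (\<Sum>j\<in>UNIV. ennreal (real N) * (\<integral>\<^sup>+y. ennreal ((norm (E j y))\<^sup>2) \<partial>lborel))"
        by (subst nn_integral_sum) (auto simp: nn_integral_cmult)
      also have "\<dots> < \<infinity>"
      proof -
        have "2 \<le> 2 * real CARD('n) + \<epsilon>" using N \<epsilon> unfolding N_def by linarith
        from dbar_square_integrable[OF W this w sub U E] show ?thesis by (simp add: ennreal_mult_less_top)
      qed
      finally show ?thesis .
    qed
    have Lq: "(\<integral>\<^sup>+y. ennreal (norm (U y) powr (2 * real CARD('n) + \<epsilon>)) \<partial>lborel) < \<infinity>"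
      using W unfolding W1p_loc_def by (intro local_rep_powr[OF _ sub U]) auto
    have L1': "(\<integral>\<^sup>+y. ennreal (norm (U y)) \<partial>lborel) < \<infinity>"
      using local_rep_powr[OF L1(1) sub U] by simp
    show "(\<integral>\<^sup>+y. ennreal ((norm (U y))\<^sup>2 * norm y powr (- real M)) \<partial>lborel) < \<infinity>" for M :: nat
    proof (rule flat_weighted_L2[OF _ _ L1' flat_local_rep[OF v R sub U] _ Lq])
      show "2 < 2 * real CARD('n) + \<epsilon>" using N \<epsilon> unfolding N_def by linarith
    qed simp_all
    show "(\<integral>\<^sup>+y. ennreal (Vh y powr (2 * real CARD('n)) * indicator (ball 0 R) y) \<partial>lborel) < \<infinity>"
    proof -
      have "(\<integral>\<^sup>+y. ennreal (Vh y powr (2 * real CARD('n)) * indicator (ball 0 R) y) \<partial>lborel)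
        \<le> (\<integral>\<^sup>+y. ennreal (real N powr (2 * real CARD('n))) * ennreal (norm (Vr y) powr (2 * real CARD('n))) \<partial>lborel)"
      proof (rule nn_integral_mono)
        fix y
        have "Vh y powr (2 * real CARD('n)) \<le> (real N * norm (Vr y)) powr (2 * real CARD('n))"
          unfolding Vh_def using N by (intro powr_mono2 mult_left_mono) auto
        then have "Vh y powr (2 * real CARD('n)) * indicator (ball 0 R) y \<le> real N powr (2 * real CARD('n)) * norm (Vr y) powr (2 * real CARD('n))"
          unfolding powr_mult by (simp add: indicator_def)
        then show "ennreal (Vh y powr (2 * real CARD('n)) * indicator (ball 0 R) y) \<le> ennreal (real N powr (2 * real CARD('n))) * ennreal (norm (Vr y) powr (2 * real CARD('n)))"
          by (subst ennreal_mult[symmetric]) (auto intro: ennreal_leI)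
      qed
      also have "\<dots> = ennreal (real N powr (2 * real CARD('n))) * (\<integral>\<^sup>+y. ennreal (norm (Vr y) powr (2 * real CARD('n))) \<partial>lborel)"
        by (rule nn_integral_cmult) measurable
      also have "\<dots> < \<infinity>" using local_rep_powr[OF VL sub Vr] by (simp add: ennreal_mult_less_top)
      finally show ?thesis .
    qed
  qed (use EV N in \<open>auto simp: zero Vh_def\<close>)
  from AE_lborel_shift[OF this, of "- a"] have "AE x in lborel. U (x - a) = 0" by simp
  then have "AE z in lborel. z \<in> ball a R \<longrightarrow> u z = 0"
    using Ue by eventually_elim (auto simp: dist_norm norm_minus_commute)
  then show ?thesis unfolding AE_completion_iff .
qed

lemma zero_near_imp_infinite_order:
  fixes u :: "'a::euclidean_space \<Rightarrow> complex"
  assumes L: "Lp_loc 1 \<Omega> u" and a: "a \<in> \<Omega>" and r: "r > 0"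
    and z: "AE z in lebesgue. z \<in> ball a r \<longrightarrow> u z = 0"
  shows "vanishes_to_infinite_order 1 \<Omega> u a"
  unfolding vanishes_to_infinite_order_def
proof (intro conjI allI impI L a)
  fix m :: nat
  have "\<forall>\<^sub>F s in at_right 0. (LINT z:ball a s|lebesgue. cmod (u z) powr 1) / s ^ m = 0"
    unfolding eventually_at_right_field
  proof (intro exI[of _ r] conjI allI impI r)
    fix s assume s: "0 < s" "s < r"
    have "AE z in lebesgue. indicator (ball a s) z *\<^sub>R cmod (u z) powr 1 = 0"
      using z by eventually_elim (use s in \<open>auto simp: indicator_def\<close>)
    then have "(LINT z:ball a s|lebesgue. cmod (u z) powr 1) = 0"
      unfolding set_lebesgue_integral_def by (rule integral_eq_zero_AE)
    then show "(LINT z:ball a s|lebesgue. cmod (u z) powr 1) / s ^ m = 0" by simp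
  qed
  then show "((\<lambda>s. (LINT z:ball a s|lebesgue. cmod (u z) powr 1) / s ^ m) \<longlongrightarrow> 0) (at_right 0)"
    by (rule tendsto_eventually)
qed

theorem theorem1p2:
  fixes \<Omega> :: "(complex ^ 'n) set"
    and u :: "complex ^ 'n \<Rightarrow> complex"
    and D :: "'n \<Rightarrow> complex ^ 'n \<Rightarrow> complex"
    and V :: "complex ^ 'n \<Rightarrow> real"
    and \<epsilon> :: real
    and z0 :: "complex ^ 'n"
  assumes "is_domain \<Omega>"
    and "\<epsilon> > 0"
    and "W1p_loc (2 * real CARD('n) + \<epsilon>) \<Omega> u"
    and "\<And>j. has_weak_dbar \<Omega> j u (D j)"
    and "\<And>z. z \<in> \<Omega> \<Longrightarrow> 0 \<le> V z"
    and "Lp_loc (2 * real CARD('n)) \<Omega> V"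
    and "AE z in lebesgue. z \<in> \<Omega> \<longrightarrow>
           sqrt (\<Sum>j\<in>UNIV. (cmod (D j z))\<^sup>2) \<le> V z * cmod (u z)"
    and "z0 \<in> \<Omega>"
    and "vanishes_to_infinite_order 1 \<Omega> u z0"
  shows "AE z in lebesgue. z \<in> \<Omega> \<longrightarrow> u z = 0"
proof -
  have op: "open \<Omega>" and conn: "connected \<Omega>" using assms(1) by (auto simp: is_domain_def)
  have L1: "Lp_loc 1 \<Omega> u" using assms(9) by (simp add: vanishes_to_infinite_order_def)
  define Z where "Z a r \<longleftrightarrow> r > 0 \<and> (AE z in lebesgue. z \<in> ball a r \<longrightarrow> u z = 0)" for a r
  define A where "A = {a \<in> \<Omega>. \<exists>r. Z a r}"
  have grow: "ball a R \<subseteq> A" if v: "vanishes_to_infinite_order 1 \<Omega> u a" and sub: "cball a R \<subseteq> \<Omega>" for a R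
  proof
    fix x assume x: "x \<in> ball a R"
    then have R: "R > 0" by (auto simp: dist_norm intro: le_less_trans[OF norm_ge_zero])
    define s where "s = R - dist a x"
    have "AE z in lebesgue. z \<in> ball a R \<longrightarrow> u z = 0"
      by (rule local_vanishing[OF assms(2-7) v R sub])
    moreover have "ball x s \<subseteq> ball a R" by (rule ball_subset_ball_iff[THEN iffD2]) (simp add: s_def dist_commute)
    ultimately have "AE z in lebesgue. z \<in> ball x s \<longrightarrow> u z = 0" by (auto elim!: eventually_mono)
    then have "Z x s" using x by (simp add: Z_def s_def)
    moreover have "x \<in> \<Omega>" using x sub by auto
    ultimately show "x \<in> A" unfolding A_def by blast
  qed
  have vA: "vanishes_to_infinite_order 1 \<Omega> u a" if "a \<in> A" for a
    using that zero_near_imp_infinite_order[OF L1] unfolding A_def Z_def by blast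
  have cb: "\<exists>r>0. cball a r \<subseteq> \<Omega>" if "a \<in> \<Omega>" for a
    using op that open_contains_cball by blast
  have "open A"
    unfolding open_contains_ball
  proof
    fix a assume a: "a \<in> A"
    then obtain r where "r > 0" "cball a r \<subseteq> \<Omega>" using cb by (auto simp: A_def)
    then show "\<exists>e>0. ball a e \<subseteq> A" using grow[OF vA[OF a]] by blast
  qed
  moreover have "open (\<Omega> - A)"
    unfolding open_contains_ball
  proof
    fix z assume z: "z \<in> \<Omega> - A"
    obtain r where r: "r > 0" "cball z r \<subseteq> \<Omega>" using cb z by auto
    have "x \<notin> A" if x: "x \<in> ball z (r/2)" for x
    proof
      assume "x \<in> A"
      have "cball x (r/2) \<subseteq> cball z r" using x by (auto simp: cball_subset_cball_iff dist_commute)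
      then have "ball x (r/2) \<subseteq> A" using grow[OF vA[OF \<open>x \<in> A\<close>]] r by blast
      then show False using x z by (auto simp: dist_commute)
    qed
    moreover have "ball z (r/2) \<subseteq> \<Omega>" using r by (auto simp: subset_iff)
    ultimately show "\<exists>e>0. ball z e \<subseteq> \<Omega> - A" using r by (intro exI[of _ "r/2"]) auto
  qed
  ultimately have "A \<inter> \<Omega> = {} \<or> (\<Omega> - A) \<inter> \<Omega> = {}"
    using conn by (intro connectedD) auto
  moreover have "z0 \<in> A"
  proof -
    obtain r where "r > 0" "cball z0 r \<subseteq> \<Omega>" using cb assms(8) by blast
    then show ?thesis using grow[OF assms(9), of r] centre_in_ball[of z0 r] by blast
  qed
  ultimately have "\<Omega> \<subseteq> A" using assms(8) by blast
  then have "\<exists>r. Z a r" if "a \<in> \<Omega>" for a using that unfolding A_def by blast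
  then obtain r where r: "\<And>a. a \<in> \<Omega> \<Longrightarrow> Z a (r a)" by metis
  obtain F where F: "F \<subseteq> (\<lambda>a. ball a (r a)) ` \<Omega>" "countable F" "\<Union>F = \<Union>((\<lambda>a. ball a (r a)) ` \<Omega>)"
    using Lindelof[of "(\<lambda>a. ball a (r a)) ` \<Omega>"] by auto
  have "AE z in lebesgue. \<forall>B\<in>F. z \<in> B \<longrightarrow> u z = 0"
    using F r unfolding Z_def by (subst AE_ball_countable) auto
  moreover have "\<Omega> \<subseteq> \<Union>F" using r unfolding F(3) Z_def by force
  ultimately show ?thesis by (auto elim!: eventually_mono)
qed

end
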